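(* Let the exponent be constant, $p(x)\equiv p$ with $2<p<2^*$, and assume (H2) and $\ell>\frac1{(p-1)^2}$. Then there are data $(u_0,u_1)\in C_c^\infty(\Omega)\times C_c^\infty(\Omega)$ with arbitrarily large initial energy $E(0)$ (i.e. for every $K>0$ there are such data with $E(0)>K$) satisfying $$\frac{C}{2p}\|u_0\|_2^2<E(0)<\frac Cp(u_0,u_1).$$ The corresponding maximal energy solutions satisfy the upper lifespan bound $$T_{\max}\le\tau+\frac{4\left[\sqrt{d_\tau^2+(p-2)^2\beta U_\tau}-d_\tau\right]}{(p-2)^2\beta},$$ where $L_0:=(u_0,u_1)-\frac pC E(0)>0$, $\beta:=\frac{CL_0}{2p}$, $\tau$ is the unique positive solution of $$CL_0\tau^2+\left[L_0-\frac{2(E(0)+\beta)}{\lambda_1}\right]\tau-\|u_0\|_2^2=0,$$ $U_\tau:=\left(\|u_0\|_2+\sqrt{\tau(E(0)+\beta)/\lambda_1}\right)^2$, $G_\tau:=\left(\|\nabla u_0\|_2+\sqrt{\tau(E(0)+\beta)}\right)^2$, and $d_\tau:=\frac{p-2}{2}L_0-2G_\tau$. In particular, these data satisfy the criterion $0<E(0)<\frac Cp(u_0,u_1)$ but violate the condition $E(0)\le\frac{C}{2p}\|u_0\|_2^2$.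
   Context: Setting. $n\ge1$ and $\Omega\subset\mathbb R^n$ is a bounded domain with smooth boundary; $2^*=2n/(n-2)$ if $n\ge3$ and $2^*=\infty$ if $n\le2$; $V=H_0^1(\Omega)$ with $\|z\|_V=\|\nabla z\|_2$; $H=L^2(\Omega)$; $\|\cdot\|_2$ and $(\cdot,\cdot)$ are the $L^2(\Omega)$ norm and inner product; $\langle\cdot,\cdot\rangle$ is the pairing of $V^*$ and $V$; $\lambda_1>0$ is the first Dirichlet eigenvalue of $-\Delta$ on $\Omega$. (H2): $g\in C^1([0,\infty))$, $g\ge0$, $g'\le0$, and $\ell:=1-\int_0^\infty g(s)\,ds>0$. Problem (P): $u_{tt}-\Delta u+\int_0^t g(t-s)\Delta u(s)\,ds-\Delta u_t=|u|^{p-2}u\log|u|$ in $\Omega\times(0,\infty)$, $u=0$ on $\partial\Omega\times(0,\infty)$, $u(0)=u_0$, $u_t(0)=u_1$; the source is $0$ at $u=0$. For $(u_0,u_1)\in V\times H$, an energy solution on $[0,T]$ is $u\in C([0,T];V)$ with $u_t\in C([0,T];H)\cap L^2(0,T;V)$, $u_{tt}\in L^2(0,T;V^* )$, $u(0)=u_0$, $u_t(0)=u_1$, such that for every $z\in V$ and a.e. $t\in(0,T)$: $\langle u_{tt},z\rangle+(\nabla u,\nabla z)+(\nabla u_t,\nabla z)-\int_0^tg(t-s)(\nabla u(s),\nabla z)\,ds=\int_\Omega|u|^{p-2}u\log|u|\,z\,dx$. Energy. $F(r)=\frac{|r|^{p}}{p}\log|r|-\frac{|r|^{p}}{p^2}$,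 $F(0)=0$; $(g\circ\nabla u)(t)=\int_0^tg(t-s)\|\nabla u(t)-\nabla u(s)\|_2^2\,ds$; $$E(t)=\tfrac12\|u_t(t)\|_2^2+\tfrac12\Big(1-\int_0^tg(s)\,ds\Big)\|\nabla u(t)\|_2^2+\tfrac12(g\circ\nabla u)(t)-\int_\Omega F(u(t))\,dx.$$ Local theory (taken as known). For every $(u_0,u_1)\in V\times H$, (P) has a unique maximal energy solution on $[0,T_{\max})$, $T_{\max}\in(0,\infty]$ (an energy solution on $[0,T]$ for each $T<T_{\max}$); if $T_{\max}<\infty$ then $\limsup_{t\uparrow T_{\max}}(\|u(t)\|_V+\|u_t(t)\|_2)=\infty$; $E$ is locally absolutely continuous and, for a.e. $t<T_{\max}$, $E'(t)=-\|\nabla u_t(t)\|_2^2-\frac12g(t)\|\nabla u(t)\|_2^2+\frac12\int_0^tg'(t-s)\|\nabla u(t)-\nabla u(s)\|_2^2\,ds$. Constant. $C=\min\left\{p+2,\ \frac{2\lambda_1[(p-1)^2\ell-1]}{2p+\lambda_1}\right\}>0$. *)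

theory Defs
  imports "HOL-Analysis.Analysis"
begin

section \<open>Smooth functions and domains\<close>

fun Ck_on :: "nat \<Rightarrow> 'a::euclidean_space set \<Rightarrow> ('a \<Rightarrow> real) \<Rightarrow> bool" where
  "Ck_on 0 S f \<longleftrightarrow> continuous_on S f"
| "Ck_on (Suc k) S f \<longleftrightarrow>
     (\<forall>x\<in>S. f differentiable (at x)) \<and>
     (\<forall>b\<in>Basis. Ck_on k S (\<lambda>x. frechet_derivative f (at x) b))"

definition smooth_on :: "'a::euclidean_space set \<Rightarrow> ('a \<Rightarrow> real) \<Rightarrow> bool" where
  "smooth_on S f \<longleftrightarrow> (\<forall>k. Ck_on k S f)"

text \<open>The class of smooth functions with compact support in \<open>\<Omega>\<close>; its members are defined on
  the whole space and vanish outside a compact subset of \<open>\<Omega>\<close>.\<close>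

definition test_fun :: "'a::euclidean_space set \<Rightarrow> ('a \<Rightarrow> real) set" where
  "test_fun \<Omega> = {\<phi>. smooth_on UNIV \<phi> \<and> (\<exists>K. compact K \<and> K \<subseteq> \<Omega> \<and> (\<forall>x. x \<notin> K \<longrightarrow> \<phi> x = 0))}"

text \<open>Smoothness of the boundary is expressed by smooth local defining functions with
  non-vanishing gradient; \<open>\<Omega>\<close> lies locally on one side of its boundary.\<close>

definition smooth_boundary :: "'a::euclidean_space set \<Rightarrow> bool" where
  "smooth_boundary \<Omega> \<longleftrightarrow>
     (\<forall>x\<in>frontier \<Omega>. \<exists>U \<psi>. open U \<and> x \<in> U \<and> smooth_on U \<psi> \<and>
        (\<forall>y\<in>U. \<exists>b. frechet_derivative \<psi> (at y) b \<noteq> 0) \<and>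
        \<Omega> \<inter> U = {y\<in>U. \<psi> y < 0})"

definition smooth_bounded_domain :: "'a::euclidean_space set \<Rightarrow> bool" where
  "smooth_bounded_domain \<Omega> \<longleftrightarrow>
     open \<Omega> \<and> connected \<Omega> \<and> \<Omega> \<noteq> {} \<and> bounded \<Omega> \<and> smooth_boundary \<Omega>"

section \<open>The spaces $H$, $V$ and $V^*$\<close>

text \<open>Elements of $L^2$ and $H_0^1$ are represented by functions, and equality of elements is
  equality almost everywhere in \<open>\<Omega>\<close>. The codomain is \<open>real\<close> for functions and the
  space itself for gradients.\<close>

definition L2 :: "'a::euclidean_space set \<Rightarrow> ('a \<Rightarrow> 'b::euclidean_space) set" where
  "L2 \<Omega> = {f. f \<in> borel_measurable (lebesgue_on \<Omega>) \<and>
               integrable (lebesgue_on \<Omega>) (\<lambda>x. (norm (f x))\<^sup>2)}"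

definition l2inner ::
  "'a::euclidean_space set \<Rightarrow> ('a \<Rightarrow> 'b::euclidean_space) \<Rightarrow> ('a \<Rightarrow> 'b) \<Rightarrow> real" where
  "l2inner \<Omega> f h = (\<integral>x. f x \<bullet> h x \<partial>lebesgue_on \<Omega>)"

definition l2norm :: "'a::euclidean_space set \<Rightarrow> ('a \<Rightarrow> 'b::euclidean_space) \<Rightarrow> real" where
  "l2norm \<Omega> f = sqrt (\<integral>x. (norm (f x))\<^sup>2 \<partial>lebesgue_on \<Omega>)"

definition is_weak_grad ::
  "'a::euclidean_space set \<Rightarrow> ('a \<Rightarrow> real) \<Rightarrow> ('a \<Rightarrow> 'a) \<Rightarrow> bool" where
  "is_weak_grad \<Omega> z G \<longleftrightarrow>
     (\<forall>\<phi>\<in>test_fun \<Omega>. \<forall>b\<in>Basis.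
        (\<integral>x. z x * frechet_derivative \<phi> (at x) b \<partial>lebesgue_on \<Omega>)
        = - (\<integral>x. (G x \<bullet> b) * \<phi> x \<partial>lebesgue_on \<Omega>))"

definition H1 :: "'a::euclidean_space set \<Rightarrow> ('a \<Rightarrow> real) set" where
  "H1 \<Omega> = {z \<in> L2 \<Omega>. \<exists>G\<in>L2 \<Omega>. is_weak_grad \<Omega> z G}"

text \<open>The weak gradient, determined up to null sets for functions in \<open>H1 \<Omega>\<close> and
  unspecified otherwise.\<close>

definition wgrad :: "'a::euclidean_space set \<Rightarrow> ('a \<Rightarrow> real) \<Rightarrow> 'a \<Rightarrow> 'a" where
  "wgrad \<Omega> z = (SOME G. G \<in> L2 \<Omega> \<and> is_weak_grad \<Omega> z G)"

definition H01 :: "'a::euclidean_space set \<Rightarrow> ('a \<Rightarrow> real) set" where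
  "H01 \<Omega> = {z \<in> H1 \<Omega>. \<exists>\<phi>. (\<forall>k::nat. \<phi> k \<in> test_fun \<Omega>) \<and>
      (\<lambda>k. l2norm \<Omega> (\<lambda>x. \<phi> k x - z x)) \<longlonglongrightarrow> 0 \<and>
      (\<lambda>k. l2norm \<Omega> (\<lambda>x. wgrad \<Omega> (\<phi> k) x - wgrad \<Omega> z x)) \<longlonglongrightarrow> 0}"

definition normV :: "'a::euclidean_space set \<Rightarrow> ('a \<Rightarrow> real) \<Rightarrow> real" where
  "normV \<Omega> z = l2norm \<Omega> (wgrad \<Omega> z)"

definition dualV :: "'a::euclidean_space set \<Rightarrow> (('a \<Rightarrow> real) \<Rightarrow> real) set" where
  "dualV \<Omega> = {\<xi>.
     (\<forall>y\<in>H01 \<Omega>. \<forall>z\<in>H01 \<Omega>. \<forall>a b. \<xi> (\<lambda>x. a * y x + b * z x) = a * \<xi> y + b * \<xi> z) \<and>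
     (\<exists>B. \<forall>z\<in>H01 \<Omega>. \<bar>\<xi> z\<bar> \<le> B * normV \<Omega> z)}"

definition norm_dualV :: "'a::euclidean_space set \<Rightarrow> (('a \<Rightarrow> real) \<Rightarrow> real) \<Rightarrow> real" where
  "norm_dualV \<Omega> \<xi> = Sup {\<bar>\<xi> z\<bar> | z. z \<in> H01 \<Omega> \<and> normV \<Omega> z \<le> 1}"

definition dirichlet_eigenvalue :: "'a::euclidean_space set \<Rightarrow> real \<Rightarrow> bool" where
  "dirichlet_eigenvalue \<Omega> \<mu> \<longleftrightarrow>
     (\<exists>w\<in>H01 \<Omega>. l2norm \<Omega> w \<noteq> 0 \<and>
        (\<forall>z\<in>H01 \<Omega>. l2inner \<Omega> (wgrad \<Omega> w) (wgrad \<Omega> z) = \<mu> * l2inner \<Omega> w z))"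

definition lambda1 :: "'a::euclidean_space set \<Rightarrow> real" where
  "lambda1 \<Omega> = (LEAST \<mu>. dirichlet_eigenvalue \<Omega> \<mu>)"

section \<open>Functions of time\<close>

text \<open>The Bochner space $L^2(0,T;X)$, where \<open>X\<close> is a space of real-valued functions or
  functionals with norm \<open>N\<close>: strongly measurable (almost everywhere the limit of simple
  functions) with square-integrable norm.\<close>

definition bochner_L2 ::
  "real \<Rightarrow> ('x \<Rightarrow> real) set \<Rightarrow> (('x \<Rightarrow> real) \<Rightarrow> real) \<Rightarrow> (real \<Rightarrow> 'x \<Rightarrow> real) \<Rightarrow> bool" where
  "bochner_L2 T X N h \<longleftrightarrow>
     (\<exists>s. (\<forall>k::nat. simple_function (lebesgue_on {0<..<T}) (s k) \<and> range (s k) \<subseteq> X) \<and>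
          (AE t in lebesgue_on {0<..<T}.
             h t \<in> X \<and> (\<lambda>k. N (\<lambda>x. s k t x - h t x)) \<longlonglongrightarrow> 0)) \<and>
     integrable (lebesgue_on {0<..<T}) (\<lambda>t. (N (h t))\<^sup>2)"

text \<open>\<open>w\<close> is the distributional time derivative on $(0,T)$ of the \<open>H\<close>-valued \<open>v\<close>, as a
  \<open>V\<^sup>*\<close>-valued function, where $H \subset V^*$ through the $L^2$ inner product. The identity of
  Bochner integrals in $V^*$ is tested with the elements of \<open>V\<close>.\<close>

definition weak_time_deriv ::
  "'a::euclidean_space set \<Rightarrow> real \<Rightarrow> (real \<Rightarrow> 'a \<Rightarrow> real) \<Rightarrow> (real \<Rightarrow> ('a \<Rightarrow> real) \<Rightarrow> real) \<Rightarrow> bool"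
where
  "weak_time_deriv \<Omega> T v w \<longleftrightarrow>
     (\<forall>\<phi>\<in>test_fun {0<..<T}. \<forall>z\<in>H01 \<Omega>.
        (\<integral>t. deriv \<phi> t * l2inner \<Omega> (v t) z \<partial>lebesgue_on {0<..<T})
        = - (\<integral>t. \<phi> t * w t z \<partial>lebesgue_on {0<..<T}))"

definition abs_cont_on :: "real \<Rightarrow> real \<Rightarrow> (real \<Rightarrow> real) \<Rightarrow> bool" where
  "abs_cont_on a b f \<longleftrightarrow>
     (\<forall>\<epsilon>>0. \<exists>\<delta>>0. \<forall>D::(real \<times> real) set.
        finite D \<and> (\<forall>(x, y)\<in>D. a \<le> x \<and> x \<le> y \<and> y \<le> b) \<and>
        pairwise (\<lambda>(x, y) (x', y'). {x<..<y} \<inter> {x'<..<y'} = {}) D \<and>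
        (\<Sum>(x, y)\<in>D. y - x) < \<delta>
        \<longrightarrow> (\<Sum>(x, y)\<in>D. \<bar>f y - f x\<bar>) < \<epsilon>)"

section \<open>The problem\<close>

definition crit_exp :: "nat \<Rightarrow> ereal" where
  "crit_exp n = (if n \<ge> 3 then ereal (2 * real n / (real n - 2)) else \<infinity>)"

definition ell :: "(real \<Rightarrow> real) \<Rightarrow> real" where
  "ell g = 1 - (\<integral>s. g s \<partial>lebesgue_on {0..})"

text \<open>\<open>g'\<close> is the derivative of \<open>g\<close> on $[0,\infty)$, one-sided at 0. Integrability is stated
  because the HOL integral of a non-integrable function is 0.\<close>

definition H2 :: "(real \<Rightarrow> real) \<Rightarrow> (real \<Rightarrow> real) \<Rightarrow> bool" where
  "H2 g g' \<longleftrightarrow>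
     (\<forall>t\<ge>0. (g has_real_derivative g' t) (at t within {0..})) \<and> continuous_on {0..} g' \<and>
     (\<forall>t\<ge>0. g t \<ge> 0) \<and> (\<forall>t\<ge>0. g' t \<le> 0) \<and>
     integrable (lebesgue_on {0..}) g \<and> ell g > 0"

definition source :: "real \<Rightarrow> real \<Rightarrow> real" where
  "source p r = (if r = 0 then 0 else \<bar>r\<bar> powr (p - 2) * r * ln \<bar>r\<bar>)"

definition source_prim :: "real \<Rightarrow> real \<Rightarrow> real" where
  "source_prim p r =
     (if r = 0 then 0 else \<bar>r\<bar> powr p / p * ln \<bar>r\<bar> - \<bar>r\<bar> powr p / p\<^sup>2)"

text \<open>\<open>u\<close> is an energy solution on $[0,T]$ and \<open>v\<close> its time derivative $u_t$, taken in \<open>H\<close>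
  at every time. The functional-valued \<open>w\<close> is $u_{tt}$.\<close>

definition energy_solution ::
  "'a::euclidean_space set \<Rightarrow> real \<Rightarrow> (real \<Rightarrow> real) \<Rightarrow> ('a \<Rightarrow> real) \<Rightarrow> ('a \<Rightarrow> real) \<Rightarrow>
   real \<Rightarrow> (real \<Rightarrow> 'a \<Rightarrow> real) \<Rightarrow> (real \<Rightarrow> 'a \<Rightarrow> real) \<Rightarrow> bool"
where
  "energy_solution \<Omega> p g u0 u1 T u v \<longleftrightarrow>
     0 < T \<and>
     (\<forall>t\<in>{0..T}. u t \<in> H01 \<Omega>) \<and>
     (\<forall>t\<in>{0..T}. ((\<lambda>s. normV \<Omega> (\<lambda>x. u s x - u t x)) \<longlongrightarrow> 0) (at t within {0..T})) \<and>
     (\<forall>t\<in>{0..T}. v t \<in> L2 \<Omega>) \<and>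
     (\<forall>t\<in>{0..T}. ((\<lambda>s. l2norm \<Omega> (\<lambda>x. v s x - v t x)) \<longlongrightarrow> 0) (at t within {0..T})) \<and>
     (\<forall>t\<in>{0..T}. ((\<lambda>s. l2norm \<Omega> (\<lambda>x. (u s x - u t x) / (s - t) - v t x)) \<longlongrightarrow> 0)
                    (at t within {0..T})) \<and>
     bochner_L2 T (H01 \<Omega>) (normV \<Omega>) v \<and>
     (AE x in lebesgue_on \<Omega>. u 0 x = u0 x) \<and>
     (AE x in lebesgue_on \<Omega>. v 0 x = u1 x) \<and>
     (\<exists>w. bochner_L2 T (dualV \<Omega>) (norm_dualV \<Omega>) w \<and> weak_time_deriv \<Omega> T v w \<and>
        (\<forall>z\<in>H01 \<Omega>. AE t in lebesgue_on {0<..<T}.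
           w t z + l2inner \<Omega> (wgrad \<Omega> (u t)) (wgrad \<Omega> z)
             + l2inner \<Omega> (wgrad \<Omega> (v t)) (wgrad \<Omega> z)
             - (\<integral>s. g (t - s) * l2inner \<Omega> (wgrad \<Omega> (u s)) (wgrad \<Omega> z) \<partial>lebesgue_on {0..t})
           = (\<integral>x. source p (u t x) * z x \<partial>lebesgue_on \<Omega>)))"

definition solution_until ::
  "'a::euclidean_space set \<Rightarrow> real \<Rightarrow> (real \<Rightarrow> real) \<Rightarrow> ('a \<Rightarrow> real) \<Rightarrow> ('a \<Rightarrow> real) \<Rightarrow>
   ereal \<Rightarrow> (real \<Rightarrow> 'a \<Rightarrow> real) \<Rightarrow> (real \<Rightarrow> 'a \<Rightarrow> real) \<Rightarrow> bool"
where
  "solution_until \<Omega> p g u0 u1 Tm u v \<longleftrightarrow>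
     0 < Tm \<and> (\<forall>T. 0 < T \<and> ereal T < Tm \<longrightarrow> energy_solution \<Omega> p g u0 u1 T u v)"

definition agree_until ::
  "'a::euclidean_space set \<Rightarrow> ereal \<Rightarrow> (real \<Rightarrow> 'a \<Rightarrow> real) \<Rightarrow> (real \<Rightarrow> 'a \<Rightarrow> real) \<Rightarrow> bool"
where
  "agree_until \<Omega> Tm u u' \<longleftrightarrow>
     (\<forall>t. 0 \<le> t \<and> ereal t < Tm \<longrightarrow> (AE x in lebesgue_on \<Omega>. u t x = u' t x))"

definition maximal_solution ::
  "'a::euclidean_space set \<Rightarrow> real \<Rightarrow> (real \<Rightarrow> real) \<Rightarrow> ('a \<Rightarrow> real) \<Rightarrow> ('a \<Rightarrow> real) \<Rightarrow>
   ereal \<Rightarrow> (real \<Rightarrow> 'a \<Rightarrow> real) \<Rightarrow> (real \<Rightarrow> 'a \<Rightarrow> real) \<Rightarrow> bool"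
where
  "maximal_solution \<Omega> p g u0 u1 Tm u v \<longleftrightarrow>
     solution_until \<Omega> p g u0 u1 Tm u v \<and>
     \<not> (\<exists>Tm' u' v'. Tm < Tm' \<and> solution_until \<Omega> p g u0 u1 Tm' u' v' \<and> agree_until \<Omega> Tm u u')"

definition energy ::
  "'a::euclidean_space set \<Rightarrow> real \<Rightarrow> (real \<Rightarrow> real) \<Rightarrow> (real \<Rightarrow> 'a \<Rightarrow> real) \<Rightarrow> (real \<Rightarrow> 'a \<Rightarrow> real) \<Rightarrow>
   real \<Rightarrow> real"
where
  "energy \<Omega> p g u v t =
     1/2 * (l2norm \<Omega> (v t))\<^sup>2
     + 1/2 * (1 - (\<integral>s. g s \<partial>lebesgue_on {0..t})) * (l2norm \<Omega> (wgrad \<Omega> (u t)))\<^sup>2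
     + 1/2 * (\<integral>s. g (t - s) * (l2norm \<Omega> (\<lambda>x. wgrad \<Omega> (u t) x - wgrad \<Omega> (u s) x))\<^sup>2
                \<partial>lebesgue_on {0..t})
     - (\<integral>x. source_prim p (u t x) \<partial>lebesgue_on \<Omega>)"

text \<open>$E(0)$ depends only on the data: the memory terms vanish at time 0, so the constant
  extensions of the data may be used.\<close>

definition initial_energy ::
  "'a::euclidean_space set \<Rightarrow> real \<Rightarrow> (real \<Rightarrow> real) \<Rightarrow> ('a \<Rightarrow> real) \<Rightarrow> ('a \<Rightarrow> real) \<Rightarrow> real"
where
  "initial_energy \<Omega> p g u0 u1 = energy \<Omega> p g (\<lambda>_. u0) (\<lambda>_. u1) 0"

definition energy_rate ::
  "'a::euclidean_space set \<Rightarrow> (real \<Rightarrow> real) \<Rightarrow> (real \<Rightarrow> real) \<Rightarrow>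
   (real \<Rightarrow> 'a \<Rightarrow> real) \<Rightarrow> (real \<Rightarrow> 'a \<Rightarrow> real) \<Rightarrow> real \<Rightarrow> real"
where
  "energy_rate \<Omega> g g' u v t =
     - (l2norm \<Omega> (wgrad \<Omega> (v t)))\<^sup>2
     - 1/2 * g t * (l2norm \<Omega> (wgrad \<Omega> (u t)))\<^sup>2
     + 1/2 * (\<integral>s. g' (t - s) * (l2norm \<Omega> (\<lambda>x. wgrad \<Omega> (u t) x - wgrad \<Omega> (u s) x))\<^sup>2
                \<partial>lebesgue_on {0..t})"

text \<open>Known well-posedness results, used as a hypothesis on the problem with given domain,
  exponent and kernel. Uniqueness is up to null sets in space.\<close>

definition local_theory ::
  "'a::euclidean_space set \<Rightarrow> real \<Rightarrow> (real \<Rightarrow> real) \<Rightarrow> (real \<Rightarrow> real) \<Rightarrow> bool"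
where
  "local_theory \<Omega> p g g' \<longleftrightarrow>
     (\<forall>u0\<in>H01 \<Omega>. \<forall>u1\<in>L2 \<Omega>.
        (\<exists>Tm u v. maximal_solution \<Omega> p g u0 u1 Tm u v) \<and>
        (\<forall>Tm u v Tm' u' v'. maximal_solution \<Omega> p g u0 u1 Tm u v \<and>
             maximal_solution \<Omega> p g u0 u1 Tm' u' v' \<longrightarrow> Tm' = Tm \<and> agree_until \<Omega> Tm u u') \<and>
        (\<forall>Tm u v. maximal_solution \<Omega> p g u0 u1 Tm u v \<longrightarrow>
           (\<forall>T. Tm = ereal T \<longrightarrow>
              Limsup (at_left T) (\<lambda>t. ereal (normV \<Omega> (u t) + l2norm \<Omega> (v t))) = \<infinity>) \<and>
           (\<forall>T. 0 < T \<and> ereal T < Tm \<longrightarrow> abs_cont_on 0 T (energy \<Omega> p g u v)) \<and>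
           (AE t in lebesgue. 0 < t \<and> ereal t < Tm \<longrightarrow>
              (energy \<Omega> p g u v has_real_derivative energy_rate \<Omega> g g' u v t) (at t))))"

definition blowup_const :: "'a::euclidean_space set \<Rightarrow> real \<Rightarrow> (real \<Rightarrow> real) \<Rightarrow> real" where
  "blowup_const \<Omega> p g =
     min (p + 2) (2 * lambda1 \<Omega> * ((p - 1)\<^sup>2 * ell g - 1) / (2 * p + lambda1 \<Omega>))"

end

theory Submission
  imports Defs "HOL-Complex_Analysis.Great_Picard"
begin

text \<open>Write \<open>N\<close> for the norm of \<open>u\<close> in \<open>V\<close> and \<open>P = (u, u\<^sub>t)\<close>. Everything rests on two differential
  inequalities. The energy satisfies \<open>E' \<le> - \<parallel>\<nabla>u\<^sub>t\<parallel>\<^sup>2\<close>, since the kernel is nonnegative and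
  nonincreasing. Testing the equation with \<open>u\<close> and eliminating the potential energy gives
  \<open>P' \<ge> (1 + p/2) \<parallel>u\<^sub>t\<parallel>\<^sup>2 + m N\<^sup>2 - p E - (\<nabla>u\<^sub>t, \<nabla>u)\<close> with \<open>m = ((p - 1)\<^sup>2 \<ell> - 1) / (2p) > 0\<close>
  (lemma \<open>pairing_rate_ge\<close>): the source contributes at least \<open>p\<close> times its primitive, and the
  memory term is paid for by the memory part of \<open>p E\<close> and by a part of \<open>N\<^sup>2\<close>, which is where the
  lower bound on \<open>\<ell>\<close> enters.

  The constant \<open>C\<close> is such that together they give \<open>L' \<ge> C L\<close> for \<open>L = P - (p/C) E\<close>
  (\<open>lyapunov_growth\<close>), whence \<open>L \<ge> L\<^sub>0 exp (C t)\<close>. The lifespan bound has two phases. As long as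
  \<open>E > -\<beta>\<close>, the pairing \<open>P\<close>
  is bounded below by \<open>L\<^sub>0/2 + C L\<^sub>0 t\<close>, so \<open>\<parallel>u\<parallel>\<^sup>2\<close> grows quadratically, whereas the total dissipation,
  at most \<open>E(0) + \<beta>\<close>, lets \<open>u\<close> move away from \<open>u\<^sub>0\<close> at most like \<open>\<surd>t\<close>. The two bounds collide at
  \<open>t = \<tau>\<close>, so the energy reaches \<open>-\<beta>\<close> by then (\<open>energy_crosses_level\<close>), at a time when
  \<open>\<parallel>u\<parallel>\<^sup>2 \<le> U\<close> and \<open>N\<^sup>2 \<le> G\<close>. In the second phase the energy is at most \<open>-\<beta>\<close>, and Levine's concavity
  method bounds the remaining time by the positive root of a quadratic polynomial
  (\<open>concavity_after_crossing\<close>). Data as required are multiples \<open>(r\<phi>, a\<phi>)\<close> of one test function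
  with \<open>r\<close> large, because \<open>- |r|\<^sup>p log r\<close> outweighs the terms of the energy that are quadratic in \<open>r\<close>
  (\<open>exists_high_energy_data\<close>).

  To make this rigorous for energy solutions, four facts about $H_0^1$ and about time are needed.
  The first eigenvalue is positive and is the minimum of the Rayleigh quotient
  (\<open>lambda1_properties\<close>), which needs Rellich's theorem; the source acts on \<open>V\<close> by the subcritical
  Sobolev inequality. Both are obtained from averages over dyadic cells: the average over cells of
  side \<open>2\<^sup>-\<^sup>k\<close> differs from a test function by at most a multiple of \<open>2\<^sup>-\<^sup>k\<close> times its gradient norm.
  The squares of the norms of \<open>u\<close> in \<open>H\<close> and \<open>V\<close> and the pairing \<open>P\<close> are integrals of the expected
  derivatives; since the derivatives of \<open>u\<close> and \<open>u\<^sub>t\<close> are weak, this is a product rule for bilinear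
  quantities with partial derivatives in integrated form (\<open>bilinear_increment\<close>). The equation, which
  holds for each fixed test function at almost every time, holds at almost every time with \<open>u\<close>
  itself as test function (\<open>equation_tested_with_u\<close>). Finally, the increments of an absolutely
  continuous function are the integrals of its derivative (\<open>abs_cont_on_has_integral\<close>).\<close>

section \<open>Smooth functions\<close>

lemma Ck_on_imp_continuous_on: "Ck_on k S f \<Longrightarrow> continuous_on S f"
  by (cases k) (auto intro: continuous_at_imp_continuous_on differentiable_imp_continuous_within)

lemma Ck_on_SucD: "Ck_on (Suc k) S f \<Longrightarrow> Ck_on k S f"
proof (induction k arbitrary: f)
  case 0
  then show ?case using Ck_on_imp_continuous_on by (simp del: Ck_on.simps(2)) blast
next
  case (Suc k)
  then show ?case by (metis Ck_on.simps(2))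
qed

lemma smooth_on_differentiable: "smooth_on S f \<Longrightarrow> x \<in> S \<Longrightarrow> f differentiable (at x)"
  unfolding smooth_on_def by (metis Ck_on.simps(2))

lemma smooth_on_frechet_derivative:
  "smooth_on S f \<Longrightarrow> b \<in> Basis \<Longrightarrow> smooth_on S (\<lambda>x. frechet_derivative f (at x) b)"
  unfolding smooth_on_def by (metis Ck_on.simps(2))

lemma smooth_on_continuous: "smooth_on S f \<Longrightarrow> continuous_on S f"
  unfolding smooth_on_def using Ck_on_imp_continuous_on by blast

lemma frechet_derivative_eqI: "(f has_derivative f') (at x) \<Longrightarrow> frechet_derivative f (at x) = f'"
  using frechet_derivative_at by metis

lemma differentiable_has_derivative:
  "f differentiable (at x) \<Longrightarrow> (f has_derivative frechet_derivative f (at x)) (at x)"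
  using frechet_derivative_works by blast

lemma Ck_on_const: "Ck_on k UNIV (\<lambda>x. c)"
  by (induction k arbitrary: c) auto

lemma Ck_on_add: "Ck_on k UNIV f \<Longrightarrow> Ck_on k UNIV g \<Longrightarrow> Ck_on k UNIV (\<lambda>x. f x + g x)"
proof (induction k arbitrary: f g)
  case (Suc k)
  have "frechet_derivative (\<lambda>x. f x + g x) (at x) =
      (\<lambda>b. frechet_derivative f (at x) b + frechet_derivative g (at x) b)" for x
    using Suc.prems by (intro frechet_derivative_eqI has_derivative_add differentiable_has_derivative) auto
  then show ?case using Suc by auto
qed (auto intro: continuous_intros)

lemma Ck_on_mult: "Ck_on k UNIV f \<Longrightarrow> Ck_on k UNIV g \<Longrightarrow> Ck_on k UNIV (\<lambda>x. f x * g x)"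
proof (induction k arbitrary: f g)
  case (Suc k)
  have "frechet_derivative (\<lambda>x. f x * g x) (at x) =
      (\<lambda>b. f x * frechet_derivative g (at x) b + frechet_derivative f (at x) b * g x)" for x
    using Suc.prems by (intro frechet_derivative_eqI has_derivative_mult differentiable_has_derivative) auto
  moreover have "Ck_on k UNIV f" "Ck_on k UNIV g" using Suc.prems Ck_on_SucD by blast+
  ultimately show ?case using Suc by (auto intro!: Ck_on_add)
qed (auto intro: continuous_intros)

lemma smooth_on_const: "smooth_on UNIV (\<lambda>x. c)"
  by (simp add: smooth_on_def Ck_on_const)

lemma smooth_on_add: "smooth_on UNIV f \<Longrightarrow> smooth_on UNIV g \<Longrightarrow> smooth_on UNIV (\<lambda>x. f x + g x)"
  by (simp add: smooth_on_def Ck_on_add)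

lemma smooth_on_mult: "smooth_on UNIV f \<Longrightarrow> smooth_on UNIV g \<Longrightarrow> smooth_on UNIV (\<lambda>x. f x * g x)"
  by (simp add: smooth_on_def Ck_on_mult)

lemma smooth_on_prod:
  "finite I \<Longrightarrow> (\<And>i. i \<in> I \<Longrightarrow> smooth_on UNIV (f i)) \<Longrightarrow> smooth_on UNIV (\<lambda>x. \<Prod>i\<in>I. f i x)"
  by (induction rule: finite_induct) (auto intro: smooth_on_const smooth_on_mult)

lemma test_funI:
  "smooth_on UNIV \<phi> \<Longrightarrow> compact K \<Longrightarrow> K \<subseteq> \<Omega> \<Longrightarrow> (\<And>x. x \<notin> K \<Longrightarrow> \<phi> x = 0) \<Longrightarrow> \<phi> \<in> test_fun \<Omega>"
  unfolding test_fun_def by blast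

lemma test_fun_smooth: "\<phi> \<in> test_fun \<Omega> \<Longrightarrow> smooth_on UNIV \<phi>"
  by (simp add: test_fun_def)

lemma test_fun_continuous: "\<phi> \<in> test_fun \<Omega> \<Longrightarrow> continuous_on UNIV \<phi>"
  by (simp add: smooth_on_continuous test_fun_smooth)

lemma test_fun_has_derivative:
  "\<phi> \<in> test_fun \<Omega> \<Longrightarrow> (\<phi> has_derivative frechet_derivative \<phi> (at x)) (at x)"
  by (meson UNIV_I differentiable_has_derivative smooth_on_differentiable test_fun_smooth)

lemma test_fun_outside: "\<phi> \<in> test_fun \<Omega> \<Longrightarrow> x \<notin> \<Omega> \<Longrightarrow> \<phi> x = 0"
  unfolding test_fun_def by blast

lemma test_fun_lincomb:
  assumes "\<phi> \<in> test_fun \<Omega>" "\<psi> \<in> test_fun \<Omega>"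
  shows "(\<lambda>x. a * \<phi> x + b * \<psi> x) \<in> test_fun \<Omega>"
proof -
  obtain K K' where "compact K" "K \<subseteq> \<Omega>" "\<And>x. x \<notin> K \<Longrightarrow> \<phi> x = 0"
    "compact K'" "K' \<subseteq> \<Omega>" "\<And>x. x \<notin> K' \<Longrightarrow> \<psi> x = 0"
    using assms unfolding test_fun_def by blast
  then show ?thesis using assms
    by (intro test_funI[of _ "K \<union> K'"] smooth_on_add smooth_on_mult smooth_on_const)
      (auto simp: test_fun_smooth)
qed

lemma test_fun_scale: "\<phi> \<in> test_fun \<Omega> \<Longrightarrow> (\<lambda>x. a * \<phi> x) \<in> test_fun \<Omega>"
  using test_fun_lincomb[of \<phi> \<Omega> \<phi> a 0] by simp

lemma test_fun_mult:
  "\<phi> \<in> test_fun \<Omega> \<Longrightarrow> \<psi> \<in> test_fun \<Omega> \<Longrightarrow> (\<lambda>x. \<phi> x * \<psi> x) \<in> test_fun \<Omega>"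
  by (auto simp: test_fun_def intro!: smooth_on_mult)

lemma test_fun_frechet_derivative:
  assumes "\<phi> \<in> test_fun \<Omega>" "b \<in> Basis"
  shows "(\<lambda>x. frechet_derivative \<phi> (at x) b) \<in> test_fun \<Omega>"
proof -
  obtain K where K: "compact K" "K \<subseteq> \<Omega>" "\<And>x. x \<notin> K \<Longrightarrow> \<phi> x = 0"
    using assms unfolding test_fun_def by blast
  have "frechet_derivative \<phi> (at x) b = 0" if "x \<notin> K" for x
  proof -
    have "((\<lambda>_. 0::real) has_derivative (\<lambda>_. 0)) (at x)" by simp
    then have "(\<phi> has_derivative (\<lambda>_. 0)) (at x)"
      by (rule has_derivative_transform_within_open[where s="- K"]) (use K that compact_imp_closed in auto)
    then show ?thesis by (simp add: frechet_derivative_eqI)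
  qed
  then show ?thesis using K assms
    by (intro test_funI[of _ K] smooth_on_frechet_derivative) (auto simp: test_fun_smooth)
qed

lemma test_fun_bounded:
  assumes "\<phi> \<in> test_fun \<Omega>"
  obtains B where "0 \<le> B" "\<And>x. \<bar>\<phi> x\<bar> \<le> B"
proof -
  obtain K where K: "compact K" "K \<subseteq> \<Omega>" "\<And>x. x \<notin> K \<Longrightarrow> \<phi> x = 0"
    using assms unfolding test_fun_def by blast
  have "compact (\<phi> ` K)"
    using K test_fun_continuous[OF assms] by (intro compact_continuous_image) (auto intro: continuous_on_subset)
  then obtain B where "\<forall>x\<in>K. \<bar>\<phi> x\<bar> \<le> B"
    by (metis compact_imp_bounded bounded_iff image_eqI real_norm_def)
  then show ?thesis using K(3) that[of "max B 0"] by (metis abs_zero max.cobounded2 max.coboundedI1)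
qed

subsection \<open>Bump functions\<close>

text \<open>The functions \<open>t\<^sup>-\<^sup>m exp (-1/t)\<close>, extended by 0 to the left half line. They form a family
  that is closed under differentiation up to linear combinations.\<close>

definition flat_exp :: "nat \<Rightarrow> real \<Rightarrow> real" where
  "flat_exp m t = (if t > 0 then inverse t ^ m * exp (- inverse t) else 0)"

lemma flat_exp_quadratic_bound: "\<bar>flat_exp m t\<bar> \<le> fact (m + 2) * t\<^sup>2"
proof (cases "t > 0")
  case True
  define y where "y = inverse t"
  have y: "y > 0" using True by (simp add: y_def)
  have "y ^ (m + 2) / fact (m + 2) \<le> exp y"
  proof -
    have "(\<Sum>n\<in>{m+2}. y ^ n / fact n) \<le> (\<Sum>n. y ^ n / fact n)"
      using y summable_exp[of y] by (intro sum_le_suminf) (auto simp: divide_inverse_commute)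
    then show ?thesis by (simp add: exp_def divide_inverse_commute scaleR_conv_of_real)
  qed
  then have "y ^ m * exp (- y) * y\<^sup>2 \<le> fact (m + 2)"
    by (simp add: exp_minus field_simps power_add power2_eq_square del: fact_Suc)
  then have "y ^ m * exp (- y) \<le> fact (m + 2) * (inverse y)\<^sup>2"
    using y by (simp add: field_simps power2_eq_square)
  then show ?thesis using True by (simp add: flat_exp_def y_def abs_mult)
qed (simp add: flat_exp_def)

lemma flat_exp_has_derivative:
  "(flat_exp m has_real_derivative flat_exp (m + 2) t - real m * flat_exp (m + 1) t) (at t)"
proof -
  consider "t > 0" | "t < 0" | "t = 0" by linarith
  then show ?thesis
  proof cases
    case 1
    have aux: "t * t ^ (n - Suc 0) = (if n = 0 then t else t ^ n)" for n by (cases n) auto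
    have "((\<lambda>t. inverse t ^ m * exp (- inverse t)) has_real_derivative
        flat_exp (m + 2) t - real m * flat_exp (m + 1) t) (at t)"
      using 1 by (cases m) (auto intro!: derivative_eq_intros
         simp: flat_exp_def field_simps power2_eq_square power_add aux)
    then show ?thesis
      by (rule has_field_derivative_transform_within_open[where S="{0<..}"])
        (use 1 in \<open>auto simp: flat_exp_def\<close>)
  next
    case 2
    have "((\<lambda>t. 0) has_real_derivative flat_exp (m + 2) t - real m * flat_exp (m + 1) t) (at t)"
      using 2 by (simp add: flat_exp_def)
    then show ?thesis
      by (rule has_field_derivative_transform_within_open[where S="{..<0}"])
        (use 2 in \<open>auto simp: flat_exp_def\<close>)
  next
    case 3
    have "((\<lambda>h. (flat_exp m (0 + h) - flat_exp m 0) / h) \<longlongrightarrow> 0) (at 0)"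
    proof (rule tendsto_rabs_zero_cancel, rule tendsto_sandwich[where f="\<lambda>_. 0"])
      show "\<forall>\<^sub>F h in at 0. \<bar>(flat_exp m (0 + h) - flat_exp m 0) / h\<bar> \<le> fact (m + 2) * \<bar>h\<bar>"
      proof (rule eventually_mono[OF eventually_at_ball'[of 1 "0::real"]])
        fix h :: real assume "h \<in> ball 0 1 \<and> h \<noteq> 0 \<and> h \<in> UNIV"
        then have "\<bar>flat_exp m h\<bar> / \<bar>h\<bar> \<le> fact (m + 2) * h\<^sup>2 / \<bar>h\<bar>"
          by (intro divide_right_mono flat_exp_quadratic_bound) auto
        also have "\<dots> = fact (m + 2) * \<bar>h\<bar>"
          using \<open>h \<in> ball 0 1 \<and> h \<noteq> 0 \<and> h \<in> UNIV\<close>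
          by (subst power2_abs[symmetric]) (simp add: power2_eq_square del: fact_Suc abs_mult_self_eq)
        finally show "\<bar>(flat_exp m (0 + h) - flat_exp m 0) / h\<bar> \<le> fact (m + 2) * \<bar>h\<bar>"
          by (simp add: flat_exp_def)
      qed auto
      show "((\<lambda>h. fact (m + 2) * \<bar>h::real\<bar>) \<longlongrightarrow> 0) (at 0)"
        by (auto intro!: tendsto_eq_intros)
    qed auto
    then show ?thesis using 3 by (simp add: flat_exp_def DERIV_def)
  qed
qed

text \<open>All indices \<open>m\<close> are treated at once, because differentiation leads from \<open>m\<close> to larger indices.\<close>

lemma smooth_on_flat_exp_affine: "smooth_on UNIV (\<lambda>x. flat_exp m (c * (x \<bullet> b) + d))"
proof -
  have "Ck_on k UNIV (\<lambda>x. flat_exp m (c * (x \<bullet> b) + d))" for k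
  proof (induction k arbitrary: m)
    case 0
    have "isCont (flat_exp m) t" for t using flat_exp_has_derivative DERIV_isCont by blast
    then have "continuous_on UNIV (flat_exp m)" by (simp add: continuous_at_imp_continuous_on)
    moreover have "continuous_on UNIV (\<lambda>x. c * (x \<bullet> b) + d)" by (intro continuous_intros)
    ultimately show ?case unfolding Ck_on.simps using continuous_on_compose2 by blast
  next
    case (Suc k)
    have d: "((\<lambda>x. flat_exp m (c * (x \<bullet> b) + d)) has_derivative
       (\<lambda>e. (flat_exp (m + 2) (c * (x \<bullet> b) + d) - real m * flat_exp (m + 1) (c * (x \<bullet> b) + d))
            * (c * (e \<bullet> b)))) (at x)" for x
    proof -
      have "((\<lambda>x. c * (x \<bullet> b) + d) has_derivative (\<lambda>e. c * (e \<bullet> b))) (at x)"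
        by (auto intro!: derivative_eq_intros)
      moreover have "(flat_exp m has_derivative (*)
         (flat_exp (m + 2) (c * (x \<bullet> b) + d) - real m * flat_exp (m + 1) (c * (x \<bullet> b) + d)))
         (at (c * (x \<bullet> b) + d))"
        using flat_exp_has_derivative by (auto simp: has_field_derivative_def)
      ultimately show ?thesis
        using has_derivative_compose by fastforce
    qed
    have "Ck_on k UNIV (\<lambda>x. (flat_exp (m + 2) (c * (x \<bullet> b) + d)
        + (- real m) * flat_exp (m + 1) (c * (x \<bullet> b) + d)) * (c * (e \<bullet> b)))" for e
      by (intro Ck_on_mult Ck_on_add Suc Ck_on_const)
    then show ?case
      using d by (auto simp: frechet_derivative_eqI[OF d] differentiable_def)
  qed
  then show ?thesis by (simp add: smooth_on_def)
qed

lemma flat_exp_nonneg: "0 \<le> flat_exp m t" and flat_exp_0_le_1: "flat_exp 0 t \<le> 1"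
  by (auto simp: flat_exp_def)

text \<open>Smooth approximations of the indicator function of an open box from below.\<close>

definition box_bump :: "'a::euclidean_space \<Rightarrow> 'a \<Rightarrow> nat \<Rightarrow> 'a \<Rightarrow> real" where
  "box_bump a c k x = (\<Prod>b\<in>Basis. flat_exp 0 (real (Suc k) * (x \<bullet> b - a \<bullet> b))
                                * flat_exp 0 (real (Suc k) * (c \<bullet> b - x \<bullet> b)))"

lemma box_bump_test_fun:
  assumes "cbox a c \<subseteq> \<Omega>"
  shows "box_bump a c k \<in> test_fun \<Omega>"
proof (rule test_funI[of _ "cbox a c"])
  have "smooth_on UNIV (\<lambda>x. flat_exp 0 (real (Suc k) * (x \<bullet> b) + (- real (Suc k) * (a \<bullet> b)))
                 * flat_exp 0 (- real (Suc k) * (x \<bullet> b) + real (Suc k) * (c \<bullet> b)))" for b :: 'a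
    by (intro smooth_on_mult smooth_on_flat_exp_affine)
  then show "smooth_on UNIV (box_bump a c k)"
    unfolding box_bump_def by (intro smooth_on_prod) (auto simp: algebra_simps)
  show "box_bump a c k x = 0" if x: "x \<notin> cbox a c" for x
  proof -
    obtain b where b: "b \<in> Basis" "\<not> (a \<bullet> b \<le> x \<bullet> b \<and> x \<bullet> b \<le> c \<bullet> b)"
      using x unfolding mem_box by blast
    then have "flat_exp 0 (real (Suc k) * (x \<bullet> b - a \<bullet> b)) * flat_exp 0 (real (Suc k) * (c \<bullet> b - x \<bullet> b)) = 0"
      by (auto simp: flat_exp_def zero_less_mult_iff)
    then show ?thesis unfolding box_bump_def using b(1) by (meson finite_Basis prod_zero)
  qed
qed (use assms in auto)

lemma box_bump_nonneg: "0 \<le> box_bump a c k x"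
  unfolding box_bump_def by (intro prod_nonneg) (simp add: flat_exp_nonneg)

lemma box_bump_le_1: "box_bump a c k x \<le> 1"
  unfolding box_bump_def
  by (intro prod_le_1) (simp add: flat_exp_nonneg flat_exp_0_le_1 mult_le_one)

lemma box_bump_pos: "x \<in> box a c \<Longrightarrow> 0 < box_bump a c k x"
  unfolding box_bump_def by (intro prod_pos) (auto simp: flat_exp_def mem_box)

lemma box_bump_outside: "x \<notin> box a c \<Longrightarrow> box_bump a c k x = 0"
proof -
  assume "x \<notin> box a c"
  then obtain b where b: "b \<in> Basis" "\<not> (a \<bullet> b < x \<bullet> b \<and> x \<bullet> b < c \<bullet> b)"
    unfolding mem_box by blast
  then have "flat_exp 0 (real (Suc k) * (x \<bullet> b - a \<bullet> b)) * flat_exp 0 (real (Suc k) * (c \<bullet> b - x \<bullet> b)) = 0"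
    by (auto simp: flat_exp_def zero_less_mult_iff)
  then show ?thesis unfolding box_bump_def using b(1) by (meson finite_Basis prod_zero)
qed

lemma box_bump_tendsto: "(\<lambda>k. box_bump a c k x) \<longlonglongrightarrow> indicator (box a c) x"
proof (cases "x \<in> box a c")
  case True
  have *: "(\<lambda>k. flat_exp 0 (real (Suc k) * s)) \<longlonglongrightarrow> 1" if "s > 0" for s
  proof -
    have "(\<lambda>k. exp (- inverse s * inverse (real (Suc k)))) \<longlonglongrightarrow> exp (- inverse s * 0)"
      by (intro tendsto_intros LIMSEQ_inverse_real_of_nat)
    moreover have "flat_exp 0 (real (Suc k) * s) = exp (- inverse s * inverse (real (Suc k)))" for k
      using that by (simp add: flat_exp_def zero_less_mult_iff field_simps del: of_nat_Suc)
    ultimately show ?thesis by simp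
  qed
  have "(\<lambda>k. box_bump a c k x) \<longlonglongrightarrow> (\<Prod>b\<in>(Basis::'a set). 1 * 1)"
    unfolding box_bump_def by (intro tendsto_prod tendsto_mult *) (use True in \<open>auto simp: mem_box\<close>)
  then show ?thesis using True by simp
qed (simp add: box_bump_outside)

section \<open>The seminormed space of square integrable functions\<close>

lemma nonneg_quadratic_imp_square_le:
  fixes A B C :: real
  assumes "\<And>x. 0 \<le> A + 2 * x * B + x\<^sup>2 * C" "0 \<le> C"
  shows "B\<^sup>2 \<le> A * C"
proof (cases "C = 0")
  case True
  have "B = 0"
  proof (rule ccontr)
    assume "B \<noteq> 0"
    then have "A + 2 * (- (A + 1) / (2 * B)) * B + (- (A + 1) / (2 * B))\<^sup>2 * C = -1"
      using True by (simp add: field_simps)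
    then show False using assms(1)[of "- (A + 1) / (2 * B)"] by linarith
  qed
  then show ?thesis using True by simp
next
  case False
  then have C: "C > 0" using assms(2) by simp
  have "A + 2 * (- B / C) * B + (- B / C)\<^sup>2 * C = (A * C - B\<^sup>2) / C"
    using C by (simp add: field_simps power2_eq_square)
  then show ?thesis using assms(1)[of "- B / C"] C by (simp add: zero_le_divide_iff)
qed

text \<open>Fatou's lemma for the Bochner integral.\<close>

lemma integral_le_of_AE_tendsto:
  fixes f :: "'a \<Rightarrow> real"
  assumes [measurable]: "f \<in> borel_measurable M" and int: "\<And>k. integrable M (s k)"
    and nn: "\<And>k. AE x in M. 0 \<le> s k x" and le: "\<And>k. integral\<^sup>L M (s k) \<le> B"
    and lim: "AE x in M. (\<lambda>k. s k x) \<longlonglongrightarrow> f x"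
  shows "integrable M f" "integral\<^sup>L M f \<le> B"
proof -
  have nn': "AE x in M. \<forall>k. 0 \<le> s k x" using nn by (simp add: AE_all_countable)
  have B: "0 \<le> B" using integral_nonneg_AE[OF nn[of 0]] le[of 0] by linarith
  have f0: "AE x in M. 0 \<le> f x"
    using lim nn' by eventually_elim (auto intro: LIMSEQ_le_const)
  have [measurable]: "s k \<in> borel_measurable M" for k using int by auto
  have "(\<integral>\<^sup>+x. ennreal (f x) \<partial>M) = (\<integral>\<^sup>+x. liminf (\<lambda>k. ennreal (s k x)) \<partial>M)"
    using lim nn' f0
  proof (intro nn_integral_cong_AE, eventually_elim)
    case (elim x)
    then have "(\<lambda>k. ennreal (s k x)) \<longlonglongrightarrow> ennreal (f x)" by (intro tendsto_ennrealI)
    then show ?case by (simp add: lim_imp_Liminf)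
  qed
  also have "\<dots> \<le> liminf (\<lambda>k. \<integral>\<^sup>+x. ennreal (s k x) \<partial>M)"
    by (intro nn_integral_liminf) auto
  also have "\<dots> \<le> liminf (\<lambda>k. ennreal B)"
    using int nn le by (intro Liminf_mono always_eventually) (auto simp: nn_integral_eq_integral intro!: ennreal_leI)
  also have "\<dots> = ennreal B" by (simp add: Liminf_const)
  finally have *: "(\<integral>\<^sup>+x. ennreal (f x) \<partial>M) \<le> ennreal B" .
  then show i: "integrable M f"
    using f0 by (intro integrableI_nonneg) (auto simp: le_less_trans[OF _ ennreal_less_top])
  show "integral\<^sup>L M f \<le> B" using * nn_integral_eq_integral[OF i f0] B by simp
qed

lemma L2_measurable: "f \<in> L2 \<Omega> \<Longrightarrow> f \<in> borel_measurable (lebesgue_on \<Omega>)"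
  and L2_integrable_norm: "f \<in> L2 \<Omega> \<Longrightarrow> integrable (lebesgue_on \<Omega>) (\<lambda>x. (norm (f x))\<^sup>2)"
  by (simp_all add: L2_def)

lemma L2_integrable_inner:
  assumes "f \<in> L2 \<Omega>" "h \<in> L2 \<Omega>"
  shows "integrable (lebesgue_on \<Omega>) (\<lambda>x. f x \<bullet> h x)"
proof (rule Bochner_Integration.integrable_bound)
  show "integrable (lebesgue_on \<Omega>) (\<lambda>x. (norm (f x))\<^sup>2 + (norm (h x))\<^sup>2)"
    using assms by (intro Bochner_Integration.integrable_add L2_integrable_norm)
  show "(\<lambda>x. f x \<bullet> h x) \<in> borel_measurable (lebesgue_on \<Omega>)"
    using assms by (intro borel_measurable_inner L2_measurable)
  have "\<bar>a \<bullet> b\<bar> \<le> (norm a)\<^sup>2 + (norm b)\<^sup>2" for a b :: 'b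
  proof -
    have "\<bar>a \<bullet> b\<bar> \<le> norm a * norm b" by (rule Cauchy_Schwarz_ineq2)
    also have "\<dots> \<le> (norm a)\<^sup>2 + (norm b)\<^sup>2"
      using sum_squares_bound[of "norm a" "norm b"]
        mult_nonneg_nonneg[OF norm_ge_zero[of a] norm_ge_zero[of b]] by linarith
    finally show ?thesis .
  qed
  then show "AE x in lebesgue_on \<Omega>. norm (f x \<bullet> h x) \<le> norm ((norm (f x))\<^sup>2 + (norm (h x))\<^sup>2)"
    by auto
qed

lemma L2_lincomb:
  assumes "f \<in> L2 \<Omega>" "h \<in> L2 \<Omega>"
  shows "(\<lambda>x. a *\<^sub>R f x + b *\<^sub>R h x) \<in> L2 \<Omega>"
proof -
  have "(norm (a *\<^sub>R f x + b *\<^sub>R h x))\<^sup>2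
      = a\<^sup>2 * (norm (f x))\<^sup>2 + 2 * a * b * (f x \<bullet> h x) + b\<^sup>2 * (norm (h x))\<^sup>2" for x
    unfolding power2_norm_eq_inner by (simp add: algebra_simps inner_commute power2_eq_square)
  moreover have "integrable (lebesgue_on \<Omega>)
     (\<lambda>x. a\<^sup>2 * (norm (f x))\<^sup>2 + 2 * a * b * (f x \<bullet> h x) + b\<^sup>2 * (norm (h x))\<^sup>2)"
    using assms by (intro Bochner_Integration.integrable_add integrable_mult_right
        L2_integrable_norm L2_integrable_inner)
  ultimately show ?thesis
    using assms unfolding L2_def by (auto intro!: borel_measurable_add borel_measurable_scaleR)
qed

lemma L2_diff: "f \<in> L2 \<Omega> \<Longrightarrow> h \<in> L2 \<Omega> \<Longrightarrow> (\<lambda>x. f x - h x) \<in> L2 \<Omega>"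
  using L2_lincomb[of f \<Omega> h 1 "-1"] by simp

lemma L2_scaleR: "f \<in> L2 \<Omega> \<Longrightarrow> (\<lambda>x. a *\<^sub>R f x) \<in> L2 \<Omega>"
  using L2_lincomb[of f \<Omega> f a 0] by simp

lemma L2_scale: "f \<in> L2 \<Omega> \<Longrightarrow> (\<lambda>x. a * f x :: real) \<in> L2 \<Omega>"
  using L2_scaleR[of f \<Omega> a] by simp

lemma l2inner_commute: "l2inner \<Omega> f h = l2inner \<Omega> h f"
  by (simp add: l2inner_def inner_commute)

lemma l2norm_nonneg [simp]: "0 \<le> l2norm \<Omega> f"
  by (simp add: l2norm_def)

lemma l2norm_square: "(l2norm \<Omega> f)\<^sup>2 = (\<integral>x. (norm (f x))\<^sup>2 \<partial>lebesgue_on \<Omega>)"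
  by (simp add: l2norm_def)

lemma l2inner_self: "l2inner \<Omega> f f = (l2norm \<Omega> f)\<^sup>2"
  by (simp add: l2inner_def l2norm_square power2_norm_eq_inner)

lemma l2inner_lincomb_left:
  assumes "f \<in> L2 \<Omega>" "h \<in> L2 \<Omega>" "z \<in> L2 \<Omega>"
  shows "l2inner \<Omega> (\<lambda>x. a *\<^sub>R f x + b *\<^sub>R h x) z = a * l2inner \<Omega> f z + b * l2inner \<Omega> h z"
proof -
  have "l2inner \<Omega> (\<lambda>x. a *\<^sub>R f x + b *\<^sub>R h x) z
     = (\<integral>x. a * (f x \<bullet> z x) + b * (h x \<bullet> z x) \<partial>lebesgue_on \<Omega>)"
    by (simp add: l2inner_def inner_left_distrib)
  also have "\<dots> = a * l2inner \<Omega> f z + b * l2inner \<Omega> h z"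
    using L2_integrable_inner[OF assms(1,3)] L2_integrable_inner[OF assms(2,3)]
    by (simp add: l2inner_def)
  finally show ?thesis .
qed

lemma l2inner_diff_left: "f \<in> L2 \<Omega> \<Longrightarrow> h \<in> L2 \<Omega> \<Longrightarrow> z \<in> L2 \<Omega> \<Longrightarrow>
    l2inner \<Omega> (\<lambda>x. f x - h x) z = l2inner \<Omega> f z - l2inner \<Omega> h z"
  using l2inner_lincomb_left[of f \<Omega> h z 1 "-1"] by simp

lemma l2inner_diff_right: "f \<in> L2 \<Omega> \<Longrightarrow> h \<in> L2 \<Omega> \<Longrightarrow> z \<in> L2 \<Omega> \<Longrightarrow>
    l2inner \<Omega> z (\<lambda>x. f x - h x) = l2inner \<Omega> z f - l2inner \<Omega> z h"
  by (simp add: l2inner_diff_left l2inner_commute[of _ z])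

lemma l2inner_scaleR_left: "l2inner \<Omega> (\<lambda>x. a *\<^sub>R f x) z = a * l2inner \<Omega> f z"
  by (simp add: l2inner_def)

lemma l2inner_scaleR_right: "l2inner \<Omega> z (\<lambda>x. a *\<^sub>R f x) = a * l2inner \<Omega> z f"
  by (simp add: l2inner_def)

lemma l2norm_scaleR: "l2norm \<Omega> (\<lambda>x. a *\<^sub>R f x) = \<bar>a\<bar> * l2norm \<Omega> f"
  by (simp add: l2norm_def power_mult_distrib real_sqrt_mult)

lemma l2norm_scale: "l2norm \<Omega> (\<lambda>x. a * f x :: real) = \<bar>a\<bar> * l2norm \<Omega> f"
  using l2norm_scaleR[of \<Omega> a f] by simp

lemma l2norm_minus_commute: "l2norm \<Omega> (\<lambda>x. f x - h x) = l2norm \<Omega> (\<lambda>x. h x - f x)"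
  by (simp add: l2norm_def norm_minus_commute)

lemma l2norm_lincomb_square:
  assumes "f \<in> L2 \<Omega>" "h \<in> L2 \<Omega>"
  shows "(l2norm \<Omega> (\<lambda>x. a *\<^sub>R f x + b *\<^sub>R h x))\<^sup>2
    = a\<^sup>2 * (l2norm \<Omega> f)\<^sup>2 + 2 * a * b * l2inner \<Omega> f h + b\<^sup>2 * (l2norm \<Omega> h)\<^sup>2"
proof -
  let ?z = "\<lambda>x. a *\<^sub>R f x + b *\<^sub>R h x"
  have z: "?z \<in> L2 \<Omega>" using assms by (rule L2_lincomb)
  have "l2inner \<Omega> ?z ?z = a * l2inner \<Omega> ?z f + b * l2inner \<Omega> ?z h"
    using assms z l2inner_lincomb_left[of f \<Omega> h ?z a b] by (simp add: l2inner_commute)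
  also have "\<dots> = a * (a * l2inner \<Omega> f f + b * l2inner \<Omega> h f)
      + b * (a * l2inner \<Omega> f h + b * l2inner \<Omega> h h)"
    using assms by (simp add: l2inner_lincomb_left)
  finally show ?thesis
    by (simp add: l2inner_self l2inner_commute[of \<Omega> h f] algebra_simps power2_eq_square)
qed

lemma l2norm_add_square:
  "f \<in> L2 \<Omega> \<Longrightarrow> h \<in> L2 \<Omega> \<Longrightarrow> (l2norm \<Omega> (\<lambda>x. f x + h x))\<^sup>2
    = (l2norm \<Omega> f)\<^sup>2 + 2 * l2inner \<Omega> f h + (l2norm \<Omega> h)\<^sup>2"
  using l2norm_lincomb_square[of f \<Omega> h 1 1] by simp

lemma l2norm_diff_square:
  "f \<in> L2 \<Omega> \<Longrightarrow> h \<in> L2 \<Omega> \<Longrightarrow> (l2norm \<Omega> (\<lambda>x. f x - h x))\<^sup>2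
    = (l2norm \<Omega> f)\<^sup>2 - 2 * l2inner \<Omega> f h + (l2norm \<Omega> h)\<^sup>2"
  using l2norm_lincomb_square[of f \<Omega> h 1 "-1"] by simp

lemma l2_Cauchy_Schwarz:
  assumes "f \<in> L2 \<Omega>" "h \<in> L2 \<Omega>"
  shows "\<bar>l2inner \<Omega> f h\<bar> \<le> l2norm \<Omega> f * l2norm \<Omega> h"
proof -
  have "0 \<le> (l2norm \<Omega> f)\<^sup>2 + 2 * x * l2inner \<Omega> f h + x\<^sup>2 * (l2norm \<Omega> h)\<^sup>2" for x
    using l2norm_lincomb_square[OF assms, of 1 x] zero_le_power2[of "l2norm \<Omega> (\<lambda>y. 1 *\<^sub>R f y + x *\<^sub>R h y)"]
    by simp
  then have "(l2inner \<Omega> f h)\<^sup>2 \<le> (l2norm \<Omega> f)\<^sup>2 * (l2norm \<Omega> h)\<^sup>2"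
    by (intro nonneg_quadratic_imp_square_le) auto
  then show ?thesis
    by (metis abs_le_square_iff abs_of_nonneg l2norm_nonneg mult_nonneg_nonneg power_mult_distrib)
qed

lemma l2norm_triangle:
  assumes "f \<in> L2 \<Omega>" "h \<in> L2 \<Omega>"
  shows "l2norm \<Omega> (\<lambda>x. f x + h x) \<le> l2norm \<Omega> f + l2norm \<Omega> h"
proof (rule power2_le_imp_le)
  show "(l2norm \<Omega> (\<lambda>x. f x + h x))\<^sup>2 \<le> (l2norm \<Omega> f + l2norm \<Omega> h)\<^sup>2"
    using l2norm_add_square[OF assms] l2_Cauchy_Schwarz[OF assms] by (simp add: power2_sum)
qed simp

lemma l2norm_triangle_diff:
  assumes "f \<in> L2 \<Omega>" "h \<in> L2 \<Omega>"
  shows "l2norm \<Omega> f \<le> l2norm \<Omega> h + l2norm \<Omega> (\<lambda>x. f x - h x)"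
  using l2norm_triangle[OF assms(2) L2_diff[OF assms]] by simp

lemma l2norm_dist_triangle:
  assumes "f \<in> L2 \<Omega>" "k \<in> L2 \<Omega>" "h \<in> L2 \<Omega>"
  shows "l2norm \<Omega> (\<lambda>x. f x - h x) \<le> l2norm \<Omega> (\<lambda>x. f x - k x) + l2norm \<Omega> (\<lambda>x. k x - h x)"
  using l2norm_triangle[OF L2_diff[OF assms(1,2)] L2_diff[OF assms(2,3)]] by simp

lemma l2norm_abs_diff_le:
  assumes "f \<in> L2 \<Omega>" "h \<in> L2 \<Omega>"
  shows "\<bar>l2norm \<Omega> f - l2norm \<Omega> h\<bar> \<le> l2norm \<Omega> (\<lambda>x. f x - h x)"
  using l2norm_triangle_diff[OF assms] l2norm_triangle_diff[OF assms(2,1)]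
  by (simp add: l2norm_minus_commute[of \<Omega> h f])

lemma l2norm_eq_0_iff:
  "f \<in> L2 \<Omega> \<Longrightarrow> l2norm \<Omega> f = 0 \<longleftrightarrow> (AE x in lebesgue_on \<Omega>. f x = 0)"
  using integral_nonneg_eq_0_iff_AE[OF L2_integrable_norm[of f \<Omega>]] by (simp add: l2norm_def)

lemma l2norm_cong_AE:
  assumes "f \<in> L2 \<Omega>" "h \<in> L2 \<Omega>" "AE x in lebesgue_on \<Omega>. f x = h x"
  shows "l2norm \<Omega> f = l2norm \<Omega> h"
proof -
  have "l2norm \<Omega> (\<lambda>x. f x - h x) = 0"
    using assms by (subst l2norm_eq_0_iff) (auto intro: L2_diff)
  then show ?thesis using l2norm_abs_diff_le[OF assms(1,2)] by simp
qed

lemma l2inner_cong_AE: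
  assumes "f \<in> L2 \<Omega>" "h \<in> L2 \<Omega>" "z \<in> L2 \<Omega>" "AE x in lebesgue_on \<Omega>. f x = h x"
  shows "l2inner \<Omega> f z = l2inner \<Omega> h z"
proof -
  have "l2norm \<Omega> (\<lambda>x. f x - h x) = 0"
    using assms by (subst l2norm_eq_0_iff) (auto intro: L2_diff)
  then show ?thesis
    using l2_Cauchy_Schwarz[OF L2_diff[OF assms(1,2)] assms(3)] l2inner_diff_left[OF assms(1,2,3)] by simp
qed

lemma l2inner_tendsto:
  assumes "\<And>k. f k \<in> L2 \<Omega>" "h \<in> L2 \<Omega>" "z \<in> L2 \<Omega>"
    and "((\<lambda>k. l2norm \<Omega> (\<lambda>x. f k x - h x)) \<longlongrightarrow> 0) F"
  shows "((\<lambda>k. l2inner \<Omega> (f k) z) \<longlongrightarrow> l2inner \<Omega> h z) F"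
proof -
  have A: "((\<lambda>k. l2norm \<Omega> (\<lambda>x. f k x - h x) * l2norm \<Omega> z) \<longlongrightarrow> 0) F"
    using assms(4) tendsto_mult_left_zero by blast
  have B: "\<bar>l2inner \<Omega> (f k) z - l2inner \<Omega> h z\<bar> \<le> l2norm \<Omega> (\<lambda>x. f k x - h x) * l2norm \<Omega> z" for k
    using l2_Cauchy_Schwarz[OF L2_diff[OF assms(1,2)] assms(3), of k]
      l2inner_diff_left[OF assms(1,2,3), of k] by simp
  have "((\<lambda>k. l2inner \<Omega> (f k) z - l2inner \<Omega> h z) \<longlongrightarrow> 0) F"
    by (rule Lim_null_comparison[OF _ A]) (use B in simp)
  then show ?thesis by (simp add: LIM_zero_iff)
qed

lemma l2norm_tendsto:
  assumes "\<And>k. f k \<in> L2 \<Omega>" "h \<in> L2 \<Omega>"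
    and "((\<lambda>k. l2norm \<Omega> (\<lambda>x. f k x - h x)) \<longlongrightarrow> 0) F"
  shows "((\<lambda>k. l2norm \<Omega> (f k)) \<longlongrightarrow> l2norm \<Omega> h) F"
proof -
  have "((\<lambda>k. l2norm \<Omega> (f k) - l2norm \<Omega> h) \<longlongrightarrow> 0) F"
    by (rule Lim_null_comparison[OF _ assms(3)])
      (use l2norm_abs_diff_le[OF assms(1,2)] in simp)
  then show ?thesis by (simp add: LIM_zero_iff)
qed

lemma L2_tendsto_AE_subseq:
  assumes "\<And>k. f k \<in> L2 \<Omega>" "h \<in> L2 \<Omega>" "(\<lambda>k. l2norm \<Omega> (\<lambda>x. f k x - h x)) \<longlonglongrightarrow> 0"
  obtains r :: "nat \<Rightarrow> nat" where "strict_mono r" "AE x in lebesgue_on \<Omega>. (\<lambda>k. f (r k) x) \<longlonglongrightarrow> h x"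
proof -
  have "(\<lambda>k. (l2norm \<Omega> (\<lambda>x. f k x - h x))\<^sup>2) \<longlonglongrightarrow> 0"
    using tendsto_power[OF assms(3), of 2] by simp
  then have "(\<lambda>k. \<integral>x. norm ((norm (f k x - h x))\<^sup>2) \<partial>lebesgue_on \<Omega>) \<longlonglongrightarrow> 0"
    by (simp add: l2norm_square)
  moreover have "integrable (lebesgue_on \<Omega>) (\<lambda>x. (norm (f k x - h x))\<^sup>2)" for k
    using L2_integrable_norm[OF L2_diff[OF assms(1,2)]] .
  ultimately obtain r :: "nat \<Rightarrow> nat" where r: "strict_mono r"
    "AE x in lebesgue_on \<Omega>. (\<lambda>k. (norm (f (r k) x - h x))\<^sup>2) \<longlonglongrightarrow> 0"
    using tendsto_L1_AE_subseq[of "lebesgue_on \<Omega>" "\<lambda>k x. (norm (f k x - h x))\<^sup>2"] by auto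
  have "AE x in lebesgue_on \<Omega>. (\<lambda>k. f (r k) x) \<longlonglongrightarrow> h x"
    using r(2)
  proof eventually_elim
    case (elim x)
    then have "(\<lambda>k. sqrt ((norm (f (r k) x - h x))\<^sup>2)) \<longlonglongrightarrow> sqrt 0" by (rule tendsto_real_sqrt)
    then have "(\<lambda>k. norm (f (r k) x - h x)) \<longlonglongrightarrow> 0" by simp
    then show ?case using LIM_zero_iff tendsto_norm_zero_iff by blast
  qed
  then show ?thesis using r(1) that by blast
qed

text \<open>Completeness. A subsequence with \<open>\<parallel>f\<^sub>k\<^sub>+\<^sub>1 - f\<^sub>k\<parallel> \<le> 2\<^sup>-\<^sup>k\<close> converges pointwise almost everywhere,
  because \<open>\<Sum> 2\<^sup>k |f\<^sub>k\<^sub>+\<^sub>1 - f\<^sub>k|\<^sup>2\<close> has finite integral; Fatou's lemma identifies the limit.\<close>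

lemma L2_complete:
  fixes f :: "nat \<Rightarrow> 'a::euclidean_space \<Rightarrow> 'b::euclidean_space"
  assumes f: "\<And>k. f k \<in> L2 \<Omega>"
    and Cauchy: "\<And>e. e > 0 \<Longrightarrow> \<exists>N. \<forall>m\<ge>N. \<forall>n\<ge>N. l2norm \<Omega> (\<lambda>x. f m x - f n x) < e"
  obtains h where "h \<in> L2 \<Omega>" "(\<lambda>k. l2norm \<Omega> (\<lambda>x. f k x - h x)) \<longlonglongrightarrow> 0"
proof -
  let ?M = "lebesgue_on \<Omega>"
  have [measurable]: "f k \<in> borel_measurable ?M" for k using f L2_measurable by blast
  have "\<exists>N. \<forall>m\<ge>N. \<forall>n\<ge>N. l2norm \<Omega> (\<lambda>x. f m x - f n x) < (1/2)^k" for k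
    by (intro Cauchy) simp
  then obtain N where N: "\<And>k m n. m \<ge> N k \<Longrightarrow> n \<ge> N k \<Longrightarrow> l2norm \<Omega> (\<lambda>x. f m x - f n x) < (1/2)^k"
    by metis
  define r where "r k = (\<Sum>j\<le>k. N j)" for k
  have rN: "N k \<le> r k" for k unfolding r_def by (intro member_le_sum) auto
  have rN': "N k \<le> r (Suc k)" for k using rN[of k] by (simp add: r_def)
  define D where "D k x = norm (f (r (Suc k)) x - f (r k) x)" for k x
  have [measurable]: "D k \<in> borel_measurable ?M" for k unfolding D_def by measurable
  have Dint: "integrable ?M (\<lambda>x. (D k x)\<^sup>2)" for k
    unfolding D_def by (intro L2_integrable_norm L2_diff f)
  have "(\<integral>\<^sup>+x. (\<Sum>k. ennreal (2^k * (D k x)\<^sup>2)) \<partial>?M) = (\<Sum>k. \<integral>\<^sup>+x. ennreal (2^k * (D k x)\<^sup>2) \<partial>?M)"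
    by (intro nn_integral_suminf) measurable
  also have "\<dots> \<le> (\<Sum>k. ennreal ((1/2)^k))"
  proof (intro suminf_le summableI)
    fix k
    have "(\<integral>\<^sup>+x. ennreal (2^k * (D k x)\<^sup>2) \<partial>?M) = ennreal (\<integral>x. 2^k * (D k x)\<^sup>2 \<partial>?M)"
      using Dint by (intro nn_integral_eq_integral) auto
    also have "(\<integral>x. 2^k * (D k x)\<^sup>2 \<partial>?M) = 2^k * (l2norm \<Omega> (\<lambda>x. f (r (Suc k)) x - f (r k) x))\<^sup>2"
      unfolding l2norm_square D_def by simp
    also have "\<dots> \<le> 2^k * ((1/2)^k)\<^sup>2"
      using N[OF rN' rN, of k] by (intro mult_left_mono power_mono) auto
    also have "\<dots> = (1/2)^k" by (simp add: power2_eq_square power_one_over field_simps)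
    finally show "(\<integral>\<^sup>+x. ennreal (2^k * (D k x)\<^sup>2) \<partial>?M) \<le> ennreal ((1/2)^k)"
      by (simp add: ennreal_leI)
  qed
  also have "\<dots> = ennreal (\<Sum>k. (1/2)^k)" by (intro suminf_ennreal2) (auto intro: summable_geometric)
  also have "\<dots> < \<infinity>" by simp
  finally have "(\<integral>\<^sup>+x. (\<Sum>k. ennreal (2^k * (D k x)\<^sup>2)) \<partial>?M) \<noteq> \<infinity>" by simp
  then have fin: "AE x in ?M. (\<Sum>k. ennreal (2^k * (D k x)\<^sup>2)) \<noteq> \<infinity>"
    by (intro nn_integral_PInf_AE) measurable
  define h where "h x = lim (\<lambda>k. f (r k) x)" for x
  have [measurable]: "h \<in> borel_measurable ?M" unfolding h_def by measurable
  have lim: "AE x in ?M. (\<lambda>k. f (r k) x) \<longlonglongrightarrow> h x"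
    using fin
  proof eventually_elim
    case (elim x)
    have sm: "summable (\<lambda>k. 2^k * (D k x)\<^sup>2)"
      by (rule summable_suminf_not_top) (use elim in auto)
    have "(\<lambda>k. 2^k * (D k x)\<^sup>2) \<longlonglongrightarrow> 0" using sm by (rule summable_LIMSEQ_zero)
    then have "Bseq (\<lambda>k. 2^k * (D k x)\<^sup>2)" using convergent_imp_Bseq convergent_def by blast
    then obtain B where B: "B > 0" "\<And>k. \<bar>2^k * (D k x)\<^sup>2\<bar> \<le> B"
      by (auto simp: Bseq_def)
    have le: "D k x \<le> sqrt B * (1 / sqrt 2)^k" for k
    proof -
      have "(D k x)\<^sup>2 \<le> B * (1/2)^k" using B(2)[of k] by (simp add: field_simps power_one_over)
      then have "sqrt ((D k x)\<^sup>2) \<le> sqrt (B * (1/2)^k)" by (rule real_sqrt_le_mono)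
      then show ?thesis by (simp add: D_def real_sqrt_mult real_sqrt_power real_sqrt_divide)
    qed
    have "summable (\<lambda>k. sqrt B * (1 / sqrt 2)^k)"
      by (intro summable_mult summable_geometric) simp
    then have "summable (\<lambda>k. f (r (Suc k)) x - f (r k) x)"
      by (rule summable_comparison_test') (use le in \<open>auto simp: D_def\<close>)
    then have "(\<lambda>n. \<Sum>k<n. f (r (Suc k)) x - f (r k) x) \<longlonglongrightarrow> (\<Sum>k. f (r (Suc k)) x - f (r k) x)"
      by (rule summable_LIMSEQ)
    then have "(\<lambda>n. (f (r n) x - f (r 0) x) + f (r 0) x) \<longlonglongrightarrow> (\<Sum>k. f (r (Suc k)) x - f (r k) x) + f (r 0) x"
      using sum_lessThan_telescope[of "\<lambda>k. f (r k) x"] by (intro tendsto_add) simp_all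
    then have "convergent (\<lambda>n. f (r n) x)" by (auto simp: convergent_def)
    then show ?case by (simp add: h_def convergent_LIMSEQ_iff)
  qed
  have *: "(\<lambda>x. f k x - h x) \<in> L2 \<Omega> \<and> (l2norm \<Omega> (\<lambda>x. f k x - h x))\<^sup>2 \<le> ((1/2)^n)\<^sup>2" if "k \<ge> N n" for k n
  proof -
    have 1: "integrable ?M (\<lambda>x. (norm (f k x - f (r (j + n)) x))\<^sup>2)" for j
      by (intro L2_integrable_norm L2_diff f)
    have 2: "(\<integral>x. (norm (f k x - f (r (j + n)) x))\<^sup>2 \<partial>?M) \<le> ((1/2)^n)\<^sup>2" for j
    proof -
      have "N n \<le> r (j + n)" unfolding r_def by (auto intro: member_le_sum)
      then show ?thesis
        using N[OF that, of "r (j + n)"] unfolding l2norm_square[symmetric] by (intro power_mono) auto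
    qed
    have 3: "AE x in ?M. (\<lambda>j. (norm (f k x - f (r (j + n)) x))\<^sup>2) \<longlonglongrightarrow> (norm (f k x - h x))\<^sup>2"
      using lim
    proof eventually_elim
      case (elim x)
      then have "(\<lambda>j. f (r (j + n)) x) \<longlonglongrightarrow> h x" by (rule LIMSEQ_ignore_initial_segment)
      then show ?case by (intro tendsto_intros)
    qed
    have "integrable ?M (\<lambda>x. (norm (f k x - h x))\<^sup>2)"
      by (rule integral_le_of_AE_tendsto(1)[OF _ 1 _ 2 3]) auto
    moreover have "(\<integral>x. (norm (f k x - h x))\<^sup>2 \<partial>?M) \<le> ((1/2)^n)\<^sup>2"
      by (rule integral_le_of_AE_tendsto(2)[OF _ 1 _ 2 3]) auto
    ultimately show ?thesis unfolding L2_def l2norm_square by simp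
  qed
  have "h \<in> L2 \<Omega>" using L2_diff[OF f[of "N 0"] conjunct1[OF *[of 0 "N 0"]]] by simp
  moreover have "(\<lambda>k. l2norm \<Omega> (\<lambda>x. f k x - h x)) \<longlonglongrightarrow> 0"
  proof (rule LIMSEQ_I)
    fix e :: real assume "e > 0"
    then obtain n where n: "(1/2)^n < e" using real_arch_pow_inv[of e "1/2"] by auto
    have "norm (l2norm \<Omega> (\<lambda>x. f k x - h x) - 0) < e" if "k \<ge> N n" for k
    proof -
      have "l2norm \<Omega> (\<lambda>x. f k x - h x) \<le> (1/2)^n"
        by (rule power2_le_imp_le) (use *[OF that] in auto)
      then show ?thesis using n by simp
    qed
    then show "\<exists>no. \<forall>k\<ge>no. norm (l2norm \<Omega> (\<lambda>x. f k x - h x) - 0) < e" by blast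
  qed
  ultimately show ?thesis using that by blast
qed

section \<open>Weak gradients and $H_0^1$\<close>

locale bounded_open_set =
  fixes \<Omega> :: "'a::euclidean_space set"
  assumes open_domain: "open \<Omega>" and bounded_domain: "bounded \<Omega>"
begin

abbreviation "dx \<equiv> lebesgue_on \<Omega>"
abbreviation "normH \<equiv> l2norm \<Omega>"
abbreviation "innerH \<equiv> l2inner \<Omega>"

lemma domain_lmeasurable: "\<Omega> \<in> lmeasurable"
  by (simp add: bounded_set_imp_lmeasurable bounded_domain open_domain)

lemma domain_sets_lebesgue [simp]: "\<Omega> \<in> sets lebesgue"
  using domain_lmeasurable by auto

lemma finite_measure_domain: "finite_measure dx"
  by (rule finite_measure_lebesgue_on[OF domain_lmeasurable])

lemma continuous_measurable:
  "continuous_on UNIV f \<Longrightarrow> f \<in> borel_measurable dx"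
  for f :: "'a \<Rightarrow> 'b::euclidean_space"
  by (meson continuous_imp_measurable_on_sets_lebesgue continuous_on_subset domain_sets_lebesgue subset_UNIV)

lemma integrable_bounded:
  fixes f :: "'a \<Rightarrow> 'b::euclidean_space"
  assumes "f \<in> borel_measurable dx" "\<And>x. norm (f x) \<le> B"
  shows "integrable dx f"
  using assms by (intro finite_measure.integrable_const_bound[OF finite_measure_domain, of _ B]) auto

lemma L2_bounded:
  fixes f :: "'a \<Rightarrow> 'b::euclidean_space"
  assumes [measurable]: "f \<in> borel_measurable dx" and "\<And>x. norm (f x) \<le> B"
  shows "f \<in> L2 \<Omega>"
proof -
  have "norm ((norm (f x))\<^sup>2) \<le> B\<^sup>2" for x
    using assms(2)[of x] by (auto intro!: power_mono)
  then have "integrable dx (\<lambda>x. (norm (f x))\<^sup>2)"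
    by (intro integrable_bounded[of _ "B\<^sup>2"]) auto
  then show ?thesis by (simp add: L2_def)
qed

lemma L2_const: "(\<lambda>x. c) \<in> L2 \<Omega>" for c :: "'b::euclidean_space"
  by (rule L2_bounded[of _ "norm c"]) auto

lemma test_fun_measurable: "\<phi> \<in> test_fun \<Omega> \<Longrightarrow> \<phi> \<in> borel_measurable dx"
  by (intro continuous_measurable test_fun_continuous)

lemma test_fun_L2: "\<phi> \<in> test_fun \<Omega> \<Longrightarrow> \<phi> \<in> L2 \<Omega>"
  by (metis L2_bounded real_norm_def test_fun_bounded test_fun_measurable)

lemma test_fun_scaleR_L2: "\<phi> \<in> test_fun \<Omega> \<Longrightarrow> (\<lambda>x. \<phi> x *\<^sub>R b) \<in> L2 \<Omega>" for b :: "'b::euclidean_space"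
proof -
  assume \<phi>: "\<phi> \<in> test_fun \<Omega>"
  obtain B where B: "0 \<le> B" "\<And>x. \<bar>\<phi> x\<bar> \<le> B" using test_fun_bounded[OF \<phi>] by blast
  have [measurable]: "\<phi> \<in> borel_measurable dx" using \<phi> by (rule test_fun_measurable)
  show ?thesis using B by (intro L2_bounded[of _ "B * norm b"]) (auto intro: mult_right_mono)
qed

lemma test_fun_probabilistic_sum:
  assumes "finite I" "\<And>i. i \<in> I \<Longrightarrow> \<phi> i \<in> test_fun \<Omega>"
  shows "(\<lambda>x. 1 - (\<Prod>i\<in>I. (1 - \<phi> i x))) \<in> test_fun \<Omega>"
  using assms
proof (induction rule: finite_induct)
  case empty
  then show ?case by (auto intro!: test_funI[of _ "{}"] smooth_on_const)
next
  case (insert i I)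
  let ?P = "\<lambda>x. 1 - (\<Prod>i\<in>I. (1 - \<phi> i x))"
  have P: "?P \<in> test_fun \<Omega>" "\<phi> i \<in> test_fun \<Omega>" using insert by auto
  have "(\<lambda>x. 1 * (1 * \<phi> i x + 1 * ?P x) + (-1) * (\<phi> i x * ?P x)) \<in> test_fun \<Omega>"
    using P by (intro test_fun_lincomb test_fun_mult)
  also have "(\<lambda>x. 1 * (1 * \<phi> i x + 1 * ?P x) + (-1) * (\<phi> i x * ?P x))
      = (\<lambda>x. 1 - (\<Prod>i\<in>insert i I. (1 - \<phi> i x)))"
    using insert by (auto simp: algebra_simps)
  finally show ?case .
qed

text \<open>The indicator function of an open set is a bounded pointwise limit of test functions:
  with boxes \<open>B\<^sub>i\<close> that exhaust the set, take \<open>1 - \<Prod>\<^sub>i\<^sub>\<le>\<^sub>k (1 - \<phi>\<^sub>i\<^sub>,\<^sub>k)\<close>, where \<open>\<phi>\<^sub>i\<^sub>,\<^sub>k\<close> is the \<open>k\<close>-th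
  approximation of \<open>B\<^sub>i\<close>.\<close>

lemma indicator_open_limit_test_fun:
  assumes "open U" "U \<subseteq> \<Omega>"
  obtains \<phi> where "\<And>k::nat. \<phi> k \<in> test_fun \<Omega>" "\<And>k x. \<bar>\<phi> k x\<bar> \<le> 1"
    "\<And>x. (\<lambda>k. \<phi> k x) \<longlonglongrightarrow> indicator U x"
proof (cases "U = {}")
  case True
  have "(\<lambda>x. 0) \<in> test_fun \<Omega>" by (auto intro!: test_funI[of _ "{}"] smooth_on_const)
  then show ?thesis using True that[of "\<lambda>k x. 0"] by simp
next
  case False
  have "\<exists>a c. y \<in> box a c \<and> cbox a c \<subseteq> U \<and> (\<forall>b\<in>Basis. a \<bullet> b \<in> \<rat> \<and> c \<bullet> b \<in> \<rat>)" if y: "y \<in> U" for y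
  proof -
    obtain e where e: "e > 0" "cball y e \<subseteq> U"
      using \<open>open U\<close> y open_contains_cball by blast
    obtain a c where ac: "\<forall>b\<in>Basis. a \<bullet> b \<in> \<rat> \<and> c \<bullet> b \<in> \<rat>" "y \<in> box a c" "box a c \<subseteq> ball y e"
      using rational_boxes[OF e(1), of y] by metis
    have "cbox a c = closure (box a c)" using ac(2) by (metis closure_box empty_iff)
    also have "\<dots> \<subseteq> cball y e" using closure_mono[OF ac(3)] closure_ball[OF e(1), of y] by simp
    finally show ?thesis using ac e by blast
  qed
  then obtain a c where ac: "\<And>y. y \<in> U \<Longrightarrow> y \<in> box (a y) (c y)" "\<And>y. y \<in> U \<Longrightarrow> cbox (a y) (c y) \<subseteq> U"
    by metis
  define \<D> where "\<D> = (\<lambda>y. box (a y) (c y)) ` U"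
  have "\<And>S. S \<in> \<D> \<Longrightarrow> open S" by (auto simp: \<D>_def)
  then obtain \<D>' where D': "\<D>' \<subseteq> \<D>" "countable \<D>'" "\<Union>\<D>' = \<Union>\<D>" using Lindelof by metis
  have "\<exists>Y. countable Y \<and> Y \<subseteq> U \<and> \<D>' = (\<lambda>y. box (a y) (c y)) ` Y"
    using D'(1,2) countable_subset_image[of \<D>' "\<lambda>y. box (a y) (c y)" U] unfolding \<D>_def by blast
  then obtain Y where Y: "countable Y" "Y \<subseteq> U" "\<Union>((\<lambda>y. box (a y) (c y)) ` Y) = \<Union>\<D>"
    using D'(3) by auto
  have UD: "\<Union>\<D> = U" unfolding \<D>_def using ac box_subset_cbox by fast
  then have "Y \<noteq> {}" using False Y by auto
  then obtain s :: "nat \<Rightarrow> 'a" where s: "range s = Y" using Y(1) by (metis range_from_nat_into)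
  have sU: "s i \<in> U" for i using s Y by auto
  have Us: "U = (\<Union>i. box (a (s i)) (c (s i)))" using Y(3) UD s by auto
  define \<phi> where "\<phi> k x = 1 - (\<Prod>i\<in>{..k}. (1 - box_bump (a (s i)) (c (s i)) k x))" for k x
  have "\<phi> k \<in> test_fun \<Omega>" for k
    unfolding \<phi>_def using ac(2)[OF sU] \<open>U \<subseteq> \<Omega>\<close>
    by (intro test_fun_probabilistic_sum box_bump_test_fun) auto
  moreover have P01: "0 \<le> (\<Prod>i\<in>I. (1 - box_bump (a (s i)) (c (s i)) k x))"
    "(\<Prod>i\<in>I. (1 - box_bump (a (s i)) (c (s i)) k x)) \<le> 1" for k x I
    by (auto intro!: prod_nonneg prod_le_1 simp: box_bump_le_1 box_bump_nonneg)
  moreover have "\<bar>\<phi> k x\<bar> \<le> 1" for k x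
    unfolding \<phi>_def using P01[of k x "{..k}"] by linarith
  moreover have "(\<lambda>k. \<phi> k x) \<longlonglongrightarrow> indicator U x" for x
  proof (cases "x \<in> U")
    case True
    then obtain j where j: "x \<in> box (a (s j)) (c (s j))" using Us by blast
    have "(\<lambda>k. 1 - box_bump (a (s j)) (c (s j)) k x) \<longlonglongrightarrow> 1 - indicator (box (a (s j)) (c (s j))) x"
      by (intro tendsto_intros box_bump_tendsto)
    then have lim: "(\<lambda>k. 1 - box_bump (a (s j)) (c (s j)) k x) \<longlonglongrightarrow> 0" using j by simp
    have "(\<Prod>i\<in>{..k}. (1 - box_bump (a (s i)) (c (s i)) k x)) \<le> 1 - box_bump (a (s j)) (c (s j)) k x"
      if "k \<ge> j" for k
    proof -
      have "(\<Prod>i\<in>{..k}. (1 - box_bump (a (s i)) (c (s i)) k x))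
        = (1 - box_bump (a (s j)) (c (s j)) k x) * (\<Prod>i\<in>{..k}-{j}. (1 - box_bump (a (s i)) (c (s i)) k x))"
        using that by (intro prod.remove) auto
      also have "\<dots> \<le> (1 - box_bump (a (s j)) (c (s j)) k x) * 1"
        using P01(2) by (intro mult_left_mono) (auto simp: box_bump_le_1)
      finally show ?thesis by simp
    qed
    then have ev: "\<forall>\<^sub>F k in sequentially. (\<Prod>i\<in>{..k}. (1 - box_bump (a (s i)) (c (s i)) k x))
        \<le> 1 - box_bump (a (s j)) (c (s j)) k x"
      unfolding eventually_sequentially by blast
    have "(\<lambda>k. \<Prod>i\<in>{..k}. (1 - box_bump (a (s i)) (c (s i)) k x)) \<longlonglongrightarrow> 0"
      by (rule tendsto_sandwich[OF _ ev tendsto_const lim]) (simp add: P01)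
    then have "(\<lambda>k. \<phi> k x) \<longlonglongrightarrow> 1 - 0" unfolding \<phi>_def by (intro tendsto_intros)
    then show ?thesis using True by simp
  next
    case False
    then have "box_bump (a (s i)) (c (s i)) k x = 0" for i k using Us by (intro box_bump_outside) blast
    then show ?thesis using False by (simp add: \<phi>_def)
  qed
  ultimately show ?thesis using that by blast
qed

text \<open>The fundamental lemma of the calculus of variations. The integral over open sets vanishes
  by the preceding approximation, hence the one over any measurable set by outer regularity.\<close>

lemma test_fun_orthogonal_AE_zero:
  fixes f :: "'a \<Rightarrow> real"
  assumes int: "integrable dx f"
    and orth: "\<And>\<phi>. \<phi> \<in> test_fun \<Omega> \<Longrightarrow> (\<integral>x. f x * \<phi> x \<partial>dx) = 0"
  shows "AE x in dx. f x = 0"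
proof -
  let ?M = "dx"
  have meas_ind: "indicator S \<in> borel_measurable ?M" if "S \<in> sets lebesgue" for S :: "'a set"
    using sets.Int[OF domain_sets_lebesgue that]
    by (intro borel_measurable_indicator') (auto simp: sets_restrict_space_iff Int_def)
  have op: "(\<integral>x. f x * indicator U x \<partial>?M) = 0" if U: "open U" "U \<subseteq> \<Omega>"
      and f: "integrable ?M f" "\<And>\<phi>. \<phi> \<in> test_fun \<Omega> \<Longrightarrow> (\<integral>x. f x * \<phi> x \<partial>?M) = 0"
    for f and U :: "'a set"
  proof -
    obtain \<phi> where \<phi>: "\<And>k::nat. \<phi> k \<in> test_fun \<Omega>" "\<And>k x. \<bar>\<phi> k x\<bar> \<le> 1"
       "\<And>x. (\<lambda>k. \<phi> k x) \<longlonglongrightarrow> indicator U x"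
      using indicator_open_limit_test_fun[OF U] by metis
    have [measurable]: "f \<in> borel_measurable ?M" "indicator U \<in> borel_measurable ?M"
      "\<phi> k \<in> borel_measurable ?M" for k
      using f U \<phi>(1) by (auto intro: meas_ind test_fun_measurable)
    have "(\<lambda>k. \<integral>x. f x * \<phi> k x \<partial>?M) \<longlonglongrightarrow> (\<integral>x. f x * indicator U x \<partial>?M)"
    proof (rule integral_dominated_convergence[where w="\<lambda>x. \<bar>f x\<bar>"])
      show "AE x in ?M. norm (f x * \<phi> k x) \<le> \<bar>f x\<bar>" for k
        using \<phi>(2)[of k] by (intro AE_I2) (simp add: abs_mult mult_left_le)
      show "AE x in ?M. (\<lambda>k. f x * \<phi> k x) \<longlonglongrightarrow> f x * indicator U x"
        using \<phi>(3) by (auto intro!: tendsto_intros)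
    qed (use f in auto)
    moreover have "(\<integral>x. f x * \<phi> k x \<partial>?M) = 0" for k using f(2) \<phi>(1) by blast
    ultimately show ?thesis by (simp add: LIMSEQ_const_iff)
  qed
  have le: "AE x in ?M. f x \<le> 0"
    if f: "integrable ?M f" "\<And>\<phi>. \<phi> \<in> test_fun \<Omega> \<Longrightarrow> (\<integral>x. f x * \<phi> x \<partial>?M) = 0" for f
  proof -
    have fm [measurable]: "f \<in> borel_measurable ?M" using f by auto
    define A where "A = {x \<in> \<Omega>. f x > 0}"
    have "{x \<in> space ?M. f x > 0} \<in> sets ?M" by measurable
    then have A: "A \<in> sets lebesgue" unfolding A_def by (simp add: sets_restrict_space_iff)
    have "\<exists>U. open U \<and> A \<subseteq> U \<and> U - A \<in> lmeasurable \<and> emeasure lebesgue (U - A) < ennreal ((1/2)^k)" for k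
      by (rule sets_lebesgue_outer_open[OF A, of "(1/2)^k"]) auto
    then obtain U where U: "\<And>k. open (U k)" "\<And>k. A \<subseteq> U k"
      "\<And>k. emeasure lebesgue (U k - A) < ennreal ((1/2)^k)" by metis
    define W where "W n = \<Omega> \<inter> (\<Inter>k\<le>n. U k)" for n :: nat
    define G where "G = \<Omega> \<inter> (\<Inter>k. U k)"
    have W: "open (W n)" "W n \<subseteq> \<Omega>" for n unfolding W_def using U(1) open_domain by auto
    have Gm: "G \<in> sets lebesgue"
      unfolding G_def using U(1) by (intro sets.Int sets.countable_INT) auto
    have null: "G - A \<in> null_sets lebesgue"
    proof -
      have "emeasure lebesgue (G - A) \<le> ennreal ((1/2)^k)" for k
      proof -
        have "U k - A \<in> sets lebesgue" using U(1) A by (intro sets.Diff) auto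
        moreover have "G - A \<subseteq> U k - A" by (auto simp: G_def)
        ultimately show ?thesis using emeasure_mono U(3)[of k] by (metis less_imp_le order_trans)
      qed
      moreover have "(\<lambda>k. ennreal ((1/2)^k)) \<longlonglongrightarrow> ennreal 0"
        by (intro tendsto_ennrealI LIMSEQ_realpow_zero) auto
      ultimately have "emeasure lebesgue (G - A) \<le> ennreal 0"
        by (intro LIMSEQ_le_const[of _ "ennreal 0"]) auto
      then show ?thesis using Gm A by (auto intro!: null_setsI)
    qed
    have [measurable]: "indicator G \<in> borel_measurable ?M" "indicator A \<in> borel_measurable ?M"
        "indicator (W n) \<in> borel_measurable ?M" for n
      using Gm A W by (auto intro: meas_ind)
    have "(\<lambda>n. \<integral>x. f x * indicator (W n) x \<partial>?M) \<longlonglongrightarrow> (\<integral>x. f x * indicator G x \<partial>?M)"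
    proof (rule integral_dominated_convergence[where w="\<lambda>x. \<bar>f x\<bar>"])
      show "AE x in ?M. (\<lambda>n. f x * indicator (W n) x) \<longlonglongrightarrow> f x * indicator G x"
      proof (intro AE_I2 tendsto_intros)
        fix x assume "x \<in> space ?M"
        show "(\<lambda>n. indicator (W n) x) \<longlonglongrightarrow> (indicator G x :: real)"
        proof (cases "x \<in> G")
          case True
          then have "x \<in> W n" for n by (auto simp: G_def W_def)
          then show ?thesis using True by simp
        next
          case False
          then obtain m where "x \<notin> W m" using \<open>x \<in> space ?M\<close> by (auto simp: G_def W_def)
          then have "x \<notin> W n" if "n \<ge> m" for n using that by (auto simp: W_def)
          then have "\<forall>\<^sub>F n in sequentially. indicator (W n) x = (0::real)"
            unfolding eventually_sequentially by (auto simp: indicator_def)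
          then show ?thesis using False by (simp add: tendsto_eventually)
        qed
      qed
      show "(\<lambda>x. f x * indicator G x) \<in> borel_measurable ?M" by measurable
      show "(\<lambda>x. f x * indicator (W n) x) \<in> borel_measurable ?M" for n by measurable
      show "AE x in ?M. norm (f x * indicator (W n) x) \<le> \<bar>f x\<bar>" for n
        by (intro AE_I2) (simp add: abs_mult indicator_def)
    qed (use f in auto)
    then have "(\<integral>x. f x * indicator G x \<partial>?M) = 0"
      using op[OF W f] by (simp add: LIMSEQ_const_iff)
    moreover have "(\<integral>x. f x * indicator G x \<partial>?M) = (\<integral>x. f x * indicator A x \<partial>?M)"
    proof (rule integral_cong_AE)
      have "AE x in lebesgue. x \<notin> G - A" using null by (rule AE_not_in)
      then show "AE x in ?M. f x * indicator G x = f x * indicator A x"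
        unfolding AE_restrict_space_iff[of \<Omega> lebesgue, simplified]
        by eventually_elim (use U(2) in \<open>auto simp: indicator_def G_def A_def\<close>)
    qed measurable
    ultimately have "(\<integral>x. f x * indicator A x \<partial>?M) = 0" by simp
    moreover have "integrable ?M (\<lambda>x. f x * indicator A x)"
      by (rule Bochner_Integration.integrable_bound[OF f(1)])
        (measurable, intro AE_I2, simp add: abs_mult indicator_def)
    ultimately have "AE x in ?M. f x * indicator A x = 0"
      by (subst (asm) integral_nonneg_eq_0_iff_AE) (auto simp: A_def indicator_def)
    then show ?thesis using AE_space by eventually_elim (auto simp: A_def indicator_def split: if_splits)
  qed
  have "AE x in ?M. f x \<le> 0" using le int orth by blast
  moreover have "AE x in ?M. - f x \<le> 0"
    by (rule le) (use int orth in auto)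
  ultimately show ?thesis by eventually_elim auto
qed

end

subsection \<open>Test functions on the whole space\<close>

lemma integrable_continuous_compact_support:
  fixes f :: "'a::euclidean_space \<Rightarrow> 'b::euclidean_space"
  assumes "continuous_on UNIV f" "compact K" "\<And>x. x \<notin> K \<Longrightarrow> f x = 0"
  shows "integrable lborel f"
proof -
  have "integrable lborel (\<lambda>x. indicator K x *\<^sub>R f x)"
    using assms by (intro borel_integrable_compact) (auto intro: continuous_on_subset)
  also have "(\<lambda>x. indicator K x *\<^sub>R f x) = f" using assms(3) by (auto simp: indicator_def)
  finally show ?thesis .
qed

lemma test_fun_borel: "\<phi> \<in> test_fun \<Omega> \<Longrightarrow> \<phi> \<in> borel_measurable borel"
  by (intro borel_measurable_continuous_onI test_fun_continuous)

lemma test_fun_integrable: "\<phi> \<in> test_fun \<Omega> \<Longrightarrow> integrable lborel \<phi>"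
  using integrable_continuous_compact_support[of \<phi>] test_fun_continuous[of \<phi>]
  by (auto simp: test_fun_def)

lemma integral_translate:
  fixes f :: "'a::euclidean_space \<Rightarrow> real"
  assumes "f \<in> borel_measurable borel"
  shows "(\<integral>x. f (x + e) \<partial>lborel) = (\<integral>x. f x \<partial>lborel)"
    and "integrable lborel (\<lambda>x. f (x + e)) \<longleftrightarrow> integrable lborel f"
proof -
  show "(\<integral>x. f (x + e) \<partial>lborel) = (\<integral>x. f x \<partial>lborel)"
    using integral_distr[of "(+) e" lborel borel f] assms by (simp add: lborel_distr_plus add.commute)
  show "integrable lborel (\<lambda>x. f (x + e)) \<longleftrightarrow> integrable lborel f"
    using integrable_distr_eq[of "(+) e" lborel borel f] assms by (simp add: lborel_distr_plus add.commute)
qed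

lemma test_fun_derivative_expand:
  assumes "\<phi> \<in> test_fun \<Omega>"
  shows "frechet_derivative \<phi> (at x) e = (\<Sum>b\<in>Basis. (e \<bullet> b) * frechet_derivative \<phi> (at x) b)"
proof -
  have lin: "linear (frechet_derivative \<phi> (at x))"
    using has_derivative_linear[OF test_fun_has_derivative[OF assms]] .
  have "frechet_derivative \<phi> (at x) (\<Sum>b\<in>Basis. (e \<bullet> b) *\<^sub>R b)
      = (\<Sum>b\<in>Basis. (e \<bullet> b) * frechet_derivative \<phi> (at x) b)"
    using lin by (simp add: linear_sum linear_scale)
  then show ?thesis by (simp add: euclidean_representation)
qed

definition classical_grad :: "('a::euclidean_space \<Rightarrow> real) \<Rightarrow> 'a \<Rightarrow> 'a" where
  "classical_grad \<phi> x = (\<Sum>b\<in>Basis. frechet_derivative \<phi> (at x) b *\<^sub>R b)"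

lemma classical_grad_inner:
  "\<phi> \<in> test_fun \<Omega> \<Longrightarrow> classical_grad \<phi> x \<bullet> e = frechet_derivative \<phi> (at x) e"
  by (subst test_fun_derivative_expand)
    (auto simp: classical_grad_def inner_sum_left inner_commute[of e] mult.commute)

lemma classical_grad_continuous: "\<phi> \<in> test_fun \<Omega> \<Longrightarrow> continuous_on UNIV (classical_grad \<phi>)"
  unfolding classical_grad_def
  by (intro continuous_intros test_fun_continuous[OF test_fun_frechet_derivative]) auto

lemma classical_grad_compact_support:
  assumes "\<phi> \<in> test_fun \<Omega>"
  obtains K where "compact K" "K \<subseteq> \<Omega>" "\<And>x. x \<notin> K \<Longrightarrow> classical_grad \<phi> x = 0" "\<And>x. x \<notin> K \<Longrightarrow> \<phi> x = 0"
proof -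
  have "\<forall>b\<in>Basis. \<exists>K. compact K \<and> K \<subseteq> \<Omega> \<and> (\<forall>x. x \<notin> K \<longrightarrow> frechet_derivative \<phi> (at x) b = 0)"
    using test_fun_frechet_derivative[OF assms] unfolding test_fun_def by blast
  then obtain K where K: "\<And>b. b \<in> Basis \<Longrightarrow> compact (K b) \<and> K b \<subseteq> \<Omega> \<and> (\<forall>x. x \<notin> K b \<longrightarrow> frechet_derivative \<phi> (at x) b = 0)"
    by metis
  obtain K' where K': "compact K'" "K' \<subseteq> \<Omega>" "\<And>x. x \<notin> K' \<Longrightarrow> \<phi> x = 0"
    using assms unfolding test_fun_def by blast
  show thesis
  proof (rule that[of "K' \<union> (\<Union>b\<in>Basis. K b)"])
    show "compact (K' \<union> (\<Union>b\<in>Basis. K b))"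
      using K K'(1) by (intro compact_Un compact_UN) auto
    show "classical_grad \<phi> x = 0" if "x \<notin> K' \<union> (\<Union>b\<in>Basis. K b)" for x
      unfolding classical_grad_def using that K by (intro sum.neutral) auto
  qed (use K K' in auto)
qed

lemma test_fun_Lipschitz:
  assumes "\<phi> \<in> test_fun \<Omega>"
  obtains B where "0 \<le> B" "\<And>x y. \<bar>\<phi> y - \<phi> x\<bar> \<le> B * norm (y - x)" "\<And>x. norm (classical_grad \<phi> x) \<le> B"
proof -
  have "\<forall>b\<in>Basis. \<exists>B. \<forall>x. \<bar>frechet_derivative \<phi> (at x) b\<bar> \<le> B"
    using test_fun_bounded[OF test_fun_frechet_derivative[OF assms]] by meson
  then obtain B where B: "\<And>b x. b \<in> Basis \<Longrightarrow> \<bar>frechet_derivative \<phi> (at x) b\<bar> \<le> B b" by metis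
  have g: "norm (classical_grad \<phi> x) \<le> (\<Sum>b\<in>Basis. B b)" for x
    unfolding classical_grad_def by (rule sum_norm_le) (use B in auto)
  have on: "onorm (frechet_derivative \<phi> (at x)) \<le> (\<Sum>b\<in>Basis. B b)" for x
  proof (rule onorm_le)
    fix e
    have "norm (frechet_derivative \<phi> (at x) e) = \<bar>classical_grad \<phi> x \<bullet> e\<bar>"
      using classical_grad_inner[OF assms] by simp
    also have "\<dots> \<le> norm (classical_grad \<phi> x) * norm e" by (rule Cauchy_Schwarz_ineq2)
    also have "\<dots> \<le> (\<Sum>b\<in>Basis. B b) * norm e" using g by (intro mult_right_mono) auto
    finally show "norm (frechet_derivative \<phi> (at x) e) \<le> (\<Sum>b\<in>Basis. B b) * norm e" .
  qed
  show thesis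
  proof (rule that)
    show "0 \<le> (\<Sum>b\<in>Basis. B b)" using g norm_ge_zero order_trans by blast
    show "\<bar>\<phi> y - \<phi> x\<bar> \<le> (\<Sum>b\<in>Basis. B b) * norm (y - x)" for x y
      using differentiable_bound[of UNIV \<phi> "\<lambda>x. frechet_derivative \<phi> (at x)" "\<Sum>b\<in>Basis. B b" y x]
        test_fun_has_derivative[OF assms] on by simp
  qed (rule g)
qed

text \<open>The common bound comes from the Lipschitz constant and the compact support; it allows passing
  to the limit under the integral.\<close>

lemma test_fun_difference_quotient:
  fixes \<phi> :: "'a::euclidean_space \<Rightarrow> real" and e :: 'a
  assumes "\<phi> \<in> test_fun \<Omega>"
  defines "q \<equiv> \<lambda>k x. real (Suc k) * (\<phi> (x + e /\<^sub>R real (Suc k)) - \<phi> x)"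
  shows "(\<lambda>k. \<integral>x. q k x \<partial>lborel) \<longlonglongrightarrow> (\<integral>x. frechet_derivative \<phi> (at x) e \<partial>lborel)"
    and "(\<lambda>k. \<integral>x. (q k x)\<^sup>2 \<partial>lborel) \<longlonglongrightarrow> (\<integral>x. (frechet_derivative \<phi> (at x) e)\<^sup>2 \<partial>lborel)"
    and "\<And>k. integrable lborel (\<lambda>x. (q k x)\<^sup>2)"
proof -
  obtain B where B: "0 \<le> B" "\<And>x y. \<bar>\<phi> y - \<phi> x\<bar> \<le> B * norm (y - x)"
    using test_fun_Lipschitz[OF assms(1)] by metis
  obtain K where K: "compact K" "\<And>x. x \<notin> K \<Longrightarrow> \<phi> x = 0"
    using assms(1) unfolding test_fun_def by blast
  define K' where "K' = {x + y |x y. x \<in> K \<and> y \<in> cball 0 (norm e)}"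
  have K': "compact K'" unfolding K'_def by (rule compact_sums[OF K(1) compact_cball])
  define L where "L = B * norm e"
  have L: "0 \<le> L" using B by (simp add: L_def)
  have le: "\<bar>q k x\<bar> \<le> indicator K' x * L" for k x
  proof (cases "x \<in> K'")
    case True
    have "\<bar>q k x\<bar> \<le> real (Suc k) * (B * norm (e /\<^sub>R real (Suc k)))"
      using B(2)[of "x + e /\<^sub>R real (Suc k)" x] by (simp add: q_def abs_mult del: of_nat_Suc)
    also have "\<dots> = L" by (simp add: L_def divide_simps)
    finally show ?thesis using True by simp
  next
    case False
    have "x \<notin> K" using False unfolding K'_def by force
    moreover have "x + e /\<^sub>R real (Suc k) \<notin> K"
    proof
      assume "x + e /\<^sub>R real (Suc k) \<in> K"
      moreover have "norm (- (e /\<^sub>R real (Suc k))) \<le> norm e"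
        by (simp add: mult_left_le_one_le inverse_le_1_iff del: of_nat_Suc)
      moreover have "x = (x + e /\<^sub>R real (Suc k)) + (- (e /\<^sub>R real (Suc k)))" by simp
      ultimately have "x \<in> K'" unfolding K'_def by (metis (mono_tags, lifting) mem_Collect_eq mem_cball_0)
      then show False using False by simp
    qed
    ultimately show ?thesis using K(2) False by (simp add: q_def)
  qed
  have [measurable]: "\<phi> \<in> borel_measurable borel" by (rule test_fun_borel[OF assms(1)])
  have [measurable]: "(\<lambda>x. frechet_derivative \<phi> (at x) e) \<in> borel_measurable borel"
    using classical_grad_inner[OF assms(1)]
    by (auto intro!: borel_measurable_continuous_onI continuous_intros classical_grad_continuous[OF assms(1)]
        simp flip: classical_grad_inner[OF assms(1)])
  have qm [measurable]: "q k \<in> borel_measurable borel" for k unfolding q_def by measurable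
  have w: "integrable lborel (\<lambda>x. indicator K' x * c)" for c :: real
    using borel_integrable_compact[OF K', of "\<lambda>_. c"] by simp
  have lim: "(\<lambda>k. q k x) \<longlonglongrightarrow> frechet_derivative \<phi> (at x) e" for x
  proof -
    have "((\<lambda>t. \<phi> (x + t *\<^sub>R e)) has_derivative (\<lambda>t. frechet_derivative \<phi> (at x) (t *\<^sub>R e))) (at 0)"
    proof -
      have "((\<lambda>t. x + t *\<^sub>R e) has_derivative (\<lambda>t. t *\<^sub>R e)) (at 0)"
        by (auto intro!: derivative_eq_intros)
      moreover have "(\<phi> has_derivative frechet_derivative \<phi> (at x)) (at (x + 0 *\<^sub>R e))"
        using test_fun_has_derivative[OF assms(1)] by simp
      ultimately show ?thesis by (rule has_derivative_compose)
    qed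
    moreover have "frechet_derivative \<phi> (at x) (t *\<^sub>R e) = frechet_derivative \<phi> (at x) e * t" for t
      using linear_scale[OF has_derivative_linear[OF test_fun_has_derivative[OF assms(1)]]] by simp
    ultimately have "DERIV (\<lambda>t. \<phi> (x + t *\<^sub>R e)) 0 :> frechet_derivative \<phi> (at x) e"
      by (simp add: has_field_derivative_def)
    then have *: "((\<lambda>h. (\<phi> (x + h *\<^sub>R e) - \<phi> x) / h) \<longlongrightarrow> frechet_derivative \<phi> (at x) e) (at 0)"
      by (simp add: DERIV_def)
    have "filterlim (\<lambda>k. inverse (real (Suc k))) (at 0) sequentially"
      using LIMSEQ_inverse_real_of_nat by (auto simp: filterlim_at intro!: always_eventually)
    from filterlim_compose[OF * this] show ?thesis
      by (simp add: q_def field_simps del: of_nat_Suc)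
  qed
  show "(\<lambda>k. \<integral>x. q k x \<partial>lborel) \<longlonglongrightarrow> (\<integral>x. frechet_derivative \<phi> (at x) e \<partial>lborel)"
    by (rule integral_dominated_convergence[where w="\<lambda>x. indicator K' x * L"]) (use le lim w in auto)
  have le2: "(q k x)\<^sup>2 \<le> indicator K' x * L\<^sup>2" for k x
    using power_mono[OF le[of k x], of 2] by (auto simp: indicator_def split: if_splits)
  show "(\<lambda>k. \<integral>x. (q k x)\<^sup>2 \<partial>lborel) \<longlonglongrightarrow> (\<integral>x. (frechet_derivative \<phi> (at x) e)\<^sup>2 \<partial>lborel)"
    by (rule integral_dominated_convergence[where w="\<lambda>x. indicator K' x * L\<^sup>2"])
      (use le2 lim w in \<open>auto intro!: tendsto_intros\<close>)
  show "integrable lborel (\<lambda>x. (q k x)\<^sup>2)" for k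
    by (rule Bochner_Integration.integrable_bound[OF w[of "L\<^sup>2"]]) (use le2[of k] in auto)
qed

lemma integral_test_fun_derivative:
  assumes "\<phi> \<in> test_fun \<Omega>"
  shows "(\<integral>x. frechet_derivative \<phi> (at x) e \<partial>lborel) = 0"
proof -
  have "(\<integral>x. real (Suc k) * (\<phi> (x + e /\<^sub>R real (Suc k)) - \<phi> x) \<partial>lborel) = 0" for k
    using test_fun_integrable[OF assms] integral_translate[OF test_fun_borel[OF assms], of "e /\<^sub>R real (Suc k)"]
    by simp
  then show ?thesis
    using test_fun_difference_quotient(1)[OF assms, of e] by (simp add: LIMSEQ_const_iff del: of_nat_Suc)
qed

lemma test_fun_integration_by_parts:
  assumes "\<phi> \<in> test_fun \<Omega>" "\<psi> \<in> test_fun \<Omega>" "b \<in> Basis"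
  shows "(\<integral>x. \<phi> x * frechet_derivative \<psi> (at x) b \<partial>lborel)
       = - (\<integral>x. frechet_derivative \<phi> (at x) b * \<psi> x \<partial>lborel)"
proof -
  have "frechet_derivative (\<lambda>x. \<phi> x * \<psi> x) (at x) =
      (\<lambda>b. \<phi> x * frechet_derivative \<psi> (at x) b + frechet_derivative \<phi> (at x) b * \<psi> x)" for x
    using assms by (intro frechet_derivative_eqI has_derivative_mult test_fun_has_derivative)
  then have "0 = (\<integral>x. \<phi> x * frechet_derivative \<psi> (at x) b + frechet_derivative \<phi> (at x) b * \<psi> x \<partial>lborel)"
    using integral_test_fun_derivative[OF test_fun_mult[OF assms(1,2)], of b] by simp
  also have "\<dots> = (\<integral>x. \<phi> x * frechet_derivative \<psi> (at x) b \<partial>lborel)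
       + (\<integral>x. frechet_derivative \<phi> (at x) b * \<psi> x \<partial>lborel)"
    by (intro Bochner_Integration.integral_add
        test_fun_integrable[OF test_fun_mult[OF assms(1) test_fun_frechet_derivative[OF assms(2,3)]]]
        test_fun_integrable[OF test_fun_mult[OF test_fun_frechet_derivative[OF assms(1,3)] assms(2)]])
  finally show ?thesis by linarith
qed

lemma classical_grad_square_integrable:
  assumes "\<phi> \<in> test_fun \<Omega>"
  shows "integrable lborel (\<lambda>x. (norm (classical_grad \<phi> x))\<^sup>2)"
proof -
  obtain K where "compact K" "\<And>x. x \<notin> K \<Longrightarrow> classical_grad \<phi> x = 0"
    using classical_grad_compact_support[OF assms] by metis
  then show ?thesis using classical_grad_continuous[OF assms]
    by (intro integrable_continuous_compact_support[of _ K] continuous_intros) auto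
qed

text \<open>Translation by \<open>e\<close> is split into \<open>n\<close> translations by \<open>e/n\<close>, all of which contribute the
  same by translation invariance, and \<open>n\<close> tends to infinity.\<close>

lemma test_fun_translation_le:
  fixes \<phi> :: "'a::euclidean_space \<Rightarrow> real"
  assumes \<phi>: "\<phi> \<in> test_fun \<Omega>"
  shows "integrable lborel (\<lambda>x. (\<phi> (x + e) - \<phi> x)\<^sup>2)"
    and "(\<integral>x. (\<phi> (x + e) - \<phi> x)\<^sup>2 \<partial>lborel) \<le> (norm e)\<^sup>2 * (\<integral>x. (norm (classical_grad \<phi> x))\<^sup>2 \<partial>lborel)"
proof -
  have [measurable]: "\<phi> \<in> borel_measurable borel" by (rule test_fun_borel[OF \<phi>])
  have int: "integrable lborel (\<lambda>x. (\<phi> (x + e) - \<phi> x)\<^sup>2)" for e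
    using test_fun_difference_quotient(3)[OF \<phi>, where e=e and k=0] by simp
  then show "integrable lborel (\<lambda>x. (\<phi> (x + e) - \<phi> x)\<^sup>2)" .
  have l2: "l2norm UNIV f = sqrt (\<integral>x. (f x)\<^sup>2 \<partial>lborel)" if "f \<in> borel_measurable borel" for f :: "'a \<Rightarrow> real"
    using that by (simp add: l2norm_def lebesgue_on_UNIV_eq integral_completion)
  have L2: "f \<in> L2 UNIV" if "f \<in> borel_measurable borel" "integrable lborel (\<lambda>x. (f x)\<^sup>2)" for f :: "'a \<Rightarrow> real"
    using that by (simp add: L2_def lebesgue_on_UNIV_eq integrable_completion measurable_completion)
  define T where "T e = l2norm UNIV (\<lambda>x. \<phi> (x + e) - \<phi> x)" for e
  have T: "T e = sqrt (\<integral>x. (\<phi> (x + e) - \<phi> x)\<^sup>2 \<partial>lborel)" for e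
    unfolding T_def by (rule l2) measurable
  have shift: "(\<lambda>x. \<phi> (x + c + a) - \<phi> (x + c)) \<in> L2 UNIV"
      "l2norm UNIV (\<lambda>x. \<phi> (x + c + a) - \<phi> (x + c)) = T a" for a c
  proof -
    have "integrable lborel (\<lambda>x. (\<phi> (x + c + a) - \<phi> (x + c))\<^sup>2)"
      using integral_translate(2)[of "\<lambda>x. (\<phi> (x + a) - \<phi> x)\<^sup>2" c] int[of a] by simp
    then show "(\<lambda>x. \<phi> (x + c + a) - \<phi> (x + c)) \<in> L2 UNIV" by (intro L2) measurable
    have "l2norm UNIV (\<lambda>x. \<phi> (x + c + a) - \<phi> (x + c)) = sqrt (\<integral>x. (\<phi> (x + c + a) - \<phi> (x + c))\<^sup>2 \<partial>lborel)"
      by (rule l2) measurable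
    then show "l2norm UNIV (\<lambda>x. \<phi> (x + c + a) - \<phi> (x + c)) = T a"
      using integral_translate(1)[of "\<lambda>x. (\<phi> (x + a) - \<phi> x)\<^sup>2" c] by (simp add: T)
  qed
  have add: "T (a + c) \<le> T a + T c" for a c
  proof -
    have "T (a + c) = l2norm UNIV (\<lambda>x. (\<phi> (x + c + a) - \<phi> (x + c)) + (\<phi> (x + c) - \<phi> x))"
      unfolding T_def by (simp add: algebra_simps)
    also have "\<dots> \<le> l2norm UNIV (\<lambda>x. \<phi> (x + c + a) - \<phi> (x + c)) + l2norm UNIV (\<lambda>x. \<phi> (x + c) - \<phi> x)"
      using shift(1)[of c a] shift(1)[of 0 c] by (intro l2norm_triangle) auto
    finally show ?thesis using shift(2)[of c a] by (simp add: T_def)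
  qed
  have mult: "T (real n *\<^sub>R a) \<le> real n * T a" for n a
  proof (induction n)
    case 0
    then show ?case by (simp add: T)
  next
    case (Suc n)
    have "T (real (Suc n) *\<^sub>R a) \<le> T a + T (real n *\<^sub>R a)"
      using add[of a "real n *\<^sub>R a"] by (simp add: scaleR_add_left)
    also have "\<dots> \<le> real (Suc n) * T a" using Suc by (simp add: algebra_simps)
    finally show ?case .
  qed
  have "(T e)\<^sup>2 \<le> (\<integral>x. (real (Suc k) * (\<phi> (x + e /\<^sub>R real (Suc k)) - \<phi> x))\<^sup>2 \<partial>lborel)" for k
  proof -
    have "T e \<le> real (Suc k) * T (e /\<^sub>R real (Suc k))"
      using mult[of "Suc k" "e /\<^sub>R real (Suc k)"] by (simp del: of_nat_Suc)
    then have "(T e)\<^sup>2 \<le> (real (Suc k) * T (e /\<^sub>R real (Suc k)))\<^sup>2"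
      by (intro power_mono) (auto simp: T_def)
    also have "\<dots> = (\<integral>x. (real (Suc k) * (\<phi> (x + e /\<^sub>R real (Suc k)) - \<phi> x))\<^sup>2 \<partial>lborel)"
      by (simp add: T power_mult_distrib del: of_nat_Suc)
    finally show ?thesis .
  qed
  then have "(T e)\<^sup>2 \<le> (\<integral>x. (frechet_derivative \<phi> (at x) e)\<^sup>2 \<partial>lborel)"
    using test_fun_difference_quotient(2)[OF \<phi>, of e] by (intro LIMSEQ_le_const) auto
  also have "\<dots> \<le> (\<integral>x. (norm e)\<^sup>2 * (norm (classical_grad \<phi> x))\<^sup>2 \<partial>lborel)"
  proof (intro Bochner_Integration.integral_mono')
    show "(frechet_derivative \<phi> (at x) e)\<^sup>2 \<le> (norm e)\<^sup>2 * (norm (classical_grad \<phi> x))\<^sup>2" for x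
      using Cauchy_Schwarz_ineq[of "classical_grad \<phi> x" e]
      by (simp add: classical_grad_inner[OF \<phi>] power2_norm_eq_inner mult.commute)
  qed (use classical_grad_square_integrable[OF \<phi>] in auto)
  finally show "(\<integral>x. (\<phi> (x + e) - \<phi> x)\<^sup>2 \<partial>lborel)
      \<le> (norm e)\<^sup>2 * (\<integral>x. (norm (classical_grad \<phi> x))\<^sup>2 \<partial>lborel)"
    by (simp add: T)
qed

context bounded_open_set
begin

subsection \<open>Weak gradients\<close>

lemma integral_domain:
  fixes f :: "'a \<Rightarrow> 'b::euclidean_space"
  assumes "f \<in> borel_measurable borel" "\<And>x. x \<notin> \<Omega> \<Longrightarrow> f x = 0"
  shows "(\<integral>x. f x \<partial>dx) = (\<integral>x. f x \<partial>lborel)"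
    and "integrable dx f \<longleftrightarrow> integrable lborel f"
proof -
  have eq: "(\<lambda>x. indicator \<Omega> x *\<^sub>R f x) = f" using assms(2) by (auto simp: indicator_def)
  show "(\<integral>x. f x \<partial>dx) = (\<integral>x. f x \<partial>lborel)"
    using integral_restrict_space[of \<Omega> lebesgue f] assms(1) by (simp add: eq integral_completion)
  show "integrable dx f \<longleftrightarrow> integrable lborel f"
    using integrable_restrict_space[of \<Omega> lebesgue f] assms(1) by (simp add: eq integrable_completion)
qed

lemma is_weak_grad_iff:
  "is_weak_grad \<Omega> z G \<longleftrightarrow> (\<forall>\<phi>\<in>test_fun \<Omega>. \<forall>b\<in>Basis.
     innerH z (\<lambda>x. frechet_derivative \<phi> (at x) b) = - innerH G (\<lambda>x. \<phi> x *\<^sub>R b))"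
  unfolding is_weak_grad_def l2inner_def by (simp add: mult.commute)

lemma classical_grad_L2: "\<phi> \<in> test_fun \<Omega> \<Longrightarrow> classical_grad \<phi> \<in> L2 \<Omega>"
  using test_fun_Lipschitz[of \<phi> \<Omega>]
  by (metis L2_bounded classical_grad_continuous continuous_measurable)

lemma classical_grad_is_weak_grad:
  assumes "\<phi> \<in> test_fun \<Omega>"
  shows "is_weak_grad \<Omega> \<phi> (classical_grad \<phi>)"
  unfolding is_weak_grad_def
proof (intro ballI)
  fix \<psi> :: "'a \<Rightarrow> real" and b :: 'a assume \<psi>: "\<psi> \<in> test_fun \<Omega>" and b: "b \<in> Basis"
  have 1: "(\<lambda>x. \<phi> x * frechet_derivative \<psi> (at x) b) \<in> test_fun \<Omega>"
    and 2: "(\<lambda>x. frechet_derivative \<phi> (at x) b * \<psi> x) \<in> test_fun \<Omega>"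
    using assms \<psi> b by (auto intro!: test_fun_mult test_fun_frechet_derivative)
  have "(\<integral>x. \<phi> x * frechet_derivative \<psi> (at x) b \<partial>dx)
     = (\<integral>x. \<phi> x * frechet_derivative \<psi> (at x) b \<partial>lborel)"
    using integral_domain(1)[OF test_fun_borel[OF 1]] test_fun_outside[OF 1] by blast
  also have "\<dots> = - (\<integral>x. frechet_derivative \<phi> (at x) b * \<psi> x \<partial>lborel)"
    by (rule test_fun_integration_by_parts[OF assms \<psi> b])
  also have "(\<integral>x. frechet_derivative \<phi> (at x) b * \<psi> x \<partial>lborel)
     = (\<integral>x. frechet_derivative \<phi> (at x) b * \<psi> x \<partial>dx)"
    using integral_domain(1)[OF test_fun_borel[OF 2]] test_fun_outside[OF 2] by simp
  finally show "(\<integral>x. \<phi> x * frechet_derivative \<psi> (at x) b \<partial>dx)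
     = - (\<integral>x. (classical_grad \<phi> x \<bullet> b) * \<psi> x \<partial>dx)"
    by (simp add: classical_grad_inner[OF assms])
qed

lemma is_weak_grad_unique:
  assumes "is_weak_grad \<Omega> z G" "is_weak_grad \<Omega> z G'" "G \<in> L2 \<Omega>" "G' \<in> L2 \<Omega>"
  shows "AE x in dx. G x = G' x"
proof -
  have "AE x in dx. (G x - G' x) \<bullet> b = 0" if b: "b \<in> Basis" for b
  proof (rule test_fun_orthogonal_AE_zero)
    have cb: "(\<lambda>x. b) \<in> L2 \<Omega>" by (rule L2_const)
    show "integrable dx (\<lambda>x. (G x - G' x) \<bullet> b)"
      using L2_integrable_inner[OF L2_diff[OF assms(3,4)] cb] .
    fix \<phi> assume \<phi>: "\<phi> \<in> test_fun \<Omega>"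
    have "innerH (\<lambda>x. G x - G' x) (\<lambda>x. \<phi> x *\<^sub>R b) = 0"
      using assms(1,2) \<phi> b unfolding is_weak_grad_iff
      by (simp add: l2inner_diff_left[OF assms(3,4) test_fun_scaleR_L2[OF \<phi>]])
    then show "(\<integral>x. (G x - G' x) \<bullet> b * \<phi> x \<partial>dx) = 0"
      by (simp add: l2inner_def mult.commute)
  qed
  then have "AE x in dx. \<forall>b\<in>Basis. (G x - G' x) \<bullet> b = 0"
    by (simp add: AE_finite_all)
  then show ?thesis
    by eventually_elim (metis euclidean_all_zero_iff eq_iff_diff_eq_0)
qed

lemma is_weak_grad_lincomb:
  assumes "is_weak_grad \<Omega> z G" "is_weak_grad \<Omega> y F" "z \<in> L2 \<Omega>" "y \<in> L2 \<Omega>" "G \<in> L2 \<Omega>" "F \<in> L2 \<Omega>"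
  shows "is_weak_grad \<Omega> (\<lambda>x. a * z x + b * y x) (\<lambda>x. a *\<^sub>R G x + b *\<^sub>R F x)"
  unfolding is_weak_grad_iff
proof (intro ballI)
  fix \<phi> :: "'a \<Rightarrow> real" and e :: 'a assume \<phi>: "\<phi> \<in> test_fun \<Omega>" and e: "e \<in> Basis"
  have d: "(\<lambda>x. frechet_derivative \<phi> (at x) e) \<in> L2 \<Omega>"
    using \<phi> e by (intro test_fun_L2 test_fun_frechet_derivative)
  show "innerH (\<lambda>x. a * z x + b * y x) (\<lambda>x. frechet_derivative \<phi> (at x) e)
      = - innerH (\<lambda>x. a *\<^sub>R G x + b *\<^sub>R F x) (\<lambda>x. \<phi> x *\<^sub>R e)"
    using assms(1,2) \<phi> e l2inner_lincomb_left[OF assms(3,4) d, of a b]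
      l2inner_lincomb_left[OF assms(5,6) test_fun_scaleR_L2[OF \<phi>], of a b e]
    unfolding is_weak_grad_iff by simp
qed

lemma is_weak_grad_limit:
  assumes "\<And>k. is_weak_grad \<Omega> (z k) (G k)" "\<And>k. z k \<in> L2 \<Omega>" "\<And>k. G k \<in> L2 \<Omega>"
    and "z' \<in> L2 \<Omega>" "G' \<in> L2 \<Omega>"
    and "(\<lambda>k. normH (\<lambda>x. z k x - z' x)) \<longlonglongrightarrow> 0" "(\<lambda>k. normH (\<lambda>x. G k x - G' x)) \<longlonglongrightarrow> 0"
  shows "is_weak_grad \<Omega> z' G'"
  unfolding is_weak_grad_iff
proof (intro ballI)
  fix \<phi> :: "'a \<Rightarrow> real" and e :: 'a assume \<phi>: "\<phi> \<in> test_fun \<Omega>" and e: "e \<in> Basis"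
  let ?d = "\<lambda>x. frechet_derivative \<phi> (at x) e"
  have d: "?d \<in> L2 \<Omega>" using \<phi> e by (intro test_fun_L2 test_fun_frechet_derivative)
  have "(\<lambda>k. innerH (z k) ?d) \<longlonglongrightarrow> innerH z' ?d"
    using assms d by (intro l2inner_tendsto)
  moreover have "(\<lambda>k. - innerH (G k) (\<lambda>x. \<phi> x *\<^sub>R e)) \<longlonglongrightarrow> - innerH G' (\<lambda>x. \<phi> x *\<^sub>R e)"
    using assms test_fun_scaleR_L2[OF \<phi>] by (intro tendsto_minus l2inner_tendsto)
  moreover have "innerH (z k) ?d = - innerH (G k) (\<lambda>x. \<phi> x *\<^sub>R e)" for k
    using assms(1) \<phi> e unfolding is_weak_grad_iff by blast
  ultimately show "innerH z' ?d = - innerH G' (\<lambda>x. \<phi> x *\<^sub>R e)"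
    using LIMSEQ_unique by force
qed

lemma is_weak_grad_cong_AE:
  assumes "is_weak_grad \<Omega> z G" "z \<in> L2 \<Omega>" "y \<in> L2 \<Omega>" "AE x in dx. z x = y x"
  shows "is_weak_grad \<Omega> y G"
  unfolding is_weak_grad_iff
proof (intro ballI)
  fix \<phi> :: "'a \<Rightarrow> real" and e :: 'a assume \<phi>: "\<phi> \<in> test_fun \<Omega>" and e: "e \<in> Basis"
  then have "(\<lambda>x. frechet_derivative \<phi> (at x) e) \<in> L2 \<Omega>"
    by (intro test_fun_L2 test_fun_frechet_derivative)
  from l2inner_cong_AE[OF assms(2,3) this assms(4)]
  show "innerH y (\<lambda>x. frechet_derivative \<phi> (at x) e) = - innerH G (\<lambda>x. \<phi> x *\<^sub>R e)"
    using assms(1) \<phi> e unfolding is_weak_grad_iff by simp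
qed

lemma wgrad_L2: "z \<in> H1 \<Omega> \<Longrightarrow> wgrad \<Omega> z \<in> L2 \<Omega>"
  and wgrad_is_weak_grad: "z \<in> H1 \<Omega> \<Longrightarrow> is_weak_grad \<Omega> z (wgrad \<Omega> z)"
proof -
  assume "z \<in> H1 \<Omega>"
  then have "\<exists>G. G \<in> L2 \<Omega> \<and> is_weak_grad \<Omega> z G" unfolding H1_def by blast
  then have "wgrad \<Omega> z \<in> L2 \<Omega> \<and> is_weak_grad \<Omega> z (wgrad \<Omega> z)"
    unfolding wgrad_def by (rule someI_ex)
  then show "wgrad \<Omega> z \<in> L2 \<Omega>" "is_weak_grad \<Omega> z (wgrad \<Omega> z)" by auto
qed

lemma H1I: "z \<in> L2 \<Omega> \<Longrightarrow> G \<in> L2 \<Omega> \<Longrightarrow> is_weak_grad \<Omega> z G \<Longrightarrow> z \<in> H1 \<Omega>"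
  unfolding H1_def by blast

lemma H1_L2: "z \<in> H1 \<Omega> \<Longrightarrow> z \<in> L2 \<Omega>"
  unfolding H1_def by blast

lemma wgrad_AE_eq:
  assumes "z \<in> L2 \<Omega>" "G \<in> L2 \<Omega>" "is_weak_grad \<Omega> z G"
  shows "AE x in dx. wgrad \<Omega> z x = G x"
  using is_weak_grad_unique wgrad_is_weak_grad wgrad_L2 H1I assms by blast

lemma test_fun_H1: "\<phi> \<in> test_fun \<Omega> \<Longrightarrow> \<phi> \<in> H1 \<Omega>"
  using H1I classical_grad_is_weak_grad classical_grad_L2 test_fun_L2 by blast

lemma wgrad_test_fun: "\<phi> \<in> test_fun \<Omega> \<Longrightarrow> AE x in dx. wgrad \<Omega> \<phi> x = classical_grad \<phi> x"
  using wgrad_AE_eq classical_grad_is_weak_grad classical_grad_L2 test_fun_L2 by blast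

lemma H1_lincomb:
  assumes "z \<in> H1 \<Omega>" "y \<in> H1 \<Omega>"
  shows "(\<lambda>x. a * z x + b * y x) \<in> H1 \<Omega>"
  using is_weak_grad_lincomb[OF wgrad_is_weak_grad[OF assms(1)] wgrad_is_weak_grad[OF assms(2)], of a b]
    L2_lincomb[of z \<Omega> y a b] L2_lincomb[of "wgrad \<Omega> z" \<Omega> "wgrad \<Omega> y" a b] assms
  by (auto intro!: H1I simp: H1_L2 wgrad_L2)

lemma wgrad_lincomb:
  assumes "z \<in> H1 \<Omega>" "y \<in> H1 \<Omega>"
  shows "AE x in dx. wgrad \<Omega> (\<lambda>x. a * z x + b * y x) x = a *\<^sub>R wgrad \<Omega> z x + b *\<^sub>R wgrad \<Omega> y x"
  using is_weak_grad_lincomb[OF wgrad_is_weak_grad[OF assms(1)] wgrad_is_weak_grad[OF assms(2)], of a b]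
    L2_lincomb[of "wgrad \<Omega> z" \<Omega> "wgrad \<Omega> y" a b] assms
  by (intro wgrad_AE_eq H1_L2[OF H1_lincomb]) (auto simp: H1_L2 wgrad_L2)

subsection \<open>The space $H_0^1$ and its inner product\<close>

definition dirichlet_form :: "('a \<Rightarrow> real) \<Rightarrow> ('a \<Rightarrow> real) \<Rightarrow> real" where
  "dirichlet_form y z = innerH (wgrad \<Omega> y) (wgrad \<Omega> z)"

lemma dirichlet_form_commute: "dirichlet_form y z = dirichlet_form z y"
  unfolding dirichlet_form_def by (rule l2inner_commute)

lemma dirichlet_form_self: "dirichlet_form z z = (normV \<Omega> z)\<^sup>2"
  unfolding dirichlet_form_def normV_def by (rule l2inner_self)

lemma normV_nonneg [simp]: "0 \<le> normV \<Omega> z"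
  by (simp add: normV_def)

lemma dirichlet_form_lincomb:
  assumes "y \<in> H1 \<Omega>" "z \<in> H1 \<Omega>" "w \<in> H1 \<Omega>"
  shows "dirichlet_form (\<lambda>x. a * y x + b * z x) w = a * dirichlet_form y w + b * dirichlet_form z w"
proof -
  have "dirichlet_form (\<lambda>x. a * y x + b * z x) w
     = innerH (\<lambda>x. a *\<^sub>R wgrad \<Omega> y x + b *\<^sub>R wgrad \<Omega> z x) (wgrad \<Omega> w)"
    unfolding dirichlet_form_def using assms
    by (intro l2inner_cong_AE wgrad_lincomb wgrad_L2 H1_lincomb L2_lincomb)
  then show ?thesis
    using assms by (simp add: l2inner_lincomb_left wgrad_L2 dirichlet_form_def)
qed

lemma dirichlet_form_Cauchy_Schwarz:
  "y \<in> H1 \<Omega> \<Longrightarrow> z \<in> H1 \<Omega> \<Longrightarrow> \<bar>dirichlet_form y z\<bar> \<le> normV \<Omega> y * normV \<Omega> z"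
  unfolding dirichlet_form_def normV_def by (intro l2_Cauchy_Schwarz wgrad_L2)

lemma normV_diff: "y \<in> H1 \<Omega> \<Longrightarrow> z \<in> H1 \<Omega> \<Longrightarrow>
    normV \<Omega> (\<lambda>x. y x - z x) = normH (\<lambda>x. wgrad \<Omega> y x - wgrad \<Omega> z x)"
  unfolding normV_def
  using wgrad_lincomb[of y z 1 "-1"] H1_lincomb[of y z 1 "-1"]
  by (intro l2norm_cong_AE) (auto intro!: wgrad_L2 L2_diff)

lemma H1_diff: "y \<in> H1 \<Omega> \<Longrightarrow> z \<in> H1 \<Omega> \<Longrightarrow> (\<lambda>x. y x - z x) \<in> H1 \<Omega>"
  using H1_lincomb[of y z 1 "-1"] by simp

lemma H01_H1: "z \<in> H01 \<Omega> \<Longrightarrow> z \<in> H1 \<Omega>"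
  and H01_L2: "z \<in> H01 \<Omega> \<Longrightarrow> z \<in> L2 \<Omega>"
  unfolding H01_def using H1_L2 by auto

lemma H01_approx:
  assumes "z \<in> H01 \<Omega>"
  obtains \<phi> where "\<And>k::nat. \<phi> k \<in> test_fun \<Omega>" "(\<lambda>k. normH (\<lambda>x. \<phi> k x - z x)) \<longlonglongrightarrow> 0"
    "(\<lambda>k. normV \<Omega> (\<lambda>x. \<phi> k x - z x)) \<longlonglongrightarrow> 0"
proof -
  obtain \<phi> where *: "\<And>k::nat. \<phi> k \<in> test_fun \<Omega>" "(\<lambda>k. normH (\<lambda>x. \<phi> k x - z x)) \<longlonglongrightarrow> 0"
    "(\<lambda>k. normH (\<lambda>x. wgrad \<Omega> (\<phi> k) x - wgrad \<Omega> z x)) \<longlonglongrightarrow> 0"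
    using assms unfolding H01_def by blast
  show thesis
    by (rule that[OF *(1,2)]) (use * H01_H1[OF assms] in \<open>simp add: normV_diff test_fun_H1\<close>)
qed

lemma H01I:
  assumes "z \<in> H1 \<Omega>" "\<And>k::nat. \<phi> k \<in> test_fun \<Omega>" "(\<lambda>k. normH (\<lambda>x. \<phi> k x - z x)) \<longlonglongrightarrow> 0"
    "(\<lambda>k. normV \<Omega> (\<lambda>x. \<phi> k x - z x)) \<longlonglongrightarrow> 0"
  shows "z \<in> H01 \<Omega>"
proof -
  have "(\<lambda>k. normH (\<lambda>x. wgrad \<Omega> (\<phi> k) x - wgrad \<Omega> z x)) \<longlonglongrightarrow> 0"
    using assms by (simp add: normV_diff test_fun_H1)
  then show ?thesis unfolding H01_def using assms by blast
qed

lemma test_fun_H01: "\<phi> \<in> test_fun \<Omega> \<Longrightarrow> \<phi> \<in> H01 \<Omega>"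
proof (rule H01I[of _ "\<lambda>_. \<phi>"])
  have "normV \<Omega> (\<lambda>x. \<phi> x - \<phi> x) = 0" if "\<phi> \<in> test_fun \<Omega>"
    using normV_diff[OF test_fun_H1[OF that] test_fun_H1[OF that]] by (simp add: l2norm_def)
  then show "\<phi> \<in> test_fun \<Omega> \<Longrightarrow> (\<lambda>k. normV \<Omega> (\<lambda>x. \<phi> x - \<phi> x)) \<longlonglongrightarrow> 0" by simp
qed (auto simp: test_fun_H1 l2norm_def)

lemma normV_lincomb_le:
  assumes "y \<in> H1 \<Omega>" "z \<in> H1 \<Omega>"
  shows "normV \<Omega> (\<lambda>x. a * y x + b * z x) \<le> \<bar>a\<bar> * normV \<Omega> y + \<bar>b\<bar> * normV \<Omega> z"
proof -
  have "normV \<Omega> (\<lambda>x. a * y x + b * z x) = normH (\<lambda>x. a *\<^sub>R wgrad \<Omega> y x + b *\<^sub>R wgrad \<Omega> z x)"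
    unfolding normV_def using assms
    by (intro l2norm_cong_AE wgrad_lincomb wgrad_L2 H1_lincomb L2_lincomb)
  also have "\<dots> \<le> normH (\<lambda>x. a *\<^sub>R wgrad \<Omega> y x) + normH (\<lambda>x. b *\<^sub>R wgrad \<Omega> z x)"
    using assms by (intro l2norm_triangle L2_scaleR wgrad_L2)
  finally show ?thesis by (simp add: l2norm_scaleR normV_def)
qed

lemma H01_lincomb:
  assumes "y \<in> H01 \<Omega>" "z \<in> H01 \<Omega>"
  shows "(\<lambda>x. a * y x + b * z x) \<in> H01 \<Omega>"
proof -
  obtain \<phi> where \<phi>: "\<And>k::nat. \<phi> k \<in> test_fun \<Omega>" "(\<lambda>k. normH (\<lambda>x. \<phi> k x - y x)) \<longlonglongrightarrow> 0"
    "(\<lambda>k. normV \<Omega> (\<lambda>x. \<phi> k x - y x)) \<longlonglongrightarrow> 0" using H01_approx[OF assms(1)] by blast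
  obtain \<psi> where \<psi>: "\<And>k::nat. \<psi> k \<in> test_fun \<Omega>" "(\<lambda>k. normH (\<lambda>x. \<psi> k x - z x)) \<longlonglongrightarrow> 0"
    "(\<lambda>k. normV \<Omega> (\<lambda>x. \<psi> k x - z x)) \<longlonglongrightarrow> 0" using H01_approx[OF assms(2)] by blast
  note H = H01_H1[OF assms(1)] H01_H1[OF assms(2)] test_fun_H1[OF \<phi>(1)] test_fun_H1[OF \<psi>(1)]
  have eq: "(\<lambda>x. a * \<phi> k x + b * \<psi> k x - (a * y x + b * z x))
      = (\<lambda>x. a * (\<phi> k x - y x) + b * (\<psi> k x - z x))" for k
    by (auto simp: algebra_simps)
  show ?thesis
  proof (rule H01I[of _ "\<lambda>k x. a * \<phi> k x + b * \<psi> k x"])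
    show "(\<lambda>x. a * y x + b * z x) \<in> H1 \<Omega>" using H by (intro H1_lincomb)
    show "(\<lambda>x. a * \<phi> k x + b * \<psi> k x) \<in> test_fun \<Omega>" for k
      using \<phi>(1) \<psi>(1) by (intro test_fun_lincomb)
    have lim: "(\<lambda>k. \<bar>a\<bar> * normV \<Omega> (\<lambda>x. \<phi> k x - y x) + \<bar>b\<bar> * normV \<Omega> (\<lambda>x. \<psi> k x - z x)) \<longlonglongrightarrow> 0"
      "(\<lambda>k. \<bar>a\<bar> * normH (\<lambda>x. \<phi> k x - y x) + \<bar>b\<bar> * normH (\<lambda>x. \<psi> k x - z x)) \<longlonglongrightarrow> 0"
      using \<phi> \<psi> by (auto intro!: tendsto_add_zero tendsto_mult_right_zero)
    show "(\<lambda>k. normV \<Omega> (\<lambda>x. a * \<phi> k x + b * \<psi> k x - (a * y x + b * z x))) \<longlonglongrightarrow> 0"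
      by (rule tendsto_sandwich[OF _ _ tendsto_const lim(1)])
        (use H in \<open>auto simp: eq intro!: always_eventually normV_lincomb_le H1_diff\<close>)
    have "normH (\<lambda>x. a * (\<phi> k x - y x) + b * (\<psi> k x - z x))
       \<le> \<bar>a\<bar> * normH (\<lambda>x. \<phi> k x - y x) + \<bar>b\<bar> * normH (\<lambda>x. \<psi> k x - z x)" for k
      using l2norm_triangle[of "\<lambda>x. a * (\<phi> k x - y x)" \<Omega> "\<lambda>x. b * (\<psi> k x - z x)"] H
      by (simp add: l2norm_scale L2_scale L2_diff H1_L2)
    then show "(\<lambda>k. normH (\<lambda>x. a * \<phi> k x + b * \<psi> k x - (a * y x + b * z x))) \<longlonglongrightarrow> 0"
      by (intro tendsto_sandwich[OF _ _ tendsto_const lim(2)]) (auto simp: eq intro!: always_eventually)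
  qed
qed

lemma H01_diff: "y \<in> H01 \<Omega> \<Longrightarrow> z \<in> H01 \<Omega> \<Longrightarrow> (\<lambda>x. y x - z x) \<in> H01 \<Omega>"
  using H01_lincomb[of y z 1 "-1"] by simp

lemma H01_add: "y \<in> H01 \<Omega> \<Longrightarrow> z \<in> H01 \<Omega> \<Longrightarrow> (\<lambda>x. y x + z x) \<in> H01 \<Omega>"
  using H01_lincomb[of y z 1 1] by simp

lemma H01_scale: "y \<in> H01 \<Omega> \<Longrightarrow> (\<lambda>x. a * y x) \<in> H01 \<Omega>"
  using H01_lincomb[of y y a 0] by simp

lemma dirichlet_form_diff_left: "y \<in> H01 \<Omega> \<Longrightarrow> z \<in> H01 \<Omega> \<Longrightarrow> w \<in> H01 \<Omega> \<Longrightarrow>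
    dirichlet_form (\<lambda>x. y x - z x) w = dirichlet_form y w - dirichlet_form z w"
  using dirichlet_form_lincomb[of y z w 1 "-1"] H01_H1 by simp

lemma dirichlet_form_add_left: "y \<in> H01 \<Omega> \<Longrightarrow> z \<in> H01 \<Omega> \<Longrightarrow> w \<in> H01 \<Omega> \<Longrightarrow>
    dirichlet_form (\<lambda>x. y x + z x) w = dirichlet_form y w + dirichlet_form z w"
  using dirichlet_form_lincomb[of y z w 1 1] H01_H1 by simp

lemma dirichlet_form_diff_right: "y \<in> H01 \<Omega> \<Longrightarrow> z \<in> H01 \<Omega> \<Longrightarrow> w \<in> H01 \<Omega> \<Longrightarrow>
    dirichlet_form w (\<lambda>x. y x - z x) = dirichlet_form w y - dirichlet_form w z"
  by (simp add: dirichlet_form_diff_left dirichlet_form_commute[of w])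

lemma dirichlet_form_add_right: "y \<in> H01 \<Omega> \<Longrightarrow> z \<in> H01 \<Omega> \<Longrightarrow> w \<in> H01 \<Omega> \<Longrightarrow>
    dirichlet_form w (\<lambda>x. y x + z x) = dirichlet_form w y + dirichlet_form w z"
  by (simp add: dirichlet_form_add_left dirichlet_form_commute[of w])

lemma normV_scale: "y \<in> H01 \<Omega> \<Longrightarrow> normV \<Omega> (\<lambda>x. a * y x) = \<bar>a\<bar> * normV \<Omega> y"
proof -
  assume y: "y \<in> H01 \<Omega>"
  have "(normV \<Omega> (\<lambda>x. a * y x))\<^sup>2 = (\<bar>a\<bar> * normV \<Omega> y)\<^sup>2"
    using dirichlet_form_lincomb[of y y "\<lambda>x. a * y x" a 0] dirichlet_form_lincomb[of y y y a 0]
      H01_H1[OF y] H01_H1[OF H01_scale[OF y]]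
    by (simp add: dirichlet_form_self dirichlet_form_commute[of y] power_mult_distrib power2_eq_square)
  then show ?thesis by (simp add: power2_eq_iff_nonneg)
qed

lemma normV_diff_square:
  assumes "y \<in> H01 \<Omega>" "z \<in> H01 \<Omega>"
  shows "(normV \<Omega> (\<lambda>x. y x - z x))\<^sup>2 = (normV \<Omega> y)\<^sup>2 - 2 * dirichlet_form y z + (normV \<Omega> z)\<^sup>2"
  using assms dirichlet_form_commute[of z y] unfolding dirichlet_form_self[symmetric]
  by (simp add: dirichlet_form_diff_left dirichlet_form_diff_right H01_diff)

lemma normV_add_square:
  assumes "y \<in> H01 \<Omega>" "z \<in> H01 \<Omega>"
  shows "(normV \<Omega> (\<lambda>x. y x + z x))\<^sup>2 = (normV \<Omega> y)\<^sup>2 + 2 * dirichlet_form y z + (normV \<Omega> z)\<^sup>2"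
  using assms dirichlet_form_commute[of z y] unfolding dirichlet_form_self[symmetric]
  by (simp add: dirichlet_form_add_left dirichlet_form_add_right H01_add)

lemma normV_triangle:
  "y \<in> H01 \<Omega> \<Longrightarrow> z \<in> H01 \<Omega> \<Longrightarrow> normV \<Omega> (\<lambda>x. y x + z x) \<le> normV \<Omega> y + normV \<Omega> z"
  using normV_lincomb_le[of y z 1 1] H01_H1 by simp

lemma normV_triangle_diff:
  "y \<in> H01 \<Omega> \<Longrightarrow> z \<in> H01 \<Omega> \<Longrightarrow> normV \<Omega> y \<le> normV \<Omega> z + normV \<Omega> (\<lambda>x. y x - z x)"
  using normV_triangle[OF _ H01_diff, of z y z] by simp

lemma normV_minus_commute:
  "y \<in> H01 \<Omega> \<Longrightarrow> z \<in> H01 \<Omega> \<Longrightarrow> normV \<Omega> (\<lambda>x. y x - z x) = normV \<Omega> (\<lambda>x. z x - y x)"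
  using l2norm_minus_commute[of \<Omega> "wgrad \<Omega> y" "wgrad \<Omega> z"] by (simp add: normV_diff H01_H1)

lemma normV_abs_diff_le:
  "y \<in> H01 \<Omega> \<Longrightarrow> z \<in> H01 \<Omega> \<Longrightarrow> \<bar>normV \<Omega> y - normV \<Omega> z\<bar> \<le> normV \<Omega> (\<lambda>x. y x - z x)"
  using normV_triangle_diff[of y z] normV_triangle_diff[of z y] normV_minus_commute[of y z] by simp

lemma wgrad_cong_AE:
  assumes "y \<in> H1 \<Omega>" "z \<in> H1 \<Omega>" "AE x in dx. y x = z x"
  shows "AE x in dx. wgrad \<Omega> y x = wgrad \<Omega> z x"
  using wgrad_AE_eq[OF H1_L2[OF assms(1)] wgrad_L2[OF assms(2)]] assms(3)
    is_weak_grad_cong_AE[OF wgrad_is_weak_grad[OF assms(2)] H1_L2[OF assms(2)] H1_L2[OF assms(1)]]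
  by (auto simp: eq_commute)

lemma normV_cong_AE:
  "y \<in> H1 \<Omega> \<Longrightarrow> z \<in> H1 \<Omega> \<Longrightarrow> AE x in dx. y x = z x \<Longrightarrow> normV \<Omega> y = normV \<Omega> z"
  unfolding normV_def by (intro l2norm_cong_AE wgrad_cong_AE wgrad_L2)

text \<open>Completeness: the functions and their gradients have limits in \<open>L\<^sup>2\<close>, and the limit of the gradients
  is the weak gradient of the limit.\<close>

lemma H01_limit_of_test_funs:
  assumes "\<And>k::nat. \<phi> k \<in> test_fun \<Omega>"
    and Cauchy: "\<And>e. e > 0 \<Longrightarrow> \<exists>N. \<forall>m\<ge>N. \<forall>n\<ge>N. normH (\<lambda>x. \<phi> m x - \<phi> n x) < e"
      "\<And>e. e > 0 \<Longrightarrow> \<exists>N. \<forall>m\<ge>N. \<forall>n\<ge>N. normV \<Omega> (\<lambda>x. \<phi> m x - \<phi> n x) < e"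
  obtains z where "z \<in> H01 \<Omega>" "(\<lambda>k. normH (\<lambda>x. \<phi> k x - z x)) \<longlonglongrightarrow> 0"
    "(\<lambda>k. normV \<Omega> (\<lambda>x. \<phi> k x - z x)) \<longlonglongrightarrow> 0"
proof -
  note H = test_fun_H1[OF assms(1)]
  obtain z where z: "z \<in> L2 \<Omega>" "(\<lambda>k. normH (\<lambda>x. \<phi> k x - z x)) \<longlonglongrightarrow> 0"
    using L2_complete[of \<phi> \<Omega>] H1_L2[OF H] Cauchy(1) by blast
  have "\<exists>N. \<forall>m\<ge>N. \<forall>n\<ge>N. normH (\<lambda>x. wgrad \<Omega> (\<phi> m) x - wgrad \<Omega> (\<phi> n) x) < e" if "e > 0" for e
    using Cauchy(2)[OF that] by (simp add: normV_diff[OF H H])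
  then obtain G where G: "G \<in> L2 \<Omega>" "(\<lambda>k. normH (\<lambda>x. wgrad \<Omega> (\<phi> k) x - G x)) \<longlonglongrightarrow> 0"
    using L2_complete[of "\<lambda>k. wgrad \<Omega> (\<phi> k)" \<Omega>] wgrad_L2[OF H] by blast
  have w: "is_weak_grad \<Omega> z G"
    by (rule is_weak_grad_limit[OF wgrad_is_weak_grad[OF H] H1_L2[OF H] wgrad_L2[OF H] z(1) G(1) z(2) G(2)])
  then have z1: "z \<in> H1 \<Omega>" using z(1) G(1) by (rule_tac H1I)
  have "normH (\<lambda>x. wgrad \<Omega> (\<phi> k) x - wgrad \<Omega> z x) = normH (\<lambda>x. wgrad \<Omega> (\<phi> k) x - G x)" for k
    using wgrad_AE_eq[OF z(1) G(1) w]
    by (intro l2norm_cong_AE L2_diff wgrad_L2 H z1 G) auto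
  then have "(\<lambda>k. normV \<Omega> (\<lambda>x. \<phi> k x - z x)) \<longlonglongrightarrow> 0"
    using G(2) by (simp add: normV_diff[OF H z1])
  then show ?thesis using that H01I[OF z1 assms(1) z(2)] z(2) by blast
qed

text \<open>Integrating by parts twice moves both derivatives to the test function.\<close>

lemma dirichlet_form_test_fun:
  assumes "y \<in> H1 \<Omega>" "\<phi> \<in> test_fun \<Omega>"
  shows "dirichlet_form y \<phi>
    = - (\<Sum>b\<in>Basis. innerH y (\<lambda>x. frechet_derivative (\<lambda>x. frechet_derivative \<phi> (at x) b) (at x) b))"
proof -
  have T: "(\<lambda>x. frechet_derivative \<phi> (at x) b) \<in> test_fun \<Omega>" if "b \<in> Basis" for b
    using test_fun_frechet_derivative[OF assms(2) that] .
  have "dirichlet_form y \<phi> = innerH (classical_grad \<phi>) (wgrad \<Omega> y)"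
    unfolding dirichlet_form_commute[of y] unfolding dirichlet_form_def
    using assms by (intro l2inner_cong_AE[OF _ _ _ wgrad_test_fun])
      (auto intro: wgrad_L2 test_fun_H1 classical_grad_L2)
  also have "\<dots> = (\<integral>x. (\<Sum>b\<in>Basis. wgrad \<Omega> y x \<bullet> (frechet_derivative \<phi> (at x) b *\<^sub>R b)) \<partial>dx)"
    unfolding l2inner_def classical_grad_def
    by (simp add: inner_sum_left inner_sum_right inner_commute)
  also have "\<dots> = (\<Sum>b\<in>Basis. \<integral>x. wgrad \<Omega> y x \<bullet> (frechet_derivative \<phi> (at x) b *\<^sub>R b) \<partial>dx)"
    by (intro Bochner_Integration.integral_sum L2_integrable_inner wgrad_L2 assms test_fun_scaleR_L2 T)
  also have "\<dots> = (\<Sum>b\<in>Basis. - innerH y (\<lambda>x. frechet_derivative (\<lambda>x. frechet_derivative \<phi> (at x) b) (at x) b))"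
  proof (rule sum.cong[OF refl])
    fix b :: 'a assume b: "b \<in> Basis"
    show "(\<integral>x. wgrad \<Omega> y x \<bullet> (frechet_derivative \<phi> (at x) b *\<^sub>R b) \<partial>dx)
      = - innerH y (\<lambda>x. frechet_derivative (\<lambda>x. frechet_derivative \<phi> (at x) b) (at x) b)"
      using wgrad_is_weak_grad[OF assms(1)] T[OF b] b unfolding is_weak_grad_iff
      by (simp add: l2inner_def)
  qed
  finally show ?thesis by (simp add: sum_negf)
qed

end

section \<open>Averages over dyadic cells\<close>

text \<open>The half-open cube of side \<open>2\<^sup>-\<^sup>k\<close> of the dyadic grid that contains \<open>x\<close>.\<close>

definition dyadic_cell :: "nat \<Rightarrow> 'a::euclidean_space \<Rightarrow> 'a set" where
  "dyadic_cell k x = {y. \<forall>b\<in>Basis. \<lfloor>2 ^ k * (y \<bullet> b)\<rfloor> = \<lfloor>2 ^ k * (x \<bullet> b)\<rfloor>}"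

definition dyadic_corner :: "nat \<Rightarrow> 'a::euclidean_space \<Rightarrow> 'a" where
  "dyadic_corner k x = (\<Sum>b\<in>Basis. (real_of_int \<lfloor>2 ^ k * (x \<bullet> b)\<rfloor> / 2 ^ k) *\<^sub>R b)"

lemma dyadic_corner_inner:
  "b \<in> Basis \<Longrightarrow> dyadic_corner k x \<bullet> b = real_of_int \<lfloor>2 ^ k * (x \<bullet> b)\<rfloor> / 2 ^ k"
  unfolding dyadic_corner_def by simp

lemma dyadic_cell_self: "x \<in> dyadic_cell k x"
  by (simp add: dyadic_cell_def)

lemma dyadic_cell_eq: "y \<in> dyadic_cell k x \<Longrightarrow> dyadic_cell k y = dyadic_cell k x"
  by (auto simp: dyadic_cell_def)

lemma dyadic_corner_in_cell: "dyadic_corner k x \<in> dyadic_cell k x"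
  by (simp add: dyadic_cell_def dyadic_corner_inner)

lemma dyadic_cell_Suc_subset: "dyadic_cell (Suc k) x \<subseteq> dyadic_cell k x"
proof
  fix y assume y: "y \<in> dyadic_cell (Suc k) x"
  have half: "\<lfloor>s\<rfloor> = \<lfloor>2 * s\<rfloor> div 2" for s :: real
    using floor_divide_real_eq_div[of 2 "2 * s"] by simp
  show "y \<in> dyadic_cell k x"
    using y half[of "2 ^ k * (y \<bullet> b)" for b] half[of "2 ^ k * (x \<bullet> b)" for b]
    by (auto simp: dyadic_cell_def mult.assoc)
qed

lemma dyadic_cell_iff:
  "y \<in> dyadic_cell k x \<longleftrightarrow> (\<forall>b\<in>Basis. dyadic_corner k x \<bullet> b \<le> y \<bullet> b
      \<and> y \<bullet> b < (dyadic_corner k x + (1 / 2 ^ k) *\<^sub>R One) \<bullet> b)"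
proof -
  have "\<lfloor>2 ^ k * (y \<bullet> b)\<rfloor> = m \<longleftrightarrow> real_of_int m / 2 ^ k \<le> y \<bullet> b \<and> y \<bullet> b < real_of_int m / 2 ^ k + 1 / 2 ^ k"
    for m b
    by (simp add: floor_eq_iff field_simps)
  then show ?thesis by (simp add: dyadic_cell_def dyadic_corner_inner inner_add_left)
qed

lemma dyadic_cell_borel [measurable]: "dyadic_cell k x \<in> sets borel"
  unfolding dyadic_cell_def by measurable

lemma emeasure_dyadic_cell:
  fixes x :: "'a::euclidean_space"
  shows "emeasure lborel (dyadic_cell k x) = ennreal ((1 / 2 ^ k) ^ DIM('a))"
proof (rule antisym)
  let ?a = "dyadic_corner k x" and ?c = "dyadic_corner k x + (1 / 2 ^ k) *\<^sub>R One"
  have eq: "(\<Prod>b\<in>Basis. (?c - ?a) \<bullet> b) = (1 / 2 ^ k) ^ DIM('a)" by simp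
  have le: "?a \<bullet> b \<le> ?c \<bullet> b" if "b \<in> Basis" for b using that by (simp add: inner_add_left)
  have "dyadic_cell k x \<subseteq> cbox ?a ?c" by (auto simp: dyadic_cell_iff mem_box less_imp_le)
  then have "emeasure lborel (dyadic_cell k x) \<le> emeasure lborel (cbox ?a ?c)"
    by (rule emeasure_mono) auto
  then show "emeasure lborel (dyadic_cell k x) \<le> ennreal ((1 / 2 ^ k) ^ DIM('a))"
    using emeasure_lborel_cbox[OF le] eq by metis
  have "box ?a ?c \<subseteq> dyadic_cell k x" by (auto simp: dyadic_cell_iff mem_box less_imp_le)
  then have "emeasure lborel (box ?a ?c) \<le> emeasure lborel (dyadic_cell k x)"
    by (rule emeasure_mono) auto
  then show "ennreal ((1 / 2 ^ k) ^ DIM('a)) \<le> emeasure lborel (dyadic_cell k x)"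
    using emeasure_lborel_box[OF le] eq by metis
qed

lemma measure_dyadic_cell:
  "measure lborel (dyadic_cell k x) = (1 / 2 ^ k) ^ DIM('a)" for x :: "'a::euclidean_space"
  by (simp add: measure_def emeasure_dyadic_cell)

lemma dyadic_cell_diff:
  assumes "y \<in> dyadic_cell k x" "b \<in> Basis"
  shows "\<bar>(y - x) \<bullet> b\<bar> \<le> 1 / 2 ^ k"
proof -
  have "y \<in> dyadic_cell k x" "x \<in> dyadic_cell k x" using assms dyadic_cell_self by auto
  then show ?thesis using assms(2) unfolding dyadic_cell_iff
    by (force simp: inner_diff_left inner_add_left abs_le_iff)
qed

lemma integrable_on_finite_set:
  fixes g :: "'a::euclidean_space \<Rightarrow> real"
  assumes [measurable]: "g \<in> borel_measurable borel" "S \<in> sets borel"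
    and "emeasure lborel S < \<infinity>" "\<And>y. y \<in> S \<Longrightarrow> \<bar>g y\<bar> \<le> B"
  shows "integrable lborel (\<lambda>y. indicator S y * g y)"
  using integrableI_bounded_set_indicator[of S lborel g B] assms by simp

lemma integral_square_le_measure_times:
  fixes g :: "'a::euclidean_space \<Rightarrow> real"
  assumes [measurable]: "S \<in> sets borel" and fin: "emeasure lborel S < \<infinity>"
    and 1: "integrable lborel (\<lambda>y. indicator S y * g y)"
    and 2: "integrable lborel (\<lambda>y. indicator S y * (g y)\<^sup>2)"
  shows "(\<integral>y. indicator S y * g y \<partial>lborel)\<^sup>2 \<le> measure lborel S * (\<integral>y. indicator S y * (g y)\<^sup>2 \<partial>lborel)"
proof -
  have 3: "integrable lborel (indicator S :: 'a \<Rightarrow> real)" using fin by (simp add: integrable_indicator_iff)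
  have "0 \<le> (\<integral>y. indicator S y * (g y)\<^sup>2 \<partial>lborel) + 2 * t * (\<integral>y. indicator S y * g y \<partial>lborel) + t\<^sup>2 * measure lborel S"
    for t
  proof -
    have "0 \<le> (\<integral>y. indicator S y * (g y + t)\<^sup>2 \<partial>lborel)" by (intro integral_nonneg_AE) auto
    also have "\<dots> = (\<integral>y. indicator S y * (g y)\<^sup>2 + 2 * t * (indicator S y * g y) + t\<^sup>2 * indicator S y \<partial>lborel)"
      by (intro Bochner_Integration.integral_cong) (auto simp: power2_sum algebra_simps indicator_def)
    also have "\<dots> = (\<integral>y. indicator S y * (g y)\<^sup>2 \<partial>lborel) + 2 * t * (\<integral>y. indicator S y * g y \<partial>lborel)
        + t\<^sup>2 * (\<integral>y. indicator S y \<partial>lborel)"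
      using 1 2 3 by simp
    finally show ?thesis by simp
  qed
  from nonneg_quadratic_imp_square_le[OF this] show ?thesis by (simp add: mult.commute)
qed

definition dyadic_avg :: "nat \<Rightarrow> ('a::euclidean_space \<Rightarrow> real) \<Rightarrow> 'a \<Rightarrow> real" where
  "dyadic_avg k f x = (2 ^ k) ^ DIM('a) * (\<integral>y. indicator (dyadic_cell k x) y * f y \<partial>lborel)"

lemma dyadic_avg_cell: "y \<in> dyadic_cell k x \<Longrightarrow> dyadic_avg k f y = dyadic_avg k f x"
  by (simp add: dyadic_avg_def dyadic_cell_eq)

lemma dyadic_avg_measurable [measurable]:
  fixes f :: "'a::euclidean_space \<Rightarrow> real"
  assumes [measurable]: "f \<in> borel_measurable borel"
  shows "dyadic_avg k f \<in> borel_measurable borel"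
proof -
  have "(\<lambda>(x, y). (if \<forall>b\<in>Basis. \<lfloor>2 ^ k * (y \<bullet> b)\<rfloor> = \<lfloor>2 ^ k * (x \<bullet> b)\<rfloor> then f y else 0))
      \<in> borel_measurable (borel \<Otimes>\<^sub>M (lborel :: 'a measure))"
    unfolding split_beta by measurable
  then have "(\<lambda>x. \<integral>y. (if \<forall>b\<in>Basis. \<lfloor>2 ^ k * (y \<bullet> b)\<rfloor> = \<lfloor>2 ^ k * (x \<bullet> b)\<rfloor> then f y else 0) \<partial>lborel)
      \<in> borel_measurable borel"
    by (rule lborel.borel_measurable_lebesgue_integral)
  also have "(\<lambda>x. \<integral>y. (if \<forall>b\<in>Basis. \<lfloor>2 ^ k * (y \<bullet> b)\<rfloor> = \<lfloor>2 ^ k * (x \<bullet> b)\<rfloor> then f y else 0) \<partial>lborel)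
     = (\<lambda>x. \<integral>y. indicator (dyadic_cell k x) y * f y \<partial>lborel)"
    by (intro ext Bochner_Integration.integral_cong) (auto simp: dyadic_cell_def indicator_def)
  finally show ?thesis unfolding dyadic_avg_def by simp
qed

lemma integrable_dyadic_cell:
  fixes g :: "'a::euclidean_space \<Rightarrow> real"
  assumes "g \<in> borel_measurable borel" "\<And>y. \<bar>g y\<bar> \<le> B"
  shows "integrable lborel (\<lambda>y. indicator (dyadic_cell k x) y * g y)"
  by (rule integrable_on_finite_set[OF assms(1) dyadic_cell_borel]) (use assms in \<open>auto simp: emeasure_dyadic_cell\<close>)

lemma integral_indicator_dyadic_cell:
  "(2 ^ k) ^ DIM('a) * (\<integral>y. indicator (dyadic_cell k x) y * c \<partial>lborel) = c" for x :: "'a::euclidean_space" and c :: real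
  by (simp add: measure_dyadic_cell power_one_over flip: power_mult_distrib)

text \<open>The error of averaging is controlled by the mean square of the increments
  \<open>\<phi> (x + z) - \<phi> x\<close> with \<open>|z|\<^sub>\<infinity> \<le> 2\<^sup>-\<^sup>k\<close>, hence by the gradient.\<close>

lemma dyadic_avg_error:
  fixes \<phi> :: "'a::euclidean_space \<Rightarrow> real"
  assumes \<phi>: "\<phi> \<in> test_fun \<Omega>"
  defines "C \<equiv> 2 ^ DIM('a) * (real DIM('a))\<^sup>2"
  defines "D \<equiv> \<integral>x. (norm (classical_grad \<phi> x))\<^sup>2 \<partial>lborel"
  shows "integrable lborel (\<lambda>x. (\<phi> x - dyadic_avg k \<phi> x)\<^sup>2)"
    and "(\<integral>x. (\<phi> x - dyadic_avg k \<phi> x)\<^sup>2 \<partial>lborel) \<le> C / 4 ^ k * D"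
proof -
  let ?n = "DIM('a)"
  define h :: real where "h = 1 / 2 ^ k"
  have h: "h > 0" by (simp add: h_def)
  have hk: "(2 ^ k) ^ ?n * h ^ ?n = 1"
    by (simp add: h_def flip: power_mult_distrib)
  define S where "S = cbox (- h *\<^sub>R One) (h *\<^sub>R One :: 'a)"
  have [measurable]: "\<phi> \<in> borel_measurable borel" by (rule test_fun_borel[OF \<phi>])
  have [measurable]: "S \<in> sets borel" by (simp add: S_def)
  obtain B where B: "0 \<le> B" "\<And>x. \<bar>\<phi> x\<bar> \<le> B" using test_fun_bounded[OF \<phi>] by blast
  have bd: "\<bar>\<phi> x - \<phi> y\<bar> \<le> 2 * B" for x y using B(2)[of x] B(2)[of y] by linarith
  then have bd2: "\<bar>(\<phi> x - \<phi> y)\<^sup>2\<bar> \<le> (2 * B)\<^sup>2" for x y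
    using power_mono[OF bd[of x y], of 2] by simp
  have Sf: "emeasure lborel S = ennreal ((2 * h) ^ ?n)"
  proof -
    have "(\<Prod>b\<in>Basis. (h *\<^sub>R One - - h *\<^sub>R One) \<bullet> (b::'a)) = (\<Prod>b\<in>(Basis::'a set). 2 * h)"
      by (rule prod.cong) (auto simp: inner_diff_left inner_add_left)
    then show ?thesis unfolding S_def using h by (subst emeasure_lborel_cbox) auto
  qed
  have D0: "D \<ge> 0" unfolding D_def by (intro integral_nonneg_AE) auto
  have pw: "(\<phi> x - dyadic_avg k \<phi> x)\<^sup>2 \<le> (2 ^ k) ^ ?n * (\<integral>z. indicator S z * (\<phi> (x + z) - \<phi> x)\<^sup>2 \<partial>lborel)" for x
  proof -
    let ?Q = "dyadic_cell k x"
    have i1: "integrable lborel (\<lambda>y. indicator ?Q y * (\<phi> x - \<phi> y))"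
      by (rule integrable_dyadic_cell[OF _ bd]) measurable
    have i2: "integrable lborel (\<lambda>y. indicator ?Q y * (\<phi> x - \<phi> y)\<^sup>2)"
      by (rule integrable_dyadic_cell[OF _ bd2]) measurable
    have i3: "integrable lborel (\<lambda>y. indicator ?Q y * \<phi> y)"
      by (rule integrable_dyadic_cell[OF _ B(2)]) measurable
    have i4: "integrable lborel (\<lambda>y. indicator ?Q y * \<phi> x)"
      by (rule integrable_dyadic_cell[of _ "\<bar>\<phi> x\<bar>"]) auto
    have "\<phi> x - dyadic_avg k \<phi> x = (2 ^ k) ^ ?n * ((\<integral>y. indicator ?Q y * \<phi> x \<partial>lborel) - (\<integral>y. indicator ?Q y * \<phi> y \<partial>lborel))"
      using integral_indicator_dyadic_cell[of k x "\<phi> x"] by (simp add: dyadic_avg_def right_diff_distrib)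
    also have "\<dots> = (2 ^ k) ^ ?n * (\<integral>y. indicator ?Q y * (\<phi> x - \<phi> y) \<partial>lborel)"
      using i3 i4 by (simp add: right_diff_distrib)
    finally have "(\<phi> x - dyadic_avg k \<phi> x)\<^sup>2
        = ((2 ^ k) ^ ?n)\<^sup>2 * (\<integral>y. indicator ?Q y * (\<phi> x - \<phi> y) \<partial>lborel)\<^sup>2"
      by (simp add: power_mult_distrib)
    also have "\<dots> \<le> ((2 ^ k) ^ ?n)\<^sup>2 * (h ^ ?n * (\<integral>y. indicator ?Q y * (\<phi> x - \<phi> y)\<^sup>2 \<partial>lborel))"
      using integral_square_le_measure_times[OF dyadic_cell_borel _ i1 i2]
      by (intro mult_left_mono) (auto simp: emeasure_dyadic_cell measure_dyadic_cell h_def)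
    also have "\<dots> = (2 ^ k) ^ ?n * (((2 ^ k) ^ ?n * h ^ ?n) * (\<integral>y. indicator ?Q y * (\<phi> x - \<phi> y)\<^sup>2 \<partial>lborel))"
      by (simp only: power2_eq_square mult.assoc)
    also have "\<dots> = (2 ^ k) ^ ?n * (\<integral>y. indicator ?Q y * (\<phi> x - \<phi> y)\<^sup>2 \<partial>lborel)" by (simp add: hk)
    also have "(\<integral>y. indicator ?Q y * (\<phi> x - \<phi> y)\<^sup>2 \<partial>lborel)
       = (\<integral>z. indicator ?Q (z + x) * (\<phi> x - \<phi> (z + x))\<^sup>2 \<partial>lborel)"
      by (rule integral_translate(1)[symmetric]) measurable
    also have "\<dots> \<le> (\<integral>z. indicator S z * (\<phi> (x + z) - \<phi> x)\<^sup>2 \<partial>lborel)"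
    proof (rule Bochner_Integration.integral_mono')
      show "integrable lborel (\<lambda>z. indicator S z * (\<phi> (x + z) - \<phi> x)\<^sup>2)"
        by (rule integrable_on_finite_set[where B="(2 * B)\<^sup>2"]) (use bd2 Sf in auto)
      show "indicator ?Q (z + x) * (\<phi> x - \<phi> (z + x))\<^sup>2 \<le> indicator S z * (\<phi> (x + z) - \<phi> x)\<^sup>2" for z
      proof (cases "z + x \<in> ?Q")
        case True
        have "- h \<le> z \<bullet> b \<and> z \<bullet> b \<le> h" if "b \<in> Basis" for b
          using abs_le_D1[OF dyadic_cell_diff[OF True that]] abs_le_D2[OF dyadic_cell_diff[OF True that]]
          unfolding h_def add_diff_cancel_right' by (intro conjI) linarith+
        then have "z \<in> S" by (auto simp: S_def mem_box)
        then show ?thesis by (simp add: power2_commute[of "\<phi> x"] add.commute indicator_def)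
      qed simp
    qed auto
    finally show ?thesis by (simp add: mult_left_mono)
  qed
  have [measurable]: "dyadic_avg k \<phi> \<in> borel_measurable borel" by measurable
  have "(\<integral>\<^sup>+x. ennreal ((\<phi> x - dyadic_avg k \<phi> x)\<^sup>2) \<partial>lborel)
     \<le> (\<integral>\<^sup>+x. ennreal ((2 ^ k) ^ ?n) * (\<integral>\<^sup>+z. ennreal (indicator S z * (\<phi> (x + z) - \<phi> x)\<^sup>2) \<partial>lborel) \<partial>lborel)"
  proof (rule nn_integral_mono)
    fix x
    have "integrable lborel (\<lambda>z. indicator S z * (\<phi> (x + z) - \<phi> x)\<^sup>2)"
      by (rule integrable_on_finite_set[where B="(2 * B)\<^sup>2"]) (use bd2 Sf in auto)
    then show "ennreal ((\<phi> x - dyadic_avg k \<phi> x)\<^sup>2)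
      \<le> ennreal ((2 ^ k) ^ ?n) * (\<integral>\<^sup>+z. ennreal (indicator S z * (\<phi> (x + z) - \<phi> x)\<^sup>2) \<partial>lborel)"
      using pw[of x] by (subst nn_integral_eq_integral) (auto simp flip: ennreal_mult'' intro!: ennreal_leI)
  qed
  also have "\<dots> = ennreal ((2 ^ k) ^ ?n) * (\<integral>\<^sup>+x. \<integral>\<^sup>+z. ennreal (indicator S z * (\<phi> (x + z) - \<phi> x)\<^sup>2) \<partial>lborel \<partial>lborel)"
    by (rule nn_integral_cmult) measurable
  also have "(\<integral>\<^sup>+x. \<integral>\<^sup>+z. ennreal (indicator S z * (\<phi> (x + z) - \<phi> x)\<^sup>2) \<partial>lborel \<partial>lborel)
      = (\<integral>\<^sup>+z. \<integral>\<^sup>+x. ennreal (indicator S z * (\<phi> (x + z) - \<phi> x)\<^sup>2) \<partial>lborel \<partial>lborel)"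
    by (rule lborel_pair.Fubini'[symmetric]) measurable
  also have "\<dots> \<le> (\<integral>\<^sup>+z. ennreal ((real ?n * h)\<^sup>2 * D) * indicator S z \<partial>lborel)"
  proof (rule nn_integral_mono)
    fix z :: 'a
    show "(\<integral>\<^sup>+x. ennreal (indicator S z * (\<phi> (x + z) - \<phi> x)\<^sup>2) \<partial>lborel) \<le> ennreal ((real ?n * h)\<^sup>2 * D) * indicator S z"
    proof (cases "z \<in> S")
      case True
      have "norm z \<le> (\<Sum>b\<in>Basis. \<bar>z \<bullet> b\<bar>)" by (rule norm_le_l1)
      also have "\<dots> \<le> (\<Sum>b\<in>(Basis::'a set). h)"
        using True by (intro sum_mono) (auto simp: S_def mem_box abs_le_iff)
      finally have nz: "norm z \<le> real ?n * h" by simp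
      have "(\<integral>\<^sup>+x. ennreal (indicator S z * (\<phi> (x + z) - \<phi> x)\<^sup>2) \<partial>lborel) = ennreal (\<integral>x. (\<phi> (x + z) - \<phi> x)\<^sup>2 \<partial>lborel)"
        using True test_fun_translation_le(1)[OF \<phi>] by (subst nn_integral_eq_integral) auto
      also have "\<dots> \<le> ennreal ((real ?n * h)\<^sup>2 * D)"
        using test_fun_translation_le(2)[OF \<phi>, of z] mult_right_mono[OF power_mono[OF nz norm_ge_zero, of 2] D0]
        by (intro ennreal_leI) (simp add: D_def)
      finally show ?thesis using True by simp
    qed simp
  qed
  also have "\<dots> = ennreal ((real ?n * h)\<^sup>2 * D) * ennreal ((2 * h) ^ ?n)"
    by (simp add: nn_integral_cmult_indicator Sf)
  also have "ennreal ((2 ^ k) ^ ?n) * (ennreal ((real ?n * h)\<^sup>2 * D) * ennreal ((2 * h) ^ ?n))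
      = ennreal ((2 ^ k) ^ ?n * ((real ?n * h)\<^sup>2 * D * (2 * h) ^ ?n))"
    using D0 h by (simp add: ennreal_mult')
  also have "(2 ^ k) ^ ?n * ((real ?n * h)\<^sup>2 * D * (2 * h) ^ ?n) = C / 4 ^ k * D"
  proof -
    have "(2 ^ k) ^ ?n * ((real ?n * h)\<^sup>2 * D * (2 * h) ^ ?n)
        = ((2 ^ k) ^ ?n * h ^ ?n) * (2 ^ ?n * (real ?n)\<^sup>2 * h\<^sup>2 * D)"
      by (simp add: power_mult_distrib)
    also have "h\<^sup>2 = 1 / 4 ^ k" by (simp add: h_def power_one_over power2_eq_square flip: power_mult_distrib)
    finally show ?thesis by (simp add: hk C_def)
  qed
  finally have *: "(\<integral>\<^sup>+x. ennreal ((\<phi> x - dyadic_avg k \<phi> x)\<^sup>2) \<partial>lborel) \<le> ennreal (C / 4 ^ k * D)"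
    by (simp add: mult_left_mono)
  then show i: "integrable lborel (\<lambda>x. (\<phi> x - dyadic_avg k \<phi> x)\<^sup>2)"
    by (intro integrableI_nonneg) (auto simp: le_less_trans[OF _ ennreal_less_top])
  show "(\<integral>x. (\<phi> x - dyadic_avg k \<phi> x)\<^sup>2 \<partial>lborel) \<le> C / 4 ^ k * D"
    using * D0 by (subst (asm) nn_integral_eq_integral[OF i]) (auto simp: C_def)
qed

section \<open>Inequalities of Poincare and Sobolev, and compactness\<close>

lemma integral_diff_square_le:
  fixes s t :: "'a \<Rightarrow> real"
  assumes [measurable]: "s \<in> borel_measurable M" "t \<in> borel_measurable M"
    and "integrable M (\<lambda>x. (s x)\<^sup>2)" "integrable M (\<lambda>x. (t x)\<^sup>2)"
  shows "integrable M (\<lambda>x. (s x - t x)\<^sup>2)"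
    and "(\<integral>x. (s x - t x)\<^sup>2 \<partial>M) \<le> 2 * (\<integral>x. (s x)\<^sup>2 \<partial>M) + 2 * (\<integral>x. (t x)\<^sup>2 \<partial>M)"
proof -
  have le: "(s x - t x)\<^sup>2 \<le> 2 * (s x)\<^sup>2 + 2 * (t x)\<^sup>2" for x
    using zero_le_power2[of "s x + t x"] by (simp add: power2_sum power2_diff)
  have i: "integrable M (\<lambda>x. 2 * (s x)\<^sup>2 + 2 * (t x)\<^sup>2)" using assms by auto
  show i2: "integrable M (\<lambda>x. (s x - t x)\<^sup>2)"
    by (rule Bochner_Integration.integrable_bound[OF i]) (use le in auto)
  have "(\<integral>x. (s x - t x)\<^sup>2 \<partial>M) \<le> (\<integral>x. 2 * (s x)\<^sup>2 + 2 * (t x)\<^sup>2 \<partial>M)"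
    using le by (intro integral_mono i i2)
  then show "(\<integral>x. (s x - t x)\<^sup>2 \<partial>M) \<le> 2 * (\<integral>x. (s x)\<^sup>2 \<partial>M) + 2 * (\<integral>x. (t x)\<^sup>2 \<partial>M)"
    using assms by simp
qed

lemma powr_add_le_weighted:
  fixes x y q \<sigma> :: real
  assumes "0 \<le> x" "0 \<le> y" "1 \<le> q" "0 < \<sigma>" "\<sigma> < 1"
  shows "(x + y) powr q \<le> (1 - \<sigma>) powr (1 - q) * x powr q + \<sigma> powr (1 - q) * y powr q"
proof -
  have ge1: "1 \<le> s powr (1 - q)" if "0 < s" "s < 1" for s
    using that assms(3) powr_mono_both'[of 0 "q - 1" s 1]
    by (metis add.left_neutral ge_one_powr_ge_zero less_eq_real_def linorder_not_le
        minus_diff_eq neg_le_0_iff_le diff_ge_0_iff_ge one_le_inverse powr_minus inverse_powr inverse_inverse_eq)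
  consider "x = 0" | "y = 0" | "x > 0" "y > 0" using assms by linarith
  then show ?thesis
  proof cases
    case 1
    then show ?thesis using ge1[of \<sigma>] assms mult_right_mono[of 1 "\<sigma> powr (1 - q)" "y powr q"] by simp
  next
    case 2
    then show ?thesis using ge1[of "1 - \<sigma>"] assms mult_right_mono[of 1 "(1 - \<sigma>) powr (1 - q)" "x powr q"] by simp
  next
    case 3
    have scale: "s * (r / s) powr q = s powr (1 - q) * r powr q" if "0 < s" "0 < r" for s r
      using that by (simp add: powr_divide powr_diff)
    have "((1 - \<sigma>) *\<^sub>R (x / (1 - \<sigma>)) + \<sigma> *\<^sub>R (y / \<sigma>)) powr q
        \<le> (1 - \<sigma>) * (x / (1 - \<sigma>)) powr q + \<sigma> * (y / \<sigma>) powr q"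
      by (rule convex_onD[OF powr_convex[OF assms(3)]]) (use 3 assms in auto)
    then show ?thesis using 3 assms by (simp add: scale)
  qed
qed

text \<open>Jensen's inequality for the geometric weights \<open>(1 - \<sigma>) \<sigma>\<^sup>k\<close>.\<close>

lemma powr_sum_le_geometric_weights:
  fixes a :: "nat \<Rightarrow> real"
  assumes "1 \<le> q" "0 < \<sigma>" "\<sigma> < 1"
  shows "\<bar>\<Sum>k<K. a k\<bar> powr q \<le> (\<Sum>k<K. (1 - \<sigma>) powr (1 - q) * (\<sigma> powr (1 - q)) ^ k * \<bar>a k\<bar> powr q)"
proof (induction K arbitrary: a)
  case 0
  then show ?case by simp
next
  case (Suc K)
  have "\<bar>\<Sum>k<Suc K. a k\<bar> powr q \<le> (\<bar>a 0\<bar> + \<bar>\<Sum>k<K. a (Suc k)\<bar>) powr q"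
    using assms by (intro powr_mono2) (auto simp: sum.lessThan_Suc_shift simp del: sum.lessThan_Suc)
  also have "\<dots> \<le> (1 - \<sigma>) powr (1 - q) * \<bar>a 0\<bar> powr q + \<sigma> powr (1 - q) * \<bar>\<Sum>k<K. a (Suc k)\<bar> powr q"
    using assms by (intro powr_add_le_weighted) auto
  also have "\<dots> \<le> (1 - \<sigma>) powr (1 - q) * \<bar>a 0\<bar> powr q + \<sigma> powr (1 - q) *
      (\<Sum>k<K. (1 - \<sigma>) powr (1 - q) * (\<sigma> powr (1 - q)) ^ k * \<bar>a (Suc k)\<bar> powr q)"
    using Suc[of "\<lambda>k. a (Suc k)"] by (intro add_left_mono mult_left_mono) auto
  also have "\<dots> = (\<Sum>k<Suc K. (1 - \<sigma>) powr (1 - q) * (\<sigma> powr (1 - q)) ^ k * \<bar>a k\<bar> powr q)"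
    by (simp add: sum.lessThan_Suc_shift sum_distrib_left algebra_simps del: sum.lessThan_Suc)
  finally show ?case .
qed

context bounded_open_set
begin

lemma l2norm_test_fun: "\<phi> \<in> test_fun \<Omega> \<Longrightarrow> (normH \<phi>)\<^sup>2 = (\<integral>x. (\<phi> x)\<^sup>2 \<partial>lborel)"
  unfolding l2norm_square using integral_domain(1)[of "\<lambda>x. (\<phi> x)\<^sup>2"] test_fun_borel[of \<phi> \<Omega>] test_fun_outside[of \<phi> \<Omega>]
  by simp

lemma normV_test_fun:
  assumes "\<phi> \<in> test_fun \<Omega>"
  shows "(normV \<Omega> \<phi>)\<^sup>2 = (\<integral>x. (norm (classical_grad \<phi> x))\<^sup>2 \<partial>lborel)"
proof -
  have "normV \<Omega> \<phi> = normH (classical_grad \<phi>)"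
    unfolding normV_def using assms
    by (intro l2norm_cong_AE[OF _ _ wgrad_test_fun] wgrad_L2 test_fun_H1 classical_grad_L2)
  moreover obtain K where "K \<subseteq> \<Omega>" "\<And>x. x \<notin> K \<Longrightarrow> classical_grad \<phi> x = 0"
    using classical_grad_compact_support[OF assms] by metis
  ultimately show ?thesis
    unfolding l2norm_square using classical_grad_continuous[OF assms]
    by (subst integral_domain(1)[symmetric])
      (auto simp: l2norm_square intro!: borel_measurable_continuous_onI continuous_intros)
qed

text \<open>Poincare's inequality: a translation that moves the domain off itself changes a test
  function by twice its mean square.\<close>

lemma Poincare_test_fun:
  obtains P where "P > 0" "\<And>\<phi>. \<phi> \<in> test_fun \<Omega> \<Longrightarrow> (normH \<phi>)\<^sup>2 \<le> P * (normV \<Omega> \<phi>)\<^sup>2"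
proof -
  obtain R where R: "R > 0" "\<And>x. x \<in> \<Omega> \<Longrightarrow> norm x \<le> R"
    using bounded_domain bounded_pos by metis
  obtain b :: 'a where b: "b \<in> Basis" using nonempty_Basis by blast
  define e where "e = (3 * R) *\<^sub>R b"
  have ne: "norm e = 3 * R" using b R by (simp add: e_def)
  have "(normH \<phi>)\<^sup>2 \<le> (9 * R\<^sup>2) * (normV \<Omega> \<phi>)\<^sup>2" if \<phi>: "\<phi> \<in> test_fun \<Omega>" for \<phi>
  proof -
    have [measurable]: "\<phi> \<in> borel_measurable borel" by (rule test_fun_borel[OF \<phi>])
    have eq: "(\<phi> (x + e) - \<phi> x)\<^sup>2 = (\<phi> (x + e))\<^sup>2 + (\<phi> x)\<^sup>2" for x
    proof -
      have "\<not> (x \<in> \<Omega> \<and> x + e \<in> \<Omega>)"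
      proof
        assume "x \<in> \<Omega> \<and> x + e \<in> \<Omega>"
        then have "norm x \<le> R" "norm (x + e) \<le> R" using R(2) by auto
        then have "norm e \<le> 2 * R" using norm_triangle_ineq4[of "x + e" x] by simp
        then show False using ne R(1) by simp
      qed
      then have "\<phi> x = 0 \<or> \<phi> (x + e) = 0" using test_fun_outside[OF \<phi>] by blast
      then show ?thesis by auto
    qed
    have i: "integrable lborel (\<lambda>x. (\<phi> x)\<^sup>2)"
      using test_fun_integrable[OF test_fun_mult[OF \<phi> \<phi>]] by (simp add: power2_eq_square)
    have i': "integrable lborel (\<lambda>x. (\<phi> (x + e))\<^sup>2)"
      using integral_translate(2)[of "\<lambda>x. (\<phi> x)\<^sup>2" e] i by simp
    have "(\<integral>x. (\<phi> (x + e) - \<phi> x)\<^sup>2 \<partial>lborel) = 2 * (\<integral>x. (\<phi> x)\<^sup>2 \<partial>lborel)"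
      unfolding eq using i i' integral_translate(1)[of "\<lambda>x. (\<phi> x)\<^sup>2" e] by simp
    then have "2 * (normH \<phi>)\<^sup>2 \<le> (9 * R\<^sup>2) * (normV \<Omega> \<phi>)\<^sup>2"
      using test_fun_translation_le(2)[OF \<phi>, of e] ne
      by (simp add: l2norm_test_fun[OF \<phi>] normV_test_fun[OF \<phi>] power_mult_distrib)
    then show ?thesis using zero_le_power2[of "normH \<phi>"] by linarith
  qed
  then show ?thesis using that[of "9 * R\<^sup>2"] R(1) by simp
qed

lemma dyadic_avg_tendsto:
  assumes "\<phi> \<in> test_fun \<Omega>"
  shows "(\<lambda>k. dyadic_avg k \<phi> x) \<longlonglongrightarrow> \<phi> x"
proof -
  obtain L where L: "0 \<le> L" "\<And>x y. \<bar>\<phi> y - \<phi> x\<bar> \<le> L * norm (y - x)"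
    using test_fun_Lipschitz[OF assms] by metis
  obtain B where B: "\<And>x. \<bar>\<phi> x\<bar> \<le> B" using test_fun_bounded[OF assms] by blast
  have [measurable]: "\<phi> \<in> borel_measurable borel" by (rule test_fun_borel[OF assms])
  let ?n = "DIM('a)"
  have le: "\<bar>dyadic_avg k \<phi> x - \<phi> x\<bar> \<le> L * real ?n * (1/2) ^ k" for k
  proof -
    let ?Q = "dyadic_cell k x" and ?c = "L * real ?n * (1/2) ^ k"
    have bd: "\<bar>\<phi> y - \<phi> x\<bar> \<le> 2 * B" for y using B[of x] B[of y] by linarith
    have i1: "integrable lborel (\<lambda>y. indicator ?Q y * \<phi> y)"
      by (rule integrable_dyadic_cell[OF _ B]) measurable
    have i2: "integrable lborel (\<lambda>y. indicator ?Q y * c)" for c :: real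
      by (rule integrable_dyadic_cell[of _ "\<bar>c\<bar>"]) auto
    have i3: "integrable lborel (\<lambda>y. indicator ?Q y * (\<phi> y - \<phi> x))"
      by (rule integrable_dyadic_cell[OF _ bd]) measurable
    have "dyadic_avg k \<phi> x - \<phi> x = (2 ^ k) ^ ?n * ((\<integral>y. indicator ?Q y * \<phi> y \<partial>lborel) - (\<integral>y. indicator ?Q y * \<phi> x \<partial>lborel))"
      using integral_indicator_dyadic_cell[of k x "\<phi> x"] by (simp add: dyadic_avg_def right_diff_distrib)
    also have "\<dots> = (2 ^ k) ^ ?n * (\<integral>y. indicator ?Q y * (\<phi> y - \<phi> x) \<partial>lborel)"
      using i1 i2[of "\<phi> x"] by (simp add: right_diff_distrib)
    finally have "\<bar>dyadic_avg k \<phi> x - \<phi> x\<bar> = (2 ^ k) ^ ?n * \<bar>\<integral>y. indicator ?Q y * (\<phi> y - \<phi> x) \<partial>lborel\<bar>"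
      by (simp add: abs_mult)
    also have "\<dots> \<le> (2 ^ k) ^ ?n * (\<integral>y. indicator ?Q y * ?c \<partial>lborel)"
    proof (rule mult_left_mono, rule integral_abs_bound[THEN order_trans], rule Bochner_Integration.integral_mono'[OF i2])
      fix y
      show "\<bar>indicator ?Q y * (\<phi> y - \<phi> x)\<bar> \<le> indicator ?Q y * ?c"
      proof (cases "y \<in> ?Q")
        case True
        have "norm (y - x) \<le> (\<Sum>b\<in>Basis. \<bar>(y - x) \<bullet> b\<bar>)" by (rule norm_le_l1)
        also have "\<dots> \<le> (\<Sum>b\<in>(Basis::'a set). (1/2) ^ k)"
          using dyadic_cell_diff[OF True] by (intro sum_mono) (simp add: power_one_over)
        finally have "L * norm (y - x) \<le> L * (real ?n * (1/2) ^ k)" using L(1) by (intro mult_left_mono) auto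
        then show ?thesis using L(2)[of y x] True by (simp add: abs_mult)
      qed simp
    qed (use L(1) in auto)
    also have "\<dots> = ?c" by (rule integral_indicator_dyadic_cell)
    finally show ?thesis .
  qed
  have lim: "(\<lambda>k. L * real ?n * (1/2) ^ k) \<longlonglongrightarrow> 0"
    by (intro tendsto_mult_right_zero LIMSEQ_realpow_zero) auto
  have "(\<lambda>k. dyadic_avg k \<phi> x - \<phi> x) \<longlonglongrightarrow> 0"
    by (rule Lim_null_comparison[OF _ lim]) (use le in auto)
  then show ?thesis by (simp add: LIM_zero_iff)
qed

text \<open>The subcritical Sobolev inequality. The \<open>k\<close>-th dyadic increment \<open>a\<^sub>k\<close> of \<open>\<phi>\<close> satisfies
  \<open>\<parallel>a\<^sub>k\<parallel>\<^sub>2 \<le> c 2\<^sup>-\<^sup>k \<parallel>\<nabla>\<phi>\<parallel>\<^sub>2\<close>; being constant on cells of side \<open>2\<^sup>-\<^sup>k\<close> it has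
  \<open>\<parallel>a\<^sub>k\<parallel>\<^sub>\<infinity> \<le> 2\<^sup>k\<^sup>n\<^sup>/\<^sup>2 \<parallel>a\<^sub>k\<parallel>\<^sub>2\<close>. Interpolation makes \<open>\<parallel>a\<^sub>k\<parallel>\<^sub>q\<close> decay geometrically below the critical
  exponent.\<close>

lemma Sobolev_test_fun:
  assumes q: "2 < q" "(real DIM('a) - 2) * (q - 2) < 4"
  obtains S where "S \<ge> 0"
    "\<And>\<phi>. \<phi> \<in> test_fun \<Omega> \<Longrightarrow> integrable lborel (\<lambda>x. \<bar>\<phi> x\<bar> powr q)"
    "\<And>\<phi>. \<phi> \<in> test_fun \<Omega> \<Longrightarrow> (\<integral>x. \<bar>\<phi> x\<bar> powr q \<partial>lborel) \<le> S * normV \<Omega> \<phi> powr q"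
proof -
  let ?n = "DIM('a)"
  obtain P where P: "P > 0" "\<And>\<phi>. \<phi> \<in> test_fun \<Omega> \<Longrightarrow> (normH \<phi>)\<^sup>2 \<le> P * (normV \<Omega> \<phi>)\<^sup>2"
    using Poincare_test_fun by blast
  define C :: real where "C = 2 ^ ?n * (real ?n)\<^sup>2"
  have C: "C > 0" by (simp add: C_def)
  define M where "M = 2 * P + 16 * C"
  have M: "M > 0" using C P by (simp add: M_def)
  \<comment> \<open>The ratio at which the interpolated norms decay; it is below 1 for subcritical \<open>q\<close>.\<close>
  define \<rho> where "\<rho> = (2 ^ ?n / 4) powr ((q - 2) / 2) / 4"
  have \<rho>: "0 < \<rho>" "\<rho> < 1"
  proof -
    show "0 < \<rho>" by (simp add: \<rho>_def)
    have "(2 ^ ?n / 4 :: real) = 2 powr (real ?n - 2)" by (simp add: powr_diff powr_realpow)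
    then have "(2 ^ ?n / 4) powr ((q - 2) / 2) = 2 powr ((real ?n - 2) * (q - 2) / 2)"
      by (simp add: powr_powr)
    also have "\<dots> < 2 powr 2" using q by (intro powr_less_mono) auto
    finally show "\<rho> < 1" by (simp add: \<rho>_def)
  qed
  \<comment> \<open>With these weights Jensen's inequality costs a factor \<open>\<rho>\<^sup>-\<^sup>k\<^sup>/\<^sup>2\<close>, half of the available decay.\<close>
  define \<sigma> where "\<sigma> = \<rho> powr (1 / (2 * (q - 1)))"
  have \<sigma>: "0 < \<sigma>" "\<sigma> < 1"
    using \<rho> q powr_less_mono2[of "1 / (2 * (q - 1))" \<rho> 1] by (auto simp: \<sigma>_def)
  have \<sigma>\<rho>: "\<sigma> powr (1 - q) * \<rho> = sqrt \<rho>"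
  proof -
    have "1 / (2 * (q - 1)) * (1 - q) = - (1 / 2)" using q by (simp add: field_simps)
    then have "\<sigma> powr (1 - q) = \<rho> powr (- (1 / 2))" unfolding \<sigma>_def powr_powr by simp
    then have "\<sigma> powr (1 - q) * \<rho> = \<rho> powr (- (1 / 2)) * \<rho> powr 1" using \<rho> by simp
    also have "\<dots> = \<rho> powr (- (1 / 2) + 1)" by (rule powr_add[symmetric])
    also have "- (1 / 2) + 1 = (1 / 2 :: real)" by simp
    finally show ?thesis using \<rho> by (simp add: powr_half_sqrt)
  qed
  define S where "S = (1 - \<sigma>) powr (1 - q) * (1 / (1 - sqrt \<rho>)) * M powr (q / 2)"
  have S0: "S \<ge> 0" using \<rho> by (simp add: S_def)
  have main: "integrable lborel (\<lambda>x. \<bar>\<phi> x\<bar> powr q) \<and> (\<integral>x. \<bar>\<phi> x\<bar> powr q \<partial>lborel) \<le> S * normV \<Omega> \<phi> powr q"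
    if \<phi>: "\<phi> \<in> test_fun \<Omega>" for \<phi>
  proof -
    define D where "D = (normV \<Omega> \<phi>)\<^sup>2"
    have D0: "D \<ge> 0" by (simp add: D_def)
    have [measurable]: "\<phi> \<in> borel_measurable borel" by (rule test_fun_borel[OF \<phi>])
    have err: "integrable lborel (\<lambda>x. (\<phi> x - dyadic_avg k \<phi> x)\<^sup>2)"
      "(\<integral>x. (\<phi> x - dyadic_avg k \<phi> x)\<^sup>2 \<partial>lborel) \<le> C / 4 ^ k * D" for k
      using dyadic_avg_error[OF \<phi>, of k] by (simp_all add: C_def D_def normV_test_fun[OF \<phi>])
    have i\<phi>: "integrable lborel (\<lambda>x. (\<phi> x)\<^sup>2)" "(\<integral>x. (\<phi> x)\<^sup>2 \<partial>lborel) \<le> P * D"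
      using test_fun_integrable[OF test_fun_mult[OF \<phi> \<phi>]] P(2)[OF \<phi>]
      by (simp_all add: power2_eq_square D_def l2norm_test_fun[OF \<phi>, unfolded power2_eq_square])
    define a where "a k x = (case k of 0 \<Rightarrow> dyadic_avg 0 \<phi> x | Suc j \<Rightarrow> dyadic_avg (Suc j) \<phi> x - dyadic_avg j \<phi> x)" for k x
    have [measurable]: "a k \<in> borel_measurable borel" for k
      unfolding a_def by (cases k) (simp_all, measurable)
    have a2: "integrable lborel (\<lambda>x. (a k x)\<^sup>2) \<and> (\<integral>x. (a k x)\<^sup>2 \<partial>lborel) \<le> M / 4 ^ k * D" for k
    proof (cases k)
      case 0
      have eq: "a 0 x = \<phi> x - (\<phi> x - dyadic_avg 0 \<phi> x)" for x by (simp add: a_def)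
      have "(\<integral>x. (a 0 x)\<^sup>2 \<partial>lborel) \<le> 2 * (\<integral>x. (\<phi> x)\<^sup>2 \<partial>lborel) + 2 * (\<integral>x. (\<phi> x - dyadic_avg 0 \<phi> x)\<^sup>2 \<partial>lborel)"
        unfolding eq by (rule integral_diff_square_le(2)) (use i\<phi> err in auto)
      also have "\<dots> \<le> 2 * (P * D) + 2 * (C * D)" using i\<phi>(2) err(2)[of 0] by simp
      also have "\<dots> \<le> M * D" using C D0 by (simp add: M_def algebra_simps)
      finally show ?thesis
        using 0 integral_diff_square_le(1)[of \<phi> lborel "\<lambda>x. \<phi> x - dyadic_avg 0 \<phi> x"] i\<phi> err[of 0] by (simp add: eq)
    next
      case (Suc j)
      have eq: "a k x = (\<phi> x - dyadic_avg j \<phi> x) - (\<phi> x - dyadic_avg (Suc j) \<phi> x)" for x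
        using Suc by (simp add: a_def)
      have "(\<integral>x. (a k x)\<^sup>2 \<partial>lborel) \<le> 2 * (\<integral>x. (\<phi> x - dyadic_avg j \<phi> x)\<^sup>2 \<partial>lborel)
          + 2 * (\<integral>x. (\<phi> x - dyadic_avg (Suc j) \<phi> x)\<^sup>2 \<partial>lborel)"
        unfolding eq by (rule integral_diff_square_le(2)) (use err in auto)
      also have "\<dots> \<le> 2 * (C / 4 ^ j * D) + 2 * (C / 4 ^ Suc j * D)" using err(2)[of j] err(2)[of "Suc j"] by simp
      also have "\<dots> = (10 * C) / 4 ^ k * D" using Suc by (simp add: field_simps)
      also have "\<dots> \<le> M / 4 ^ k * D" using C P D0 by (intro mult_right_mono divide_right_mono) (auto simp: M_def)
      finally show ?thesis
        using integral_diff_square_le(1)[of "\<lambda>x. \<phi> x - dyadic_avg j \<phi> x" lborel "\<lambda>x. \<phi> x - dyadic_avg (Suc j) \<phi> x"] err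
        by (simp add: eq)
    qed
    have const: "a k y = a k x" if "y \<in> dyadic_cell k x" for k x y
      using that dyadic_avg_cell[of y k x \<phi>] dyadic_cell_Suc_subset[of "k - 1" x] dyadic_avg_cell[of y "k - 1" x \<phi>]
      by (cases k) (auto simp: a_def)
    have sup: "(a k x)\<^sup>2 \<le> (2 ^ ?n / 4) ^ k * (M * D)" for k x
    proof -
      have "(a k x)\<^sup>2 = (2 ^ k) ^ ?n * (\<integral>y. indicator (dyadic_cell k x) y * (a k x)\<^sup>2 \<partial>lborel)"
        by (rule integral_indicator_dyadic_cell[symmetric])
      also have "(\<integral>y. indicator (dyadic_cell k x) y * (a k x)\<^sup>2 \<partial>lborel) \<le> (\<integral>y. (a k y)\<^sup>2 \<partial>lborel)"
        using a2 const by (intro Bochner_Integration.integral_mono') (auto simp: indicator_def)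
      also have "\<dots> \<le> M / 4 ^ k * D" using a2 by blast
      finally have "(a k x)\<^sup>2 \<le> (2 ^ k) ^ ?n * (M / 4 ^ k * D)" by (simp add: mult_left_mono)
      then show ?thesis by (simp add: power_divide power_mult[symmetric] mult.commute)
    qed
    have aq: "integrable lborel (\<lambda>x. \<bar>a k x\<bar> powr q) \<and> (\<integral>x. \<bar>a k x\<bar> powr q \<partial>lborel) \<le> \<rho> ^ k * (M * D) powr (q / 2)" for k
    proof -
      let ?s = "((2 ^ ?n / 4) ^ k * (M * D)) powr ((q - 2) / 2)"
      have pw: "\<bar>a k x\<bar> powr q \<le> ?s * (a k x)\<^sup>2" for x
      proof (cases "a k x = 0")
        case False
        have "\<bar>a k x\<bar> powr q = \<bar>a k x\<bar> powr (q - 2) * \<bar>a k x\<bar> powr 2"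
          using powr_add[of "\<bar>a k x\<bar>" "q - 2" 2] by simp
        also have "\<bar>a k x\<bar> powr 2 = (a k x)\<^sup>2" using False by simp
        also have "\<bar>a k x\<bar> powr (q - 2) = ((a k x)\<^sup>2) powr ((q - 2) / 2)"
        proof -
          have "((a k x)\<^sup>2) powr ((q - 2) / 2) = (\<bar>a k x\<bar> powr 2) powr ((q - 2) / 2)" using False by simp
          moreover have "2 * ((q - 2) / 2) = q - 2" by simp
          ultimately show ?thesis unfolding powr_powr by metis
        qed
        also have "\<dots> \<le> ?s" using sup[of k x] q by (intro powr_mono2) auto
        finally show ?thesis by (simp add: mult_right_mono)
      qed (use q in simp)
      have i: "integrable lborel (\<lambda>x. \<bar>a k x\<bar> powr q)"
        by (rule Bochner_Integration.integrable_bound[of _ "\<lambda>x. ?s * (a k x)\<^sup>2"]) (use a2 pw in auto)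
      have "(\<integral>x. \<bar>a k x\<bar> powr q \<partial>lborel) \<le> (\<integral>x. ?s * (a k x)\<^sup>2 \<partial>lborel)"
        using a2 pw by (intro integral_mono i) auto
      also have "\<dots> \<le> ?s * (M / 4 ^ k * D)" 
        unfolding integral_mult_right_zero by (rule mult_left_mono) (use a2[of k] in auto)
      also have "\<dots> = \<rho> ^ k * ((M * D) powr ((q - 2) / 2) * (M * D))"
      proof -
        have "?s = ((2 ^ ?n / 4) powr ((q - 2) / 2)) ^ k * (M * D) powr ((q - 2) / 2)"
          using M D0 by (simp add: powr_mult powr_powr mult.commute flip: powr_realpow)
        then show ?thesis by (simp add: \<rho>_def power_divide field_simps)
      qed
      also have "(M * D) powr ((q - 2) / 2) * (M * D) = (M * D) powr (q / 2)"
      proof (cases "M * D = 0")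
        case False
        then have pos: "M * D > 0" using M D0 by simp
        have "(M * D) powr ((q - 2) / 2) * (M * D) = (M * D) powr ((q - 2) / 2) * (M * D) powr 1"
          using pos by simp
        also have "\<dots> = (M * D) powr ((q - 2) / 2 + 1)" by (rule powr_add[symmetric])
        also have "(q - 2) / 2 + 1 = q / 2" by (simp add: field_simps)
        finally show ?thesis .
      qed auto
      finally show ?thesis using i by simp
    qed
    have tele: "(\<Sum>k<Suc K. a k x) = dyadic_avg K \<phi> x" for K x
      by (induction K) (simp_all add: a_def)
    have avgq: "integrable lborel (\<lambda>x. \<bar>dyadic_avg K \<phi> x\<bar> powr q) \<and>
       (\<integral>x. \<bar>dyadic_avg K \<phi> x\<bar> powr q \<partial>lborel) \<le> S * D powr (q / 2)" for K
    proof -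
      let ?c = "\<lambda>k. (1 - \<sigma>) powr (1 - q) * (\<sigma> powr (1 - q)) ^ k"
      have pw: "\<bar>dyadic_avg K \<phi> x\<bar> powr q \<le> (\<Sum>k<Suc K. ?c k * \<bar>a k x\<bar> powr q)" for x
        using powr_sum_le_geometric_weights[of q \<sigma> "\<lambda>k. a k x" "Suc K"] q \<sigma> unfolding tele by simp
      have iS: "integrable lborel (\<lambda>x. \<Sum>k<Suc K. ?c k * \<bar>a k x\<bar> powr q)"
        using aq by (intro Bochner_Integration.integrable_sum integrable_mult_right) auto
      have i: "integrable lborel (\<lambda>x. \<bar>dyadic_avg K \<phi> x\<bar> powr q)"
        by (rule Bochner_Integration.integrable_bound[OF iS])
          (use pw in \<open>auto intro: order_trans[OF pw abs_ge_self] simp del: sum.lessThan_Suc\<close>)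
      have "(\<integral>x. \<bar>dyadic_avg K \<phi> x\<bar> powr q \<partial>lborel) \<le> (\<integral>x. (\<Sum>k<Suc K. ?c k * \<bar>a k x\<bar> powr q) \<partial>lborel)"
        by (intro integral_mono i iS pw)
      also have "\<dots> = (\<Sum>k<Suc K. ?c k * (\<integral>x. \<bar>a k x\<bar> powr q \<partial>lborel))"
        using aq by (subst Bochner_Integration.integral_sum) (auto intro!: integrable_mult_right simp del: sum.lessThan_Suc)
      also have "\<dots> \<le> (\<Sum>k<Suc K. ?c k * (\<rho> ^ k * (M * D) powr (q / 2)))"
        using aq by (intro sum_mono mult_left_mono) auto
      also have "\<dots> = (1 - \<sigma>) powr (1 - q) * (M * D) powr (q / 2) * (\<Sum>k<Suc K. sqrt \<rho> ^ k)"
        unfolding \<sigma>\<rho>[symmetric] sum_distrib_left power_mult_distrib by (intro sum.cong) (auto simp: algebra_simps)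
      also have "\<dots> \<le> (1 - \<sigma>) powr (1 - q) * (M * D) powr (q / 2) * (1 / (1 - sqrt \<rho>))"
      proof (intro mult_left_mono)
        have r: "0 \<le> sqrt \<rho>" "sqrt \<rho> < 1" using \<rho> by auto
        have "(\<Sum>k<Suc K. sqrt \<rho> ^ k) \<le> (\<Sum>k. sqrt \<rho> ^ k)"
          using r by (intro sum_le_suminf summable_geometric) auto
        also have "\<dots> = 1 / (1 - sqrt \<rho>)" using r by (intro suminf_geometric) auto
        finally show "(\<Sum>k<Suc K. sqrt \<rho> ^ k) \<le> 1 / (1 - sqrt \<rho>)" .
      qed auto
      also have "\<dots> = S * D powr (q / 2)" using M D0 by (simp add: S_def powr_mult)
      finally show ?thesis using i by simp
    qed
    have Dq: "D powr (q / 2) = normV \<Omega> \<phi> powr q"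
    proof (cases "normV \<Omega> \<phi> = 0")
      case False
      then have "D powr (q / 2) = (normV \<Omega> \<phi> powr 2) powr (q / 2)" by (simp add: D_def less_le)
      then show ?thesis unfolding powr_powr by simp
    qed (use q in \<open>simp add: D_def\<close>)
    have lim: "AE x in lborel. (\<lambda>K. \<bar>dyadic_avg K \<phi> x\<bar> powr q) \<longlonglongrightarrow> \<bar>\<phi> x\<bar> powr q"
      using dyadic_avg_tendsto[OF \<phi>] q by (intro AE_I2 tendsto_powr' tendsto_rabs tendsto_const) auto
    show ?thesis
      using integral_le_of_AE_tendsto[of "\<lambda>x. \<bar>\<phi> x\<bar> powr q" lborel "\<lambda>K x. \<bar>dyadic_avg K \<phi> x\<bar> powr q" "S * D powr (q / 2)"]
        avgq lim unfolding Dq by auto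
  qed
  show ?thesis using that[of S] S0 main by blast
qed

end

context bounded_open_set
begin

lemma H01_approx_norms:
  assumes "z \<in> H01 \<Omega>"
  obtains \<phi> where "\<And>k::nat. \<phi> k \<in> test_fun \<Omega>" "(\<lambda>k. normH (\<lambda>x. \<phi> k x - z x)) \<longlonglongrightarrow> 0"
    "(\<lambda>k. normH (\<phi> k)) \<longlonglongrightarrow> normH z" "(\<lambda>k. normV \<Omega> (\<phi> k)) \<longlonglongrightarrow> normV \<Omega> z"
proof -
  obtain \<phi> where \<phi>: "\<And>k::nat. \<phi> k \<in> test_fun \<Omega>" "(\<lambda>k. normH (\<lambda>x. \<phi> k x - z x)) \<longlonglongrightarrow> 0"
    "(\<lambda>k. normV \<Omega> (\<lambda>x. \<phi> k x - z x)) \<longlonglongrightarrow> 0" using H01_approx[OF assms] by blast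
  have "(\<lambda>k. normV \<Omega> (\<phi> k) - normV \<Omega> z) \<longlonglongrightarrow> 0"
    by (rule Lim_null_comparison[OF _ \<phi>(3)]) (simp add: normV_abs_diff_le test_fun_H01 \<phi>(1) assms)
  then have "(\<lambda>k. normV \<Omega> (\<phi> k)) \<longlonglongrightarrow> normV \<Omega> z" by (simp add: LIM_zero_iff)
  moreover have "(\<lambda>k. normH (\<phi> k)) \<longlonglongrightarrow> normH z"
    using \<phi> assms by (intro l2norm_tendsto) (auto simp: test_fun_L2 H01_L2)
  ultimately show ?thesis using that \<phi> by blast
qed

text \<open>The inequality passes from test functions to $H_0^1$ by Fatou's lemma along a subsequence that
  converges almost everywhere.\<close>

lemma Sobolev_H01:
  assumes q: "2 < q" "(real DIM('a) - 2) * (q - 2) < 4"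
  obtains S where "S \<ge> 0"
    "\<And>z. z \<in> H01 \<Omega> \<Longrightarrow> integrable dx (\<lambda>x. \<bar>z x\<bar> powr q)"
    "\<And>z. z \<in> H01 \<Omega> \<Longrightarrow> (\<integral>x. \<bar>z x\<bar> powr q \<partial>dx) \<le> S * normV \<Omega> z powr q"
proof -
  obtain S where S: "S \<ge> 0"
    "\<And>\<phi>. \<phi> \<in> test_fun \<Omega> \<Longrightarrow> integrable lborel (\<lambda>x. \<bar>\<phi> x\<bar> powr q)"
    "\<And>\<phi>. \<phi> \<in> test_fun \<Omega> \<Longrightarrow> (\<integral>x. \<bar>\<phi> x\<bar> powr q \<partial>lborel) \<le> S * normV \<Omega> \<phi> powr q"
    using Sobolev_test_fun[OF q] by blast
  have main: "integrable dx (\<lambda>x. \<bar>z x\<bar> powr q) \<and>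
     (\<integral>x. \<bar>z x\<bar> powr q \<partial>dx) \<le> S * (normV \<Omega> z + inverse (real (Suc j))) powr q"
    if z: "z \<in> H01 \<Omega>" for z j
  proof -
    let ?B = "S * (normV \<Omega> z + inverse (real (Suc j))) powr q"
    obtain \<phi> where \<phi>: "\<And>k::nat. \<phi> k \<in> test_fun \<Omega>" "(\<lambda>k. normH (\<lambda>x. \<phi> k x - z x)) \<longlonglongrightarrow> 0"
      "(\<lambda>k. normV \<Omega> (\<phi> k)) \<longlonglongrightarrow> normV \<Omega> z" using H01_approx_norms[OF z] by blast
    obtain r where r: "strict_mono r" "AE x in dx. (\<lambda>k. \<phi> (r k) x) \<longlonglongrightarrow> z x"
      using L2_tendsto_AE_subseq[OF test_fun_L2[OF \<phi>(1)] H01_L2[OF z] \<phi>(2)] by blast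
    have "(\<lambda>k. normV \<Omega> (\<phi> (r k))) \<longlonglongrightarrow> normV \<Omega> z"
      using LIMSEQ_subseq_LIMSEQ[OF \<phi>(3) r(1)] by (simp add: o_def)
    then have "\<forall>\<^sub>F k in sequentially. normV \<Omega> (\<phi> (r k)) < normV \<Omega> z + inverse (real (Suc j))"
      by (rule order_tendstoD) simp
    then obtain K where K: "\<And>k. k \<ge> K \<Longrightarrow> normV \<Omega> (\<phi> (r k)) < normV \<Omega> z + inverse (real (Suc j))"
      unfolding eventually_sequentially by blast
    define \<psi> where "\<psi> k = \<phi> (r (k + K))" for k
    have \<psi>: "\<psi> k \<in> test_fun \<Omega>" for k using \<phi>(1) by (simp add: \<psi>_def)
    have lim: "AE x in dx. (\<lambda>k. \<bar>\<psi> k x\<bar> powr q) \<longlonglongrightarrow> \<bar>z x\<bar> powr q"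
      using r(2)
    proof eventually_elim
      case (elim x)
      then have "(\<lambda>k. \<psi> k x) \<longlonglongrightarrow> z x" unfolding \<psi>_def by (rule LIMSEQ_ignore_initial_segment)
      then show ?case using q by (intro tendsto_powr' tendsto_rabs tendsto_const) auto
    qed
    have dom: "integrable dx (\<lambda>x. \<bar>\<psi> k x\<bar> powr q)"
      "(\<integral>x. \<bar>\<psi> k x\<bar> powr q \<partial>dx) \<le> ?B" for k
    proof -
      have b: "(\<lambda>x. \<bar>\<psi> k x\<bar> powr q) \<in> borel_measurable borel"
        using test_fun_borel[OF \<psi>] by measurable
      have o: "\<bar>\<psi> k x\<bar> powr q = 0" if "x \<notin> \<Omega>" for x using test_fun_outside[OF \<psi> that] by simp
      show "integrable dx (\<lambda>x. \<bar>\<psi> k x\<bar> powr q)"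
        using integral_domain(2)[OF b o] S(2)[OF \<psi>] by simp
      have "(\<integral>x. \<bar>\<psi> k x\<bar> powr q \<partial>dx) \<le> S * normV \<Omega> (\<psi> k) powr q"
        using integral_domain(1)[OF b o] S(3)[OF \<psi>, of k] by simp
      also have "\<dots> \<le> ?B"
        using K[of "k + K"] S(1) q by (intro mult_left_mono powr_mono2) (auto simp: \<psi>_def)
      finally show "(\<integral>x. \<bar>\<psi> k x\<bar> powr q \<partial>dx) \<le> ?B" .
    qed
    have [measurable]: "z \<in> borel_measurable dx" using H01_L2[OF z] by (rule L2_measurable)
    have "(\<lambda>x. \<bar>z x\<bar> powr q) \<in> borel_measurable dx" by measurable
    from integral_le_of_AE_tendsto[OF this dom(1) _ dom(2) lim] show ?thesis by auto
  qed
  show ?thesis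
  proof (rule that[OF S(1)])
    fix z assume z: "z \<in> H01 \<Omega>"
    show "integrable dx (\<lambda>x. \<bar>z x\<bar> powr q)" using main[OF z] by blast
    have "(\<lambda>j. S * (normV \<Omega> z + inverse (real (Suc j))) powr q) \<longlonglongrightarrow> S * (normV \<Omega> z + 0) powr q"
      using q LIMSEQ_inverse_real_of_nat by (intro tendsto_mult tendsto_powr' tendsto_add tendsto_const) auto
    then show "(\<integral>x. \<bar>z x\<bar> powr q \<partial>dx) \<le> S * normV \<Omega> z powr q"
      using main[OF z] by (intro LIMSEQ_le_const) auto
  qed
qed

lemma integral_domain_le:
  fixes f :: "'a \<Rightarrow> real"
  assumes "integrable lborel f" "\<And>x. 0 \<le> f x"
  shows "integrable dx f" "(\<integral>x. f x \<partial>dx) \<le> (\<integral>x. f x \<partial>lborel)"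
proof -
  have m: "f \<in> borel_measurable lborel" using assms(1) by auto
  have i: "integrable lebesgue f" using assms(1) m by (simp add: integrable_completion)
  have i2: "integrable lebesgue (\<lambda>x. indicator \<Omega> x *\<^sub>R f x)"
    using i by (intro integrable_mult_indicator) auto
  then show "integrable dx f" by (simp add: integrable_restrict_space)
  have "(\<integral>x. f x \<partial>dx) = (\<integral>x. indicator \<Omega> x *\<^sub>R f x \<partial>lebesgue)"
    by (simp add: integral_restrict_space)
  also have "\<dots> \<le> (\<integral>x. f x \<partial>lebesgue)"
    using assms(2) by (intro integral_mono i i2) (auto simp: indicator_def)
  also have "\<dots> = (\<integral>x. f x \<partial>lborel)" using m by (simp add: integral_completion)
  finally show "(\<integral>x. f x \<partial>dx) \<le> (\<integral>x. f x \<partial>lborel)" .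
qed

lemma countable_dyadic_corners: "countable (range (dyadic_corner k :: 'a \<Rightarrow> 'a))"
proof (rule countable_subset)
  let ?F = "\<lambda>m::'a \<Rightarrow> int. \<Sum>b\<in>Basis. (real_of_int (m b) / 2 ^ k) *\<^sub>R b :: 'a"
  show "range (dyadic_corner k :: 'a \<Rightarrow> 'a) \<subseteq> ?F ` (Basis \<rightarrow>\<^sub>E UNIV)"
  proof
    fix y :: 'a assume "y \<in> range (dyadic_corner k)"
    then obtain x where x: "y = dyadic_corner k x" by blast
    have eq: "y = ?F (restrict (\<lambda>b. \<lfloor>2 ^ k * (x \<bullet> b)\<rfloor>) Basis)" by (simp add: x dyadic_corner_def)
    show "y \<in> ?F ` (Basis \<rightarrow>\<^sub>E UNIV)"
      by (rule image_eqI[where f="?F" and x="restrict (\<lambda>b. \<lfloor>2 ^ k * (x \<bullet> b)\<rfloor>) Basis", OF eq]) auto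
  qed
  show "countable (?F ` (Basis \<rightarrow>\<^sub>E UNIV))" by (intro countable_image countable_PiE) auto
qed

text \<open>Rellich's theorem. A diagonal subsequence makes all averages over dyadic cells converge;
  at a fixed level this is convergence in \<open>L\<^sup>2\<close>, and the averaging error is uniformly small.\<close>

lemma Rellich_test_fun:
  assumes \<phi>: "\<And>k::nat. \<phi> k \<in> test_fun \<Omega>" and B: "\<And>k. normV \<Omega> (\<phi> k) \<le> B"
  obtains r :: "nat \<Rightarrow> nat" where "strict_mono r"
    "\<And>e. e > 0 \<Longrightarrow> \<exists>N. \<forall>m\<ge>N. \<forall>n\<ge>N. normH (\<lambda>x. \<phi> (r m) x - \<phi> (r n) x) < e"
proof -
  let ?n = "DIM('a)"
  have B0: "0 \<le> B" using B[of 0] normV_nonneg order_trans by blast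
  obtain P where P: "P > 0" "\<And>\<phi>. \<phi> \<in> test_fun \<Omega> \<Longrightarrow> (normH \<phi>)\<^sup>2 \<le> P * (normV \<Omega> \<phi>)\<^sup>2"
    using Poincare_test_fun by blast
  define M where "M = sqrt P * B"
  have M0: "M \<ge> 0" using P B0 by (simp add: M_def)
  have borel [measurable]: "\<phi> n \<in> borel_measurable borel" for n by (rule test_fun_borel[OF \<phi>])
  have i2: "integrable lborel (\<lambda>x. (\<phi> n x)\<^sup>2)" for n
    using test_fun_integrable[OF test_fun_mult[OF \<phi>[of n] \<phi>[of n]]] by (simp add: power2_eq_square)
  have bd: "\<bar>\<integral>y. indicator (dyadic_cell k s) y * \<phi> n y \<partial>lborel\<bar> \<le> M" for k n and s :: 'a
  proof (rule abs_le_square_iff[THEN iffD2, of _ M, unfolded abs_of_nonneg[OF M0]])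
    obtain b where b: "\<And>x. \<bar>\<phi> n x\<bar> \<le> b" using test_fun_bounded[OF \<phi>] by blast
    have i3: "integrable lborel (\<lambda>y. indicator (dyadic_cell k s) y * (\<phi> n y)\<^sup>2)"
      using integrable_mult_indicator[OF _ i2, of "dyadic_cell k s"] by simp
    have "(\<integral>y. indicator (dyadic_cell k s) y * \<phi> n y \<partial>lborel)\<^sup>2
       \<le> (1 / 2 ^ k) ^ ?n * (\<integral>y. indicator (dyadic_cell k s) y * (\<phi> n y)\<^sup>2 \<partial>lborel)"
      using integral_square_le_measure_times[OF dyadic_cell_borel _ integrable_dyadic_cell[OF borel b] i3]
      by (simp add: measure_dyadic_cell emeasure_dyadic_cell)
    also have "\<dots> \<le> 1 * (\<integral>y. (\<phi> n y)\<^sup>2 \<partial>lborel)"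
      using i2 i3 by (intro mult_mono integral_mono power_le_one integral_nonneg_AE)
        (auto simp: indicator_def)
    also have "\<dots> \<le> P * (normV \<Omega> (\<phi> n))\<^sup>2" using P(2)[OF \<phi>] by (simp add: l2norm_test_fun[OF \<phi>])
    also have "\<dots> \<le> P * B\<^sup>2" using P B by (intro mult_left_mono power_mono) auto
    also have "\<dots> = M\<^sup>2" using P by (simp add: M_def power_mult_distrib)
    finally show "(\<integral>y. indicator (dyadic_cell k s) y * \<phi> n y \<partial>lborel)\<^sup>2 \<le> M\<^sup>2" .
  qed
  define S where "S = (SIGMA k:(UNIV::nat set). range (dyadic_corner k :: 'a \<Rightarrow> 'a))"
  have "countable S" unfolding S_def by (intro countable_SIGMA countable_dyadic_corners) auto
  then obtain r :: "nat \<Rightarrow> nat" where r: "strict_mono r"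
    "\<And>ks. ks \<in> S \<Longrightarrow> \<exists>l. (\<lambda>n. \<integral>y. indicator (dyadic_cell (fst ks) (snd ks)) y * \<phi> (r n) y \<partial>lborel) \<longlonglongrightarrow> l"
    using function_convergent_subsequence[of S "\<lambda>n ks. \<integral>y. indicator (dyadic_cell (fst ks) (snd ks)) y * \<phi> n y \<partial>lborel" M]
      bd by auto
  define A where "A k x = lim (\<lambda>n. dyadic_avg k (\<phi> (r n)) x)" for k x
  have A: "(\<lambda>n. dyadic_avg k (\<phi> (r n)) x) \<longlonglongrightarrow> A k x" for k x
  proof -
    have "(k, dyadic_corner k x) \<in> S" by (auto simp: S_def)
    from r(2)[OF this] obtain l where
      "(\<lambda>n. \<integral>y. indicator (dyadic_cell k (dyadic_corner k x)) y * \<phi> (r n) y \<partial>lborel) \<longlonglongrightarrow> l" by auto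
    then have "(\<lambda>n. dyadic_avg k (\<phi> (r n)) x) \<longlonglongrightarrow> (2 ^ k) ^ ?n * l"
      unfolding dyadic_avg_def dyadic_cell_eq[OF dyadic_corner_in_cell] by (intro tendsto_intros)
    then show ?thesis unfolding A_def by (metis convergentI convergent_LIMSEQ_iff)
  qed
  have avg_bd: "\<bar>dyadic_avg k (\<phi> n) x\<bar> \<le> (2 ^ k) ^ ?n * M" for k n x
    unfolding dyadic_avg_def abs_mult using bd by (simp add: mult_left_mono)
  have A_bd: "\<bar>A k x\<bar> \<le> (2 ^ k) ^ ?n * M" for k x
    by (rule LIMSEQ_le_const2[OF tendsto_rabs[OF A]]) (use avg_bd in auto)
  have avg_m [measurable]: "dyadic_avg k (\<phi> n) \<in> borel_measurable borel" for k n by measurable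
  have A_m [measurable]: "A k \<in> borel_measurable borel" for k
    by (rule borel_measurable_LIMSEQ_metric[OF _ A]) measurable
  have to_leb: "f \<in> borel_measurable dx" if "f \<in> borel_measurable borel" for f :: "'a \<Rightarrow> real"
    using that by (intro measurable_restrict_space1 measurable_completion) simp
  have avg_L2: "dyadic_avg k (\<phi> n) \<in> L2 \<Omega>" for k n
    using avg_bd[of k n] by (intro L2_bounded to_leb) auto
  have A_L2: "A k \<in> L2 \<Omega>" for k
    using A_bd[of k] by (intro L2_bounded to_leb) auto
  have conv: "(\<lambda>n. normH (\<lambda>x. dyadic_avg k (\<phi> (r n)) x - A k x)) \<longlonglongrightarrow> 0" for k
  proof -
    let ?b = "((2 ^ k) ^ ?n * M + (2 ^ k) ^ ?n * M)\<^sup>2"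
    have [measurable]: "dyadic_avg k (\<phi> n) \<in> borel_measurable dx"
      "A k \<in> borel_measurable dx" for n
      using avg_L2 A_L2 L2_measurable by blast+
    have "(\<lambda>n. \<integral>x. (norm (dyadic_avg k (\<phi> (r n)) x - A k x))\<^sup>2 \<partial>dx) \<longlonglongrightarrow> (\<integral>x. 0 \<partial>dx)"
    proof (rule integral_dominated_convergence[where w="\<lambda>x. ?b"])
      show "integrable dx (\<lambda>x. ?b)" by (rule integrable_bounded[of _ ?b]) auto
      show "AE x in dx. (\<lambda>n. (norm (dyadic_avg k (\<phi> (r n)) x - A k x))\<^sup>2) \<longlonglongrightarrow> 0"
      proof (rule AE_I2)
        fix x
        have "(\<lambda>n. (norm (dyadic_avg k (\<phi> (r n)) x - A k x))\<^sup>2) \<longlonglongrightarrow> (norm (A k x - A k x))\<^sup>2"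
          by (intro tendsto_intros A)
        then show "(\<lambda>n. (norm (dyadic_avg k (\<phi> (r n)) x - A k x))\<^sup>2) \<longlonglongrightarrow> 0" by simp
      qed
      show "AE x in dx. norm ((norm (dyadic_avg k (\<phi> (r n)) x - A k x))\<^sup>2) \<le> ?b" for n
      proof (rule AE_I2)
        fix x
        have "\<bar>dyadic_avg k (\<phi> (r n)) x - A k x\<bar> \<le> (2 ^ k) ^ ?n * M + (2 ^ k) ^ ?n * M"
          using avg_bd[of k "r n" x] A_bd[of k x] by linarith
        from power_mono[OF this, of 2]
        show "norm ((norm (dyadic_avg k (\<phi> (r n)) x - A k x))\<^sup>2) \<le> ?b" by simp
      qed
    qed measurable
    then have "(\<lambda>n. sqrt (\<integral>x. (norm (dyadic_avg k (\<phi> (r n)) x - A k x))\<^sup>2 \<partial>dx)) \<longlonglongrightarrow> sqrt 0"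
      by (intro tendsto_real_sqrt) simp
    then show ?thesis by (simp add: l2norm_def)
  qed
  define C :: real where "C = 2 ^ ?n * (real ?n)\<^sup>2"
  have C: "C \<ge> 0" by (simp add: C_def)
  have err: "normH (\<lambda>x. \<phi> n x - dyadic_avg k (\<phi> n) x) \<le> sqrt C * B * (1/2) ^ k" for n k
  proof (rule power2_le_imp_le)
    have "(normH (\<lambda>x. \<phi> n x - dyadic_avg k (\<phi> n) x))\<^sup>2 \<le> (\<integral>x. (\<phi> n x - dyadic_avg k (\<phi> n) x)\<^sup>2 \<partial>lborel)"
      using integral_domain_le(2)[OF dyadic_avg_error(1)[OF \<phi>[of n], of k]] by (simp add: l2norm_square)
    also have "\<dots> \<le> C / 4 ^ k * (normV \<Omega> (\<phi> n))\<^sup>2"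
      using dyadic_avg_error(2)[OF \<phi>[of n], of k] by (simp add: C_def normV_test_fun[OF \<phi>])
    also have "\<dots> \<le> C / 4 ^ k * B\<^sup>2" using C B by (intro mult_left_mono power_mono) auto
    also have "\<dots> = (sqrt C * B * (1/2) ^ k)\<^sup>2"
    proof -
      have "((1/2) ^ k)\<^sup>2 = (1 / 4 ^ k :: real)"
        by (simp add: power2_eq_square power_one_over flip: power_mult_distrib)
      then show ?thesis using C by (simp add: power_mult_distrib)
    qed
    finally show "(normH (\<lambda>x. \<phi> n x - dyadic_avg k (\<phi> n) x))\<^sup>2 \<le> (sqrt C * B * (1/2) ^ k)\<^sup>2" .
  qed (use C B0 in auto)
  show ?thesis
  proof (rule that[OF r(1)])
    fix e :: real assume e: "e > 0"
    have "(\<lambda>k. sqrt C * B * (1/2) ^ k) \<longlonglongrightarrow> 0"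
      by (intro tendsto_mult_right_zero LIMSEQ_realpow_zero) auto
    then have "\<forall>\<^sub>F k in sequentially. sqrt C * B * (1/2) ^ k < e / 4"
      using e by (intro order_tendstoD) auto
    then obtain k where k: "sqrt C * B * (1/2) ^ k < e / 4" by (auto simp: eventually_sequentially)
    have "\<forall>\<^sub>F n in sequentially. normH (\<lambda>x. dyadic_avg k (\<phi> (r n)) x - A k x) < e / 4"
      using e by (intro order_tendstoD[OF conv]) auto
    then obtain N where N: "\<And>n. n \<ge> N \<Longrightarrow> normH (\<lambda>x. dyadic_avg k (\<phi> (r n)) x - A k x) < e / 4"
      by (auto simp: eventually_sequentially)
    have near: "normH (\<lambda>x. \<phi> (r n) x - A k x) < e / 2" if "n \<ge> N" for n
      using l2norm_dist_triangle[OF test_fun_L2[OF \<phi>] avg_L2 A_L2, of "r n" k k "r n"] err[of "r n" k] k N[OF that]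
      by linarith
    have "normH (\<lambda>x. \<phi> (r m) x - \<phi> (r n) x) < e" if "m \<ge> N" "n \<ge> N" for m n
      using l2norm_dist_triangle[OF test_fun_L2[OF \<phi>] A_L2 test_fun_L2[OF \<phi>], of "r m" "r n" k]
        near[OF that(1)] near[OF that(2)] l2norm_minus_commute[of \<Omega> "A k" "\<phi> (r n)"] by linarith
    then show "\<exists>N. \<forall>m\<ge>N. \<forall>n\<ge>N. normH (\<lambda>x. \<phi> (r m) x - \<phi> (r n) x) < e" by blast
  qed
qed

lemma nonzero_test_fun:
  assumes "\<Omega> \<noteq> {}"
  obtains \<phi> where "\<phi> \<in> test_fun \<Omega>" "normH \<phi> > 0"
proof -
  obtain y where "y \<in> \<Omega>" using assms by blast
  then obtain a c where ac: "y \<in> box a c" "cbox a c \<subseteq> \<Omega>"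
    using open_contains_cbox[of \<Omega> y] open_domain by (metis box_subset_cbox subset_trans interior_cbox)
  have T: "box_bump a c 0 \<in> test_fun \<Omega>" using ac(2) by (rule box_bump_test_fun)
  have "normH (box_bump a c 0) \<noteq> 0"
  proof
    assume "normH (box_bump a c 0) = 0"
    then have "AE x in dx. box_bump a c 0 x = 0" using l2norm_eq_0_iff[OF test_fun_L2[OF T]] by simp
    then have "AE x in lebesgue. x \<in> \<Omega> \<longrightarrow> box_bump a c 0 x = 0"
      by (simp add: AE_restrict_space_iff)
    then have "AE x in lebesgue. x \<notin> box a c"
      by eventually_elim (use ac box_subset_cbox box_bump_pos in \<open>metis less_irrefl subsetD\<close>)
    then have "box a c \<in> null_sets lebesgue"
      using AE_iff_null_sets[of "box a c" lebesgue] by simp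
    then have "negligible (box a c)" by (simp add: negligible_iff_null_sets)
    then show False using open_not_negligible[of "box a c"] ac(1) by auto
  qed
  then show ?thesis using that[OF T] by (simp add: less_le)
qed

subsection \<open>The first eigenvalue\<close>

text \<open>The infimum \<open>m\<close> of the Rayleigh quotient is attained: a minimising sequence of test functions
  has an \<open>L\<^sup>2\<close>-convergent subsequence, and the parallelogram law shows that it converges in
  $H_0^1$ too. A minimiser is an eigenfunction, and no eigenvalue is below \<open>m\<close>.\<close>

theorem lambda1_properties:
  assumes "\<Omega> \<noteq> {}"
  shows "lambda1 \<Omega> > 0" and "\<And>z. z \<in> H01 \<Omega> \<Longrightarrow> lambda1 \<Omega> * (normH z)\<^sup>2 \<le> (normV \<Omega> z)\<^sup>2"
proof -
  obtain P where P: "P > 0" "\<And>\<phi>. \<phi> \<in> test_fun \<Omega> \<Longrightarrow> (normH \<phi>)\<^sup>2 \<le> P * (normV \<Omega> \<phi>)\<^sup>2"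
    using Poincare_test_fun by blast
  define R where "R = {(normV \<Omega> \<phi>)\<^sup>2 | \<phi>. \<phi> \<in> test_fun \<Omega> \<and> normH \<phi> = 1}"
  have normalise: "(\<lambda>x. inverse (normH \<phi>) * \<phi> x) \<in> test_fun \<Omega>"
    "normH (\<lambda>x. inverse (normH \<phi>) * \<phi> x) = 1"
    "normV \<Omega> (\<lambda>x. inverse (normH \<phi>) * \<phi> x) = inverse (normH \<phi>) * normV \<Omega> \<phi>"
    if "\<phi> \<in> test_fun \<Omega>" "normH \<phi> > 0" for \<phi>
    using that by (auto simp: test_fun_scale l2norm_scale normV_scale test_fun_H01)
  have inR: "(inverse (normH \<phi>) * normV \<Omega> \<phi>)\<^sup>2 \<in> R"
    if "\<phi> \<in> test_fun \<Omega>" "normH \<phi> > 0" for \<phi>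
    unfolding R_def using normalise[OF that]
    by (intro CollectI exI[of _ "\<lambda>x. inverse (normH \<phi>) * \<phi> x"]) simp
  have Rne: "R \<noteq> {}" using nonzero_test_fun[OF assms] inR by (metis empty_iff)
  have Rge: "inverse P \<le> s" if s: "s \<in> R" for s
  proof -
    obtain \<phi> where \<phi>: "s = (normV \<Omega> \<phi>)\<^sup>2" "\<phi> \<in> test_fun \<Omega>" "normH \<phi> = 1" using s unfolding R_def by blast
    have "1 \<le> P * s" using P(2)[OF \<phi>(2)] \<phi> by simp
    then show ?thesis using P(1) by (simp add: inverse_eq_divide divide_le_eq mult.commute)
  qed
  have Rbdd: "bdd_below R" using Rge by (intro bdd_belowI)
  define m where "m = Inf R"
  have m0: "m > 0"
    using cInf_greatest[OF Rne Rge] P(1) positive_imp_inverse_positive less_le_trans unfolding m_def by blast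
  have m_test: "m * (normH \<phi>)\<^sup>2 \<le> (normV \<Omega> \<phi>)\<^sup>2" if \<phi>: "\<phi> \<in> test_fun \<Omega>" for \<phi>
  proof (cases "normH \<phi> = 0")
    case False
    then have pos: "normH \<phi> > 0" by (simp add: less_le)
    from inR[OF \<phi> pos] have "m \<le> (inverse (normH \<phi>) * normV \<Omega> \<phi>)\<^sup>2" unfolding m_def by (rule cInf_lower[OF _ Rbdd])
    then show ?thesis using pos by (simp add: field_simps power2_eq_square)
  qed simp
  have m_H01: "m * (normH z)\<^sup>2 \<le> (normV \<Omega> z)\<^sup>2" if z: "z \<in> H01 \<Omega>" for z
  proof -
    obtain \<phi> where \<phi>: "\<And>k::nat. \<phi> k \<in> test_fun \<Omega>" "(\<lambda>k. normH (\<phi> k)) \<longlonglongrightarrow> normH z"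
      "(\<lambda>k. normV \<Omega> (\<phi> k)) \<longlonglongrightarrow> normV \<Omega> z" using H01_approx_norms[OF z] by blast
    have "(\<lambda>k. m * (normH (\<phi> k))\<^sup>2) \<longlonglongrightarrow> m * (normH z)\<^sup>2" "(\<lambda>k. (normV \<Omega> (\<phi> k))\<^sup>2) \<longlonglongrightarrow> (normV \<Omega> z)\<^sup>2"
      using \<phi> by (auto intro!: tendsto_intros)
    then show ?thesis by (rule LIMSEQ_le) (use m_test \<phi>(1) in auto)
  qed
  have "\<exists>\<phi>. \<phi> \<in> test_fun \<Omega> \<and> normH \<phi> = 1 \<and> (normV \<Omega> \<phi>)\<^sup>2 < m + inverse (real (Suc k))" for k
  proof -
    have "Inf R < m + inverse (real (Suc k))" unfolding m_def by simp
    then obtain s where "s \<in> R" "s < m + inverse (real (Suc k))" using cInf_lessD[OF Rne] by blast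
    then show ?thesis unfolding R_def by blast
  qed
  then obtain \<phi> where \<phi>: "\<And>k::nat. \<phi> k \<in> test_fun \<Omega>" "\<And>k. normH (\<phi> k) = 1"
    "\<And>k. (normV \<Omega> (\<phi> k))\<^sup>2 < m + inverse (real (Suc k))" by metis
  have bd: "normV \<Omega> (\<phi> k) \<le> sqrt (m + 1)" for k
  proof (rule real_le_rsqrt)
    have "inverse (real (Suc k)) \<le> 1" by (simp add: inverse_le_1_iff)
    then show "(normV \<Omega> (\<phi> k))\<^sup>2 \<le> m + 1" using \<phi>(3)[of k] by linarith
  qed
  obtain r :: "nat \<Rightarrow> nat" where r: "strict_mono r"
    "\<And>e. e > 0 \<Longrightarrow> \<exists>N. \<forall>m\<ge>N. \<forall>n\<ge>N. normH (\<lambda>x. \<phi> (r m) x - \<phi> (r n) x) < e"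
    by (rule Rellich_test_fun[of \<phi>, OF \<phi>(1) bd]) (rule that)
  have para: "(normV \<Omega> (\<lambda>x. \<phi> i x - \<phi> j x))\<^sup>2
     \<le> 2 * inverse (real (Suc i)) + 2 * inverse (real (Suc j)) + m * (normH (\<lambda>x. \<phi> i x - \<phi> j x))\<^sup>2" for i j
  proof -
    note T = test_fun_H01[OF \<phi>(1)] and L = test_fun_L2[OF \<phi>(1)]
    have "m * (normH (\<lambda>x. \<phi> i x + \<phi> j x))\<^sup>2 \<le> (normV \<Omega> (\<lambda>x. \<phi> i x + \<phi> j x))\<^sup>2"
      by (intro m_H01 H01_add T)
    moreover have "(normH (\<lambda>x. \<phi> i x + \<phi> j x))\<^sup>2 = 4 - (normH (\<lambda>x. \<phi> i x - \<phi> j x))\<^sup>2"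
      using l2norm_add_square[OF L L, of i j] l2norm_diff_square[OF L L, of i j] by (simp add: \<phi>(2))
    ultimately show ?thesis
      using normV_add_square[OF T T, of i j] normV_diff_square[OF T T, of i j] \<phi>(3)[of i] \<phi>(3)[of j]
      by (simp add: right_diff_distrib)
  qed
  have CauchyV: "\<exists>N. \<forall>i\<ge>N. \<forall>j\<ge>N. normV \<Omega> (\<lambda>x. \<phi> (r i) x - \<phi> (r j) x) < e" if e: "e > 0" for e
  proof -
    define d where "d = e\<^sup>2 / 8"
    have d: "d > 0" using e by (simp add: d_def)
    obtain N1 where N1: "\<forall>i\<ge>N1. \<forall>j\<ge>N1. normH (\<lambda>x. \<phi> (r i) x - \<phi> (r j) x) < sqrt (d / m)"
      using r(2)[of "sqrt (d / m)"] d m0 by auto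
    obtain N2 where N2: "inverse (real (Suc N2)) < d" using reals_Archimedean[OF d] by blast
    have "normV \<Omega> (\<lambda>x. \<phi> (r i) x - \<phi> (r j) x) < e" if "i \<ge> max N1 N2" "j \<ge> max N1 N2" for i j
    proof (rule power2_less_imp_less)
      have inv: "inverse (real (Suc (r i))) < d" if "i \<ge> N2" for i
      proof -
        have "N2 \<le> r i" using that seq_suble[OF r(1), of i] by linarith
        then have "inverse (real (Suc (r i))) \<le> inverse (real (Suc N2))" by (intro le_imp_inverse_le) auto
        then show ?thesis using N2 by linarith
      qed
      have "(normH (\<lambda>x. \<phi> (r i) x - \<phi> (r j) x))\<^sup>2 \<le> (sqrt (d / m))\<^sup>2"
        using N1 that by (intro power_mono) (auto intro: less_imp_le)
      then have "m * (normH (\<lambda>x. \<phi> (r i) x - \<phi> (r j) x))\<^sup>2 \<le> d"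
        using d m0 by (simp add: field_simps)
      then have "(normV \<Omega> (\<lambda>x. \<phi> (r i) x - \<phi> (r j) x))\<^sup>2 < 8 * d"
        using para[of "r i" "r j"] inv[of i] inv[of j] that d by auto
      then show "(normV \<Omega> (\<lambda>x. \<phi> (r i) x - \<phi> (r j) x))\<^sup>2 < e\<^sup>2" by (simp add: d_def)
    qed (use e in auto)
    then show ?thesis by blast
  qed
  obtain w where w: "w \<in> H01 \<Omega>" "(\<lambda>k. normH (\<lambda>x. \<phi> (r k) x - w x)) \<longlonglongrightarrow> 0"
    "(\<lambda>k. normV \<Omega> (\<lambda>x. \<phi> (r k) x - w x)) \<longlonglongrightarrow> 0"
    by (rule H01_limit_of_test_funs[of "\<lambda>k. \<phi> (r k)", OF \<phi>(1) r(2) CauchyV]; (assumption | rule that))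
  have w1: "normH w = 1"
    using l2norm_tendsto[OF test_fun_L2[OF \<phi>(1)] H01_L2[OF w(1)] w(2)] by (simp add: \<phi>(2) LIMSEQ_const_iff)
  have wm: "(normV \<Omega> w)\<^sup>2 = m"
  proof (rule antisym)
    have "(\<lambda>k. normV \<Omega> (\<phi> (r k)) - normV \<Omega> w) \<longlonglongrightarrow> 0"
      by (rule Lim_null_comparison[OF _ w(3)]) (simp add: normV_abs_diff_le test_fun_H01 \<phi>(1) w(1))
    then have 1: "(\<lambda>k. (normV \<Omega> (\<phi> (r k)))\<^sup>2) \<longlonglongrightarrow> (normV \<Omega> w)\<^sup>2"
      by (intro tendsto_power) (simp add: LIM_zero_iff)
    have "(\<lambda>k. m + inverse (real (Suc (r k)))) \<longlonglongrightarrow> m + 0"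
      using LIMSEQ_subseq_LIMSEQ[OF LIMSEQ_inverse_real_of_nat r(1)] by (intro tendsto_intros) (simp add: o_def)
    then show "(normV \<Omega> w)\<^sup>2 \<le> m"
      using LIMSEQ_le[OF 1, of "\<lambda>k. m + inverse (real (Suc (r k)))" "m + 0"] \<phi>(3) by (auto intro: less_imp_le)
    show "m \<le> (normV \<Omega> w)\<^sup>2" using m_H01[OF w(1)] w1 by simp
  qed
  have eig: "dirichlet_form w z = m * innerH w z" if z: "z \<in> H01 \<Omega>" for z
  proof -
    have q: "0 \<le> 0 + 2 * t * (dirichlet_form w z - m * innerH w z) + t\<^sup>2 * ((normV \<Omega> z)\<^sup>2 - m * (normH z)\<^sup>2)" for t
    proof -
      have tz: "(\<lambda>x. t * z x) \<in> H01 \<Omega>" by (rule H01_scale[OF z])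
      have "m * (normH (\<lambda>x. w x + t * z x))\<^sup>2 \<le> (normV \<Omega> (\<lambda>x. w x + t * z x))\<^sup>2"
        by (intro m_H01 H01_add w z tz)
      moreover have "dirichlet_form w (\<lambda>x. t * z x) = t * dirichlet_form w z"
        using dirichlet_form_lincomb[of z z w t 0] z w(1) H01_H1 by (simp add: dirichlet_form_commute[of w])
      moreover have "innerH w (\<lambda>x. t * z x) = t * innerH w z"
        using l2inner_scaleR_right[of \<Omega> w t z] by simp
      ultimately show ?thesis
        using l2norm_add_square[OF H01_L2[OF w(1)] H01_L2[OF tz]] normV_add_square[OF w(1) tz] z
        by (simp add: w1 wm l2norm_scale normV_scale power_mult_distrib algebra_simps)
    qed
    have "(dirichlet_form w z - m * innerH w z)\<^sup>2 \<le> 0 * ((normV \<Omega> z)\<^sup>2 - m * (normH z)\<^sup>2)"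
      using q by (rule nonneg_quadratic_imp_square_le) (use m_H01[OF z] in simp)
    then show ?thesis by simp
  qed
  have "lambda1 \<Omega> = m"
    unfolding lambda1_def
  proof (rule Least_equality)
    show "dirichlet_eigenvalue \<Omega> m"
      unfolding dirichlet_eigenvalue_def using w(1) w1 eig
      by (intro bexI[of _ w]) (auto simp: dirichlet_form_def)
    fix \<mu> assume "dirichlet_eigenvalue \<Omega> \<mu>"
    then obtain y where y: "y \<in> H01 \<Omega>" "normH y \<noteq> 0"
      "\<And>z. z \<in> H01 \<Omega> \<Longrightarrow> dirichlet_form y z = \<mu> * innerH y z"
      unfolding dirichlet_eigenvalue_def dirichlet_form_def by blast
    have "m * (normH y)\<^sup>2 \<le> \<mu> * (normH y)\<^sup>2"
      using m_H01[OF y(1)] y(3)[OF y(1)] by (simp add: dirichlet_form_self l2inner_self)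
    then show "m \<le> \<mu>" using y(2) by simp
  qed
  then show "lambda1 \<Omega> > 0" "\<And>z. z \<in> H01 \<Omega> \<Longrightarrow> lambda1 \<Omega> * (normH z)\<^sup>2 \<le> (normV \<Omega> z)\<^sup>2"
    using m0 m_H01 by auto
qed

end

section \<open>Functions of one real variable\<close>

subsection \<open>Absolutely continuous functions\<close>

lemma abs_cont_onE:
  assumes "abs_cont_on a b f" "\<epsilon> > 0"
  obtains \<delta> where "\<delta> > 0" "\<And>D::(real \<times> real) set. finite D \<Longrightarrow> (\<forall>(x, y)\<in>D. a \<le> x \<and> x \<le> y \<and> y \<le> b) \<Longrightarrow>
        pairwise (\<lambda>(x, y) (x', y'). {x<..<y} \<inter> {x'<..<y'} = {}) D \<Longrightarrow>
        (\<Sum>(x, y)\<in>D. y - x) < \<delta> \<Longrightarrow> (\<Sum>(x, y)\<in>D. \<bar>f y - f x\<bar>) < \<epsilon>"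
proof -
  from assms(1)[unfolded abs_cont_on_def, rule_format, OF assms(2)] obtain \<delta> where
    \<delta>: "\<delta> > 0" "\<forall>D. finite D \<and> (\<forall>(x, y)\<in>D. a \<le> x \<and> x \<le> y \<and> y \<le> b) \<and>
        pairwise (\<lambda>(x, y) (x', y'). {x<..<y} \<inter> {x'<..<y'} = {}) D \<and>
        (\<Sum>(x, y)\<in>D. y - x) < \<delta> \<longrightarrow> (\<Sum>(x, y)\<in>D. \<bar>f y - f x\<bar>) < \<epsilon>"
    by (elim exE conjE)
  show thesis by (rule that[OF \<delta>(1)], rule \<delta>(2)[rule_format]) (intro conjI)
qed

text \<open>The gauge integral makes the fundamental theorem elementary: a gauge that is fine enough at
  the exceptional points confines the corresponding intervals to an open set of small measure, on
  which the increments of an absolutely continuous function are small in total.\<close>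

theorem abs_cont_on_has_integral:
  fixes f f' :: "real \<Rightarrow> real"
  assumes ab: "a < b" and ac: "abs_cont_on a b f" and N: "N \<in> null_sets lebesgue"
    and der: "\<And>t. t \<in> {a..b} \<Longrightarrow> t \<notin> N \<Longrightarrow> (f has_real_derivative f' t) (at t within {a..b})"
  shows "((\<lambda>t. if t \<in> N then 0 else f' t) has_integral (f b - f a)) {a..b}"
  unfolding has_integral_factor_content_real
proof (intro allI impI)
  fix e0 :: real assume "e0 > 0"
  define e where "e = e0 / 2"
  have e: "e > 0" using \<open>e0 > 0\<close> by (simp add: e_def)
  let ?F = "\<lambda>t. if t \<in> N then 0 else f' t"
  have "e * (b - a) > 0" using e ab by simp
  then obtain \<delta> where \<delta>: "\<delta> > 0" "\<And>D::(real \<times> real) set. finite D \<Longrightarrow> (\<forall>(x, y)\<in>D. a \<le> x \<and> x \<le> y \<and> y \<le> b) \<Longrightarrow>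
        pairwise (\<lambda>(x, y) (x', y'). {x<..<y} \<inter> {x'<..<y'} = {}) D \<Longrightarrow>
        (\<Sum>(x, y)\<in>D. y - x) < \<delta> \<Longrightarrow> (\<Sum>(x, y)\<in>D. \<bar>f y - f x\<bar>) < e * (b - a)"
    by (rule abs_cont_onE[OF ac]) (rule that)
  obtain W where W: "open W" "N \<subseteq> W" "W - N \<in> lmeasurable" "emeasure lebesgue (W - N) < ennreal \<delta>"
    using sets_lebesgue_outer_open[of N \<delta>] N \<delta>(1) by blast
  have Ws: "W \<in> sets lebesgue" using W(1) by auto
  have Wem: "emeasure lebesgue W < ennreal \<delta>"
    using emeasure_Diff_null_set[OF N Ws] W(4) by simp
  have Wl: "W \<in> lmeasurable" using Ws Wem by (simp add: fmeasurable_def less_trans[OF _ ennreal_less_top])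
  have Wm: "measure lebesgue W < \<delta>"
    using Wem \<delta>(1) Wl by (simp add: emeasure_eq_measure2 ennreal_less_iff)
  have "\<forall>x. \<exists>d>0. x \<in> {a..b} - N \<longrightarrow>
         (\<forall>y\<in>{a..b}. norm (y-x) < d \<longrightarrow> norm (f y - f x - (y-x) *\<^sub>R f' x) \<le> e * norm (y-x))"
  proof
    fix x
    show "\<exists>d>0. x \<in> {a..b} - N \<longrightarrow>
         (\<forall>y\<in>{a..b}. norm (y-x) < d \<longrightarrow> norm (f y - f x - (y-x) *\<^sub>R f' x) \<le> e * norm (y-x))"
    proof (cases "x \<in> {a..b} - N")
      case True
      then have "(f has_vector_derivative f' x) (at x within {a..b})"
        using der by (simp add: has_real_derivative_iff_has_vector_derivative)
      then show ?thesis using e unfolding has_vector_derivative_def has_derivative_within_alt by blast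
    next
      case False
      then show ?thesis by (intro exI[of _ 1]) auto
    qed
  qed
  then obtain d where d: "\<And>x. 0 < d x"
     "\<And>x y. x \<in> {a..b} \<Longrightarrow> x \<notin> N \<Longrightarrow> y \<in> {a..b} \<Longrightarrow> norm (y-x) < d x
                        \<Longrightarrow> norm (f y - f x - (y-x) *\<^sub>R f' x) \<le> e * norm (y-x)"
    by (metis Diff_iff)
  define \<gamma> where "\<gamma> x = (if x \<in> N then W else ball x (d x))" for x
  have gauge: "gauge \<gamma>" using W(1,2) d(1) by (auto simp: gauge_def \<gamma>_def)
  have "norm ((\<Sum>(x, K)\<in>p. measure lborel K *\<^sub>R ?F x) - (f b - f a)) \<le> e0 * measure lborel {a..b}"
    if p: "p tagged_division_of {a..b}" and fine: "\<gamma> fine p" for p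
  proof -
    have fin: "finite p" using p by blast
    have ba: "b - a = (\<Sum>(x,K)\<in>p. Sup K - Inf K)" "f b - f a = (\<Sum>(x,K)\<in>p. f(Sup K) - f(Inf K))"
      using additive_tagged_division_1[OF less_imp_le[OF ab] p, of "\<lambda>x. x"]
        additive_tagged_division_1[OF less_imp_le[OF ab] p, of f] by simp_all
    have K: "x \<in> K \<and> K \<subseteq> {a..b} \<and> K = {Inf K..Sup K} \<and> Inf K \<le> x \<and> x \<le> Sup K \<and> a \<le> Inf K \<and> Sup K \<le> b"
      if xK: "(x, K) \<in> p" for x K
    proof -
      have "x \<in> K" "K \<subseteq> {a..b}" using p xK by blast+
      moreover obtain u v where "K = cbox u v" using tagged_division_ofD(4)[OF p xK] by blast
      ultimately show ?thesis by auto
    qed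
    have good: "norm (measure lborel K *\<^sub>R ?F x - (f (Sup K) - f (Inf K))) \<le> e * (Sup K - Inf K)"
      if xK: "(x, K) \<in> p" "x \<notin> N" for x K
    proof -
      define u v where "u = Inf K" and "v = Sup K"
      have k: "K = {u..v}" "u \<le> x" "x \<le> v" "u \<in> K" "v \<in> K" and kab: "K \<subseteq> {a..b}"
        using K[OF xK(1)] by (auto simp: u_def v_def)
      have ball: "K \<subseteq> ball x (d x)" using fine xK by (force simp: fine_def \<gamma>_def)
      have near: "norm (u - x) < d x" "norm (v - x) < d x"
        using subsetD[OF ball k(4)] subsetD[OF ball k(5)] by (auto simp: dist_real_def abs_minus_commute)
      have "norm ((v - u) *\<^sub>R f' x - (f v - f u)) = norm (f u - f x - (u - x) *\<^sub>R f' x - (f v - f x - (v - x) *\<^sub>R f' x))"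
        by (auto simp: algebra_simps)
      also have "\<dots> \<le> norm (f u - f x - (u - x) *\<^sub>R f' x) + norm (f v - f x - (v - x) *\<^sub>R f' x)"
        by (rule norm_triangle_ineq4)
      also have "\<dots> \<le> e * norm (u - x) + e * norm (v - x)"
        using near k kab xK(2) by (intro add_mono d(2)) auto
      also have "\<dots> = e * (v - u)" using k by (simp add: algebra_simps)
      finally show ?thesis using k xK(2) unfolding u_def[symmetric] v_def[symmetric] by simp
    qed
    define q where "q = {(x, K) \<in> p. x \<in> N \<and> Inf K < Sup K}"
    have qp: "q \<subseteq> p" by (auto simp: q_def)
    have finq: "finite q" using fin qp finite_subset by blast
    let ?g = "\<lambda>(x::real, K::real set). (Inf K, Sup K)"
    have int: "interior K = {Inf K<..<Sup K}" if "(x, K) \<in> p" for x K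
      using K[OF that] by (metis interior_atLeastAtMost_real)
    have disj: "{Inf K<..<Sup K} \<inter> {Inf K'<..<Sup K'} = {}"
      if "(x, K) \<in> p" "(x', K') \<in> p" "(x, K) \<noteq> (x', K')" for x K x' K'
      using tagged_division_ofD(5)[OF p that] int[OF that(1)] int[OF that(2)] by simp
    have inj: "inj_on ?g q"
    proof (rule inj_onI, clarify)
      fix x K x' K' assume q: "(x, K) \<in> q" "(x', K') \<in> q" and eq: "Inf K = Inf K'" "Sup K = Sup K'"
      show "x = x' \<and> K = K'"
      proof (rule ccontr)
        assume "\<not> (x = x' \<and> K = K')"
        then have "{Inf K<..<Sup K} \<inter> {Inf K'<..<Sup K'} = {}" using disj[of x K x' K'] q by (auto simp: q_def)
        then have "{Inf K<..<Sup K} = {}" using eq by simp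
        then show False using q(1) by (simp add: q_def)
      qed
    qed
    have len: "(\<Sum>(x, K)\<in>q. Sup K - Inf K) < \<delta>"
    proof -
      have "(\<Sum>(x, K)\<in>q. Sup K - Inf K) = (\<Sum>i\<in>q. measure lebesgue {Inf (snd i)<..<Sup (snd i)})"
        by (intro sum.cong) (auto simp: q_def)
      also have "\<dots> = measure lebesgue (\<Union>i\<in>q. {Inf (snd i)<..<Sup (snd i)})"
      proof (rule measure_finite_Union[symmetric, OF finq])
        show "disjoint_family_on (\<lambda>i. {Inf (snd i)<..<Sup (snd i)}) q"
          unfolding disjoint_family_on_def using disj qp by (metis prod.collapse subsetD)
        show "emeasure lebesgue {Inf (snd i)<..<Sup (snd i)} \<noteq> \<infinity>" if "i \<in> q" for i
          using that by (auto simp: q_def)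
      qed auto
      also have "\<dots> \<le> measure lebesgue W"
      proof (rule measure_mono_fmeasurable)
        show "(\<Union>i\<in>q. {Inf (snd i)<..<Sup (snd i)}) \<subseteq> W"
        proof clarify
          fix x K y assume "(x, K) \<in> q" and y: "y \<in> {Inf (snd (x, K))<..<Sup (snd (x, K))}"
          then have xK: "(x, K) \<in> p" "x \<in> N" by (auto simp: q_def)
          then have "K \<subseteq> W" using fine by (force simp: fine_def \<gamma>_def)
          then show "y \<in> W" using K[OF xK(1)] y by auto
        qed
        show "(\<Union>i\<in>q. {Inf (snd i)<..<Sup (snd i)}) \<in> sets lebesgue"
          by (intro sets.finite_UN finq) auto
      qed (rule Wl)
      finally show ?thesis using Wm by simp
    qed
    have "(\<Sum>(x, y)\<in>?g ` q. \<bar>f y - f x\<bar>) < e * (b - a)"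
    proof (rule \<delta>(2))
      show "pairwise (\<lambda>(x, y) (x', y'). {x<..<y} \<inter> {x'<..<y'} = {}) (?g ` q)"
        unfolding pairwise_def using disj qp by fastforce
      show "(\<Sum>(x, y)\<in>?g ` q. y - x) < \<delta>"
        using len by (subst sum.reindex[OF inj]) (simp add: o_def split_beta)
      show "\<forall>(x, y)\<in>?g ` q. a \<le> x \<and> x \<le> y \<and> y \<le> b" using K qp by (fastforce simp: q_def)
    qed (use finq in simp)
    then have bad: "(\<Sum>(x, K)\<in>q. \<bar>f (Sup K) - f (Inf K)\<bar>) < e * (b - a)"
      by (subst (asm) sum.reindex[OF inj]) (simp add: o_def split_beta)
    have "norm ((\<Sum>(x, K)\<in>p. measure lborel K *\<^sub>R ?F x) - (f b - f a))
       = norm (\<Sum>(x, K)\<in>p. measure lborel K *\<^sub>R ?F x - (f (Sup K) - f (Inf K)))"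
      by (simp add: ba(2) split_def sum_subtractf)
    also have "\<dots> \<le> (\<Sum>i\<in>p. e * (Sup (snd i) - Inf (snd i)) + (if i \<in> q then \<bar>f (Sup (snd i)) - f (Inf (snd i))\<bar> else 0))"
    proof (rule sum_norm_le, clarify)
      fix x K assume xK: "(x, K) \<in> p"
      have nn: "e * (Sup K - Inf K) \<ge> 0" using K[OF xK] e by auto
      consider "x \<notin> N" | "(x, K) \<in> q" | "x \<in> N" "Inf K = Sup K"
        using K[OF xK] xK by (cases "Inf K < Sup K") (fastforce simp: q_def)+
      then show "norm (measure lborel K *\<^sub>R ?F x - (f (Sup K) - f (Inf K)))
        \<le> e * (Sup (snd (x, K)) - Inf (snd (x, K))) + (if (x, K) \<in> q then \<bar>f (Sup (snd (x, K))) - f (Inf (snd (x, K)))\<bar> else 0)"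
      proof cases
        case 1
        then show ?thesis using good[OF xK 1] by (auto simp: q_def)
      next
        case 2
        then have "x \<in> N" by (simp add: q_def)
        then show ?thesis using 2 nn by simp
      next
        case 3
        then show ?thesis by (auto simp: q_def)
      qed
    qed
    also have "\<dots> = e * (b - a) + (\<Sum>(x, K)\<in>q. \<bar>f (Sup K) - f (Inf K)\<bar>)"
      using qp fin
      by (simp add: ba(1) sum.distrib sum_distrib_left split_def sum.If_cases Int_absorb1)
    also have "\<dots> \<le> e0 * measure lborel {a..b}" using bad ab by (simp add: e_def field_simps)
    finally show ?thesis .
  qed
  then show "\<exists>d. gauge d \<and> (\<forall>p. p tagged_division_of {a..b} \<and> d fine p \<longrightarrow>
      norm ((\<Sum>(x, k)\<in>p. measure lborel k *\<^sub>R ?F x) - (f b - f a)) \<le> e0 * measure lborel {a..b})"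
    using gauge by blast
qed

corollary abs_cont_on_increment_le:
  fixes f f' h :: "real \<Rightarrow> real"
  assumes ab: "a \<le> b" and ac: "abs_cont_on a b f"
    and der: "AE t in lebesgue. a < t \<and> t < b \<longrightarrow> (f has_real_derivative f' t) (at t)"
    and le: "AE t in lebesgue. a < t \<and> t < b \<longrightarrow> f' t \<le> h t" and h: "h integrable_on {a..b}"
  shows "f b - f a \<le> integral {a..b} h"
proof (cases "a = b")
  case False
  then have ab': "a < b" using ab by simp
  have "AE t in lebesgue. a < t \<and> t < b \<longrightarrow> (f has_real_derivative f' t) (at t) \<and> f' t \<le> h t"
    using der le by eventually_elim blast
  then obtain N where N: "N \<in> null_sets lebesgue"
      "\<And>t. t \<in> space lebesgue - N \<Longrightarrow> a < t \<and> t < b \<longrightarrow> (f has_real_derivative f' t) (at t) \<and> f' t \<le> h t"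
    by (rule AE_E3) (rule that)
  define N' where "N' = N \<union> {a, b}"
  have N': "N' \<in> null_sets lebesgue"
    unfolding N'_def using N(1) by (intro null_sets.Un) (auto simp: negligible_iff_null_sets[symmetric])
  have out: "(f has_real_derivative f' t) (at t) \<and> f' t \<le> h t" if "t \<in> {a..b}" "t \<notin> N'" for t
    using that N(2)[of t] by (auto simp: N'_def)
  have "((\<lambda>t. if t \<in> N' then 0 else f' t) has_integral (f b - f a)) {a..b}"
    using out by (intro abs_cont_on_has_integral[OF ab' ac N']) (auto intro: has_field_derivative_at_within)
  moreover have "((\<lambda>t. if t \<in> N' then 0 else h t) has_integral integral {a..b} h) {a..b}"
    by (rule has_integral_spike[OF _ _ integrable_integral[OF h], of N'])
      (use N' in \<open>auto simp: negligible_iff_null_sets\<close>)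
  ultimately show ?thesis
    by (rule has_integral_le) (use out in auto)
qed simp

lemma abs_cont_on_subinterval:
  assumes "abs_cont_on a b f" "a \<le> c" "d \<le> b"
  shows "abs_cont_on c d f"
  unfolding abs_cont_on_def
proof (intro allI impI)
  fix \<epsilon> :: real assume "\<epsilon> > 0"
  then obtain \<delta> where \<delta>: "\<delta> > 0" "\<And>D::(real \<times> real) set. finite D \<Longrightarrow> (\<forall>(x, y)\<in>D. a \<le> x \<and> x \<le> y \<and> y \<le> b) \<Longrightarrow>
        pairwise (\<lambda>(x, y) (x', y'). {x<..<y} \<inter> {x'<..<y'} = {}) D \<Longrightarrow>
        (\<Sum>(x, y)\<in>D. y - x) < \<delta> \<Longrightarrow> (\<Sum>(x, y)\<in>D. \<bar>f y - f x\<bar>) < \<epsilon>"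
    by (rule abs_cont_onE[OF assms(1)]) (rule that)
  show "\<exists>\<delta>>0. \<forall>D. finite D \<and> (\<forall>(x, y)\<in>D. c \<le> x \<and> x \<le> y \<and> y \<le> d) \<and>
        pairwise (\<lambda>(x, y) (x', y'). {x<..<y} \<inter> {x'<..<y'} = {}) D \<and>
        (\<Sum>(x, y)\<in>D. y - x) < \<delta> \<longrightarrow> (\<Sum>(x, y)\<in>D. \<bar>f y - f x\<bar>) < \<epsilon>"
  proof (intro exI[of _ \<delta>] conjI allI impI \<delta>(1))
    fix D :: "(real \<times> real) set"
    assume D: "finite D \<and> (\<forall>(x, y)\<in>D. c \<le> x \<and> x \<le> y \<and> y \<le> d) \<and>
        pairwise (\<lambda>(x, y) (x', y'). {x<..<y} \<inter> {x'<..<y'} = {}) D \<and> (\<Sum>(x, y)\<in>D. y - x) < \<delta>"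
    then have "\<forall>(x, y)\<in>D. a \<le> x \<and> x \<le> y \<and> y \<le> b" using assms(2,3) by fastforce
    then show "(\<Sum>(x, y)\<in>D. \<bar>f y - f x\<bar>) < \<epsilon>" using D by (intro \<delta>(2)) auto
  qed
qed

lemma abs_cont_on_continuous:
  assumes "abs_cont_on a b f"
  shows "continuous_on {a..b} f"
  unfolding continuous_on_iff
proof (intro ballI allI impI)
  fix x \<epsilon> :: real assume x: "x \<in> {a..b}" and "\<epsilon> > 0"
  from \<open>\<epsilon> > 0\<close> obtain \<delta> where \<delta>: "\<delta> > 0" "\<And>D::(real \<times> real) set. finite D \<Longrightarrow> (\<forall>(x, y)\<in>D. a \<le> x \<and> x \<le> y \<and> y \<le> b) \<Longrightarrow>
        pairwise (\<lambda>(x, y) (x', y'). {x<..<y} \<inter> {x'<..<y'} = {}) D \<Longrightarrow>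
        (\<Sum>(x, y)\<in>D. y - x) < \<delta> \<Longrightarrow> (\<Sum>(x, y)\<in>D. \<bar>f y - f x\<bar>) < \<epsilon>"
    by (rule abs_cont_onE[OF assms]) (rule that)
  have "dist (f y) (f x) < \<epsilon>" if y: "y \<in> {a..b}" "dist y x < \<delta>" for y
    using \<delta>(2)[of "{(min x y, max x y)}"] x y
    by (cases "x \<le> y") (auto simp: dist_real_def min_def max_def)
  then show "\<exists>d>0. \<forall>x'\<in>{a..b}. dist x' x < d \<longrightarrow> dist (f x') (f x) < \<epsilon>" using \<delta>(1) by blast
qed

subsection \<open>Identities from local estimates\<close>

text \<open>An additive function of intervals that is small relative to the length, and to an integral,
  on all short intervals, vanishes.\<close>

lemma increment_eq_integral_of_local:
  fixes \<Psi> \<rho> k :: "real \<Rightarrow> real"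
  assumes \<rho>: "\<rho> integrable_on {0..T}" and k: "k integrable_on {0..T}"
    and loc: "\<And>\<epsilon>. \<epsilon> > 0 \<Longrightarrow> \<exists>\<delta>>0. \<forall>s t. 0 \<le> s \<and> s \<le> t \<and> t \<le> T \<and> t - s < \<delta> \<longrightarrow>
        \<bar>\<Psi> t - \<Psi> s - integral {s..t} \<rho>\<bar> \<le> \<epsilon> * integral {s..t} k"
    and st: "0 \<le> s" "s \<le> t" "t \<le> T"
  shows "\<Psi> t - \<Psi> s = integral {s..t} \<rho>"
proof -
  let ?K = "\<bar>integral {s..t} k\<bar>"
  have est: "\<bar>\<Psi> t - \<Psi> s - integral {s..t} \<rho>\<bar> \<le> \<epsilon> * ?K" if \<epsilon>: "\<epsilon> > 0" for \<epsilon>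
  proof -
    obtain \<delta> where \<delta>: "\<delta> > 0" "\<And>s t. 0 \<le> s \<Longrightarrow> s \<le> t \<Longrightarrow> t \<le> T \<Longrightarrow> t - s < \<delta> \<Longrightarrow>
        \<bar>\<Psi> t - \<Psi> s - integral {s..t} \<rho>\<bar> \<le> \<epsilon> * integral {s..t} k"
      using loc[OF \<epsilon>] by blast
    obtain n :: nat where n: "(t - s) / \<delta> < real n" using reals_Archimedean2 by blast
    then have n0: "real n > 0" using st \<delta>(1) by (smt (verit) divide_nonneg_pos)
    define h where "h = (t - s) / real n"
    have h: "0 \<le> h" "h < \<delta>" "real n * h = t - s" using n n0 st \<delta>(1) by (auto simp: h_def field_simps)
    have "\<bar>\<Psi> (s + real i * h) - \<Psi> s - integral {s..s + real i * h} \<rho>\<bar> \<le> \<epsilon> * integral {s..s + real i * h} k"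
      if "i \<le> n" for i
      using that
    proof (induction i)
      case (Suc i)
      let ?x = "s + real i * h" and ?y = "s + real (Suc i) * h"
      have y: "?y \<le> t" using h Suc.prems mult_right_mono[of "real (Suc i)" "real n" h] by simp
      have xy: "s \<le> ?x" "?x \<le> ?y" "?y - ?x < \<delta>" using h by (auto simp: algebra_simps)
      have comb: "integral {s..?y} f = integral {s..?x} f + integral {?x..?y} f"
        if "f integrable_on {0..T}" for f :: "real \<Rightarrow> real"
      proof -
        have "f integrable_on {s..?y}" using integrable_subinterval_real[OF that, of s ?y] st y by auto
        then show ?thesis using Henstock_Kurzweil_Integration.integral_combine[of s ?x ?y f] xy by simp
      qed
      have "\<bar>\<Psi> ?y - \<Psi> ?x - integral {?x..?y} \<rho>\<bar> \<le> \<epsilon> * integral {?x..?y} k"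
        using st y xy by (intro \<delta>(2)) auto
      moreover have "\<bar>\<Psi> ?x - \<Psi> s - integral {s..?x} \<rho>\<bar> \<le> \<epsilon> * integral {s..?x} k"
        using Suc by simp
      ultimately show ?case unfolding comb[OF \<rho>] comb[OF k] by (simp add: distrib_left)
    qed simp
    from this[of n] have "\<bar>\<Psi> t - \<Psi> s - integral {s..t} \<rho>\<bar> \<le> \<epsilon> * integral {s..t} k" using h(3) by simp
    also have "\<dots> \<le> \<epsilon> * ?K" using \<epsilon> by (intro mult_left_mono) auto
    finally show ?thesis .
  qed
  have "\<bar>\<Psi> t - \<Psi> s - integral {s..t} \<rho>\<bar> \<le> 0 + e" if "e > 0" for e
  proof -
    have "\<bar>\<Psi> t - \<Psi> s - integral {s..t} \<rho>\<bar> \<le> e / (?K + 1) * ?K" using that by (intro est) simp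
    also have "\<dots> \<le> e" using that by (simp add: field_simps)
    finally show ?thesis by simp
  qed
  then have "\<bar>\<Psi> t - \<Psi> s - integral {s..t} \<rho>\<bar> \<le> 0" by (rule field_le_epsilon)
  then show ?thesis by simp
qed

subsection \<open>Differential inequalities\<close>

text \<open>Gronwall's inequality from below, for a function that need not be differentiable.\<close>

lemma linear_growth_integral_inequality:
  fixes L :: "real \<Rightarrow> real"
  assumes C: "C > 0" and cont: "continuous_on {0..T} L"
    and ge: "\<And>t. t \<in> {0..T} \<Longrightarrow> L t - L 0 \<ge> C * integral {0..t} L" and t: "t \<in> {0..T}"
  shows "L t \<ge> L 0 * exp (C * t)"
proof -
  define N where "N s = integral {0..s} L * exp (- C * s) + L 0 / C * exp (- C * s)" for s
  have "N 0 \<le> N t"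
  proof (rule DERIV_nonneg_imp_increasing_open[where f=N and a=0 and b=t])
    show "continuous_on {0..t} N"
      unfolding N_def using cont t
      by (intro continuous_intros indefinite_integral_continuous_1 integrable_continuous_interval)
        (auto intro: continuous_on_subset)
    fix s assume s: "0 < s" "s < t"
    have "((\<lambda>x. integral {0..x} L) has_real_derivative L s) (at s within {0..T})"
      using s t by (intro integral_has_real_derivative[OF cont]) auto
    then have d: "((\<lambda>x. integral {0..x} L) has_real_derivative L s) (at s)"
      using s t at_within_interior[of s "{0..T}"] by simp
    have "(N has_real_derivative (L s * exp (- C * s) + integral {0..s} L * (exp (- C * s) * - C)
        + L 0 / C * (exp (- C * s) * - C))) (at s)"
      unfolding N_def by (auto intro!: derivative_eq_intros d)
    moreover have "L s * exp (- C * s) + integral {0..s} L * (exp (- C * s) * - C) + L 0 / C * (exp (- C * s) * - C)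
       = exp (- C * s) * (L s - L 0 - C * integral {0..s} L)"
      using C by (simp add: field_simps)
    moreover have "\<dots> \<ge> 0" using ge[of s] s t by simp
    ultimately show "\<exists>y. (N has_real_derivative y) (at s) \<and> 0 \<le> y" by auto
  qed (use t in auto)
  then have "L 0 / C \<le> (integral {0..t} L + L 0 / C) * exp (- C * t)"
    by (simp add: N_def distrib_right)
  then have "L 0 / C * exp (C * t) \<le> (integral {0..t} L + L 0 / C) * exp (- C * t) * exp (C * t)"
    by (intro mult_right_mono) auto
  also have "\<dots> = integral {0..t} L + L 0 / C" by (simp add: mult.assoc flip: exp_add)
  finally have "L 0 * exp (C * t) \<le> C * integral {0..t} L + L 0"
    using C by (simp add: field_simps)
  then show ?thesis using ge[OF t] by linarith
qed

text \<open>Levine's concavity argument in integrated form: \<open>Z = \<Phi>'(a) + \<gamma> \<integral> \<Phi>'\<^sup>2/\<Phi>\<close> is a lower bound of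
  \<open>\<Phi>'\<close>, \<open>Z / \<Phi>\<^sup>\<gamma>\<close> increases, and so \<open>\<Phi>\<^sup>1\<^sup>-\<^sup>\<gamma>\<close> decreases at least linearly.\<close>

lemma concavity_lifespan_bound:
  fixes \<Phi> \<Phi>' :: "real \<Rightarrow> real"
  assumes ab: "a \<le> b" and \<gamma>: "\<gamma> > 1"
    and cont: "continuous_on {a..b} \<Phi>" "continuous_on {a..b} \<Phi>'"
    and der: "\<And>t. a < t \<Longrightarrow> t < b \<Longrightarrow> (\<Phi> has_real_derivative \<Phi>' t) (at t)"
    and pos: "\<And>t. t \<in> {a..b} \<Longrightarrow> \<Phi> t > 0" and pos': "\<Phi>' a > 0"
    and ge: "\<And>t. t \<in> {a..b} \<Longrightarrow> \<Phi>' t - \<Phi>' a \<ge> \<gamma> * integral {a..t} (\<lambda>s. (\<Phi>' s)\<^sup>2 / \<Phi> s)"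
  shows "(\<gamma> - 1) * \<Phi>' a * (b - a) < \<Phi> a"
proof -
  define I where "I = (\<lambda>s. (\<Phi>' s)\<^sup>2 / \<Phi> s)"
  have Ic: "continuous_on {a..b} I"
    unfolding I_def using cont pos by (intro continuous_intros) (auto simp: less_imp_neq[symmetric])
  have I0: "I s \<ge> 0" if "s \<in> {a..b}" for s unfolding I_def using pos[OF that] by simp
  define Z where "Z t = \<Phi>' a + \<gamma> * integral {a..t} I" for t
  have Zc: "continuous_on {a..b} Z"
    unfolding Z_def using Ic by (intro continuous_intros indefinite_integral_continuous_1 integrable_continuous_interval)
  have Zd: "(Z has_real_derivative \<gamma> * I t) (at t)" if t: "a < t" "t < b" for t
  proof -
    have "((\<lambda>x. integral {a..x} I) has_real_derivative I t) (at t within {a..b})"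
      using t by (intro integral_has_real_derivative[OF Ic]) auto
    then have "((\<lambda>x. integral {a..x} I) has_real_derivative I t) (at t)"
      using t at_within_interior[of t "{a..b}"] by simp
    then show ?thesis unfolding Z_def by (auto intro!: derivative_eq_intros)
  qed
  have Zpos: "Z t > 0" if t: "t \<in> {a..b}" for t
  proof -
    have "integral {a..t} I \<ge> 0"
      using t I0 Ic by (intro integral_nonneg integrable_continuous_interval) (auto intro: continuous_on_subset)
    then show ?thesis unfolding Z_def using pos' \<gamma> by (simp add: add_pos_nonneg)
  qed
  have Zle: "Z t \<le> \<Phi>' t" if "t \<in> {a..b}" for t using ge[OF that] by (simp add: Z_def I_def)
  define Y where "Y t = Z t * \<Phi> t powr (- \<gamma>)" for t
  have ne: "\<And>t. t \<in> {a..b} \<Longrightarrow> \<Phi> t \<noteq> 0" using pos by fastforce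
  have Ymono: "Y a \<le> Y t" if t: "t \<in> {a..b}" for t
  proof (rule DERIV_nonneg_imp_increasing_open[where f=Y and a=a and b=t])
    show "continuous_on {a..t} Y"
      unfolding Y_def using t ne by (intro continuous_intros continuous_on_subset[OF Zc] continuous_on_subset[OF cont(1)]) auto
    fix s assume s: "a < s" "s < t"
    then have s': "s \<in> {a..b}" "s < b" using t by auto
    have p: "\<Phi> s > 0" by (rule pos[OF s'(1)])
    have "(Y has_real_derivative \<gamma> * I s * \<Phi> s powr (- \<gamma>) + Z s * (- \<gamma> * \<Phi> s powr (- \<gamma> - 1) * \<Phi>' s)) (at s)"
      unfolding Y_def
      by (auto intro!: derivative_eq_intros Zd der s s'(2) DERIV_fun_powr[THEN DERIV_cong] p simp: p)
    moreover have "\<gamma> * I s * \<Phi> s powr (- \<gamma>) + Z s * (- \<gamma> * \<Phi> s powr (- \<gamma> - 1) * \<Phi>' s)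
        = \<gamma> * \<Phi> s powr (- \<gamma>) / \<Phi> s * \<Phi>' s * (\<Phi>' s - Z s)"
      using p by (simp add: I_def powr_diff field_simps power2_eq_square)
    moreover have "\<dots> \<ge> 0" using p \<gamma> Zle[OF s'(1)] Zpos[OF s'(1)] by (intro mult_nonneg_nonneg) auto
    ultimately show "\<exists>y. (Y has_real_derivative y) (at s) \<and> 0 \<le> y" by auto
  qed (use t in auto)
  define X where "X t = - (\<Phi> t powr (1 - \<gamma>)) - (\<gamma> - 1) * Y a * t" for t
  have "X a \<le> X b"
  proof (rule DERIV_nonneg_imp_increasing_open[where f=X, OF ab])
    show "continuous_on {a..b} X"
      unfolding X_def using ne by (intro continuous_intros cont(1)) auto
    fix s assume s: "a < s" "s < b"
    then have s': "s \<in> {a..b}" by auto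
    have p: "\<Phi> s > 0" by (rule pos[OF s'])
    have "(X has_real_derivative - ((1 - \<gamma>) * \<Phi> s powr (1 - \<gamma> - 1) * \<Phi>' s) - (\<gamma> - 1) * Y a) (at s)"
      unfolding X_def
      by (auto intro!: derivative_eq_intros der s DERIV_fun_powr[THEN DERIV_cong] p simp: p)
    moreover have "- ((1 - \<gamma>) * \<Phi> s powr (1 - \<gamma> - 1) * \<Phi>' s) - (\<gamma> - 1) * Y a
        = (\<gamma> - 1) * (\<Phi> s powr (- \<gamma>) * \<Phi>' s - Y a)"
      by (simp add: algebra_simps)
    moreover have "Y a \<le> \<Phi> s powr (- \<gamma>) * \<Phi>' s"
      using Ymono[OF s'] mult_left_mono[OF Zle[OF s'], of "\<Phi> s powr (- \<gamma>)"] by (simp add: Y_def mult.commute)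
    ultimately show "\<exists>y. (X has_real_derivative y) (at s) \<and> 0 \<le> y" using \<gamma> by auto
  qed
  then have "(\<gamma> - 1) * Y a * (b - a) \<le> \<Phi> a powr (1 - \<gamma>) - \<Phi> b powr (1 - \<gamma>)"
    by (simp add: X_def algebra_simps)
  also have "\<dots> < \<Phi> a powr (1 - \<gamma>)" using pos[of b] ab by simp
  finally have "(\<gamma> - 1) * (\<Phi>' a * \<Phi> a powr (- \<gamma>)) * (b - a) < \<Phi> a * \<Phi> a powr (- \<gamma>)"
    using pos[of a] ab by (simp add: Y_def Z_def powr_diff powr_minus divide_inverse)
  then have "\<Phi> a powr (- \<gamma>) * ((\<gamma> - 1) * \<Phi>' a * (b - a)) < \<Phi> a powr (- \<gamma>) * \<Phi> a" by (simp add: algebra_simps)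
  then show ?thesis using pos[of a] ab by (simp add: mult_less_cancel_left_pos)
qed

subsection \<open>Integrals over time intervals\<close>

lemma integrable_open_imp_HK:
  fixes f :: "real \<Rightarrow> real"
  assumes "integrable (lebesgue_on {0<..<T}) f"
  shows "f integrable_on {0..T}" "f absolutely_integrable_on {0..T}"
    "(\<integral>t. f t \<partial>lebesgue_on {0<..<T}) = integral {0..T} f"
proof -
  show i: "f integrable_on {0..T}"
    using integrable_on_lebesgue_on[OF assms] integrable_on_open_interval_real by auto
  have "(\<lambda>t. norm (f t)) integrable_on {0..T}"
    using integrable_on_lebesgue_on[of "{0<..<T}" "\<lambda>t. norm (f t)"] assms integrable_on_open_interval_real by auto
  then show "f absolutely_integrable_on {0..T}" using i by (simp add: absolutely_integrable_on_def)
  show "(\<integral>t. f t \<partial>lebesgue_on {0<..<T}) = integral {0..T} f"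
    using lebesgue_integral_eq_integral[OF assms] by (simp add: integral_open_interval_real)
qed

lemma integrable_on_subinterval_0T:
  fixes f :: "real \<Rightarrow> real"
  shows "f integrable_on {0..T} \<Longrightarrow> 0 \<le> s \<Longrightarrow> t \<le> T \<Longrightarrow> f integrable_on {s..t}"
  by (rule integrable_subinterval_real) auto

text \<open>A function of two variables that is measurable in the first and continuous in the second one is
  measurable along the diagonal: approximate the second argument by multiples of \<open>T/n\<close>.\<close>

lemma measurable_diagonal:
  fixes h :: "real \<Rightarrow> real \<Rightarrow> real"
  assumes T: "T > 0"
    and meas: "\<And>r. r \<in> {0..T} \<Longrightarrow> (\<lambda>s. h s r) \<in> borel_measurable (lebesgue_on {0<..<T})"
    and cont: "\<And>s. s \<in> {0<..<T} \<Longrightarrow> continuous_on {0..T} (h s)"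
  shows "(\<lambda>s. h s s) \<in> borel_measurable (lebesgue_on {0<..<T})"
proof -
  let ?M = "lebesgue_on {0<..<T}"
  \<comment> \<open>Clamping to \<open>[0, T]\<close> keeps the approximating arguments in the domain.\<close>
  define c where "c r = max 0 (min T r)" for r
  define \<tau> where "\<tau> n s = real_of_int \<lfloor>s * real (Suc n)\<rfloor> / real (Suc n)" for n s
  have cT: "c r \<in> {0..T}" for r using T by (auto simp: c_def)
  have borel: "f \<in> borel_measurable ?M" if "f \<in> borel_measurable borel" for f :: "real \<Rightarrow> real"
    using that by (intro measurable_restrict_space1 measurable_completion) simp
  have "(\<lambda>s. h s (c (\<tau> n s))) \<in> borel_measurable ?M" for n
  proof -
    have "(\<lambda>s. (\<lambda>(i::int) s. h s (c (real_of_int i / real (Suc n)))) \<lfloor>s * real (Suc n)\<rfloor> s) \<in> borel_measurable ?M"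
    proof (rule measurable_compose_countable[where f="\<lambda>(i::int) s. h s (c (real_of_int i / real (Suc n)))"])
      show "(\<lambda>s. h s (c (real_of_int i / real (Suc n)))) \<in> borel_measurable ?M" for i by (rule meas[OF cT])
      have "(\<lambda>s. s * real (Suc n)) \<in> borel_measurable ?M" by (rule borel) simp
      then show "(\<lambda>s. \<lfloor>s * real (Suc n)\<rfloor>) \<in> ?M \<rightarrow>\<^sub>M count_space UNIV"
        by (rule measurable_compose[OF _ measurable_real_floor])
    qed
    then show ?thesis by (simp add: \<tau>_def)
  qed
  moreover have "(\<lambda>n. h s (c (\<tau> n s))) \<longlonglongrightarrow> h s s" if s: "s \<in> space ?M" for s
  proof -
    have sT: "s \<in> {0<..<T}" using s by simp
    have le: "\<bar>\<tau> n s - s\<bar> \<le> inverse (real (Suc n))" for n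
    proof -
      have "\<bar>real_of_int \<lfloor>s * real (Suc n)\<rfloor> - s * real (Suc n)\<bar> \<le> 1" by linarith
      moreover have "\<tau> n s - s = (real_of_int \<lfloor>s * real (Suc n)\<rfloor> - s * real (Suc n)) / real (Suc n)"
        unfolding \<tau>_def diff_divide_distrib by simp
      ultimately show ?thesis by (simp add: abs_divide inverse_eq_divide divide_right_mono del: of_nat_Suc)
    qed
    have "(\<lambda>n. \<tau> n s - s) \<longlonglongrightarrow> 0"
      by (rule Lim_null_comparison[OF _ LIMSEQ_inverse_real_of_nat]) (use le in auto)
    then have "(\<lambda>n. \<tau> n s) \<longlonglongrightarrow> s" by (simp add: LIM_zero_iff)
    then have "(\<lambda>n. c (\<tau> n s)) \<longlonglongrightarrow> c s" unfolding c_def by (intro tendsto_intros)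
    moreover have "c s = s" using sT by (simp add: c_def)
    ultimately have lim: "(\<lambda>n. c (\<tau> n s)) \<longlonglongrightarrow> s" by simp
    have "(h s \<longlongrightarrow> h s s) (at s within {0..T})"
      using cont[OF sT] sT by (simp add: continuous_on_def)
    then show ?thesis
      using lim cT by (intro continuous_within_tendsto_compose'[of s "{0..T}" "h s"])
        (auto simp: continuous_within)
  qed
  ultimately show ?thesis by (rule borel_measurable_LIMSEQ_metric)
qed

lemma box_bump_real_support:
  "x \<notin> {a<..<c} \<Longrightarrow> box_bump a c k x = 0" for a c x :: real
  using box_bump_outside[of x a c k] by simp

text \<open>The lemma of du Bois-Reymond: test with \<open>\<phi>\<close> rising from 0 to 1 just after \<open>s\<close> and falling back to
  0 just after \<open>t\<close>.\<close>

lemma du_Bois_Reymond_interior: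
  fixes f w :: "real \<Rightarrow> real"
  assumes f: "continuous_on {0..T} f" and w: "integrable (lebesgue_on {0<..<T}) w"
    and weak: "\<And>\<phi>. \<phi> \<in> test_fun {0<..<T} \<Longrightarrow>
      (\<integral>x. deriv \<phi> x * f x \<partial>lebesgue_on {0<..<T}) = - (\<integral>x. \<phi> x * w x \<partial>lebesgue_on {0<..<T})"
    and st: "0 < s" "s < t" "t < T"
  shows "f t - f s = integral {s..t} w"
proof -
  let ?M = "lebesgue_on {0<..<T}"
  interpret B: bounded_open_set "{0<..<T}" by unfold_locales auto
  define h where "h = min (t - s) (T - t)"
  have h: "h > 0" "s + h \<le> t" "t + h \<le> T" using st by (auto simp: h_def)
  \<comment> \<open>The length of the two ramps of \<open>\<phi>\<close>, short enough for them to be disjoint and inside \<open>(0, T)\<close>.\<close>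
  define \<epsilon> where "\<epsilon> n = h / real (n + 2)" for n
  have \<epsilon>: "0 < \<epsilon> n" "\<epsilon> n < h" for n
    using h(1) add_pos_nonneg[OF h(1) mult_nonneg_nonneg[OF less_imp_le[OF h(1)] of_nat_0_le_iff[of n]]]
    by (auto simp: \<epsilon>_def field_simps)
  have \<epsilon>0: "\<epsilon> \<longlonglongrightarrow> 0"
    unfolding \<epsilon>_def by (rule LIMSEQ_ignore_initial_segment[where k=2, of "\<lambda>n. h / real n"]) (rule lim_const_over_n)
  define b where "b n a = box_bump a (a + \<epsilon> n) 0" for n and a :: real
  have b_test: "b n a \<in> test_fun {0<..<T}" if "0 < a" "a + \<epsilon> n < T" for n a
    unfolding b_def using that by (intro box_bump_test_fun) auto
  have b_smooth: "smooth_on UNIV (b n a)" for n a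
    using test_fun_smooth[OF box_bump_test_fun[of a "a + \<epsilon> n" UNIV 0]] by (simp add: b_def)
  have b_cont: "continuous_on S (b n a)" for n a S
    using smooth_on_continuous[OF b_smooth] continuous_on_subset by blast
  have b_nn: "0 \<le> b n a x" for n a x by (simp add: b_def box_bump_nonneg)
  have b_out: "b n a x = 0" if "x \<notin> {a<..<a + \<epsilon> n}" for n a x
    using box_bump_real_support[OF that] by (simp add: b_def)
  have b_int: "b n a integrable_on {x..y}" for n a x y
    by (intro integrable_continuous_interval b_cont)
  define J where "J n a = integral {a..a + \<epsilon> n} (b n a)" for n a
  have J_shift: "J n a = J n 0" for n a
  proof -
    have eq: "b n a = (\<lambda>x. b n 0 (x + - a))" by (rule ext) (simp add: b_def box_bump_def algebra_simps)
    have "integral {a..a + \<epsilon> n} (b n a) = integral {a..a + \<epsilon> n} (\<lambda>x. b n 0 (x + - a))"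
      by (rule arg_cong[OF eq])
    also have "\<dots> = integral {0..\<epsilon> n} (b n 0)"
      using integral_shift_real_ivl[of 0 "-a" "\<epsilon> n" "b n 0"] by (simp add: add.commute)
    finally show ?thesis by (simp add: J_def)
  qed
  have J_pos: "J n 0 > 0" for n
  proof -
    have "J n 0 \<noteq> 0"
    proof
      assume "J n 0 = 0"
      then have "b n 0 x = 0" if "x \<in> {0..\<epsilon> n}" for x
        using integral_eq_0_iff[of 0 "\<epsilon> n" "b n 0"] b_cont b_nn \<epsilon>(1)[of n] that by (simp add: J_def)
      from this[of "\<epsilon> n / 2"] show False
        using box_bump_pos[of "\<epsilon> n / 2" 0 "\<epsilon> n" 0] \<epsilon>(1)[of n] by (simp add: b_def)
    qed
    moreover have "J n 0 \<ge> 0" unfolding J_def by (intro integral_nonneg b_int b_nn)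
    ultimately show ?thesis by linarith
  qed
  define j where "j n = J n 0" for n
  define \<psi> where "\<psi> n x = (b n s x - b n t x) / j n" for n x
  define \<phi> where "\<phi> n x = integral {0..x} (\<psi> n)" for n x
  have \<psi>_cont: "continuous_on S (\<psi> n)" for n S
    unfolding \<psi>_def using J_pos by (intro continuous_intros b_cont) (simp add: j_def less_imp_neq[symmetric])
  have \<psi>_smooth: "smooth_on UNIV (\<psi> n)" for n
  proof -
    have "smooth_on UNIV (\<lambda>x. b n s x * (1 / j n) + b n t x * (- 1 / j n))"
      by (intro smooth_on_add smooth_on_mult b_smooth smooth_on_const)
    then show ?thesis unfolding \<psi>_def by (simp add: diff_divide_distrib)
  qed
  have piece: "integral {0..x} (b n a) = (if x \<le> a then 0 else if a + \<epsilon> n \<le> x then j n else integral {a..x} (b n a))"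
    if a: "0 < a" for n a x
  proof -
    have zero: "integral {y..z} (b n a) = 0" if "z \<le> a \<or> a + \<epsilon> n \<le> y" for y z
    proof -
      have "integral {y..z} (b n a) = integral {y..z} (\<lambda>_. 0)"
        by (rule Henstock_Kurzweil_Integration.integral_cong) (use that b_out in auto)
      then show ?thesis by simp
    qed
    have comb: "integral {y..z} (b n a) = integral {y..m} (b n a) + integral {m..z} (b n a)" if "y \<le> m" "m \<le> z" for y m z
      using Henstock_Kurzweil_Integration.integral_combine[OF that b_int] by simp
    show ?thesis
      using zero[of x 0] zero[of a 0] zero[of x "a + \<epsilon> n"] comb[of 0 a x] comb[of a "a + \<epsilon> n" x] a \<epsilon>(1)[of n] J_shift[of n a]
      by (auto simp: j_def J_def)
  qed
  have \<phi>_eq: "\<phi> n x = (integral {0..x} (b n s) - integral {0..x} (b n t)) / j n" for n x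
    unfolding \<phi>_def \<psi>_def using b_int by (simp add: Henstock_Kurzweil_Integration.integral_diff integral_divide)
  have part: "0 \<le> integral {0..x} (b n a) \<and> integral {0..x} (b n a) \<le> j n" if "0 < a" for n a x
  proof (cases "a < x \<and> x < a + \<epsilon> n")
    case True
    have "integral {a..x} (b n a) \<le> integral {a..a + \<epsilon> n} (b n a)"
      by (rule integral_subset_le) (use True b_int b_nn in auto)
    then have "integral {a..x} (b n a) \<le> j n" using J_shift[of n a] by (simp add: j_def J_def)
    moreover have "0 \<le> integral {a..x} (b n a)" by (intro integral_nonneg b_int b_nn)
    ultimately show ?thesis using True piece[OF that, of x n] by simp
  next
    case False
    then show ?thesis using piece[OF that, of x n] J_pos[of n] by (auto simp: j_def)
  qed
  have \<phi>_bd: "\<bar>\<phi> n x\<bar> \<le> 1" for n x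
    unfolding \<phi>_eq using part[of s x n] part[of t x n] st J_pos[of n] by (simp add: j_def abs_le_iff divide_le_eq le_divide_eq)
  have \<phi>_out: "\<phi> n x = 0" if out: "x \<notin> {s..t + \<epsilon> n}" for n x
  proof -
    consider "x < s" | "x > t + \<epsilon> n" using out by (auto simp: not_le)
    then show ?thesis using piece[of s x n] piece[of t x n] st h \<epsilon>[of n] unfolding \<phi>_eq by cases auto
  qed
  have \<phi>_in: "\<phi> n x = 1" if "s + \<epsilon> n \<le> x" "x \<le> t" for n x
    using piece[of s x n] piece[of t x n] st h \<epsilon>[of n] that J_pos[of n] unfolding \<phi>_eq by (simp add: j_def)
  have \<phi>_der: "(\<phi> n has_real_derivative \<psi> n x) (at x)" for n x
  proof (cases "x < s")
    case True
    have "((\<lambda>_. 0) has_real_derivative \<psi> n x) (at x)"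
      using True b_out[of x s n] b_out[of x t n] st by (simp add: \<psi>_def)
    then show ?thesis
      by (rule has_field_derivative_transform_within_open[where S="{..<s}"]) (use True \<phi>_out in auto)
  next
    case False
    have "((\<lambda>x. integral {0..x} (\<psi> n)) has_real_derivative \<psi> n x) (at x within {0..x + 1})"
      using False st by (intro integral_has_real_derivative \<psi>_cont) auto
    then show ?thesis unfolding \<phi>_def using False st at_within_interior[of x "{0..x + 1}"] by simp
  qed
  have \<phi>_fd: "frechet_derivative (\<phi> n) (at x) = (\<lambda>y. \<psi> n x * y)" for n x
    using \<phi>_der[of n x] by (intro frechet_derivative_eqI) (simp add: has_field_derivative_def)
  have \<phi>_test: "\<phi> n \<in> test_fun {0<..<T}" for n
  proof (rule test_funI[of _ "{s..t + \<epsilon> n}"])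
    have "Ck_on k UNIV (\<phi> n)" for k
    proof (cases k)
      case 0
      have "isCont (\<phi> n) x" for x using \<phi>_der[of n x] by (rule DERIV_isCont)
      then show ?thesis using 0 by (simp add: continuous_at_imp_continuous_on)
    next
      case (Suc m)
      have "Ck_on m UNIV (\<psi> n)" using \<psi>_smooth by (simp add: smooth_on_def)
      then show ?thesis
        using Suc \<phi>_der[of n] by (auto simp: \<phi>_fd has_field_derivative_def differentiable_def)
    qed
    then show "smooth_on UNIV (\<phi> n)" by (simp add: smooth_on_def)
    show "{s..t + \<epsilon> n} \<subseteq> {0<..<T}" using st h \<epsilon>[of n] by auto
  qed (use \<phi>_out in auto)
  have eqn: "(\<integral>x. \<psi> n x * f x \<partial>?M) = - (\<integral>x. \<phi> n x * w x \<partial>?M)" for n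
    using weak[OF \<phi>_test, of n] DERIV_imp_deriv[OF \<phi>_der] by simp
  have wm [measurable]: "w \<in> borel_measurable ?M" using w by auto
  have "(\<lambda>n. \<integral>x. \<phi> n x * w x \<partial>?M) \<longlonglongrightarrow> (\<integral>x. indicator {s<..t} x * w x \<partial>?M)"
  proof (rule integral_dominated_convergence[where w="\<lambda>x. \<bar>w x\<bar>"])
    have [measurable]: "\<phi> n \<in> borel_measurable ?M" for n by (rule B.test_fun_measurable[OF \<phi>_test])
    show "(\<lambda>x. \<phi> n x * w x) \<in> borel_measurable ?M" for n by measurable
    have "indicator {s<..t} \<in> borel_measurable ?M"
      by (intro measurable_restrict_space1 measurable_completion) simp
    then show "(\<lambda>x. indicator {s<..t} x * w x) \<in> borel_measurable ?M" by measurable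
    show "AE x in ?M. norm (\<phi> n x * w x) \<le> \<bar>w x\<bar>" for n
      using \<phi>_bd[of n] by (intro AE_I2) (simp add: abs_mult mult_left_le_one_le)
    show "AE x in ?M. (\<lambda>n. \<phi> n x * w x) \<longlonglongrightarrow> indicator {s<..t} x * w x"
    proof (intro AE_I2 tendsto_intros)
      fix x
      show "(\<lambda>n. \<phi> n x) \<longlonglongrightarrow> indicator {s<..t} x"
      proof (cases "x \<in> {s<..t}")
        case True
        then have "\<forall>\<^sub>F n in sequentially. \<epsilon> n < x - s" using \<epsilon>0 by (intro order_tendstoD) auto
        then have "\<forall>\<^sub>F n in sequentially. \<phi> n x = 1"
          by eventually_elim (use True in \<open>auto intro!: \<phi>_in\<close>)
        then show ?thesis using True by (simp add: tendsto_eventually)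
      next
        case False
        show ?thesis
        proof (cases "x \<le> s")
          case True
          then have "\<phi> n x = 0" for n using piece[of s x n] piece[of t x n] st unfolding \<phi>_eq by simp
          then show ?thesis using False by simp
        next
          case gt: False
          then have "x > t" using False by auto
          then have "\<forall>\<^sub>F n in sequentially. \<epsilon> n < x - t" using \<epsilon>0 by (intro order_tendstoD) auto
          then have "\<forall>\<^sub>F n in sequentially. \<phi> n x = 0"
            by eventually_elim (auto intro!: \<phi>_out)
          then show ?thesis using False by (simp add: tendsto_eventually)
        qed
      qed
    qed
  qed (use w in auto)
  moreover have "(\<integral>x. indicator {s<..t} x * w x \<partial>?M) = integral {s..t} w"
  proof -
    have i: "integrable ?M (\<lambda>x. indicator {s<..t} x * w x)"
    proof -
      have "{s<..t} \<subseteq> {0<..<T}" using st by auto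
      then show ?thesis
        using integrable_mult_indicator[OF _ w, of "{s<..t}"] by (simp add: sets_restrict_space_iff)
    qed
    have "(\<integral>x. indicator {s<..t} x * w x \<partial>?M) = integral {0..T} (\<lambda>x. indicator {s<..t} x * w x)"
      by (rule integrable_open_imp_HK(3)[OF i])
    also have "\<dots> = integral {0..T} (\<lambda>x. if x \<in> {s..t} then w x else 0)"
      by (rule integral_spike[of "{s}"]) (auto simp: indicator_def)
    also have "\<dots> = integral {s..t} w"
    proof -
      have "{s..t} \<inter> {0..T} = {s..t}" using st by auto
      then show ?thesis by (simp only: integral_restrict_Int)
    qed
    finally show ?thesis .
  qed
  ultimately have "(\<lambda>n. \<integral>x. \<phi> n x * w x \<partial>?M) \<longlonglongrightarrow> integral {s..t} w" by simp
  from tendsto_minus[OF this] have lim_w: "(\<lambda>n. \<integral>x. \<psi> n x * f x \<partial>?M) \<longlonglongrightarrow> - integral {s..t} w"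
    by (simp add: eqn)
  have mol: "(\<lambda>n. integral {0..T} (\<lambda>x. b n a x / j n * f x)) \<longlonglongrightarrow> f a" if a: "0 < a" "a + h \<le> T" for a
  proof (rule LIMSEQ_I)
    fix e :: real assume e: "e > 0"
    have aT: "a \<in> {0..T}" using a h by auto
    obtain \<delta> where \<delta>: "\<delta> > 0" "\<And>x. x \<in> {0..T} \<Longrightarrow> \<bar>x - a\<bar> < \<delta> \<Longrightarrow> \<bar>f x - f a\<bar> < e / 2"
      using f[unfolded continuous_on_iff dist_real_def, THEN bspec, OF aT, rule_format, of "e / 2"] e by auto
    have "\<forall>\<^sub>F n in sequentially. \<epsilon> n < \<delta>" using \<epsilon>0 \<delta>(1) by (intro order_tendstoD) auto
    then obtain n0 where n0: "\<And>n. n \<ge> n0 \<Longrightarrow> \<epsilon> n < \<delta>" unfolding eventually_sequentially by blast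
    have "norm (integral {0..T} (\<lambda>x. b n a x / j n * f x) - f a) < e" if n: "n \<ge> n0" for n
    proof -
      have jn: "j n > 0" using J_pos by (simp add: j_def)
      have c1: "continuous_on {0..T} (\<lambda>x. b n a x / j n)" using jn by (intro continuous_intros b_cont) simp
      have i1: "(\<lambda>x. b n a x / j n * g x) integrable_on {0..T}" if "continuous_on {0..T} g" for g
        by (intro integrable_continuous_interval continuous_on_mult c1 that)
      have one: "integral {0..T} (\<lambda>x. b n a x / j n) = 1"
        using piece[of a T n] a h \<epsilon>[of n] jn by (simp add: integral_divide)
      then have "f a = integral {0..T} (\<lambda>x. b n a x / j n * f a)" by simp
      then have "integral {0..T} (\<lambda>x. b n a x / j n * f x) - f a
         = integral {0..T} (\<lambda>x. b n a x / j n * f x) - integral {0..T} (\<lambda>x. b n a x / j n * f a)" by simp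
      also have "\<dots> = integral {0..T} (\<lambda>x. b n a x / j n * (f x - f a))"
        unfolding right_diff_distrib
        by (rule Henstock_Kurzweil_Integration.integral_diff[symmetric]) (rule i1, intro f continuous_on_const)+
      also have "norm \<dots> \<le> integral {0..T} (\<lambda>x. b n a x / j n * (e / 2))"
      proof (rule Henstock_Kurzweil_Integration.integral_norm_bound_integral)
        show "(\<lambda>x. b n a x / j n * (f x - f a)) integrable_on {0..T}"
          by (rule i1) (intro continuous_intros f)
        show "(\<lambda>x. b n a x / j n * (e / 2)) integrable_on {0..T}" by (rule i1) simp
        fix x assume x: "x \<in> {0..T}"
        show "norm (b n a x / j n * (f x - f a)) \<le> b n a x / j n * (e / 2)"
        proof (cases "x \<in> {a<..<a + \<epsilon> n}")
          case True
          then have "\<bar>f x - f a\<bar> \<le> e / 2" using \<delta>(2)[OF x] n0[OF n] by (auto intro: less_imp_le)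
          moreover have "0 \<le> b n a x / j n" using b_nn[of n a x] jn by simp
          ultimately show ?thesis by (simp only: real_norm_def abs_mult abs_of_nonneg mult_left_mono)
        qed (simp add: b_out)
      qed
      also have "\<dots> = e / 2" using one by simp
      finally show ?thesis using e by simp
    qed
    then show "\<exists>no. \<forall>n\<ge>no. norm (integral {0..T} (\<lambda>x. b n a x / j n * f x) - f a) < e" by blast
  qed
  have "(\<integral>x. \<psi> n x * f x \<partial>?M)
     = integral {0..T} (\<lambda>x. b n s x / j n * f x) - integral {0..T} (\<lambda>x. b n t x / j n * f x)" for n
  proof -
    have c: "continuous_on {0..T} (\<lambda>x. b n a x / j n * f x)" for a
      using J_pos[of n] by (intro continuous_intros b_cont f) (simp add: j_def)
    have "continuous_on {0..T} (\<lambda>x. \<psi> n x * f x)" by (intro continuous_intros \<psi>_cont f)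
    then have "(\<lambda>x. \<psi> n x * f x) absolutely_integrable_on {0..T}"
      by (rule absolutely_integrable_continuous_real)
    then have "(\<lambda>x. \<psi> n x * f x) absolutely_integrable_on {0<..<T}"
      using absolutely_integrable_on_open_interval[where f="\<lambda>x. \<psi> n x * f x" and a=0 and b=T] by simp
    then have "integrable ?M (\<lambda>x. \<psi> n x * f x)" by (rule absolutely_integrable_imp_integrable) auto
    then have "(\<integral>x. \<psi> n x * f x \<partial>?M) = integral {0..T} (\<lambda>x. \<psi> n x * f x)" by (rule integrable_open_imp_HK(3))
    also have "\<dots> = integral {0..T} (\<lambda>x. b n s x / j n * f x - b n t x / j n * f x)"
      by (simp add: \<psi>_def diff_divide_distrib left_diff_distrib)
    also have "\<dots> = integral {0..T} (\<lambda>x. b n s x / j n * f x) - integral {0..T} (\<lambda>x. b n t x / j n * f x)"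
      by (intro Henstock_Kurzweil_Integration.integral_diff integrable_continuous_interval c)
    finally show ?thesis .
  qed
  then have "(\<lambda>n. \<integral>x. \<psi> n x * f x \<partial>?M) \<longlonglongrightarrow> f s - f t"
    using tendsto_diff[OF mol[of s] mol[of t]] st h by simp
  from LIMSEQ_unique[OF this lim_w] show ?thesis by simp
qed

text \<open>Both sides are continuous in the end points, so these may be 0 and \<open>T\<close>.\<close>

lemma du_Bois_Reymond:
  fixes f w :: "real \<Rightarrow> real"
  assumes f: "continuous_on {0..T} f" and w: "integrable (lebesgue_on {0<..<T}) w"
    and weak: "\<And>\<phi>. \<phi> \<in> test_fun {0<..<T} \<Longrightarrow>
      (\<integral>x. deriv \<phi> x * f x \<partial>lebesgue_on {0<..<T}) = - (\<integral>x. \<phi> x * w x \<partial>lebesgue_on {0<..<T})"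
    and st: "0 \<le> s" "s \<le> t" "t \<le> T"
  shows "f t - f s = integral {s..t} w"
proof (cases "s = t")
  case False
  then have st': "s < t" using st by simp
  have wi: "w integrable_on {0..T}" by (rule integrable_open_imp_HK(1)[OF w])
  define W where "W x = integral {0..x} w" for x
  have Wc: "continuous_on {0..T} W" unfolding W_def by (rule indefinite_integral_continuous_1[OF wi])
  have W: "integral {x..y} w = W y - W x" if "0 \<le> x" "x \<le> y" "y \<le> T" for x y
    using Henstock_Kurzweil_Integration.integral_combine[of 0 x y w] that
      integrable_on_subinterval_0T[OF wi, of 0 y] by (simp add: W_def)
  define d where "d x = f x - W x" for x
  have dc: "continuous_on {0..T} d" unfolding d_def by (intro continuous_intros f Wc)
  have const: "d x = d y" if "x \<in> {0<..<T}" "y \<in> {0<..<T}" for x y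
  proof -
    have *: "d x = d y" if "0 < x" "x < y" "y < T" for x y
      using du_Bois_Reymond_interior[OF f w weak, of x y] that W[of x y] by (simp add: d_def)
    show ?thesis using that *[of x y] *[of y x] by (metis greaterThanLessThan_iff linorder_less_linear)
  qed
  have "d x = d (T / 2)" if x: "x \<in> {0..T}" for x
  proof (rule continuous_constant_on_closure[of "{0<..<T}" d "d (T / 2)"])
    have T: "0 < T" using st st' by simp
    show "continuous_on (closure {0<..<T}) d" using dc T by simp
    show "x \<in> closure {0<..<T}" using x T by simp
    show "d y = d (T / 2)" if "y \<in> {0<..<T}" for y using const[OF that, of "T / 2"] T by simp
  qed
  then have "d t = d s" using st by (metis atLeastAtMost_iff order_trans)
  then show ?thesis using W[OF st] by (simp add: d_def)
qed simp

text \<open>A bilinear quantity \<open>\<beta> r s\<close> along a curve is differentiated by the product rule even if both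
  partial derivatives are known only in integrated form, because they depend continuously on the
  other variable.\<close>

lemma bilinear_increment:
  fixes \<beta> h h' N :: "real \<Rightarrow> real \<Rightarrow> real" and k :: "real \<Rightarrow> real"
  assumes h: "\<And>r s t. r \<in> {0..T} \<Longrightarrow> 0 \<le> s \<Longrightarrow> s \<le> t \<Longrightarrow> t \<le> T \<Longrightarrow> \<beta> t r - \<beta> s r = integral {s..t} (\<lambda>x. h x r)"
    and h': "\<And>r s t. r \<in> {0..T} \<Longrightarrow> 0 \<le> s \<Longrightarrow> s \<le> t \<Longrightarrow> t \<le> T \<Longrightarrow> \<beta> r t - \<beta> r s = integral {s..t} (\<lambda>x. h' x r)"
    and int: "\<And>r. r \<in> {0..T} \<Longrightarrow> (\<lambda>x. h x r) integrable_on {0..T}" "\<And>r. r \<in> {0..T} \<Longrightarrow> (\<lambda>x. h' x r) integrable_on {0..T}"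
    and mod: "\<And>x r r'. x \<in> {0..T} \<Longrightarrow> r \<in> {0..T} \<Longrightarrow> r' \<in> {0..T} \<Longrightarrow> \<bar>h x r - h x r'\<bar> \<le> k x * N r r'"
      "\<And>x r r'. x \<in> {0..T} \<Longrightarrow> r \<in> {0..T} \<Longrightarrow> r' \<in> {0..T} \<Longrightarrow> \<bar>h' x r - h' x r'\<bar> \<le> k x * N r r'"
    and unif: "\<And>\<epsilon>. \<epsilon> > 0 \<Longrightarrow> \<exists>\<delta>>0. \<forall>r\<in>{0..T}. \<forall>s\<in>{0..T}. \<bar>r - s\<bar> < \<delta> \<longrightarrow> N r s < \<epsilon>"
    and k: "k integrable_on {0..T}" "\<And>x. x \<in> {0..T} \<Longrightarrow> k x \<ge> 0"
    and diag: "(\<lambda>x. h x x) integrable_on {0..T}" "(\<lambda>x. h' x x) integrable_on {0..T}"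
    and st: "0 \<le> s" "s \<le> t" "t \<le> T"
  shows "\<beta> t t - \<beta> s s = integral {s..t} (\<lambda>x. h x x + h' x x)"
proof (rule increment_eq_integral_of_local[where \<Psi>="\<lambda>t. \<beta> t t" and k=k and T=T])
  show "(\<lambda>x. h x x + h' x x) integrable_on {0..T}" by (intro integrable_add diag)
  fix \<epsilon> :: real assume \<epsilon>: "\<epsilon> > 0"
  then obtain \<delta> where \<delta>: "\<delta> > 0" "\<And>r s. r \<in> {0..T} \<Longrightarrow> s \<in> {0..T} \<Longrightarrow> \<bar>r - s\<bar> < \<delta> \<Longrightarrow> N r s < \<epsilon> / 2"
    using unif[of "\<epsilon> / 2"] by auto
  have "\<bar>\<beta> t t - \<beta> s s - integral {s..t} (\<lambda>x. h x x + h' x x)\<bar> \<le> \<epsilon> * integral {s..t} k"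
    if st: "0 \<le> s" "s \<le> t" "t \<le> T" "t - s < \<delta>" for s t
  proof -
    have sT: "s \<in> {0..T}" "t \<in> {0..T}" using st by auto
    have i: "f integrable_on {s..t}" if "f integrable_on {0..T}" for f :: "real \<Rightarrow> real"
      by (rule integrable_on_subinterval_0T[OF that]) (use st in auto)
    note ii = i[OF int(1)[OF sT(1)]] i[OF int(2)[OF sT(2)]] i[OF diag(1)] i[OF diag(2)]
    have "\<beta> t t - \<beta> s s = (\<beta> t s - \<beta> s s) + (\<beta> t t - \<beta> t s)" by simp
    also have "\<dots> = integral {s..t} (\<lambda>x. h x s) + integral {s..t} (\<lambda>x. h' x t)"
      using h[OF sT(1) st(1-3)] h'[OF sT(2) st(1-3)] by simp
    finally have "\<beta> t t - \<beta> s s - integral {s..t} (\<lambda>x. h x x + h' x x)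
      = integral {s..t} (\<lambda>x. (h x s - h x x) + (h' x t - h' x x))"
      using ii by (simp add: Henstock_Kurzweil_Integration.integral_add Henstock_Kurzweil_Integration.integral_diff
          integrable_diff)
    also have "\<bar>\<dots>\<bar> \<le> integral {s..t} (\<lambda>x. \<epsilon> * k x)"
    proof (rule Henstock_Kurzweil_Integration.integral_norm_bound_integral[where 'a=real, unfolded real_norm_def])
      show "(\<lambda>x. (h x s - h x x) + (h' x t - h' x x)) integrable_on {s..t}"
        using ii by (intro integrable_add integrable_diff)
      show "(\<lambda>x. \<epsilon> * k x) integrable_on {s..t}" using i[OF k(1)] by (rule integrable_on_mult_right)
      fix x assume x: "x \<in> {s..t}"
      then have xT: "x \<in> {0..T}" using st by auto
      have "\<bar>h x s - h x x\<bar> \<le> k x * (\<epsilon> / 2)"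
        using mod(1)[OF xT sT(1) xT] mult_left_mono[OF less_imp_le[OF \<delta>(2)[OF sT(1) xT]] k(2)[OF xT]] x st by auto
      moreover have "\<bar>h' x t - h' x x\<bar> \<le> k x * (\<epsilon> / 2)"
        using mod(2)[OF xT sT(2) xT] mult_left_mono[OF less_imp_le[OF \<delta>(2)[OF sT(2) xT]] k(2)[OF xT]] x st by auto
      moreover have "k x * (\<epsilon> / 2) + k x * (\<epsilon> / 2) = \<epsilon> * k x" by (simp add: field_simps)
      ultimately show "\<bar>(h x s - h x x) + (h' x t - h' x x)\<bar> \<le> \<epsilon> * k x"
        using abs_triangle_ineq[of "h x s - h x x" "h' x t - h' x x"] by linarith
    qed
    finally show ?thesis by simp
  qed
  then show "\<exists>\<delta>>0. \<forall>s t. 0 \<le> s \<and> s \<le> t \<and> t \<le> T \<and> t - s < \<delta> \<longrightarrow>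
        \<bar>\<beta> t t - \<beta> s s - integral {s..t} (\<lambda>x. h x x + h' x x)\<bar> \<le> \<epsilon> * integral {s..t} k"
    using \<delta>(1) by blast
qed (use k st in auto)

text \<open>Heine's theorem for a curve in a pseudometric space, expressed by the distances of its points.\<close>

lemma pseudometric_uniformly_small:
  fixes N :: "real \<Rightarrow> real \<Rightarrow> real"
  assumes self: "\<And>r. N r r = 0" and sym: "\<And>r s. N r s = N s r"
    and tri: "\<And>r s t. r \<in> {0..T} \<Longrightarrow> s \<in> {0..T} \<Longrightarrow> t \<in> {0..T} \<Longrightarrow> N r t \<le> N r s + N s t"
    and cont: "\<And>t. t \<in> {0..T} \<Longrightarrow> ((\<lambda>s. N s t) \<longlongrightarrow> 0) (at t within {0..T})"
    and \<epsilon>: "\<epsilon> > 0"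
  shows "\<exists>\<delta>>0. \<forall>r\<in>{0..T}. \<forall>s\<in>{0..T}. \<bar>r - s\<bar> < \<delta> \<longrightarrow> N r s < \<epsilon>"
proof (rule ccontr)
  assume neg: "\<not> ?thesis"
  have "\<exists>r s. r \<in> {0..T} \<and> s \<in> {0..T} \<and> \<bar>r - s\<bar> < inverse (real (Suc n)) \<and> N r s \<ge> \<epsilon>" for n
  proof -
    have "\<not> (\<forall>r\<in>{0..T}. \<forall>s\<in>{0..T}. \<bar>r - s\<bar> < inverse (real (Suc n)) \<longrightarrow> N r s < \<epsilon>)"
      using neg by (metis inverse_positive_iff_positive of_nat_0_less_iff zero_less_Suc)
    then show ?thesis by (meson not_le)
  qed
  then obtain r s where rs: "\<And>n. r n \<in> {0..T}" "\<And>n. s n \<in> {0..T}" "\<And>n. \<bar>r n - s n\<bar> < inverse (real (Suc n))"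
    "\<And>n. N (r n) (s n) \<ge> \<epsilon>" by metis
  obtain l \<kappa> where l: "l \<in> {0..T}" "strict_mono \<kappa>" "(r \<circ> \<kappa>) \<longlonglongrightarrow> l"
    using compact_Icc[of 0 T] rs(1) unfolding compact_def by metis
  have "(\<lambda>n. r (\<kappa> n) - s (\<kappa> n)) \<longlonglongrightarrow> 0"
  proof (rule Lim_null_comparison)
    show "(\<lambda>n. inverse (real (Suc (\<kappa> n)))) \<longlonglongrightarrow> 0"
      using LIMSEQ_subseq_LIMSEQ[OF LIMSEQ_inverse_real_of_nat l(2)] by (simp add: o_def)
    show "\<forall>\<^sub>F n in sequentially. norm (r (\<kappa> n) - s (\<kappa> n)) \<le> inverse (real (Suc (\<kappa> n)))"
      by (intro always_eventually allI) (use less_imp_le[OF rs(3)] in \<open>simp only: real_norm_def\<close>)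
  qed
  then have "(\<lambda>n. r (\<kappa> n) - (r (\<kappa> n) - s (\<kappa> n))) \<longlonglongrightarrow> l - 0"
    using l(3) by (intro tendsto_diff) (simp_all add: o_def)
  then have sl: "(s \<circ> \<kappa>) \<longlonglongrightarrow> l" by (simp add: o_def)
  have lim: "(\<lambda>n. N (y n) l) \<longlonglongrightarrow> 0" if "y \<longlonglongrightarrow> l" "\<And>n. y n \<in> {0..T}" for y
  proof -
    have "continuous (at l within {0..T}) (\<lambda>s. N s l)"
      using cont[OF l(1)] by (simp add: continuous_within self)
    then have "(\<lambda>n. N (y n) l) \<longlonglongrightarrow> N l l"
      using that by (intro continuous_within_tendsto_compose'[of l "{0..T}" "\<lambda>s. N s l"]) auto
    then show ?thesis by (simp add: self)
  qed
  have "(\<lambda>n. N ((r \<circ> \<kappa>) n) l + N ((s \<circ> \<kappa>) n) l) \<longlonglongrightarrow> 0 + 0"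
    using rs by (intro tendsto_add lim l sl) auto
  then have "\<forall>\<^sub>F n in sequentially. N ((r \<circ> \<kappa>) n) l + N ((s \<circ> \<kappa>) n) l < \<epsilon>"
    using \<epsilon> by (intro order_tendstoD) auto
  then obtain n where "N (r (\<kappa> n)) l + N (s (\<kappa> n)) l < \<epsilon>" by (auto simp: eventually_sequentially)
  then show False
    using tri[OF rs(1) l(1) rs(2), of "\<kappa> n" "\<kappa> n"] rs(4)[of "\<kappa> n"] sym[of l "s (\<kappa> n)"] by linarith
qed

lemma continuous_on_of_modulus:
  fixes f :: "real \<Rightarrow> real"
  assumes "\<And>t. t \<in> S \<Longrightarrow> ((\<lambda>s. N s t) \<longlongrightarrow> 0) (at t within S)"
    and "\<And>s t. s \<in> S \<Longrightarrow> t \<in> S \<Longrightarrow> \<bar>f s - f t\<bar> \<le> C * N s t"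
  shows "continuous_on S f"
  unfolding continuous_on_def
proof
  fix t assume t: "t \<in> S"
  have "((\<lambda>s. C * N s t) \<longlongrightarrow> 0) (at t within S)" using assms(1)[OF t] by (rule tendsto_mult_right_zero)
  then have "((\<lambda>s. f s - f t) \<longlongrightarrow> 0) (at t within S)"
    by (rule Lim_null_comparison[rotated]) (use assms(2) t in \<open>auto simp: eventually_at_filter\<close>)
  then show "(f \<longlongrightarrow> f t) (at t within S)" by (simp add: LIM_zero_iff)
qed

section \<open>Energy solutions\<close>

text \<open>An element of a Bochner space has a version with values in the space everywhere, and
  continuous functionals of it are measurable as limits of simple functions.\<close>

lemma bochner_L2_version:
  assumes b: "bochner_L2 T X N h" and zero: "(\<lambda>_. 0) \<in> X" "N (\<lambda>_. 0) = 0"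
  obtains h' where "\<And>s. h' s \<in> X" "AE s in lebesgue_on {0<..<T}. h' s = h s"
    "integrable (lebesgue_on {0<..<T}) (\<lambda>s. (N (h' s))\<^sup>2)"
    "\<And>F :: _ \<Rightarrow> real. (\<And>y ys. y \<in> X \<Longrightarrow> (\<And>k::nat. ys k \<in> X) \<Longrightarrow> (\<lambda>k. N (\<lambda>x. ys k x - y x)) \<longlonglongrightarrow> 0 \<Longrightarrow>
         (\<lambda>k. F (ys k)) \<longlonglongrightarrow> F y) \<Longrightarrow> (\<lambda>s. F (h' s)) \<in> borel_measurable (lebesgue_on {0<..<T})"
proof -
  let ?M = "lebesgue_on {0<..<T}"
  obtain \<sigma> where \<sigma>: "\<And>k::nat. simple_function ?M (\<sigma> k)" "\<And>k. range (\<sigma> k) \<subseteq> X"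
    and ae: "AE t in ?M. h t \<in> X \<and> (\<lambda>k. N (\<lambda>x. \<sigma> k t x - h t x)) \<longlonglongrightarrow> 0"
    and int: "integrable ?M (\<lambda>t. (N (h t))\<^sup>2)"
    using b unfolding bochner_L2_def by blast
  obtain A where A: "\<And>t. t \<in> space ?M - A \<Longrightarrow> h t \<in> X \<and> (\<lambda>k. N (\<lambda>x. \<sigma> k t x - h t x)) \<longlonglongrightarrow> 0" "A \<in> null_sets ?M"
    using AE_E3[OF ae] by blast
  define h' where "h' s = (if s \<in> space ?M - A then h s else (\<lambda>_. 0))" for s
  have As [measurable]: "A \<in> sets ?M" using A(2) by auto
  have AEA: "AE s in ?M. s \<notin> A" using A(2) by (rule AE_not_in)
  show ?thesis
  proof (rule that[of h'])
    show "h' s \<in> X" for s using A(1) zero(1) by (auto simp: h'_def)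
    show ae': "AE s in ?M. h' s = h s" using AEA AE_space by eventually_elim (simp add: h'_def)
    have "(\<lambda>s. if s \<in> A then 0 else (N (h s))\<^sup>2) \<in> borel_measurable ?M" using int by measurable
    then have m: "(\<lambda>s. (N (h' s))\<^sup>2) \<in> borel_measurable ?M"
      by (rule measurable_cong[THEN iffD1, rotated]) (auto simp: h'_def zero(2))
    show "integrable ?M (\<lambda>s. (N (h' s))\<^sup>2)"
      by (rule integrable_cong_AE_imp[OF int m]) (use ae' in eventually_elim, simp)
    fix F :: "_ \<Rightarrow> real"
    assume F: "\<And>y ys. y \<in> X \<Longrightarrow> (\<And>k::nat. ys k \<in> X) \<Longrightarrow> (\<lambda>k. N (\<lambda>x. ys k x - y x)) \<longlonglongrightarrow> 0 \<Longrightarrow> (\<lambda>k. F (ys k)) \<longlonglongrightarrow> F y"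
    show "(\<lambda>s. F (h' s)) \<in> borel_measurable ?M"
    proof (rule borel_measurable_LIMSEQ_metric)
      have [measurable]: "(\<lambda>s. F (\<sigma> k s)) \<in> borel_measurable ?M" for k
        by (rule borel_measurable_simple_function, rule simple_function_compose1[OF \<sigma>(1)])
      show "(\<lambda>s. if s \<in> A then F (\<lambda>_. 0) else F (\<sigma> k s)) \<in> borel_measurable ?M" for k by measurable
      fix s assume s: "s \<in> space ?M"
      show "(\<lambda>k. if s \<in> A then F (\<lambda>_. 0) else F (\<sigma> k s)) \<longlonglongrightarrow> F (h' s)"
        using F[of "h s" "\<lambda>k. \<sigma> k s"] A(1)[of s] s \<sigma>(2) by (cases "s \<in> A") (auto simp: h'_def)
    qed
  qed
qed

context bounded_open_set
begin

lemma zero_H01: "(\<lambda>_. 0) \<in> H01 \<Omega>"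
  by (rule test_fun_H01) (auto intro!: test_funI[of _ "{}"] smooth_on_const)

lemma normV_zero: "normV \<Omega> (\<lambda>_. 0) = 0"
  using normV_scale[OF zero_H01, of 0] by simp

text \<open>Homogeneity. A function whose gradient vanishes cannot be normalised, but on it the functional
  vanishes.\<close>

lemma dualV_bound:
  assumes \<xi>: "\<xi> \<in> dualV \<Omega>" and z: "z \<in> H01 \<Omega>"
  shows "\<bar>\<xi> z\<bar> \<le> norm_dualV \<Omega> \<xi> * normV \<Omega> z"
proof -
  obtain B where B: "\<And>z. z \<in> H01 \<Omega> \<Longrightarrow> \<bar>\<xi> z\<bar> \<le> B * normV \<Omega> z"
    and lin: "\<And>y z a b. y \<in> H01 \<Omega> \<Longrightarrow> z \<in> H01 \<Omega> \<Longrightarrow> \<xi> (\<lambda>x. a * y x + b * z x) = a * \<xi> y + b * \<xi> z"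
    using \<xi> unfolding dualV_def by blast
  show ?thesis
  proof (cases "normV \<Omega> z = 0")
    case True
    then show ?thesis using B[OF z] by simp
  next
    case False
    then have pos: "normV \<Omega> z > 0" by (simp add: less_le)
    let ?y = "\<lambda>x. inverse (normV \<Omega> z) * z x"
    have y: "?y \<in> H01 \<Omega>" "normV \<Omega> ?y = 1" using z pos by (auto simp: H01_scale normV_scale)
    have \<xi>y: "\<xi> ?y = inverse (normV \<Omega> z) * \<xi> z" using lin[OF z z, of "inverse (normV \<Omega> z)" 0] by simp
    have "\<bar>\<xi> ?y\<bar> \<le> norm_dualV \<Omega> \<xi>"
      unfolding norm_dualV_def
    proof (rule cSup_upper)
      show "\<bar>\<xi> ?y\<bar> \<in> {\<bar>\<xi> z\<bar> |z. z \<in> H01 \<Omega> \<and> normV \<Omega> z \<le> 1}" using y by auto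
      show "bdd_above {\<bar>\<xi> z\<bar> |z. z \<in> H01 \<Omega> \<and> normV \<Omega> z \<le> 1}"
      proof (rule bdd_aboveI[of _ "\<bar>B\<bar>"])
        fix c assume "c \<in> {\<bar>\<xi> z\<bar> |z. z \<in> H01 \<Omega> \<and> normV \<Omega> z \<le> 1}"
        then obtain z' where z': "c = \<bar>\<xi> z'\<bar>" "z' \<in> H01 \<Omega>" "normV \<Omega> z' \<le> 1" by blast
        have "c \<le> B * normV \<Omega> z'" using B[OF z'(2)] z'(1) by simp
        also have "\<dots> \<le> \<bar>B\<bar> * normV \<Omega> z'" by (intro mult_right_mono) auto
        also have "\<dots> \<le> \<bar>B\<bar>" using z'(3) by (simp add: mult_left_le)
        finally show "c \<le> \<bar>B\<bar>" .
      qed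
    qed
    then show ?thesis using pos unfolding \<xi>y by (simp add: abs_mult field_simps)
  qed
qed

lemma dualV_diff:
  assumes "\<xi> \<in> dualV \<Omega>" "\<eta> \<in> dualV \<Omega>"
  shows "(\<lambda>z. \<xi> z - \<eta> z) \<in> dualV \<Omega>"
proof -
  obtain B B' where B: "\<And>z. z \<in> H01 \<Omega> \<Longrightarrow> \<bar>\<xi> z\<bar> \<le> B * normV \<Omega> z" "\<And>z. z \<in> H01 \<Omega> \<Longrightarrow> \<bar>\<eta> z\<bar> \<le> B' * normV \<Omega> z"
    using assms unfolding dualV_def by blast
  have "\<bar>\<xi> z - \<eta> z\<bar> \<le> (B + B') * normV \<Omega> z" if "z \<in> H01 \<Omega>" for z
    using B(1)[OF that] B(2)[OF that] by (simp add: distrib_right)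
  then have "\<exists>B. \<forall>z\<in>H01 \<Omega>. \<bar>\<xi> z - \<eta> z\<bar> \<le> B * normV \<Omega> z" by blast
  then show ?thesis using assms unfolding dualV_def by (simp add: right_diff_distrib)
qed

lemma dualV_apply_diff:
  assumes "\<xi> \<in> dualV \<Omega>" "y \<in> H01 \<Omega>" "z \<in> H01 \<Omega>"
  shows "\<bar>\<xi> y - \<xi> z\<bar> \<le> norm_dualV \<Omega> \<xi> * normV \<Omega> (\<lambda>x. y x - z x)"
proof -
  have "\<xi> (\<lambda>x. 1 * y x + (-1) * z x) = 1 * \<xi> y + (-1) * \<xi> z" using assms unfolding dualV_def by blast
  then show ?thesis using dualV_bound[OF assms(1) H01_diff[OF assms(2,3)]] by simp
qed

lemma zero_dualV: "(\<lambda>_. 0) \<in> dualV \<Omega>" "norm_dualV \<Omega> (\<lambda>_. 0) = 0"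
proof -
  show "(\<lambda>_. 0) \<in> dualV \<Omega>" unfolding dualV_def by (auto intro!: exI[of _ 0])
  have "{\<bar>0::real\<bar> |z. z \<in> H01 \<Omega> \<and> normV \<Omega> z \<le> 1} = {0}" using zero_H01 normV_zero by force
  then show "norm_dualV \<Omega> (\<lambda>_. 0) = 0" unfolding norm_dualV_def by simp
qed

lemma norm_dualV_nonneg: "\<xi> \<in> dualV \<Omega> \<Longrightarrow> 0 \<le> norm_dualV \<Omega> \<xi>" if "\<Omega> \<noteq> {}"
proof -
  assume \<xi>: "\<xi> \<in> dualV \<Omega>"
  obtain \<phi> where \<phi>: "\<phi> \<in> test_fun \<Omega>" "normH \<phi> > 0" using nonzero_test_fun[OF \<open>\<Omega> \<noteq> {}\<close>] by blast
  have "0 < lambda1 \<Omega> * (normH \<phi>)\<^sup>2" using lambda1_properties(1)[OF that] \<phi>(2) by simp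
  also have "\<dots> \<le> (normV \<Omega> \<phi>)\<^sup>2" by (rule lambda1_properties(2)[OF that test_fun_H01[OF \<phi>(1)]])
  finally have "normV \<Omega> \<phi> > 0" by (simp add: less_le)
  moreover have "0 \<le> norm_dualV \<Omega> \<xi> * normV \<Omega> \<phi>"
    using dualV_bound[OF \<xi> test_fun_H01[OF \<phi>(1)]] abs_ge_zero order_trans by blast
  ultimately show "0 \<le> norm_dualV \<Omega> \<xi>" by (simp add: zero_le_mult_iff)
qed

end

locale energy_solution_on = bounded_open_set \<Omega> for \<Omega> :: "'a::euclidean_space set" +
  fixes p :: real and g :: "real \<Rightarrow> real" and u0 u1 :: "'a \<Rightarrow> real" and T :: real
    and u v :: "real \<Rightarrow> 'a \<Rightarrow> real"
  assumes nonempty: "\<Omega> \<noteq> {}" and solution: "energy_solution \<Omega> p g u0 u1 T u v"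
begin

abbreviation "time \<equiv> lebesgue_on {0<..<T}"

lemma T_pos: "0 < T"
  and u_H01: "t \<in> {0..T} \<Longrightarrow> u t \<in> H01 \<Omega>"
  and u_cont: "t \<in> {0..T} \<Longrightarrow> ((\<lambda>s. normV \<Omega> (\<lambda>x. u s x - u t x)) \<longlongrightarrow> 0) (at t within {0..T})"
  and v_L2: "t \<in> {0..T} \<Longrightarrow> v t \<in> L2 \<Omega>"
  and v_cont: "t \<in> {0..T} \<Longrightarrow> ((\<lambda>s. normH (\<lambda>x. v s x - v t x)) \<longlongrightarrow> 0) (at t within {0..T})"
  and u_deriv: "t \<in> {0..T} \<Longrightarrow>
     ((\<lambda>s. normH (\<lambda>x. (u s x - u t x) / (s - t) - v t x)) \<longlongrightarrow> 0) (at t within {0..T})"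
  and v_bochner: "bochner_L2 T (H01 \<Omega>) (normV \<Omega>) v"
  and u_initial: "AE x in dx. u 0 x = u0 x"
  and v_initial: "AE x in dx. v 0 x = u1 x"
  using solution unfolding energy_solution_def by blast+

lemma u_L2: "t \<in> {0..T} \<Longrightarrow> u t \<in> L2 \<Omega>"
  by (intro H01_L2 u_H01)

lemma l2norm_le_normV: "z \<in> H01 \<Omega> \<Longrightarrow> normH z \<le> normV \<Omega> z / sqrt (lambda1 \<Omega>)"
proof -
  assume z: "z \<in> H01 \<Omega>"
  note l = lambda1_properties(1)[OF nonempty] lambda1_properties(2)[OF nonempty z]
  have "(sqrt (lambda1 \<Omega>) * normH z)\<^sup>2 \<le> (normV \<Omega> z)\<^sup>2" using l by (simp add: power_mult_distrib)
  then have "sqrt (lambda1 \<Omega>) * normH z \<le> normV \<Omega> z" by (rule power2_le_imp_le) simp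
  then show ?thesis using l(1) by (simp add: field_simps)
qed

definition "du s t = normV \<Omega> (\<lambda>x. u s x - u t x)"
definition "dv s t = normH (\<lambda>x. v s x - v t x)"

lemma l2_u_diff_le: "s \<in> {0..T} \<Longrightarrow> t \<in> {0..T} \<Longrightarrow> normH (\<lambda>x. u s x - u t x) \<le> inverse (sqrt (lambda1 \<Omega>)) * du s t"
  using l2norm_le_normV[OF H01_diff[OF u_H01 u_H01], of s t] by (simp add: du_def field_simps)

lemma du_uniform: "\<epsilon> > 0 \<Longrightarrow> \<exists>\<delta>>0. \<forall>r\<in>{0..T}. \<forall>s\<in>{0..T}. \<bar>r - s\<bar> < \<delta> \<longrightarrow> du' r s < \<epsilon>"
  if "du' = (\<lambda>r s. if r \<in> {0..T} \<and> s \<in> {0..T} then du r s else 0)"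
proof (rule pseudometric_uniformly_small)
  show "du' r r = 0" for r by (simp add: that du_def normV_zero)
  show "du' r s = du' s r" for r s
    using normV_minus_commute[OF u_H01 u_H01, of r s] by (auto simp: that du_def)
  show "du' r t \<le> du' r s + du' s t" if rst: "r \<in> {0..T}" "s \<in> {0..T}" "t \<in> {0..T}" for r s t
    using normV_triangle[OF H01_diff[OF u_H01[OF rst(1)] u_H01[OF rst(2)]] H01_diff[OF u_H01[OF rst(2)] u_H01[OF rst(3)]]]
      rst by (simp add: \<open>du' = _\<close> du_def)
  show "((\<lambda>s. du' s t) \<longlongrightarrow> 0) (at t within {0..T})" if t: "t \<in> {0..T}" for t
    using u_cont[OF t]
    by (rule Lim_transform_eventually) (use t in \<open>auto simp: \<open>du' = _\<close> du_def eventually_at_filter\<close>)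
qed

lemma dv_uniform: "\<epsilon> > 0 \<Longrightarrow> \<exists>\<delta>>0. \<forall>r\<in>{0..T}. \<forall>s\<in>{0..T}. \<bar>r - s\<bar> < \<delta> \<longrightarrow> dv' r s < \<epsilon>"
  if "dv' = (\<lambda>r s. if r \<in> {0..T} \<and> s \<in> {0..T} then dv r s else 0)"
proof (rule pseudometric_uniformly_small)
  show "dv' r r = 0" for r by (simp add: that dv_def l2norm_def)
  show "dv' r s = dv' s r" for r s
    using l2norm_minus_commute[of \<Omega> "v r" "v s"] by (auto simp: that dv_def)
  show "dv' r t \<le> dv' r s + dv' s t" if rst: "r \<in> {0..T}" "s \<in> {0..T}" "t \<in> {0..T}" for r s t
    using l2norm_dist_triangle[OF v_L2[OF rst(1)] v_L2[OF rst(2)] v_L2[OF rst(3)]] rst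
    by (simp add: \<open>dv' = _\<close> dv_def)
  show "((\<lambda>s. dv' s t) \<longlongrightarrow> 0) (at t within {0..T})" if t: "t \<in> {0..T}" for t
    using v_cont[OF t]
    by (rule Lim_transform_eventually) (use t in \<open>auto simp: \<open>dv' = _\<close> dv_def eventually_at_filter\<close>)
qed

lemma uv_uniform:
  assumes "\<epsilon> > 0"
  shows "\<exists>\<delta>>0. \<forall>r\<in>{0..T}. \<forall>s\<in>{0..T}. \<bar>r - s\<bar> < \<delta> \<longrightarrow> du r s + dv r s < \<epsilon>"
proof -
  obtain \<delta>1 where 1: "\<delta>1 > 0" "\<forall>r\<in>{0..T}. \<forall>s\<in>{0..T}. \<bar>r - s\<bar> < \<delta>1 \<longrightarrow> du r s < \<epsilon> / 2"
    using du_uniform[OF refl, of "\<epsilon> / 2"] assms by auto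
  obtain \<delta>2 where 2: "\<delta>2 > 0" "\<forall>r\<in>{0..T}. \<forall>s\<in>{0..T}. \<bar>r - s\<bar> < \<delta>2 \<longrightarrow> dv r s < \<epsilon> / 2"
    using dv_uniform[OF refl, of "\<epsilon> / 2"] assms by auto
  show ?thesis
  proof (intro exI[of _ "min \<delta>1 \<delta>2"] conjI ballI impI)
    fix r s assume "r \<in> {0..T}" "s \<in> {0..T}" "\<bar>r - s\<bar> < min \<delta>1 \<delta>2"
    then have "du r s < \<epsilon> / 2" "dv r s < \<epsilon> / 2" using 1(2) 2(2) by auto
    then show "du r s + dv r s < \<epsilon>" by linarith
  qed (use 1(1) 2(1) in simp)
qed

lemma du_nonneg: "0 \<le> du s t" and dv_nonneg: "0 \<le> dv s t"
  by (simp_all add: du_def dv_def)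

lemma du_tendsto: "t \<in> {0..T} \<Longrightarrow> ((\<lambda>s. du s t) \<longlongrightarrow> 0) (at t within {0..T})"
  and dv_tendsto: "t \<in> {0..T} \<Longrightarrow> ((\<lambda>s. dv s t) \<longlongrightarrow> 0) (at t within {0..T})"
  unfolding du_def dv_def using u_cont v_cont by auto

lemma normV_u_continuous: "continuous_on {0..T} (\<lambda>t. normV \<Omega> (u t))"
  by (rule continuous_on_of_modulus[where N=du and C=1, OF du_tendsto])
    (auto simp: du_def normV_abs_diff_le u_H01)

lemma l2norm_v_continuous: "continuous_on {0..T} (\<lambda>t. normH (v t))"
  by (rule continuous_on_of_modulus[where N=dv and C=1, OF dv_tendsto])
    (auto simp: dv_def l2norm_abs_diff_le v_L2)

lemma l2inner_v_continuous: "z \<in> L2 \<Omega> \<Longrightarrow> continuous_on {0..T} (\<lambda>t. innerH (v t) z)"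
proof (rule continuous_on_of_modulus[where N=dv and C="normH z", OF dv_tendsto])
  fix s t assume "z \<in> L2 \<Omega>" "s \<in> {0..T}" "t \<in> {0..T}"
  then show "\<bar>innerH (v s) z - innerH (v t) z\<bar> \<le> normH z * dv s t"
    using l2_Cauchy_Schwarz[OF L2_diff[OF v_L2 v_L2], of s t z] v_L2
    by (simp add: l2inner_diff_left dv_def mult.commute)
qed

lemma dirichlet_form_u_diff:
  "s \<in> {0..T} \<Longrightarrow> t \<in> {0..T} \<Longrightarrow> z \<in> H01 \<Omega> \<Longrightarrow> \<bar>dirichlet_form z (u s) - dirichlet_form z (u t)\<bar> \<le> normV \<Omega> z * du s t"
  using dirichlet_form_Cauchy_Schwarz[OF H01_H1 H01_H1, of z "\<lambda>x. u s x - u t x"]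
  by (simp add: du_def dirichlet_form_diff_right u_H01 H01_diff)

lemma dirichlet_form_u_continuous: "z \<in> H01 \<Omega> \<Longrightarrow> continuous_on {0..T} (\<lambda>t. dirichlet_form z (u t))"
  by (rule continuous_on_of_modulus[where N=du and C="normV \<Omega> z", OF du_tendsto])
    (auto simp: dirichlet_form_u_diff)

lemma l2inner_u_diff: "s \<in> {0..T} \<Longrightarrow> t \<in> {0..T} \<Longrightarrow> z \<in> L2 \<Omega> \<Longrightarrow>
    \<bar>innerH z (u s) - innerH z (u t)\<bar> \<le> normH z * (inverse (sqrt (lambda1 \<Omega>)) * du s t)"
  using l2_Cauchy_Schwarz[OF _ L2_diff[OF u_L2 u_L2], of z s t] l2_u_diff_le[of s t]
    mult_left_mono[OF l2_u_diff_le[of s t] l2norm_nonneg[of \<Omega> z]]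
  by (simp add: l2inner_diff_right u_L2)

lemma v_u_continuous: "continuous_on {0..T} (\<lambda>t. innerH (v t) (u t))"
proof -
  obtain M where M: "\<And>t. t \<in> {0..T} \<Longrightarrow> normH (v t) \<le> M"
    using compact_imp_bounded[OF compact_continuous_image[OF l2norm_v_continuous compact_Icc]]
    unfolding bounded_iff by fastforce
  have M0: "M \<ge> 0" using order_trans[OF l2norm_nonneg M[of 0]] T_pos by simp
  show ?thesis
  proof (rule continuous_on_of_modulus[where C=1 and
      N="\<lambda>s t. normH (u t) * dv s t + M * inverse (sqrt (lambda1 \<Omega>)) * du s t"])
    fix t assume t: "t \<in> {0..T}"
    show "((\<lambda>s. normH (u t) * dv s t + M * inverse (sqrt (lambda1 \<Omega>)) * du s t) \<longlongrightarrow> 0) (at t within {0..T})"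
      by (intro tendsto_add_zero tendsto_mult_right_zero du_tendsto dv_tendsto t)
    fix s assume s: "s \<in> {0..T}"
    have "innerH (v s) (u s) - innerH (v t) (u t)
       = (innerH (v s) (u s) - innerH (v s) (u t)) + innerH (\<lambda>x. v s x - v t x) (u t)"
      using s t by (simp add: l2inner_diff_left v_L2 u_L2)
    also have "\<bar>\<dots>\<bar> \<le> normH (v s) * (inverse (sqrt (lambda1 \<Omega>)) * du s t) + dv s t * normH (u t)"
      using l2inner_u_diff[OF s t v_L2[OF s]] l2_Cauchy_Schwarz[OF L2_diff[OF v_L2[OF s] v_L2[OF t]] u_L2[OF t]]
      unfolding dv_def by linarith
    also have "\<dots> \<le> M * (inverse (sqrt (lambda1 \<Omega>)) * du s t) + dv s t * normH (u t)"
      using M[OF s] du_nonneg lambda1_properties(1)[OF nonempty] by (intro add_right_mono mult_right_mono) auto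
    finally show "\<bar>innerH (v s) (u s) - innerH (v t) (u t)\<bar>
       \<le> 1 * (normH (u t) * dv s t + M * inverse (sqrt (lambda1 \<Omega>)) * du s t)" by (simp add: mult.commute mult.left_commute)
  qed
qed

text \<open>The derivative of \<open>u\<close> exists in the norm of \<open>H\<close> at every time, so pairing it with a fixed function
  gives an ordinary derivative.\<close>

lemma u_increment:
  assumes z: "z \<in> L2 \<Omega>" and st: "0 \<le> s" "s \<le> t" "t \<le> T"
  shows "innerH (u t) z - innerH (u s) z = integral {s..t} (\<lambda>x. innerH (v x) z)"
proof -
  have der: "((\<lambda>r. innerH (u r) z) has_real_derivative innerH (v r) z) (at r within {0..T})"
    if r: "r \<in> {0..T}" for r
    unfolding has_field_derivative_iff
  proof -
    let ?q = "\<lambda>y x. (u y x - u r x) / (y - r) - v r x"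
    have lim: "((\<lambda>y. normH (?q y) * normH z) \<longlongrightarrow> 0) (at r within {0..T})"
      using tendsto_mult_left_zero[OF u_deriv[OF r]] .
    have "norm ((innerH (u y) z - innerH (u r) z) / (y - r) - innerH (v r) z) \<le> normH (?q y) * normH z"
      if y: "y \<in> {0..T}" for y
    proof -
      have d: "(\<lambda>x. inverse (y - r) * (u y x - u r x)) \<in> L2 \<Omega>"
        using y r by (intro L2_scale L2_diff u_L2)
      have "innerH (\<lambda>x. inverse (y - r) * (u y x - u r x) - v r x) z
          = inverse (y - r) * (innerH (u y) z - innerH (u r) z) - innerH (v r) z"
        using l2inner_diff_left[OF d v_L2[OF r] z] l2inner_scaleR_left[of \<Omega> "inverse (y - r)" "\<lambda>x. u y x - u r x" z]
          l2inner_diff_left[OF u_L2[OF y] u_L2[OF r] z] by simp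
      then show ?thesis
        using l2_Cauchy_Schwarz[OF L2_diff[OF d v_L2[OF r]] z] by (simp add: divide_inverse mult.commute)
    qed
    then have "((\<lambda>y. (innerH (u y) z - innerH (u r) z) / (y - r) - innerH (v r) z) \<longlongrightarrow> 0) (at r within {0..T})"
      by (intro Lim_null_comparison[OF _ lim]) (auto simp: eventually_at_filter)
    then show "((\<lambda>y. (innerH (u y) z - innerH (u r) z) / (y - r)) \<longlongrightarrow> innerH (v r) z) (at r within {0..T})"
      by (simp add: LIM_zero_iff)
  qed
  have "((\<lambda>r. innerH (u r) z) has_real_derivative innerH (v x) z) (at x within {s..t})"
    if "x \<in> {s..t}" for x by (rule DERIV_subset[OF der]) (use that st in auto)
  then have "((\<lambda>x. innerH (v x) z) has_integral (innerH (u t) z - innerH (u s) z)) {s..t}"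
    by (intro fundamental_theorem_of_calculus[OF st(2)]) (simp add: has_real_derivative_iff_has_vector_derivative)
  then show ?thesis by (simp add: integral_unique)
qed

lemma l2norm_u_increment:
  assumes st: "0 \<le> s" "s \<le> t" "t \<le> T"
  shows "(normH (u t))\<^sup>2 - (normH (u s))\<^sup>2 = integral {s..t} (\<lambda>x. innerH (v x) (u x) + innerH (v x) (u x))"
  unfolding l2inner_self[symmetric]
proof (rule bilinear_increment[where N="\<lambda>r s. du r s + dv r s" and k="\<lambda>x. normH (v x) * inverse (sqrt (lambda1 \<Omega>))"
      and \<beta>="\<lambda>r s. innerH (u r) (u s)" and h="\<lambda>x r. innerH (v x) (u r)" and h'="\<lambda>x r. innerH (v x) (u r)" and T=T])
  show mod: "\<bar>innerH (v x) (u r) - innerH (v x) (u r')\<bar> \<le> normH (v x) * inverse (sqrt (lambda1 \<Omega>)) * (du r r' + dv r r')"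
    if "x \<in> {0..T}" "r \<in> {0..T}" "r' \<in> {0..T}" for x r r'
  proof -
    have "normH (v x) * (inverse (sqrt (lambda1 \<Omega>)) * du r r') \<le> normH (v x) * (inverse (sqrt (lambda1 \<Omega>)) * (du r r' + dv r r'))"
      using lambda1_properties(1)[OF nonempty] dv_nonneg by (intro mult_left_mono) auto
    then show ?thesis using l2inner_u_diff[OF that(2,3) v_L2[OF that(1)]] by (simp add: mult.assoc)
  qed
  then show "\<bar>innerH (v x) (u r) - innerH (v x) (u r')\<bar> \<le> normH (v x) * inverse (sqrt (lambda1 \<Omega>)) * (du r r' + dv r r')"
    if "x \<in> {0..T}" "r \<in> {0..T}" "r' \<in> {0..T}" for x r r' using that by blast
  show "innerH (u t) (u r) - innerH (u s) (u r) = integral {s..t} (\<lambda>x. innerH (v x) (u r))"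
    if "r \<in> {0..T}" "0 \<le> s" "s \<le> t" "t \<le> T" for r s t using u_increment[OF u_L2[OF that(1)] that(2-4)] .
  show "innerH (u r) (u t) - innerH (u r) (u s) = integral {s..t} (\<lambda>x. innerH (v x) (u r))"
    if "r \<in> {0..T}" "0 \<le> s" "s \<le> t" "t \<le> T" for r s t
    using u_increment[OF u_L2[OF that(1)] that(2-4)] by (simp add: l2inner_commute[of _ "u r"])
  show "(\<lambda>x. normH (v x) * inverse (sqrt (lambda1 \<Omega>))) integrable_on {0..T}"
    by (intro integrable_continuous_interval continuous_intros l2norm_v_continuous)
  show "(\<lambda>x. innerH (v x) (u r)) integrable_on {0..T}" if "r \<in> {0..T}" for r
    by (intro integrable_continuous_interval l2inner_v_continuous u_L2 that)
  then show "(\<lambda>x. innerH (v x) (u r)) integrable_on {0..T}" if "r \<in> {0..T}" for r using that by blast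
  show d: "(\<lambda>x. innerH (v x) (u x)) integrable_on {0..T}"
    by (intro integrable_continuous_interval v_u_continuous)
  show "(\<lambda>x. innerH (v x) (u x)) integrable_on {0..T}" by (rule d)
  show "0 \<le> normH (v x) * inverse (sqrt (lambda1 \<Omega>))" for x
    using lambda1_properties(1)[OF nonempty] by simp
  show "\<exists>\<delta>>0. \<forall>r\<in>{0..T}. \<forall>s\<in>{0..T}. \<bar>r - s\<bar> < \<delta> \<longrightarrow> du r s + dv r s < \<epsilon>" if "\<epsilon> > 0" for \<epsilon>
    using that by (rule uv_uniform)
qed (rule st)+

end

lemma measurable_lebesgue_on_cong_AE:
  fixes f h :: "real \<Rightarrow> real"
  assumes "h \<in> borel_measurable (lebesgue_on S)" "AE x in lebesgue_on S. f x = h x" "S \<in> sets lebesgue"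
  shows "f \<in> borel_measurable (lebesgue_on S)"
proof -
  obtain A where A: "\<And>x. x \<in> space (lebesgue_on S) - A \<Longrightarrow> f x = h x" "A \<in> null_sets (lebesgue_on S)"
    using AE_E3[OF assms(2)] by blast
  have "h \<in> borel_measurable (lebesgue_on (S - A))"
    using borel_measurable_diff_null[OF A(2) assms(3)] assms(1) by blast
  then have "f \<in> borel_measurable (lebesgue_on (S - A))"
    by (rule measurable_cong[THEN iffD2, rotated]) (use A(1) in auto)
  then show ?thesis using borel_measurable_diff_null[OF A(2) assms(3)] by blast
qed

text \<open>Statements that hold almost everywhere in the open time interval suffice for integrals.\<close>

lemma time_null_set:
  assumes "AE x in lebesgue_on {0<..<T}. P x"
  obtains A where "negligible A" "\<And>x::real. x \<in> {0..T} - A \<Longrightarrow> P x"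
proof -
  obtain A where A: "\<And>x. x \<in> space (lebesgue_on {0<..<T}) - A \<Longrightarrow> P x" "A \<in> null_sets (lebesgue_on {0<..<T})"
    using AE_E3[OF assms] by blast
  have "A \<in> null_sets lebesgue" using A(2) by (subst (asm) null_sets_restrict_space) auto
  then have "negligible (A \<union> {0, T})" by (simp add: negligible_iff_null_sets[symmetric] negligible_Un)
  moreover have "P x" if "x \<in> {0..T} - (A \<union> {0, T})" for x using A(1)[of x] that by auto
  ultimately show thesis by (rule that)
qed

lemma integral_cong_time:
  fixes f h :: "real \<Rightarrow> real"
  assumes "AE x in lebesgue_on {0<..<T}. f x = h x" "0 \<le> s" "t \<le> T"
  shows "integral {s..t} f = integral {s..t} h"
proof -
  obtain A where A: "negligible A" "\<And>x. x \<in> {0..T} - A \<Longrightarrow> f x = h x" using time_null_set[OF assms(1)] by blast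
  show ?thesis by (rule integral_spike[OF A(1)]) (use A(2) assms(2,3) in auto)
qed

lemma integral_mono_time:
  fixes f h :: "real \<Rightarrow> real"
  assumes "AE x in lebesgue_on {0<..<T}. f x \<le> h x" "0 \<le> s" "t \<le> T"
    and i: "f integrable_on {s..t}" "h integrable_on {s..t}"
  shows "integral {s..t} f \<le> integral {s..t} h"
proof -
  obtain A where A: "negligible A" "\<And>x. x \<in> {0..T} - A \<Longrightarrow> f x \<le> h x" using time_null_set[OF assms(1)] by blast
  let ?f = "\<lambda>x. if x \<in> A then 0 else f x" and ?h = "\<lambda>x. if x \<in> A then 0 else h x"
  have "integral {s..t} f = integral {s..t} ?f" "integral {s..t} h = integral {s..t} ?h"
    by (rule integral_spike[OF A(1)], simp)+
  moreover have "integral {s..t} ?f \<le> integral {s..t} ?h"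
  proof (rule integral_le)
    show "?f integrable_on {s..t}" by (rule integrable_spike[OF i(1) A(1)]) simp
    show "?h integrable_on {s..t}" by (rule integrable_spike[OF i(2) A(1)]) simp
  qed (use A(2) assms(2,3) in auto)
  ultimately show ?thesis by simp
qed

lemma integrable_time_of_square:
  fixes f :: "real \<Rightarrow> real"
  assumes "integrable (lebesgue_on {0<..<T}) (\<lambda>s. (f s)\<^sup>2)" "\<And>s. 0 \<le> f s"
  shows "integrable (lebesgue_on {0<..<T}) f"
proof -
  interpret B: bounded_open_set "{0<..<T}" by unfold_locales auto
  have [measurable]: "(\<lambda>s. (f s)\<^sup>2) \<in> borel_measurable (lebesgue_on {0<..<T})" using assms(1) by auto
  have eq: "f = (\<lambda>s. sqrt ((f s)\<^sup>2))" using assms(2) by simp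
  have m: "f \<in> borel_measurable (lebesgue_on {0<..<T})" by (subst eq) measurable
  have "integrable (lebesgue_on {0<..<T}) (\<lambda>s. 1 + (f s)\<^sup>2)"
    using assms(1) B.integrable_bounded[of "\<lambda>_. 1::real" 1] by auto
  then show ?thesis
  proof (rule Bochner_Integration.integrable_bound[OF _ m])
    have "\<bar>y\<bar> \<le> 1 + y\<^sup>2" for y :: real
      using zero_le_power2[of "\<bar>y\<bar> - 1"] by (simp add: power2_diff)
    then show "AE s in lebesgue_on {0<..<T}. norm (f s) \<le> norm (1 + (f s)\<^sup>2)" by auto
  qed
qed

context energy_solution_on
begin

text \<open>The velocity belongs to \<open>V\<close> only at almost every time. Here it is replaced, on a null set, by a
  representative in \<open>V\<close> that depends measurably on time.\<close>

definition v_rep where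
  "v_rep = (SOME h. (\<forall>s. h s \<in> H01 \<Omega>) \<and> (AE s in time. h s = v s) \<and>
     integrable time (\<lambda>s. (normV \<Omega> (h s))\<^sup>2) \<and>
     (\<forall>z\<in>H01 \<Omega>. (\<lambda>s. dirichlet_form (h s) z) \<in> borel_measurable time))"

lemma v_rep: "v_rep s \<in> H01 \<Omega>" "AE s in time. v_rep s = v s"
    "integrable time (\<lambda>s. (normV \<Omega> (v_rep s))\<^sup>2)"
    "z \<in> H01 \<Omega> \<Longrightarrow> (\<lambda>s. dirichlet_form (v_rep s) z) \<in> borel_measurable time"
proof -
  obtain h where h: "\<And>s. h s \<in> H01 \<Omega>" "AE s in time. h s = v s" "integrable time (\<lambda>s. (normV \<Omega> (h s))\<^sup>2)"
    "\<And>F :: _ \<Rightarrow> real. (\<And>y ys. y \<in> H01 \<Omega> \<Longrightarrow> (\<And>k::nat. ys k \<in> H01 \<Omega>) \<Longrightarrow> (\<lambda>k. normV \<Omega> (\<lambda>x. ys k x - y x)) \<longlonglongrightarrow> 0 \<Longrightarrow>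
         (\<lambda>k. F (ys k)) \<longlonglongrightarrow> F y) \<Longrightarrow> (\<lambda>s. F (h s)) \<in> borel_measurable time"
    using bochner_L2_version[OF v_bochner zero_H01 normV_zero] by blast
  have "(\<lambda>s. dirichlet_form (h s) z) \<in> borel_measurable time" if z: "z \<in> H01 \<Omega>" for z
  proof (rule h(4))
    fix y and ys :: "nat \<Rightarrow> 'a \<Rightarrow> real"
    assume y: "y \<in> H01 \<Omega>" "\<And>k. ys k \<in> H01 \<Omega>" and lim: "(\<lambda>k. normV \<Omega> (\<lambda>x. ys k x - y x)) \<longlonglongrightarrow> 0"
    have "(\<lambda>k. dirichlet_form (ys k) z - dirichlet_form y z) \<longlonglongrightarrow> 0"
      by (rule Lim_null_comparison[OF _ tendsto_mult_left_zero[OF lim, of "normV \<Omega> z"]])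
        (use dirichlet_form_Cauchy_Schwarz[OF H01_H1[OF H01_diff[OF y(2) y(1)]] H01_H1[OF z]] in
          \<open>simp add: dirichlet_form_diff_left y z\<close>)
    then show "(\<lambda>k. dirichlet_form (ys k) z) \<longlonglongrightarrow> dirichlet_form y z" by (simp add: LIM_zero_iff)
  qed
  then have "(\<forall>s. h s \<in> H01 \<Omega>) \<and> (AE s in time. h s = v s) \<and> integrable time (\<lambda>s. (normV \<Omega> (h s))\<^sup>2) \<and>
     (\<forall>z\<in>H01 \<Omega>. (\<lambda>s. dirichlet_form (h s) z) \<in> borel_measurable time)"
    using h(1-3) by blast
  from someI[of "\<lambda>h. (\<forall>s. h s \<in> H01 \<Omega>) \<and> (AE s in time. h s = v s) \<and>
     integrable time (\<lambda>s. (normV \<Omega> (h s))\<^sup>2) \<and>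
     (\<forall>z\<in>H01 \<Omega>. (\<lambda>s. dirichlet_form (h s) z) \<in> borel_measurable time)", OF this]
  show "v_rep s \<in> H01 \<Omega>" "AE s in time. v_rep s = v s"
    "integrable time (\<lambda>s. (normV \<Omega> (v_rep s))\<^sup>2)"
    "z \<in> H01 \<Omega> \<Longrightarrow> (\<lambda>s. dirichlet_form (v_rep s) z) \<in> borel_measurable time"
    unfolding v_rep_def[symmetric] by blast+
qed

definition memory where
  "memory t z = (\<integral>s. g (t - s) * dirichlet_form (u s) z \<partial>lebesgue_on {0..t})"

text \<open>Likewise a representative of the acceleration in \<open>V\<^sup>*\<close>, chosen together with all its properties
  because the solution only asserts its existence.\<close>

definition utt where
  "utt = (SOME w. (\<forall>s. w s \<in> dualV \<Omega>) \<and> integrable time (\<lambda>s. (norm_dualV \<Omega> (w s))\<^sup>2) \<and>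
     (\<forall>z\<in>H01 \<Omega>. (\<lambda>s. w s z) \<in> borel_measurable time) \<and> weak_time_deriv \<Omega> T v w \<and>
     (\<forall>z\<in>H01 \<Omega>. AE t in time. w t z + dirichlet_form (u t) z + dirichlet_form (v_rep t) z - memory t z
         = (\<integral>x. source p (u t x) * z x \<partial>dx)))"

lemma utt: "utt s \<in> dualV \<Omega>" "integrable time (\<lambda>s. (norm_dualV \<Omega> (utt s))\<^sup>2)"
    "z \<in> H01 \<Omega> \<Longrightarrow> (\<lambda>s. utt s z) \<in> borel_measurable time" "weak_time_deriv \<Omega> T v utt"
    "z \<in> H01 \<Omega> \<Longrightarrow> AE t in time. utt t z + dirichlet_form (u t) z + dirichlet_form (v_rep t) z - memory t z
         = (\<integral>x. source p (u t x) * z x \<partial>dx)"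
proof -
  have ex: "\<exists>w. bochner_L2 T (dualV \<Omega>) (norm_dualV \<Omega>) w \<and> weak_time_deriv \<Omega> T v w \<and>
        (\<forall>z\<in>H01 \<Omega>. AE t in time.
           w t z + innerH (wgrad \<Omega> (u t)) (wgrad \<Omega> z)
             + innerH (wgrad \<Omega> (v t)) (wgrad \<Omega> z)
             - (\<integral>s. g (t - s) * innerH (wgrad \<Omega> (u s)) (wgrad \<Omega> z) \<partial>lebesgue_on {0..t})
           = (\<integral>x. source p (u t x) * z x \<partial>dx))"
    using solution unfolding energy_solution_def by (elim conjE)
  then obtain w where w: "bochner_L2 T (dualV \<Omega>) (norm_dualV \<Omega>) w" "weak_time_deriv \<Omega> T v w"
    "\<And>z. z \<in> H01 \<Omega> \<Longrightarrow> AE t in time. w t z + dirichlet_form (u t) z + dirichlet_form (v t) z - memory t z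
         = (\<integral>x. source p (u t x) * z x \<partial>dx)"
    unfolding dirichlet_form_def memory_def by blast
  obtain h where h: "\<And>s. h s \<in> dualV \<Omega>" "AE s in time. h s = w s" "integrable time (\<lambda>s. (norm_dualV \<Omega> (h s))\<^sup>2)"
    "\<And>F :: _ \<Rightarrow> real. (\<And>y ys. y \<in> dualV \<Omega> \<Longrightarrow> (\<And>k::nat. ys k \<in> dualV \<Omega>) \<Longrightarrow> (\<lambda>k. norm_dualV \<Omega> (\<lambda>x. ys k x - y x)) \<longlonglongrightarrow> 0 \<Longrightarrow>
         (\<lambda>k. F (ys k)) \<longlonglongrightarrow> F y) \<Longrightarrow> (\<lambda>s. F (h s)) \<in> borel_measurable time"
    using bochner_L2_version[OF w(1) zero_dualV] by blast
  have hm: "(\<lambda>s. h s z) \<in> borel_measurable time" if z: "z \<in> H01 \<Omega>" for z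
  proof (rule h(4)[of "\<lambda>\<xi>. \<xi> z"])
    fix y and ys :: "nat \<Rightarrow> ('a \<Rightarrow> real) \<Rightarrow> real"
    assume y: "y \<in> dualV \<Omega>" "\<And>k. ys k \<in> dualV \<Omega>" and lim: "(\<lambda>k. norm_dualV \<Omega> (\<lambda>x. ys k x - y x)) \<longlonglongrightarrow> 0"
    have "(\<lambda>k. ys k z - y z) \<longlonglongrightarrow> 0"
      by (rule Lim_null_comparison[OF _ tendsto_mult_left_zero[OF lim, of "normV \<Omega> z"]])
        (use dualV_bound[OF dualV_diff[OF y(2) y(1)] z] in simp)
    then show "(\<lambda>k. ys k z) \<longlonglongrightarrow> y z" by (simp add: LIM_zero_iff)
  qed
  have "weak_time_deriv \<Omega> T v h"
    unfolding weak_time_deriv_def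
  proof (intro ballI)
    fix \<phi> :: "real \<Rightarrow> real" and z assume \<phi>: "\<phi> \<in> test_fun {0<..<T}" and z: "z \<in> H01 \<Omega>"
    interpret B: bounded_open_set "{0<..<T}" by unfold_locales auto
    have hw: "AE s in time. h s z = w s z" using h(2) by eventually_elim simp
    have [measurable]: "\<phi> \<in> borel_measurable time" by (rule B.test_fun_measurable[OF \<phi>])
    have [measurable]: "(\<lambda>s. h s z) \<in> borel_measurable time" by (rule hm[OF z])
    have "AE s in time. w s z = h s z" using hw by eventually_elim simp
    from measurable_lebesgue_on_cong_AE[OF hm[OF z] this]
    have [measurable]: "(\<lambda>s. w s z) \<in> borel_measurable time" by simp
    have "(\<integral>t. \<phi> t * h t z \<partial>time) = (\<integral>t. \<phi> t * w t z \<partial>time)"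
    proof (rule integral_cong_AE)
      show "AE t in time. \<phi> t * h t z = \<phi> t * w t z" using hw by eventually_elim simp
    qed measurable
    then show "(\<integral>t. deriv \<phi> t * innerH (v t) z \<partial>time) = - (\<integral>t. \<phi> t * h t z \<partial>time)"
      using w(2) \<phi> z unfolding weak_time_deriv_def by simp
  qed
  moreover have "AE t in time. h t z + dirichlet_form (u t) z + dirichlet_form (v_rep t) z - memory t z
         = (\<integral>x. source p (u t x) * z x \<partial>dx)" if "z \<in> H01 \<Omega>" for z
    using w(3)[OF that] h(2) v_rep(2) by eventually_elim simp
  ultimately have "(\<forall>s. h s \<in> dualV \<Omega>) \<and> integrable time (\<lambda>s. (norm_dualV \<Omega> (h s))\<^sup>2) \<and>
     (\<forall>z\<in>H01 \<Omega>. (\<lambda>s. h s z) \<in> borel_measurable time) \<and> weak_time_deriv \<Omega> T v h \<and>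
     (\<forall>z\<in>H01 \<Omega>. AE t in time. h t z + dirichlet_form (u t) z + dirichlet_form (v_rep t) z - memory t z
         = (\<integral>x. source p (u t x) * z x \<partial>dx))"
    using h(1,3) hm by blast
  from someI[of "\<lambda>w. (\<forall>s. w s \<in> dualV \<Omega>) \<and> integrable time (\<lambda>s. (norm_dualV \<Omega> (w s))\<^sup>2) \<and>
     (\<forall>z\<in>H01 \<Omega>. (\<lambda>s. w s z) \<in> borel_measurable time) \<and> weak_time_deriv \<Omega> T v w \<and>
     (\<forall>z\<in>H01 \<Omega>. AE t in time. w t z + dirichlet_form (u t) z + dirichlet_form (v_rep t) z - memory t z
         = (\<integral>x. source p (u t x) * z x \<partial>dx))", OF this]
  show "utt s \<in> dualV \<Omega>" "integrable time (\<lambda>s. (norm_dualV \<Omega> (utt s))\<^sup>2)"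
    "z \<in> H01 \<Omega> \<Longrightarrow> (\<lambda>s. utt s z) \<in> borel_measurable time" "weak_time_deriv \<Omega> T v utt"
    "z \<in> H01 \<Omega> \<Longrightarrow> AE t in time. utt t z + dirichlet_form (u t) z + dirichlet_form (v_rep t) z - memory t z
         = (\<integral>x. source p (u t x) * z x \<partial>dx)"
    unfolding utt_def[symmetric] by blast+
qed

lemma normV_v_rep_integrable: "integrable time (\<lambda>s. normV \<Omega> (v_rep s))"
  by (rule integrable_time_of_square[OF v_rep(3)]) simp

lemma norm_utt_integrable: "integrable time (\<lambda>s. norm_dualV \<Omega> (utt s))"
  by (rule integrable_time_of_square[OF utt(2)]) (rule norm_dualV_nonneg[OF nonempty utt(1)])

lemma integrable_time_bound:
  fixes f k :: "real \<Rightarrow> real"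
  assumes "integrable time k" "f \<in> borel_measurable time" "\<And>s. s \<in> {0<..<T} \<Longrightarrow> \<bar>f s\<bar> \<le> C * k s"
  shows "integrable time f"
proof (rule Bochner_Integration.integrable_bound[OF _ assms(2)])
  show "integrable time (\<lambda>s. C * k s)" using assms(1) by simp
  show "AE s in time. norm (f s) \<le> norm (C * k s)"
    using assms(3) by (intro AE_I2) (auto intro: order_trans[OF _ abs_ge_self])
qed

lemma dirichlet_v_rep_integrable: "z \<in> H01 \<Omega> \<Longrightarrow> integrable time (\<lambda>s. dirichlet_form (v_rep s) z)"
  by (rule integrable_time_bound[OF normV_v_rep_integrable v_rep(4), of z "normV \<Omega> z"])
    (use dirichlet_form_Cauchy_Schwarz[OF H01_H1[OF v_rep(1)] H01_H1, of z] in \<open>auto simp: mult.commute\<close>)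

lemma utt_integrable: "z \<in> H01 \<Omega> \<Longrightarrow> integrable time (\<lambda>s. utt s z)"
  by (rule integrable_time_bound[OF norm_utt_integrable utt(3), of z "normV \<Omega> z"])
    (use dualV_bound[OF utt(1), of z] in \<open>auto simp: mult.commute\<close>)

lemma normV_u_bounded: obtains M where "M \<ge> 0" "\<And>t. t \<in> {0..T} \<Longrightarrow> normV \<Omega> (u t) \<le> M"
proof -
  obtain M where M: "\<And>t. t \<in> {0..T} \<Longrightarrow> normV \<Omega> (u t) \<le> M"
    using compact_imp_bounded[OF compact_continuous_image[OF normV_u_continuous compact_Icc]]
    unfolding bounded_iff by fastforce
  show ?thesis by (rule that[of "\<bar>M\<bar>"]) (use M in \<open>auto intro: order_trans[OF _ abs_ge_self]\<close>)
qed

lemma dirichlet_v_u_integrable: "integrable time (\<lambda>s. dirichlet_form (v_rep s) (u s))"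
proof -
  obtain M where M: "M \<ge> 0" "\<And>t. t \<in> {0..T} \<Longrightarrow> normV \<Omega> (u t) \<le> M" using normV_u_bounded by blast
  show ?thesis
  proof (rule integrable_time_bound[OF normV_v_rep_integrable, of _ M])
    show "(\<lambda>s. dirichlet_form (v_rep s) (u s)) \<in> borel_measurable time"
      using measurable_diagonal[of T "\<lambda>s r. dirichlet_form (v_rep s) (u r)"] T_pos v_rep(1,4) u_H01
        dirichlet_form_u_continuous by blast
    fix s assume s: "s \<in> {0<..<T}"
    then have sT: "s \<in> {0..T}" by auto
    have "\<bar>dirichlet_form (v_rep s) (u s)\<bar> \<le> normV \<Omega> (v_rep s) * normV \<Omega> (u s)"
      by (intro dirichlet_form_Cauchy_Schwarz H01_H1 v_rep u_H01 sT)
    also have "\<dots> \<le> normV \<Omega> (v_rep s) * M" using M(2)[OF sT] by (intro mult_left_mono) auto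
    finally show "\<bar>dirichlet_form (v_rep s) (u s)\<bar> \<le> M * normV \<Omega> (v_rep s)" by (simp add: mult.commute)
  qed
qed

lemma utt_u_integrable: "integrable time (\<lambda>s. utt s (u s))"
proof -
  obtain M where M: "M \<ge> 0" "\<And>t. t \<in> {0..T} \<Longrightarrow> normV \<Omega> (u t) \<le> M" using normV_u_bounded by blast
  show ?thesis
  proof (rule integrable_time_bound[OF norm_utt_integrable, of _ M])
    have "continuous_on {0..T} (\<lambda>r. utt s (u r))" for s
      by (rule continuous_on_of_modulus[where N=du and C="norm_dualV \<Omega> (utt s)", OF du_tendsto])
        (use dualV_apply_diff[OF utt(1) u_H01 u_H01] in \<open>auto simp: du_def\<close>)
    then show "(\<lambda>s. utt s (u s)) \<in> borel_measurable time"
      using measurable_diagonal[of T "\<lambda>s r. utt s (u r)"] T_pos utt(3) u_H01 by blast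
    fix s assume s: "s \<in> {0<..<T}"
    then have sT: "s \<in> {0..T}" by auto
    have "\<bar>utt s (u s)\<bar> \<le> norm_dualV \<Omega> (utt s) * normV \<Omega> (u s)" by (intro dualV_bound utt u_H01 sT)
    also have "\<dots> \<le> norm_dualV \<Omega> (utt s) * M"
      using M(2)[OF sT] norm_dualV_nonneg[OF nonempty utt(1)] by (intro mult_left_mono) auto
    finally show "\<bar>utt s (u s)\<bar> \<le> M * norm_dualV \<Omega> (utt s)" by (simp add: mult.commute)
  qed
qed

text \<open>In $H_0^1$ the increment of \<open>u\<close> is the integral of \<open>v\<close>: against a test function both derivatives can
  be moved away from \<open>u\<close>, and test functions are dense.\<close>

lemma dirichlet_u_increment:
  assumes z: "z \<in> H01 \<Omega>" and st: "0 \<le> s" "s \<le> t" "t \<le> T"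
  shows "dirichlet_form (u t) z - dirichlet_form (u s) z = integral {s..t} (\<lambda>x. dirichlet_form (v_rep x) z)"
proof -
  have sT: "s \<in> {0..T}" "t \<in> {0..T}" using st by auto
  have test: "dirichlet_form (u t) \<phi> - dirichlet_form (u s) \<phi> = integral {s..t} (\<lambda>x. dirichlet_form (v_rep x) \<phi>)"
    if \<phi>: "\<phi> \<in> test_fun \<Omega>" for \<phi>
  proof -
    let ?\<psi> = "\<lambda>b x. frechet_derivative (\<lambda>x. frechet_derivative \<phi> (at x) b) (at x) b"
    have \<psi>: "?\<psi> b \<in> L2 \<Omega>" if "b \<in> Basis" for b
      by (intro test_fun_L2 test_fun_frechet_derivative \<phi> that)
    have i: "(\<lambda>x. innerH (v x) (?\<psi> b)) integrable_on {s..t}" if "b \<in> Basis" for b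
      using st by (intro integrable_continuous_interval continuous_on_subset[OF l2inner_v_continuous[OF \<psi>[OF that]]]) auto
    have "dirichlet_form (u t) \<phi> - dirichlet_form (u s) \<phi>
       = - (\<Sum>b\<in>Basis. innerH (u t) (?\<psi> b) - innerH (u s) (?\<psi> b))"
      using dirichlet_form_test_fun[OF H01_H1[OF u_H01[OF sT(1)]] \<phi>]
        dirichlet_form_test_fun[OF H01_H1[OF u_H01[OF sT(2)]] \<phi>] by (simp add: sum_subtractf)
    also have "\<dots> = - (\<Sum>b\<in>Basis. integral {s..t} (\<lambda>x. innerH (v x) (?\<psi> b)))"
      using u_increment[OF \<psi> st] by simp
    also have "\<dots> = integral {s..t} (\<lambda>x. - (\<Sum>b\<in>Basis. innerH (v x) (?\<psi> b)))"
      using i by (simp add: Henstock_Kurzweil_Integration.integral_sum)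
    also have "\<dots> = integral {s..t} (\<lambda>x. dirichlet_form (v_rep x) \<phi>)"
    proof (rule integral_cong_time[OF _ st(1,3)])
      show "AE x in time. - (\<Sum>b\<in>Basis. innerH (v x) (?\<psi> b)) = dirichlet_form (v_rep x) \<phi>"
        using v_rep(2)
      proof eventually_elim
        case (elim x)
        show ?case using dirichlet_form_test_fun[OF H01_H1[OF v_rep(1)[of x]] \<phi>] by (simp add: elim)
      qed
    qed
    finally show ?thesis .
  qed
  obtain \<phi> where \<phi>: "\<And>k::nat. \<phi> k \<in> test_fun \<Omega>" "(\<lambda>k. normV \<Omega> (\<lambda>x. \<phi> k x - z x)) \<longlonglongrightarrow> 0"
    using H01_approx[OF z] by blast
  have \<phi>H: "\<phi> k \<in> H01 \<Omega>" for k by (rule test_fun_H01[OF \<phi>(1)])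
  have D: "\<bar>dirichlet_form y (\<phi> k) - dirichlet_form y z\<bar> \<le> normV \<Omega> y * normV \<Omega> (\<lambda>x. \<phi> k x - z x)"
    if "y \<in> H01 \<Omega>" for y k
    using dirichlet_form_Cauchy_Schwarz[OF H01_H1[OF that] H01_H1[OF H01_diff[OF \<phi>H z]], of k]
    by (simp add: dirichlet_form_diff_right that \<phi>H z)
  have lim: "(\<lambda>k. dirichlet_form y (\<phi> k)) \<longlonglongrightarrow> dirichlet_form y z" if y: "y \<in> H01 \<Omega>" for y
  proof -
    have "(\<lambda>k. dirichlet_form y (\<phi> k) - dirichlet_form y z) \<longlonglongrightarrow> 0"
      by (rule Lim_null_comparison[OF _ tendsto_mult_right_zero[OF \<phi>(2), of "normV \<Omega> y"]]) (use D[OF y] in simp)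
    then show ?thesis by (simp add: LIM_zero_iff)
  qed
  note HK = integrable_on_subinterval_0T[OF integrable_open_imp_HK(1) st(1,3)]
  have "(\<lambda>k. integral {s..t} (\<lambda>x. dirichlet_form (v_rep x) (\<phi> k)) - integral {s..t} (\<lambda>x. dirichlet_form (v_rep x) z)) \<longlonglongrightarrow> 0"
  proof (rule Lim_null_comparison[OF _ tendsto_mult_right_zero[OF \<phi>(2), of "integral {s..t} (\<lambda>x. normV \<Omega> (v_rep x))"]],
      intro always_eventually allI)
    fix k
    have i: "(\<lambda>x. dirichlet_form (v_rep x) (\<phi> k)) integrable_on {s..t}" "(\<lambda>x. dirichlet_form (v_rep x) z) integrable_on {s..t}"
      by (intro HK dirichlet_v_rep_integrable \<phi>H z)+
    have "norm (integral {s..t} (\<lambda>x. dirichlet_form (v_rep x) (\<phi> k)) - integral {s..t} (\<lambda>x. dirichlet_form (v_rep x) z))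
       = norm (integral {s..t} (\<lambda>x. dirichlet_form (v_rep x) (\<phi> k) - dirichlet_form (v_rep x) z))"
      using i by (simp add: Henstock_Kurzweil_Integration.integral_diff)
    also have "\<dots> \<le> integral {s..t} (\<lambda>x. normV \<Omega> (v_rep x) * normV \<Omega> (\<lambda>x. \<phi> k x - z x))"
    proof (rule Henstock_Kurzweil_Integration.integral_norm_bound_integral)
      show "(\<lambda>x. dirichlet_form (v_rep x) (\<phi> k) - dirichlet_form (v_rep x) z) integrable_on {s..t}"
        by (intro integrable_diff i)
      show "(\<lambda>x. normV \<Omega> (v_rep x) * normV \<Omega> (\<lambda>x. \<phi> k x - z x)) integrable_on {s..t}"
        by (intro integrable_on_mult_left HK normV_v_rep_integrable)
    qed (use D[OF v_rep(1)] in simp)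
    finally show "norm (integral {s..t} (\<lambda>x. dirichlet_form (v_rep x) (\<phi> k)) - integral {s..t} (\<lambda>x. dirichlet_form (v_rep x) z))
       \<le> integral {s..t} (\<lambda>x. normV \<Omega> (v_rep x)) * normV \<Omega> (\<lambda>x. \<phi> k x - z x)" by simp
  qed
  then have 1: "(\<lambda>k. integral {s..t} (\<lambda>x. dirichlet_form (v_rep x) (\<phi> k))) \<longlonglongrightarrow> integral {s..t} (\<lambda>x. dirichlet_form (v_rep x) z)"
    by (simp add: LIM_zero_iff)
  have "(\<lambda>k. dirichlet_form (u t) (\<phi> k) - dirichlet_form (u s) (\<phi> k)) \<longlonglongrightarrow> dirichlet_form (u t) z - dirichlet_form (u s) z"
    by (intro tendsto_diff lim u_H01 sT)
  then show ?thesis using 1 unfolding test[OF \<phi>(1)] by (rule LIMSEQ_unique)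
qed

lemma normV_u_increment:
  assumes st: "0 \<le> s" "s \<le> t" "t \<le> T"
  shows "(normV \<Omega> (u t))\<^sup>2 - (normV \<Omega> (u s))\<^sup>2 = integral {s..t} (\<lambda>x. dirichlet_form (v_rep x) (u x) + dirichlet_form (v_rep x) (u x))"
  unfolding dirichlet_form_self[symmetric]
proof (rule bilinear_increment[where N="\<lambda>r s. du r s + dv r s" and k="\<lambda>x. normV \<Omega> (v_rep x)"
      and \<beta>="\<lambda>r s. dirichlet_form (u r) (u s)" and h="\<lambda>x r. dirichlet_form (v_rep x) (u r)"
      and h'="\<lambda>x r. dirichlet_form (v_rep x) (u r)" and T=T])
  show mod: "\<bar>dirichlet_form (v_rep x) (u r) - dirichlet_form (v_rep x) (u r')\<bar> \<le> normV \<Omega> (v_rep x) * (du r r' + dv r r')"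
    if "x \<in> {0..T}" "r \<in> {0..T}" "r' \<in> {0..T}" for x r r'
    using dirichlet_form_u_diff[OF that(2,3) v_rep(1)[of x]]
      mult_left_mono[of "du r r'" "du r r' + dv r r'" "normV \<Omega> (v_rep x)"] dv_nonneg[of r r'] by simp
  then show "\<bar>dirichlet_form (v_rep x) (u r) - dirichlet_form (v_rep x) (u r')\<bar> \<le> normV \<Omega> (v_rep x) * (du r r' + dv r r')"
    if "x \<in> {0..T}" "r \<in> {0..T}" "r' \<in> {0..T}" for x r r' using that by blast
  show "dirichlet_form (u t) (u r) - dirichlet_form (u s) (u r) = integral {s..t} (\<lambda>x. dirichlet_form (v_rep x) (u r))"
    if "r \<in> {0..T}" "0 \<le> s" "s \<le> t" "t \<le> T" for r s t using dirichlet_u_increment[OF u_H01[OF that(1)] that(2-4)] .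
  show "dirichlet_form (u r) (u t) - dirichlet_form (u r) (u s) = integral {s..t} (\<lambda>x. dirichlet_form (v_rep x) (u r))"
    if "r \<in> {0..T}" "0 \<le> s" "s \<le> t" "t \<le> T" for r s t
    using dirichlet_u_increment[OF u_H01[OF that(1)] that(2-4)] by (simp add: dirichlet_form_commute[of "u r"])
  show i: "(\<lambda>x. dirichlet_form (v_rep x) (u r)) integrable_on {0..T}" if "r \<in> {0..T}" for r
    by (intro integrable_open_imp_HK dirichlet_v_rep_integrable u_H01 that)
  show "(\<lambda>x. dirichlet_form (v_rep x) (u r)) integrable_on {0..T}" if "r \<in> {0..T}" for r using i[OF that] .
  show d: "(\<lambda>x. dirichlet_form (v_rep x) (u x)) integrable_on {0..T}"
    by (intro integrable_open_imp_HK dirichlet_v_u_integrable)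
  show "(\<lambda>x. dirichlet_form (v_rep x) (u x)) integrable_on {0..T}" by (rule d)
  show "(\<lambda>x. normV \<Omega> (v_rep x)) integrable_on {0..T}" by (intro integrable_open_imp_HK normV_v_rep_integrable)
  show "\<exists>\<delta>>0. \<forall>r\<in>{0..T}. \<forall>s\<in>{0..T}. \<bar>r - s\<bar> < \<delta> \<longrightarrow> du r s + dv r s < \<epsilon>" if "\<epsilon> > 0" for \<epsilon>
    using that by (rule uv_uniform)
qed (use st in simp_all)

lemma v_increment:
  assumes z: "z \<in> H01 \<Omega>" and st: "0 \<le> s" "s \<le> t" "t \<le> T"
  shows "innerH (v t) z - innerH (v s) z = integral {s..t} (\<lambda>x. utt x z)"
  by (rule du_Bois_Reymond[OF l2inner_v_continuous[OF H01_L2[OF z]] utt_integrable[OF z] _ st])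
    (use utt(4) z in \<open>auto simp: weak_time_deriv_def\<close>)

text \<open>The product rule for the pairing of \<open>v\<close>, whose derivative is in \<open>V\<^sup>*\<close>, with \<open>u\<close>, whose derivative in
  \<open>H\<close> is \<open>v\<close>.\<close>

lemma v_u_increment:
  assumes st: "0 \<le> s" "s \<le> t" "t \<le> T"
  shows "innerH (v t) (u t) - innerH (v s) (u s) = integral {s..t} (\<lambda>x. utt x (u x) + innerH (v x) (v x))"
proof (rule bilinear_increment[where N="\<lambda>r s. du r s + dv r s" and k="\<lambda>x. norm_dualV \<Omega> (utt x) + normH (v x)"
      and \<beta>="\<lambda>r s. innerH (v r) (u s)" and h="\<lambda>x r. utt x (u r)"
      and h'="\<lambda>x r. innerH (v x) (v r)" and T=T])
  show "\<bar>utt x (u r) - utt x (u r')\<bar> \<le> (norm_dualV \<Omega> (utt x) + normH (v x)) * (du r r' + dv r r')"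
    if "x \<in> {0..T}" "r \<in> {0..T}" "r' \<in> {0..T}" for x r r'
  proof -
    have "norm_dualV \<Omega> (utt x) * du r r' \<le> (norm_dualV \<Omega> (utt x) + normH (v x)) * (du r r' + dv r r')"
      using norm_dualV_nonneg[OF nonempty utt(1)[of x]] du_nonneg dv_nonneg by (intro mult_mono) auto
    then show ?thesis using dualV_apply_diff[OF utt(1) u_H01[OF that(2)] u_H01[OF that(3)], of x] by (simp add: du_def)
  qed
  show "\<bar>innerH (v x) (v r) - innerH (v x) (v r')\<bar> \<le> (norm_dualV \<Omega> (utt x) + normH (v x)) * (du r r' + dv r r')"
    if "x \<in> {0..T}" "r \<in> {0..T}" "r' \<in> {0..T}" for x r r'
  proof -
    have "normH (v x) * dv r r' \<le> (norm_dualV \<Omega> (utt x) + normH (v x)) * (du r r' + dv r r')"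
      using norm_dualV_nonneg[OF nonempty utt(1)[of x]] du_nonneg dv_nonneg by (intro mult_mono) auto
    then show ?thesis
      using l2_Cauchy_Schwarz[OF v_L2[OF that(1)] L2_diff[OF v_L2[OF that(2)] v_L2[OF that(3)]]] that
      by (simp add: dv_def l2inner_diff_right v_L2)
  qed
  show "innerH (v t) (u r) - innerH (v s) (u r) = integral {s..t} (\<lambda>x. utt x (u r))"
    if "r \<in> {0..T}" "0 \<le> s" "s \<le> t" "t \<le> T" for r s t using v_increment[OF u_H01[OF that(1)] that(2-4)] .
  show "innerH (v r) (u t) - innerH (v r) (u s) = integral {s..t} (\<lambda>x. innerH (v x) (v r))"
    if "r \<in> {0..T}" "0 \<le> s" "s \<le> t" "t \<le> T" for r s t
    using u_increment[OF v_L2[OF that(1)] that(2-4)] by (simp add: l2inner_commute[of _ "v r"])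
  show "(\<lambda>x. utt x (u r)) integrable_on {0..T}" if "r \<in> {0..T}" for r
    by (intro integrable_open_imp_HK utt_integrable u_H01 that)
  show "(\<lambda>x. innerH (v x) (v r)) integrable_on {0..T}" if "r \<in> {0..T}" for r
    by (intro integrable_continuous_interval l2inner_v_continuous v_L2 that)
  show "(\<lambda>x. utt x (u x)) integrable_on {0..T}" by (intro integrable_open_imp_HK utt_u_integrable)
  show "(\<lambda>x. innerH (v x) (v x)) integrable_on {0..T}"
    unfolding l2inner_self by (intro integrable_continuous_interval continuous_intros l2norm_v_continuous)
  show "(\<lambda>x. norm_dualV \<Omega> (utt x) + normH (v x)) integrable_on {0..T}"
    by (intro integrable_add integrable_open_imp_HK norm_utt_integrable integrable_continuous_interval l2norm_v_continuous)
  show "0 \<le> norm_dualV \<Omega> (utt x) + normH (v x)" for x using norm_dualV_nonneg[OF nonempty utt(1)[of x]] by simp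
  show "\<exists>\<delta>>0. \<forall>r\<in>{0..T}. \<forall>s\<in>{0..T}. \<bar>r - s\<bar> < \<delta> \<longrightarrow> du r s + dv r s < \<epsilon>" if "\<epsilon> > 0" for \<epsilon>
    using that by (rule uv_uniform)
qed (use st in simp_all)

text \<open>\<open>\<parallel>\<nabla>z\<parallel>\<^sup>2 = \<integral> (\<nabla>v, \<nabla>z)\<close> for \<open>z = u t - u s\<close>, and Young's inequality with weight \<open>t - s\<close>.\<close>

lemma normV_u_diff_square_le:
  assumes st: "0 \<le> s" "s \<le> t" "t \<le> T"
  shows "(normV \<Omega> (\<lambda>x. u t x - u s x))\<^sup>2 \<le> (t - s) * integral {s..t} (\<lambda>x. (normV \<Omega> (v_rep x))\<^sup>2)"
proof (cases "s = t")
  case True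
  then show ?thesis by (simp add: normV_zero)
next
  case False
  let ?z = "\<lambda>x. u t x - u s x" and ?D = "integral {s..t} (\<lambda>x. (normV \<Omega> (v_rep x))\<^sup>2)"
  define h where "h = t - s"
  have h: "h > 0" using st False by (simp add: h_def)
  have sT: "s \<in> {0..T}" "t \<in> {0..T}" using st by auto
  have z: "?z \<in> H01 \<Omega>" by (intro H01_diff u_H01 sT)
  note HK = integrable_on_subinterval_0T[OF integrable_open_imp_HK(1) st(1,3)]
  have "(normV \<Omega> ?z)\<^sup>2 = integral {s..t} (\<lambda>x. dirichlet_form (v_rep x) ?z)"
    using dirichlet_u_increment[OF z st] dirichlet_form_diff_left[OF u_H01[OF sT(2)] u_H01[OF sT(1)] z]
    by (simp add: dirichlet_form_self)
  also have "\<dots> \<le> integral {s..t} (\<lambda>x. h / 2 * (normV \<Omega> (v_rep x))\<^sup>2 + (normV \<Omega> ?z)\<^sup>2 / (2 * h))"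
  proof (rule integral_le)
    show "(\<lambda>x. dirichlet_form (v_rep x) ?z) integrable_on {s..t}" by (intro HK dirichlet_v_rep_integrable z)
    show "(\<lambda>x. h / 2 * (normV \<Omega> (v_rep x))\<^sup>2 + (normV \<Omega> ?z)\<^sup>2 / (2 * h)) integrable_on {s..t}"
      by (intro integrable_add integrable_on_mult_right HK v_rep(3) integrable_const_ivl)
    fix x
    have "dirichlet_form (v_rep x) ?z \<le> normV \<Omega> (v_rep x) * normV \<Omega> ?z"
      using dirichlet_form_Cauchy_Schwarz[OF H01_H1[OF v_rep(1)] H01_H1[OF z], of x] by linarith
    also have "\<dots> \<le> h / 2 * (normV \<Omega> (v_rep x))\<^sup>2 + (normV \<Omega> ?z)\<^sup>2 / (2 * h)"
      using h zero_le_power2[of "h * normV \<Omega> (v_rep x) - normV \<Omega> ?z"]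
      by (simp add: field_simps power2_eq_square)
    finally show "dirichlet_form (v_rep x) ?z \<le> h / 2 * (normV \<Omega> (v_rep x))\<^sup>2 + (normV \<Omega> ?z)\<^sup>2 / (2 * h)" .
  qed
  also have "\<dots> = h / 2 * ?D + (normV \<Omega> ?z)\<^sup>2 / 2"
  proof -
    have "integral {s..t} (\<lambda>x. h / 2 * (normV \<Omega> (v_rep x))\<^sup>2 + (normV \<Omega> ?z)\<^sup>2 / (2 * h))
        = h / 2 * ?D + (normV \<Omega> ?z)\<^sup>2 / (2 * h) * h"
      using st by (subst Henstock_Kurzweil_Integration.integral_add)
        (auto intro!: integrable_on_mult_right HK[OF v_rep(3)] simp: h_def)
    then show ?thesis using h by simp
  qed
  finally show ?thesis by (simp add: h_def)
qed

end

section \<open>The logarithmic source\<close>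

text \<open>The logarithm is dominated by arbitrarily small positive and negative powers, so raising the
  exponent slightly absorbs it.\<close>

lemma powr_mult_abs_ln_le:
  fixes x a b :: real
  assumes "0 < x" "0 < a" "a < b"
  shows "x powr a * \<bar>ln x\<bar> \<le> (1 / (b - a) + 1 / a) * (1 + x powr b)"
proof (cases "1 \<le> x")
  case True
  have "x powr a * \<bar>ln x\<bar> \<le> x powr a * (x powr (b - a) / (b - a))"
    using True ln_powr_bound[of x "b - a"] assms by (intro mult_left_mono) auto
  also have "\<dots> = 1 / (b - a) * x powr b" by (simp add: powr_add[symmetric])
  also have "\<dots> \<le> (1 / (b - a) + 1 / a) * (1 + x powr b)" using assms by (intro mult_mono) auto
  finally show ?thesis .
next
  case False
  have "\<bar>ln x\<bar> = ln (1 / x)" using False assms by (simp add: ln_div)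
  also have "\<dots> \<le> (1 / x) powr a / a" using False assms by (intro ln_powr_bound) auto
  finally have "x powr a * \<bar>ln x\<bar> \<le> x powr a * ((1 / x) powr a / a)" by (intro mult_left_mono) auto
  also have "\<dots> = 1 / a * 1" using assms by (simp add: powr_divide)
  also have "\<dots> \<le> (1 / (b - a) + 1 / a) * (1 + x powr b)" using assms by (intro mult_mono) auto
  finally show ?thesis .
qed

lemma powr_le_one_add_powr:
  fixes x a b :: real
  assumes "0 \<le> x" "0 \<le> a" "a \<le> b"
  shows "x powr a \<le> 1 + x powr b"
proof (cases "1 \<le> x")
  case True
  then have "x powr a \<le> x powr b" using assms by (intro powr_mono) auto
  then show ?thesis by simp
next
  case False
  then have "x powr a \<le> 1" using assms by (intro powr_le1) auto
  then show ?thesis using powr_ge_zero[of x b] by linarith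
qed

lemma powr_Young:
  fixes x y q :: real
  assumes "0 \<le> x" "0 \<le> y" "1 < q"
  shows "x powr (q - 1) * y \<le> x powr q + y powr q"
proof -
  define m where "m = max x y"
  have m: "m \<ge> 0" using assms by (simp add: m_def)
  have "x powr (q - 1) * y \<le> m powr (q - 1) * m powr 1"
    using assms by (intro mult_mono powr_mono2) (auto simp: m_def)
  also have "\<dots> = m powr q" by (simp only: powr_add[symmetric]) simp
  also have "\<dots> \<le> x powr q + y powr q" by (auto simp: m_def max_def)
  finally show ?thesis .
qed

lemma abs_source: "r \<noteq> 0 \<Longrightarrow> \<bar>source p r\<bar> = \<bar>r\<bar> powr (p - 1) * \<bar>ln \<bar>r\<bar>\<bar>"
  using powr_add[of "\<bar>r\<bar>" "p - 2" 1] by (simp add: source_def abs_mult)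

lemma abs_source_le:
  assumes "2 < p" "p < q"
  shows "\<bar>source p r\<bar> \<le> (1 / (q - p) + 1 / (p - 1)) * (1 + \<bar>r\<bar> powr (q - 1))"
proof (cases "r = 0")
  case False
  then show ?thesis using powr_mult_abs_ln_le[of "\<bar>r\<bar>" "p - 1" "q - 1"] assms by (simp add: abs_source)
qed (use assms in \<open>simp add: source_def\<close>)

lemma abs_source_prim_le:
  assumes "2 < p" "p < q"
  shows "\<bar>source_prim p r\<bar> \<le> (1 / (q - p) + 1 / p + 1) * (1 + \<bar>r\<bar> powr q)"
proof (cases "r = 0")
  case False
  have 1: "\<bar>r\<bar> powr p * \<bar>ln \<bar>r\<bar>\<bar> \<le> (1 / (q - p) + 1 / p) * (1 + \<bar>r\<bar> powr q)"
    using powr_mult_abs_ln_le[of "\<bar>r\<bar>" p q] assms False by simp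
  have 2: "\<bar>r\<bar> powr p \<le> 1 + \<bar>r\<bar> powr q" using assms by (intro powr_le_one_add_powr) auto
  have "\<bar>source_prim p r\<bar> \<le> \<bar>r\<bar> powr p * \<bar>ln \<bar>r\<bar>\<bar> / p + \<bar>r\<bar> powr p / p\<^sup>2"
    using False assms by (auto simp: source_prim_def abs_mult intro!: order_trans[OF abs_triangle_ineq4])
  also have "\<dots> \<le> \<bar>r\<bar> powr p * \<bar>ln \<bar>r\<bar>\<bar> / 1 + \<bar>r\<bar> powr p / 1"
    using assms one_le_power[of p 2] by (intro add_mono divide_left_mono) auto
  finally show ?thesis using 1 2 by (simp add: algebra_simps)
qed (use assms in \<open>simp add: source_prim_def\<close>)

lemma source_mult_self:
  assumes "p \<noteq> 0"
  shows "source p r * r = p * source_prim p r + \<bar>r\<bar> powr p / p"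
proof (cases "r = 0")
  case False
  have "\<bar>r\<bar> powr p = \<bar>r\<bar> powr (p - 2) * r\<^sup>2"
    using False powr_add[of "\<bar>r\<bar>" "p - 2" 2] by (simp add: powr_numeral)
  then show ?thesis using False assms
    by (simp add: source_def source_prim_def field_simps power2_eq_square)
qed (simp add: source_def source_prim_def)

lemma source_prim_scale:
  assumes "0 < r"
  shows "source_prim p (r * x) = r powr p * ln r * (\<bar>x\<bar> powr p / p) + r powr p * source_prim p x"
proof (cases "x = 0")
  case False
  have "\<bar>r * x\<bar> powr p = r powr p * \<bar>x\<bar> powr p" "ln \<bar>r * x\<bar> = ln r + ln \<bar>x\<bar>"
    using assms False by (simp_all add: abs_mult powr_mult ln_mult)
  then show ?thesis using False assms by (simp add: source_prim_def field_simps add_divide_distrib)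
qed (simp add: source_prim_def)

lemma source_measurable [measurable]: "source p \<in> borel_measurable borel"
  and source_prim_measurable [measurable]: "source_prim p \<in> borel_measurable borel"
  unfolding source_def[abs_def] source_prim_def[abs_def] by measurable

text \<open>The strict subcriticality condition leaves room for a slightly larger subcritical exponent.\<close>

lemma larger_subcritical_exponent:
  fixes c p :: real
  assumes "c * (p - 2) < 4"
  obtains q where "p < q" "c * (q - 2) < 4"
proof
  define s where "s = 4 - c * (p - 2)"
  have s: "s > 0" using assms by (simp add: s_def)
  show "p < p + s / (2 * (\<bar>c\<bar> + 1))" using s by simp
  have "c * (s / (2 * (\<bar>c\<bar> + 1))) \<le> \<bar>c\<bar> * (s / (2 * (\<bar>c\<bar> + 1)))"
    using s by (intro mult_right_mono) auto
  also have "\<dots> < s" using s by (simp add: field_simps) (smt (verit) mult_nonneg_nonneg abs_ge_zero)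
  finally show "c * (p + s / (2 * (\<bar>c\<bar> + 1)) - 2) < 4" by (simp add: s_def algebra_simps)
qed

context bounded_open_set
begin

text \<open>By the Sobolev inequality the source \<open>source p y\<close> with \<open>y \<in> V\<close> is a bounded functional on
  \<open>V\<close>. Young's inequality bounds it on the unit sphere, and homogeneity does the rest.\<close>

lemma source_functional_bounded:
  assumes p: "2 < p" "(real DIM('a) - 2) * (p - 2) < 4" and ne: "\<Omega> \<noteq> {}" and y: "y \<in> H01 \<Omega>"
  obtains K where "K \<ge> 0" "\<And>z. z \<in> H01 \<Omega> \<Longrightarrow> integrable dx (\<lambda>x. source p (y x) * z x)"
    "\<And>z. z \<in> H01 \<Omega> \<Longrightarrow> \<bar>\<integral>x. source p (y x) * z x \<partial>dx\<bar> \<le> K * normV \<Omega> z"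
proof -
  obtain q where q: "p < q" "(real DIM('a) - 2) * (q - 2) < 4"
    using larger_subcritical_exponent[OF p(2)] by blast
  have q2: "2 < q" using p q by simp
  obtain S where S: "S \<ge> 0" "\<And>z. z \<in> H01 \<Omega> \<Longrightarrow> integrable dx (\<lambda>x. \<bar>z x\<bar> powr q)"
    "\<And>z. z \<in> H01 \<Omega> \<Longrightarrow> (\<integral>x. \<bar>z x\<bar> powr q \<partial>dx) \<le> S * normV \<Omega> z powr q"
    using Sobolev_H01[OF q2 q(2)] by blast
  define A where "A = 1 / (q - p) + 1 / (p - 1)"
  have A: "A \<ge> 0" using p q by (simp add: A_def)
  have one: "integrable dx (\<lambda>x. 1::real)" by (rule integrable_bounded[where B=1]) auto
  define m where "m = (\<integral>x. (1::real) \<partial>dx)"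
  have m: "m \<ge> 0" unfolding m_def by (rule integral_nonneg_AE) simp
  have bd: "\<bar>source p a * b\<bar> \<le> A * (1 + \<bar>a\<bar> powr q + 2 * \<bar>b\<bar> powr q) + A * 1" for a b
  proof -
    have "\<bar>source p a * b\<bar> \<le> A * (1 + \<bar>a\<bar> powr (q - 1)) * \<bar>b\<bar>"
      unfolding abs_mult A_def by (intro mult_right_mono abs_source_le p q) auto
    also have "\<dots> = A * (\<bar>b\<bar> powr 1 + \<bar>a\<bar> powr (q - 1) * \<bar>b\<bar>)" by (simp add: algebra_simps)
    also have "\<dots> \<le> A * ((1 + \<bar>b\<bar> powr q) + (\<bar>a\<bar> powr q + \<bar>b\<bar> powr q))"
      using q2 by (intro mult_left_mono add_mono powr_le_one_add_powr powr_Young A) auto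
    also have "\<dots> \<le> A * (1 + \<bar>a\<bar> powr q + 2 * \<bar>b\<bar> powr q) + A * 1" using A by (simp add: algebra_simps)
    finally show ?thesis .
  qed
  have dom: "integrable dx (\<lambda>x. A * (1 + \<bar>y x\<bar> powr q + 2 * \<bar>z x\<bar> powr q) + A * 1)"
    if "z \<in> H01 \<Omega>" for z
    using S(2)[OF y] S(2)[OF that] one
    by (intro Bochner_Integration.integrable_add integrable_mult_right)
  have int: "integrable dx (\<lambda>x. source p (y x) * z x)" if z: "z \<in> H01 \<Omega>" for z
  proof (rule Bochner_Integration.integrable_bound[OF dom[OF z]])
    have [measurable]: "y \<in> borel_measurable dx" "z \<in> borel_measurable dx"
      using y z by (auto intro: L2_measurable H01_L2)
    show "(\<lambda>x. source p (y x) * z x) \<in> borel_measurable dx" by measurable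
    show "AE x in dx. norm (source p (y x) * z x) \<le> norm (A * (1 + \<bar>y x\<bar> powr q + 2 * \<bar>z x\<bar> powr q) + A * 1)"
    proof (rule AE_I2)
      fix x
      show "norm (source p (y x) * z x) \<le> norm (A * (1 + \<bar>y x\<bar> powr q + 2 * \<bar>z x\<bar> powr q) + A * 1)"
        using bd[of "y x" "z x"] unfolding real_norm_def by linarith
    qed
  qed
  define K where "K = A * (m + S * normV \<Omega> y powr q + 2 * S) + A * m"
  have K: "K \<ge> 0" using A m S(1) by (simp add: K_def)
  have unit: "\<bar>\<integral>x. source p (y x) * z x \<partial>dx\<bar> \<le> K" if z: "z \<in> H01 \<Omega>" and n1: "normV \<Omega> z = 1" for z
  proof -
    have "\<bar>\<integral>x. source p (y x) * z x \<partial>dx\<bar> \<le> (\<integral>x. \<bar>source p (y x) * z x\<bar> \<partial>dx)"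
      by (rule integral_abs_bound)
    also have "\<dots> \<le> (\<integral>x. A * (1 + \<bar>y x\<bar> powr q + 2 * \<bar>z x\<bar> powr q) + A * 1 \<partial>dx)"
      using int[OF z] dom[OF z] bd by (intro integral_mono) auto
    also have "\<dots> = A * (m + (\<integral>x. \<bar>y x\<bar> powr q \<partial>dx) + 2 * (\<integral>x. \<bar>z x\<bar> powr q \<partial>dx)) + A * m"
    proof -
      note i12 = Bochner_Integration.integrable_add[OF one S(2)[OF y]]
      note i3 = integrable_mult_right[OF S(2)[OF z], of 2]
      show ?thesis
        by (simp only: m_def Bochner_Integration.integral_add[OF one S(2)[OF y]] Bochner_Integration.integral_add[OF i12 i3]
            Bochner_Integration.integral_add[OF integrable_mult_right[OF Bochner_Integration.integrable_add[OF i12 i3], of A]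
              integrable_mult_right[OF one, of A]] Bochner_Integration.integral_mult_right_zero)
    qed
    also have "\<dots> \<le> K"
      unfolding K_def using S(3)[OF y] S(3)[OF z] n1 A by (intro add_mono mult_left_mono) auto
    finally show ?thesis .
  qed
  show thesis
  proof (rule that[OF K])
    fix z assume z: "z \<in> H01 \<Omega>"
    show "integrable dx (\<lambda>x. source p (y x) * z x)" by (rule int[OF z])
    show "\<bar>\<integral>x. source p (y x) * z x \<partial>dx\<bar> \<le> K * normV \<Omega> z"
    proof (cases "normV \<Omega> z = 0")
      case True
      then have "lambda1 \<Omega> * (normH z)\<^sup>2 \<le> 0" using lambda1_properties(2)[OF ne z] by simp
      then have "normH z = 0" using lambda1_properties(1)[OF ne] by (simp add: mult_le_0_iff)
      then have "AE x in dx. z x = 0" using l2norm_eq_0_iff[OF H01_L2[OF z]] by simp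
      then have "(\<integral>x. source p (y x) * z x \<partial>dx) = 0"
        by (intro integral_eq_zero_AE) (auto elim!: eventually_mono)
      then show ?thesis using True by simp
    next
      case False
      define N where "N = normV \<Omega> z"
      have N: "N > 0" using False normV_nonneg[of z] unfolding N_def by linarith
      have "\<bar>\<integral>x. source p (y x) * (inverse N * z x) \<partial>dx\<bar> \<le> K"
        using N normV_scale[OF z, of "inverse N"] by (intro unit H01_scale z) (simp add: N_def[symmetric])
      moreover have "(\<integral>x. source p (y x) * (inverse N * z x) \<partial>dx)
          = inverse N * (\<integral>x. source p (y x) * z x \<partial>dx)"
        by (simp only: mult.left_commute Bochner_Integration.integral_mult_right_zero)
      ultimately show ?thesis using N by (simp add: abs_mult field_simps N_def)
    qed
  qed
qed

lemma source_prim_integrable: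
  assumes p: "2 < p" "(real DIM('a) - 2) * (p - 2) < 4" and y: "y \<in> H01 \<Omega>"
  shows "integrable dx (\<lambda>x. source_prim p (y x))"
proof -
  obtain q where q: "p < q" "(real DIM('a) - 2) * (q - 2) < 4"
    using larger_subcritical_exponent[OF p(2)] by blast
  have q2: "2 < q" using p q by simp
  obtain S where S: "\<And>z. z \<in> H01 \<Omega> \<Longrightarrow> integrable dx (\<lambda>x. \<bar>z x\<bar> powr q)"
    using Sobolev_H01[OF q2 q(2)] by blast
  have one: "integrable dx (\<lambda>x. 1::real)" by (rule integrable_bounded[where B=1]) auto
  have [measurable]: "y \<in> borel_measurable dx" using y by (auto intro: L2_measurable H01_L2)
  show ?thesis
  proof (rule Bochner_Integration.integrable_bound)
    show "integrable dx (\<lambda>x. (1 / (q - p) + 1 / p + 1) * (1 + \<bar>y x\<bar> powr q))"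
      using one S[OF y] by auto
    show "AE x in dx. norm (source_prim p (y x)) \<le> norm ((1 / (q - p) + 1 / p + 1) * (1 + \<bar>y x\<bar> powr q))"
      using abs_source_prim_le[OF p(1) q(1)] by (intro AE_I2) (simp add: order_trans[OF _ abs_ge_self])
  qed measurable
qed

text \<open>The identity \<open>f(r) r = p F(r) + |r|\<^sup>p / p\<close> between the source \<open>f\<close> and its primitive \<open>F\<close>.\<close>

lemma source_self_ge:
  assumes p: "2 < p" "(real DIM('a) - 2) * (p - 2) < 4" and ne: "\<Omega> \<noteq> {}" and y: "y \<in> H01 \<Omega>"
  shows "p * (\<integral>x. source_prim p (y x) \<partial>dx) \<le> (\<integral>x. source p (y x) * y x \<partial>dx)"
proof -
  obtain K where "integrable dx (\<lambda>x. source p (y x) * y x)"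
    using source_functional_bounded[OF p ne y] y by blast
  then have "(\<integral>x. p * source_prim p (y x) \<partial>dx) \<le> (\<integral>x. source p (y x) * y x \<partial>dx)"
    using p source_prim_integrable[OF p y] by (intro integral_mono) (auto simp: source_mult_self)
  then show ?thesis by simp
qed

end

section \<open>Data with large energy\<close>

lemma integral_lebesgue_on_point: "(\<integral>s. f s \<partial>lebesgue_on {0..0::real}) = (0::real)"
  by (rule integral_eq_zero_null_sets) simp

lemma blowup_const_pos:
  assumes "lambda1 \<Omega> > 0" "2 < p" "ell g > 1 / (p - 1)\<^sup>2"
  shows "blowup_const \<Omega> p g > 0"
proof -
  have "(p - 1)\<^sup>2 * ell g > 1" using assms(2,3) by (simp add: field_simps)
  then show ?thesis using assms by (auto simp: blowup_const_def)
qed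

context bounded_open_set
begin

lemma initial_energy_eq:
  "initial_energy \<Omega> p g u0 u1 = 1/2 * (normH u1)\<^sup>2 + 1/2 * (normV \<Omega> u0)\<^sup>2 - (\<integral>x. source_prim p (u0 x) \<partial>dx)"
  by (simp add: initial_energy_def energy_def normV_def integral_lebesgue_on_point[simplified])

text \<open>The data are \<open>r\<phi>\<close> and \<open>a\<phi>\<close> for a fixed test function \<open>\<phi>\<close>. For large \<open>r\<close> the logarithmic
  term makes the potential energy as negative as desired, so that the velocity factor \<open>a \<ge> r\<close> can
  be chosen to give the energy the value \<open>(3/4) (C/p) r\<^sup>2 \<parallel>\<phi>\<parallel>\<^sup>2\<close>, which lies between
  \<open>C/(2p) \<parallel>r\<phi>\<parallel>\<^sup>2\<close> and \<open>(C/p) (r\<phi>, a\<phi>)\<close>.\<close>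

lemma exists_high_energy_data:
  assumes p: "2 < p" "(real DIM('a) - 2) * (p - 2) < 4" and ne: "\<Omega> \<noteq> {}" and C: "C > 0" and K: "K > 0"
  obtains u0 u1 where "u0 \<in> test_fun \<Omega>" "u1 \<in> test_fun \<Omega>" "initial_energy \<Omega> p g u0 u1 > K"
    "C / (2 * p) * (normH u0)\<^sup>2 < initial_energy \<Omega> p g u0 u1"
    "initial_energy \<Omega> p g u0 u1 < C / p * innerH u0 u1"
proof -
  obtain \<phi> where \<phi>: "\<phi> \<in> test_fun \<Omega>" and pos: "normH \<phi> > 0" using nonzero_test_fun[OF ne] by blast
  have \<phi>H: "\<phi> \<in> H01 \<Omega>" by (rule test_fun_H01[OF \<phi>])
  have pint: "integrable dx (\<lambda>x. \<bar>\<phi> x\<bar> powr p)" using Sobolev_H01[OF p] \<phi>H by metis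
  define N where "N = (normH \<phi>)\<^sup>2"
  define D where "D = (normV \<Omega> \<phi>)\<^sup>2"
  define A where "A = (\<integral>x. \<bar>\<phi> x\<bar> powr p / p \<partial>dx)"
  define B where "B = (\<integral>x. source_prim p (\<phi> x) \<partial>dx)"
  have N: "N > 0" using pos by (simp add: N_def)
  have D: "D \<ge> 0" by (simp add: D_def)
  have A: "A > 0"
  proof -
    have "A \<ge> 0" unfolding A_def using p by (intro integral_nonneg_AE) auto
    moreover have "A \<noteq> 0"
    proof
      assume "A = 0"
      then have "AE x in dx. \<bar>\<phi> x\<bar> powr p / p = 0"
        unfolding A_def using p pint by (subst (asm) integral_nonneg_eq_0_iff_AE) auto
      then have "AE x in dx. \<phi> x = 0" using p by (auto elim!: eventually_mono)
      then show False using pos l2norm_eq_0_iff[OF H01_L2[OF \<phi>H]] by simp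
    qed
    ultimately show ?thesis by simp
  qed
  define r where "r = exp ((N / 2 + D / 2 + \<bar>B\<bar>) / A) + 4 * p * K / (3 * C * N)"
  have r1: "r \<ge> exp ((N / 2 + D / 2 + \<bar>B\<bar>) / A)" and r2: "r > 4 * p * K / (3 * C * N)"
    using p C K N by (auto simp: r_def)
  have r: "r \<ge> 1" using r1 one_le_exp_iff[of "(N / 2 + D / 2 + \<bar>B\<bar>) / A"] N D A by (smt (verit) divide_nonneg_pos)
  have "ln r \<ge> (N / 2 + D / 2 + \<bar>B\<bar>) / A" using r1 r by (simp add: ln_ge_iff)
  then have lnr: "ln r * A + B \<ge> N / 2 + D / 2" using A by (simp add: field_simps)
  define X where "X = r powr p * (ln r * A + B)"
  have "r\<^sup>2 * (N / 2 + D / 2) \<le> r powr p * (ln r * A + B)"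
  proof (rule mult_mono[OF _ lnr])
    show "r\<^sup>2 \<le> r powr p" using powr_mono[of 2 p r] p r by (simp add: powr_numeral)
  qed (use N D in auto)
  then have X: "X \<ge> r\<^sup>2 * N / 2 + r\<^sup>2 * D / 2" by (simp add: X_def algebra_simps)
  define R where "R = 3/4 * (C / p) * r\<^sup>2 * N - r\<^sup>2 * D / 2 + X"
  have "3/4 * (C / p) * r\<^sup>2 * N \<ge> 0" using C p N by auto
  then have R: "R \<ge> r\<^sup>2 * N / 2" using X unfolding R_def by linarith
  define a where "a = sqrt (2 * R / N)"
  have R0: "R \<ge> 0" using R N by (smt (verit) divide_nonneg_pos mult_nonneg_nonneg zero_le_power2)
  have a2: "a\<^sup>2 = 2 * R / N" unfolding a_def using R0 N by simp
  have ar: "a \<ge> r"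
  proof (rule power2_le_imp_le)
    show "r\<^sup>2 \<le> a\<^sup>2" using R N by (simp add: a2 field_simps)
    show "0 \<le> a" using R0 N by (simp add: a_def)
  qed
  have scale: "(\<lambda>x. c * \<phi> x) \<in> test_fun \<Omega>" for c by (rule test_fun_scale[OF \<phi>])
  have prim: "(\<integral>x. source_prim p (r * \<phi> x) \<partial>dx) = X"
    using source_prim_integrable[OF p \<phi>H] pint r
    by (simp add: source_prim_scale X_def A_def B_def algebra_simps)
  have E: "initial_energy \<Omega> p g (\<lambda>x. r * \<phi> x) (\<lambda>x. a * \<phi> x) = 3/4 * (C / p) * r\<^sup>2 * N"
  proof -
    have "initial_energy \<Omega> p g (\<lambda>x. r * \<phi> x) (\<lambda>x. a * \<phi> x) = 1/2 * (a\<^sup>2 * N) + 1/2 * (r\<^sup>2 * D) - X"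
      unfolding initial_energy_eq prim N_def D_def by (simp add: l2norm_scale normV_scale[OF \<phi>H] power_mult_distrib)
    then show ?thesis unfolding a2 using N by (simp add: R_def field_simps)
  qed
  have inner: "innerH (\<lambda>x. r * \<phi> x) (\<lambda>x. a * \<phi> x) = r * a * N"
    using l2inner_scaleR_left[of \<Omega> r \<phi> "\<lambda>x. a *\<^sub>R \<phi> x"] l2inner_scaleR_right[of \<Omega> \<phi> a \<phi>]
    by (simp add: l2inner_self N_def)
  have CpN: "C / p * N > 0" using C p N by simp
  show thesis
  proof (rule that[OF scale scale])
    have "K < 3/4 * (C / p * N) * r" using r2 C p N by (simp add: field_simps)
    also have "\<dots> \<le> 3/4 * (C / p * N) * r\<^sup>2"
      using CpN r by (intro mult_left_mono) (auto simp: power2_eq_square)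
    finally show "K < initial_energy \<Omega> p g (\<lambda>x. r * \<phi> x) (\<lambda>x. a * \<phi> x)" unfolding E by (simp add: algebra_simps)
    have rr: "C / p * N * r\<^sup>2 > 0" using CpN by (rule mult_pos_pos) (use r in simp)
    then show "C / (2 * p) * (normH (\<lambda>x. r * \<phi> x))\<^sup>2 < initial_energy \<Omega> p g (\<lambda>x. r * \<phi> x) (\<lambda>x. a * \<phi> x)"
      unfolding E l2norm_scale by (simp add: N_def power_mult_distrib algebra_simps)
    have "C / p * N * r\<^sup>2 \<le> C / p * N * (r * a)"
      using CpN r ar by (intro mult_left_mono) (auto simp: power2_eq_square)
    then show "initial_energy \<Omega> p g (\<lambda>x. r * \<phi> x) (\<lambda>x. a * \<phi> x) < C / p * innerH (\<lambda>x. r * \<phi> x) (\<lambda>x. a * \<phi> x)"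
      unfolding E inner using rr by (simp add: algebra_simps)
  qed
qed

end

section \<open>Energy inequalities along a solution\<close>

locale damped_wave_solution = energy_solution_on \<Omega> p g u0 u1 T u v
  for \<Omega> :: "'a::euclidean_space set" and p g u0 u1 T u v +
  fixes g' :: "real \<Rightarrow> real"
  assumes p_gt_2: "2 < p" and subcritical: "(real DIM('a) - 2) * (p - 2) < 4"
    and kernel: "H2 g g'"
    and energy_abs_cont: "abs_cont_on 0 T (energy \<Omega> p g u v)"
    and energy_derivative: "AE t in lebesgue. 0 < t \<and> t < T \<longrightarrow>
      (energy \<Omega> p g u v has_real_derivative energy_rate \<Omega> g g' u v t) (at t)"
begin

lemma g_continuous: "continuous_on {0..} g"
  and g_nonneg: "0 \<le> t \<Longrightarrow> 0 \<le> g t"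
  and g'_nonpos: "0 \<le> t \<Longrightarrow> g' t \<le> 0"
  and g_integrable: "integrable (lebesgue_on {0..}) g"
  using kernel unfolding H2_def
  by (auto intro!: DERIV_continuous_on)

lemma g_reflected_continuous: "continuous_on {0..x} (\<lambda>s. g (x - s))"
  by (rule continuous_on_compose2[OF g_continuous]) (auto intro!: continuous_intros)

lemma kernel_mass_reflect: "(\<integral>s. g (x - s) \<partial>lebesgue_on {0..x}) = (\<integral>s. g s \<partial>lebesgue_on {0..x})"
proof -
  have c: "continuous_on {0..x} g" by (rule continuous_on_subset[OF g_continuous]) auto
  have i1: "integrable (lebesgue_on {0..x}) g" "integrable (lebesgue_on {0..x}) (\<lambda>s. g (x - s))"
    by (intro continuous_imp_integrable_real c g_reflected_continuous)+
  have "(g has_integral integral {0..x} g) (cbox 0 x)"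
    using integrable_integral[OF integrable_continuous_real[OF c]] by simp
  from has_integral_affinity[OF this, of "-1" x]
  have "((\<lambda>s. g (x - s)) has_integral integral {0..x} g) ((\<lambda>s. x - s) ` {0..x})"
    by (simp add: image_affinity_cbox split: if_splits)
  moreover have "(\<lambda>s. x - s) ` {0..x} = {0..x}" by (simp add: image_diff_atLeastAtMost)
  ultimately have "integral {0..x} (\<lambda>s. g (x - s)) = integral {0..x} g" by (simp add: integral_unique)
  then show ?thesis using i1 by (simp add: lebesgue_integral_eq_integral)
qed

lemma kernel_mass_le: "(\<integral>s. g s \<partial>lebesgue_on {0..x}) \<le> 1 - ell g"
proof -
  have "(\<integral>s. g s \<partial>lebesgue_on {0..x}) = (\<integral>s. indicator {0..x} s * g s \<partial>lebesgue)"
    by (subst integral_restrict_space) (auto simp: set_lebesgue_integral_def)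
  also have "\<dots> \<le> (\<integral>s. indicator {0..} s * g s \<partial>lebesgue)"
  proof (rule integral_mono_AE')
    show "integrable lebesgue (\<lambda>s. indicator {0..} s * g s)"
      using g_integrable by (subst (asm) integrable_restrict_space) (auto simp: set_integrable_def)
    show "AE s in lebesgue. indicator {0..x} s * g s \<le> indicator {0..} s * g s"
      by (auto simp: indicator_def g_nonneg)
    show "AE s in lebesgue. 0 \<le> indicator {0..} s * g s"
      by (auto simp: indicator_def g_nonneg)
  qed
  also have "\<dots> = (\<integral>s. g s \<partial>lebesgue_on {0..})"
    by (subst integral_restrict_space) (auto simp: set_lebesgue_integral_def)
  finally show ?thesis by (simp add: ell_def)
qed

lemma subinterval: "x \<in> {0..T} \<Longrightarrow> {0..x} \<subseteq> {0..T}" by auto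

lemma memory_integrable:
  assumes "x \<in> {0..T}" "z \<in> H01 \<Omega>"
  shows "integrable (lebesgue_on {0..x}) (\<lambda>s. g (x - s) * dirichlet_form (u s) z)"
  unfolding dirichlet_form_commute[of "u _"]
  by (intro continuous_imp_integrable_real continuous_intros g_reflected_continuous
      continuous_on_subset[OF dirichlet_form_u_continuous[OF assms(2)] subinterval[OF assms(1)]])

lemma memory_diff_bounded:
  assumes x: "x \<in> {0..T}"
  obtains K where "\<And>y z. y \<in> H01 \<Omega> \<Longrightarrow> z \<in> H01 \<Omega> \<Longrightarrow> \<bar>memory x y - memory x z\<bar> \<le> K * normV \<Omega> (\<lambda>\<xi>. y \<xi> - z \<xi>)"
proof -
  obtain M where M: "M \<ge> 0" "\<And>t. t \<in> {0..T} \<Longrightarrow> normV \<Omega> (u t) \<le> M" using normV_u_bounded by blast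
  define m where "m = (\<integral>s. g (x - s) \<partial>lebesgue_on {0..x})"
  show thesis
  proof (rule that[of "m * M"])
    fix y z assume y: "y \<in> H01 \<Omega>" and z: "z \<in> H01 \<Omega>"
    define n where "n = normV \<Omega> (\<lambda>\<xi>. y \<xi> - z \<xi>)"
    have d: "(\<lambda>\<xi>. y \<xi> - z \<xi>) \<in> H01 \<Omega>" by (rule H01_diff[OF y z])
    have eq: "memory x y - memory x z
        = (\<integral>s. g (x - s) * dirichlet_form (u s) y - g (x - s) * dirichlet_form (u s) z \<partial>lebesgue_on {0..x})"
      unfolding memory_def by (intro Bochner_Integration.integral_diff[symmetric] memory_integrable x y z)
    have "\<bar>memory x y - memory x z\<bar> \<le> (\<integral>s. \<bar>g (x - s) * dirichlet_form (u s) y - g (x - s) * dirichlet_form (u s) z\<bar> \<partial>lebesgue_on {0..x})"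
      unfolding eq by (rule integral_abs_bound)
    also have "\<dots> \<le> (\<integral>s. g (x - s) * (M * n) \<partial>lebesgue_on {0..x})"
    proof (rule integral_mono)
      show "integrable (lebesgue_on {0..x}) (\<lambda>s. \<bar>g (x - s) * dirichlet_form (u s) y - g (x - s) * dirichlet_form (u s) z\<bar>)"
        by (intro integrable_abs Bochner_Integration.integrable_diff memory_integrable x y z)
      show "integrable (lebesgue_on {0..x}) (\<lambda>s. g (x - s) * (M * n))"
        by (intro integrable_mult_left continuous_imp_integrable_real g_reflected_continuous)
      fix s assume "s \<in> space (lebesgue_on {0..x})"
      then have s: "0 \<le> s" "s \<le> x" "s \<in> {0..T}" using x by auto
      have "\<bar>dirichlet_form (u s) y - dirichlet_form (u s) z\<bar> = \<bar>dirichlet_form (u s) (\<lambda>\<xi>. y \<xi> - z \<xi>)\<bar>"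
        by (simp add: dirichlet_form_diff_right y z u_H01[OF s(3)])
      also have "\<dots> \<le> normV \<Omega> (u s) * n" unfolding n_def
        by (intro dirichlet_form_Cauchy_Schwarz H01_H1 d u_H01 s)
      also have "\<dots> \<le> M * n" unfolding n_def by (intro mult_right_mono M s) simp
      finally have "g (x - s) * \<bar>dirichlet_form (u s) y - dirichlet_form (u s) z\<bar> \<le> g (x - s) * (M * n)"
        using s by (intro mult_left_mono g_nonneg) auto
      then show "\<bar>g (x - s) * dirichlet_form (u s) y - g (x - s) * dirichlet_form (u s) z\<bar> \<le> g (x - s) * (M * n)"
        using s g_nonneg[of "x - s"] by (simp add: abs_mult right_diff_distrib[symmetric])
    qed
    also have "\<dots> = m * M * n" by (simp add: m_def)
    finally show "\<bar>memory x y - memory x z\<bar> \<le> m * M * normV \<Omega> (\<lambda>\<xi>. y \<xi> - z \<xi>)" by (simp add: n_def)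
  qed
qed

text \<open>The equation is tested with the solution itself. The null set on which the weak equation may
  fail depends on the test function; it can be chosen independently of the test functions
  \<open>u r\<close> with rational \<open>r\<close>, and these approximate \<open>u x\<close> because \<open>u\<close> is continuous into \<open>V\<close>.\<close>

lemma equation_tested_with_u:
  "AE x in time. utt x (u x) + (normV \<Omega> (u x))\<^sup>2 + dirichlet_form (v_rep x) (u x) - memory x (u x)
     = (\<integral>y. source p (u x y) * u x y \<partial>dx)"
proof -
  define R where "R x z = utt x z + dirichlet_form (u x) z + dirichlet_form (v_rep x) z - memory x z
      - (\<integral>y. source p (u x y) * z y \<partial>dx)" for x z
  have "AE x in time. \<forall>r\<in>\<rat> \<inter> {0..T}. R x (u r) = 0"
  proof (subst AE_ball_countable)
    show "countable (\<rat> \<inter> {0..T})" using countable_rat by (rule countable_subset[rotated]) auto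
    show "\<forall>r\<in>\<rat> \<inter> {0..T}. AE x in time. R x (u r) = 0"
      using utt(5)[OF u_H01] by (auto simp: R_def elim!: eventually_mono)
  qed
  moreover have "R x (u x) = 0" if x: "x \<in> {0<..<T}" and all: "\<forall>r\<in>\<rat> \<inter> {0..T}. R x (u r) = 0" for x
  proof -
    have xT: "x \<in> {0..T}" using x by auto
    note ux = u_H01[OF xT]
    obtain K1 where K1: "\<And>y z. y \<in> H01 \<Omega> \<Longrightarrow> z \<in> H01 \<Omega> \<Longrightarrow> \<bar>memory x y - memory x z\<bar> \<le> K1 * normV \<Omega> (\<lambda>\<xi>. y \<xi> - z \<xi>)"
      by (rule memory_diff_bounded[OF xT]) (rule that)
    obtain K2 where "K2 \<ge> 0" and K2: "\<And>z. z \<in> H01 \<Omega> \<Longrightarrow> integrable dx (\<lambda>y. source p (u x y) * z y)"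
      "\<And>z. z \<in> H01 \<Omega> \<Longrightarrow> \<bar>\<integral>y. source p (u x y) * z y \<partial>dx\<bar> \<le> K2 * normV \<Omega> z"
      by (rule source_functional_bounded[OF p_gt_2 subcritical nonempty ux]) (rule that)
    define K where "K = norm_dualV \<Omega> (utt x) + normV \<Omega> (u x) + normV \<Omega> (v_rep x) + K1 + K2"
    have bound: "\<bar>R x y - R x z\<bar> \<le> K * normV \<Omega> (\<lambda>\<xi>. y \<xi> - z \<xi>)" if y: "y \<in> H01 \<Omega>" and z: "z \<in> H01 \<Omega>" for y z
    proof -
      have d: "(\<lambda>\<xi>. y \<xi> - z \<xi>) \<in> H01 \<Omega>" by (rule H01_diff[OF y z])
      have 1: "\<bar>utt x y - utt x z\<bar> \<le> norm_dualV \<Omega> (utt x) * normV \<Omega> (\<lambda>\<xi>. y \<xi> - z \<xi>)"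
        by (rule dualV_apply_diff[OF utt(1) y z])
      have 2: "\<bar>dirichlet_form w y - dirichlet_form w z\<bar> \<le> normV \<Omega> w * normV \<Omega> (\<lambda>\<xi>. y \<xi> - z \<xi>)" if "w \<in> H01 \<Omega>" for w
        using dirichlet_form_Cauchy_Schwarz[OF H01_H1[OF that] H01_H1[OF d]] dirichlet_form_diff_right[OF y z that] by simp
      have 3: "\<bar>(\<integral>\<xi>. source p (u x \<xi>) * y \<xi> \<partial>dx) - (\<integral>\<xi>. source p (u x \<xi>) * z \<xi> \<partial>dx)\<bar>
          \<le> K2 * normV \<Omega> (\<lambda>\<xi>. y \<xi> - z \<xi>)"
        using K2(2)[OF d] K2(1)[OF y] K2(1)[OF z]
        by (simp add: right_diff_distrib Bochner_Integration.integral_diff)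
      show ?thesis using 1 2[OF ux] 2[OF v_rep(1), of x] 3 K1[OF y z]
        unfolding R_def K_def distrib_right by linarith
    qed
    show ?thesis
    proof (rule ccontr)
      assume nz: "R x (u x) \<noteq> 0"
      define e where "e = \<bar>R x (u x)\<bar> / (\<bar>K\<bar> + 1)"
      have e: "e > 0" using nz by (simp add: e_def)
      have "eventually (\<lambda>s. du s x < e) (at x within {0..T})" using order_tendstoD(2)[OF du_tendsto[OF xT] e] .
      then obtain \<delta> where \<delta>: "\<delta> > 0" "\<And>s. s \<in> {0..T} \<Longrightarrow> s \<noteq> x \<Longrightarrow> dist s x < \<delta> \<Longrightarrow> du s x < e"
        by (auto simp: eventually_at)
      have "x < min T (x + \<delta>)" using x \<delta> by auto
      then obtain r where r: "r \<in> \<rat>" "x < r" "r < min T (x + \<delta>)" using Rats_dense_in_real by blast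
      have rT: "r \<in> {0..T}" using r x by auto
      have "du r x < e" using r rT by (intro \<delta>(2)) (auto simp: dist_real_def)
      have "\<bar>R x (u x)\<bar> = \<bar>R x (u r) - R x (u x)\<bar>" using all r rT by auto
      also have "\<dots> \<le> K * du r x" unfolding du_def by (intro bound u_H01 rT xT)
      also have "\<dots> \<le> \<bar>K\<bar> * e"
        using \<open>du r x < e\<close> du_nonneg[of r x] by (intro mult_mono) auto
      also have "\<dots> < \<bar>R x (u x)\<bar>" using nz by (simp add: e_def field_simps)
      finally show False by simp
    qed
  qed
  ultimately have "AE x in time. R x (u x) = 0"
    by (auto simp: AE_restrict_space_iff elim!: eventually_mono)
  then show ?thesis by (auto simp: R_def dirichlet_form_self elim!: eventually_mono)
qed

abbreviation "E \<equiv> energy \<Omega> p g u v"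

lemma E_continuous: "continuous_on {0..T} E"
  by (rule abs_cont_on_continuous[OF energy_abs_cont])

lemma du_continuous: "x \<in> {0..T} \<Longrightarrow> continuous_on {0..T} (\<lambda>s. du s x)"
proof (rule continuous_on_of_modulus[where N = du and C = 1])
  fix s t assume x: "x \<in> {0..T}" and st: "s \<in> {0..T}" "t \<in> {0..T}"
  have "\<bar>normV \<Omega> (\<lambda>\<xi>. u s \<xi> - u x \<xi>) - normV \<Omega> (\<lambda>\<xi>. u t \<xi> - u x \<xi>)\<bar>
      \<le> normV \<Omega> (\<lambda>\<xi>. (u s \<xi> - u x \<xi>) - (u t \<xi> - u x \<xi>))"
    by (intro normV_abs_diff_le H01_diff u_H01 st x)
  then show "\<bar>du s x - du t x\<bar> \<le> 1 * du s t" by (simp add: du_def)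
qed (rule du_tendsto)

definition memory_energy where
  "memory_energy x = (\<integral>s. g (x - s) * (du s x)\<^sup>2 \<partial>lebesgue_on {0..x})"

lemma energy_eq:
  assumes "x \<in> {0..T}"
  shows "E x = 1/2 * (normH (v x))\<^sup>2 + 1/2 * (1 - (\<integral>s. g s \<partial>lebesgue_on {0..x})) * (normV \<Omega> (u x))\<^sup>2
     + 1/2 * memory_energy x - (\<integral>y. source_prim p (u x y) \<partial>dx)"
proof -
  have "(\<integral>s. g (x - s) * (normH (\<lambda>y. wgrad \<Omega> (u x) y - wgrad \<Omega> (u s) y))\<^sup>2 \<partial>lebesgue_on {0..x}) = memory_energy x"
    unfolding memory_energy_def
  proof (rule Bochner_Integration.integral_cong[OF refl])
    fix s assume "s \<in> space (lebesgue_on {0..x})"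
    then have s: "s \<in> {0..T}" using assms by auto
    have "du s x = normV \<Omega> (\<lambda>y. u x y - u s y)"
      unfolding du_def by (intro normV_minus_commute u_H01 s assms)
    then show "g (x - s) * (normH (\<lambda>y. wgrad \<Omega> (u x) y - wgrad \<Omega> (u s) y))\<^sup>2 = g (x - s) * (du s x)\<^sup>2"
      using normV_diff[OF H01_H1[OF u_H01[OF assms]] H01_H1[OF u_H01[OF s]]] by simp
  qed
  then show ?thesis by (simp add: energy_def normV_def)
qed

text \<open>In the memory term, \<open>u s\<close> is replaced by \<open>u x\<close>; Young's inequality with weight \<open>p\<close> makes the
  error exactly the memory part of \<open>p E\<close>.\<close>

lemma memory_ge:
  assumes x: "x \<in> {0..T}"
  shows "memory x (u x) \<ge> (1 - 1 / (2 * p)) * (normV \<Omega> (u x))\<^sup>2 * (\<integral>s. g s \<partial>lebesgue_on {0..x}) - p / 2 * memory_energy x"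
proof -
  define N where "N = normV \<Omega> (u x)"
  have ig: "integrable (lebesgue_on {0..x}) (\<lambda>s. g (x - s))"
    by (intro continuous_imp_integrable_real g_reflected_continuous)
  have id: "integrable (lebesgue_on {0..x}) (\<lambda>s. g (x - s) * (du s x)\<^sup>2)"
    by (intro continuous_imp_integrable_real continuous_intros g_reflected_continuous
        continuous_on_subset[OF du_continuous[OF x] subinterval[OF x]])
  have "(\<integral>s. (1 - 1 / (2 * p)) * N\<^sup>2 * g (x - s) - p / 2 * (g (x - s) * (du s x)\<^sup>2) \<partial>lebesgue_on {0..x}) \<le> memory x (u x)"
    unfolding memory_def
  proof (rule integral_mono)
    show "integrable (lebesgue_on {0..x}) (\<lambda>s. (1 - 1 / (2 * p)) * N\<^sup>2 * g (x - s) - p / 2 * (g (x - s) * (du s x)\<^sup>2))"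
      by (intro Bochner_Integration.integrable_diff integrable_mult_right ig id)
    show "integrable (lebesgue_on {0..x}) (\<lambda>s. g (x - s) * dirichlet_form (u s) (u x))"
      by (intro memory_integrable u_H01 x)
    fix s assume "s \<in> space (lebesgue_on {0..x})"
    then have s: "0 \<le> s" "s \<le> x" "s \<in> {0..T}" using x by auto
    have "dirichlet_form (u s) (u x) = dirichlet_form (\<lambda>\<xi>. u s \<xi> - u x \<xi>) (u x) + N\<^sup>2"
      using dirichlet_form_diff_left[OF u_H01[OF s(3)] u_H01[OF x] u_H01[OF x]] by (simp add: dirichlet_form_self N_def)
    moreover have "\<bar>dirichlet_form (\<lambda>\<xi>. u s \<xi> - u x \<xi>) (u x)\<bar> \<le> du s x * N"
      unfolding du_def N_def by (intro dirichlet_form_Cauchy_Schwarz H01_H1 H01_diff u_H01 s x)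
    moreover have "du s x * N \<le> p / 2 * (du s x)\<^sup>2 + N\<^sup>2 / (2 * p)"
      using p_gt_2 zero_le_power2[of "p * du s x - N"] by (simp add: field_simps power2_eq_square)
    ultimately have "(1 - 1 / (2 * p)) * N\<^sup>2 - p / 2 * (du s x)\<^sup>2 \<le> dirichlet_form (u s) (u x)"
      unfolding left_diff_distrib by simp
    from mult_left_mono[OF this g_nonneg[of "x - s"]] s
    show "(1 - 1 / (2 * p)) * N\<^sup>2 * g (x - s) - p / 2 * (g (x - s) * (du s x)\<^sup>2) \<le> g (x - s) * dirichlet_form (u s) (u x)"
      by (simp add: algebra_simps)
  qed
  moreover have "(\<integral>s. (1 - 1 / (2 * p)) * N\<^sup>2 * g (x - s) - p / 2 * (g (x - s) * (du s x)\<^sup>2) \<partial>lebesgue_on {0..x})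
     = (1 - 1 / (2 * p)) * N\<^sup>2 * (\<integral>s. g (x - s) \<partial>lebesgue_on {0..x}) - p / 2 * memory_energy x"
    by (simp only: memory_energy_def Bochner_Integration.integral_diff[OF integrable_mult_right[OF ig] integrable_mult_right[OF id]]
        Bochner_Integration.integral_mult_right_zero)
  ultimately show ?thesis by (simp add: N_def kernel_mass_reflect)
qed

definition "gradient_gain = ((p - 1)\<^sup>2 * ell g - 1) / (2 * p)"

text \<open>This is the lower bound for the derivative of \<open>(u, v)\<close>. The potential energy in the tested
  equation is eliminated in favour of \<open>p E\<close>; what remains of the gradient has a coefficient that is
  affine and decreasing in the mass of the kernel on \<open>[0, x]\<close>, so its smallest value is the one for
  the full mass \<open>1 - \<ell>\<close>.\<close>

lemma pairing_rate_ge: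
  "AE x in time. utt x (u x) + (normH (v x))\<^sup>2
     \<ge> (1 + p / 2) * (normH (v x))\<^sup>2 + gradient_gain * (normV \<Omega> (u x))\<^sup>2 - p * E x - dirichlet_form (v_rep x) (u x)"
proof -
  have main: "utt x (u x) + (normH (v x))\<^sup>2
     \<ge> (1 + p / 2) * (normH (v x))\<^sup>2 + gradient_gain * (normV \<Omega> (u x))\<^sup>2 - p * E x - dirichlet_form (v_rep x) (u x)"
    if x: "x \<in> {0<..<T}" and eq: "utt x (u x) + (normV \<Omega> (u x))\<^sup>2 + dirichlet_form (v_rep x) (u x) - memory x (u x)
     = (\<integral>y. source p (u x y) * u x y \<partial>dx)" for x
  proof -
    have xT: "x \<in> {0..T}" using x by auto
    define m where "m = (\<integral>s. g s \<partial>lebesgue_on {0..x})"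
    define N where "N = (normV \<Omega> (u x))\<^sup>2"
    define F where "F = (\<integral>y. source_prim p (u x y) \<partial>dx)"
    have m: "m \<le> 1 - ell g" unfolding m_def by (rule kernel_mass_le)
    have F: "p * F \<le> (\<integral>y. source p (u x y) * u x y \<partial>dx)"
      unfolding F_def by (rule source_self_ge[OF p_gt_2 subcritical nonempty u_H01[OF xT]])
    have M: "memory x (u x) \<ge> (1 - 1 / (2 * p)) * N * m - p / 2 * memory_energy x"
      unfolding N_def m_def by (rule memory_ge[OF xT])
    have E: "p * E x = p / 2 * (normH (v x))\<^sup>2 + p / 2 * (1 - m) * N + p / 2 * memory_energy x - p * F"
      unfolding energy_eq[OF xT] m_def N_def F_def by (simp add: algebra_simps)
    have "gradient_gain * N \<le> (p / 2 * (1 - m) + (1 - 1 / (2 * p)) * m - 1) * N"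
    proof (rule mult_right_mono)
      show "gradient_gain \<le> p / 2 * (1 - m) + (1 - 1 / (2 * p)) * m - 1"
      proof -
        have "p / 2 * (1 - m) + (1 - 1 / (2 * p)) * m - 1 = ((p - 1)\<^sup>2 * (1 - m) - 1) / (2 * p)"
          using p_gt_2 by (simp add: field_simps power2_eq_square)
        moreover have "(p - 1)\<^sup>2 * ell g - 1 \<le> (p - 1)\<^sup>2 * (1 - m) - 1"
          using m by (intro diff_right_mono mult_left_mono) auto
        ultimately show ?thesis
          unfolding gradient_gain_def using p_gt_2 by (simp only:) (intro divide_right_mono, auto)
      qed
    qed (simp add: N_def)
    then show ?thesis using F M E eq unfolding N_def[symmetric] by (simp add: algebra_simps)
  qed
  show ?thesis using equation_tested_with_u main
    by (auto simp: AE_restrict_space_iff elim!: eventually_mono)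
qed

text \<open>The two memory contributions to the rate of the energy are nonpositive as the kernel is nonnegative
  and nonincreasing.\<close>

lemma energy_dissipation:
  assumes st: "0 \<le> s" "s \<le> t" "t \<le> T"
  shows "E t - E s \<le> - integral {s..t} (\<lambda>x. (normV \<Omega> (v_rep x))\<^sup>2)"
proof -
  have int: "(\<lambda>x. (normV \<Omega> (v_rep x))\<^sup>2) integrable_on {s..t}"
    using integrable_on_subinterval_0T[OF integrable_open_imp_HK(1)[OF v_rep(3)]] st by blast
  have rate: "energy_rate \<Omega> g g' u v x \<le> - (normV \<Omega> (v x))\<^sup>2" if x: "0 < x" for x
  proof -
    have "0 \<le> (\<integral>s. - (g' (x - s) * (normH (\<lambda>y. wgrad \<Omega> (u x) y - wgrad \<Omega> (u s) y))\<^sup>2) \<partial>lebesgue_on {0..x})"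
      by (rule integral_nonneg_AE, rule AE_I2) (auto intro!: mult_nonpos_nonneg g'_nonpos simp del: mult_le_0_iff)
    moreover have "0 \<le> g x * (normH (wgrad \<Omega> (u x)))\<^sup>2" using g_nonneg[of x] x by simp
    ultimately show ?thesis by (simp add: energy_rate_def normV_def)
  qed
  have "E t - E s \<le> integral {s..t} (\<lambda>x. - (normV \<Omega> (v_rep x))\<^sup>2)"
  proof (rule abs_cont_on_increment_le[OF st(2)])
    show "abs_cont_on s t E" by (rule abs_cont_on_subinterval[OF energy_abs_cont st(1,3)])
    show "AE x in lebesgue. s < x \<and> x < t \<longrightarrow> (E has_real_derivative energy_rate \<Omega> g g' u v x) (at x)"
      using energy_derivative by eventually_elim (use st in auto)
    have "AE x in lebesgue. x \<in> {0<..<T} \<longrightarrow> v_rep x = v x"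
      using v_rep(2) by (simp add: AE_restrict_space_iff)
    then show "AE x in lebesgue. s < x \<and> x < t \<longrightarrow> energy_rate \<Omega> g g' u v x \<le> - (normV \<Omega> (v_rep x))\<^sup>2"
      by eventually_elim (use st rate in auto)
    show "(\<lambda>x. - (normV \<Omega> (v_rep x))\<^sup>2) integrable_on {s..t}" using int by (rule integrable_neg)
  qed
  then show ?thesis by simp
qed

end

section \<open>The lifespan bound\<close>

context damped_wave_solution
begin

abbreviation "P t \<equiv> l2inner \<Omega> (v t) (u t)"

lemma dissipation_integrable: "0 \<le> s \<Longrightarrow> t \<le> T \<Longrightarrow> (\<lambda>x. (normV \<Omega> (v_rep x))\<^sup>2) integrable_on {s..t}"
  and dirichlet_v_u_integrable_on: "0 \<le> s \<Longrightarrow> t \<le> T \<Longrightarrow> (\<lambda>x. dirichlet_form (v_rep x) (u x)) integrable_on {s..t}"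
  and utt_u_integrable_on: "0 \<le> s \<Longrightarrow> t \<le> T \<Longrightarrow> (\<lambda>x. utt x (u x)) integrable_on {s..t}"
  by (rule integrable_on_subinterval_0T[OF integrable_open_imp_HK(1)[OF v_rep(3)]]
      integrable_on_subinterval_0T[OF integrable_open_imp_HK(1)[OF dirichlet_v_u_integrable]]
      integrable_on_subinterval_0T[OF integrable_open_imp_HK(1)[OF utt_u_integrable]]; assumption)+

lemma continuous_on_subinterval: "continuous_on {0..T} f \<Longrightarrow> 0 \<le> s \<Longrightarrow> t \<le> T \<Longrightarrow> continuous_on {s..t} f"
  for f :: "real \<Rightarrow> real"
  by (erule continuous_on_subset) auto

lemma continuous_integrable_on: "continuous_on {0..T} f \<Longrightarrow> 0 \<le> s \<Longrightarrow> t \<le> T \<Longrightarrow> f integrable_on {s..t}"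
  for f :: "real \<Rightarrow> real"
  by (rule integrable_continuous_real[OF continuous_on_subinterval])

lemma dissipation_nonneg: "0 \<le> s \<Longrightarrow> t \<le> T \<Longrightarrow> 0 \<le> integral {s..t} (\<lambda>x. (normV \<Omega> (v_rep x))\<^sup>2)"
  by (intro Henstock_Kurzweil_Integration.integral_nonneg dissipation_integrable) auto

text \<open>The functional \<open>(u, v) - (p/C) E\<close> grows exponentially. Its dissipation term absorbs the mixed
  term \<open>(\<nabla>v, \<nabla>u)\<close> at the price of \<open>C/(4p) \<parallel>\<nabla>u\<parallel>\<^sup>2\<close>; the two bounds on \<open>C\<close> say that what is left
  of the velocity and of the gradient still dominates \<open>C (u, v)\<close>, the latter by the Poincare
  inequality.\<close>

lemma lyapunov_growth:
  fixes C :: real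
  assumes C: "C > 0" "C \<le> p + 2" "C * (2 * p + lambda1 \<Omega>) \<le> 4 * p * lambda1 \<Omega> * gradient_gain"
    and t: "t \<in> {0..T}"
  defines "L \<equiv> \<lambda>t. P t - p / C * E t"
  shows "L t \<ge> L 0 * exp (C * t)"
proof (rule linear_growth_integral_inequality[OF C(1) _ _ t])
  have p: "p > 0" using p_gt_2 by simp
  have lam: "lambda1 \<Omega> > 0" by (rule lambda1_properties(1)[OF nonempty])
  show contL: "continuous_on {0..T} L" unfolding L_def by (intro continuous_intros v_u_continuous E_continuous)
  fix t assume t: "t \<in> {0..T}"
  then have st: "0 \<le> (0::real)" "0 \<le> t" "t \<le> T" by auto
  note iV = dissipation_integrable[OF st(1,3)]
  note iu = utt_u_integrable_on[OF st(1,3)]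
  have iv: "(\<lambda>x. (normH (v x))\<^sup>2) integrable_on {0..t}"
    by (intro continuous_integrable_on continuous_intros l2norm_v_continuous st)
  note iuv = integrable_add[OF iu iv] and ipV = integrable_on_mult_right[OF iV, of "p / C"]
  have "C * integral {0..t} L = integral {0..t} (\<lambda>x. C * L x)" by simp
  also have "\<dots> \<le> integral {0..t} (\<lambda>x. (utt x (u x) + (normH (v x))\<^sup>2) + p / C * (normV \<Omega> (v_rep x))\<^sup>2)"
  proof (rule integral_mono_time[OF _ st(1,3)])
    show "(\<lambda>x. C * L x) integrable_on {0..t}"
      by (intro integrable_on_mult_right continuous_integrable_on contL st)
    show "(\<lambda>x. (utt x (u x) + (normH (v x))\<^sup>2) + p / C * (normV \<Omega> (v_rep x))\<^sup>2) integrable_on {0..t}"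
      by (rule integrable_add[OF iuv ipV])
    have pointwise: "C * L x \<le> utt x (u x) + (normH (v x))\<^sup>2 + p / C * (normV \<Omega> (v_rep x))\<^sup>2"
      if x: "x \<in> {0<..<T}" and ge: "utt x (u x) + (normH (v x))\<^sup>2
        \<ge> (1 + p / 2) * (normH (v x))\<^sup>2 + gradient_gain * (normV \<Omega> (u x))\<^sup>2 - p * E x - dirichlet_form (v_rep x) (u x)" for x
    proof -
      have xT: "x \<in> {0..T}" using x by auto
      define V where "V = normV \<Omega> (v_rep x)"
      define N where "N = normV \<Omega> (u x)"
      define a where "a = normH (v x)"
      define b where "b = normH (u x)"
      have D: "dirichlet_form (v_rep x) (u x) \<le> V * N"
        using dirichlet_form_Cauchy_Schwarz[OF H01_H1[OF v_rep(1)] H01_H1[OF u_H01[OF xT]], of x]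
        unfolding V_def N_def by linarith
      have "V * N \<le> p / C * V\<^sup>2 + C / (4 * p) * N\<^sup>2"
        using p C(1) zero_le_power2[of "2 * p * V - C * N"] by (simp add: field_simps power2_eq_square)
      moreover have "C / 2 * b\<^sup>2 \<le> (gradient_gain - C / (4 * p)) * N\<^sup>2"
      proof -
        have c: "C / 2 \<le> lambda1 \<Omega> * (gradient_gain - C / (4 * p))" using C(3) p by (simp add: field_simps)
        then have gain: "gradient_gain - C / (4 * p) \<ge> 0" using C(1) lam by (smt (verit) mult_pos_neg half_gt_zero)
        have "C / 2 * b\<^sup>2 \<le> lambda1 \<Omega> * (gradient_gain - C / (4 * p)) * b\<^sup>2" using c by (intro mult_right_mono) auto
        also have "\<dots> = (gradient_gain - C / (4 * p)) * (lambda1 \<Omega> * b\<^sup>2)" by simp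
        also have "\<dots> \<le> (gradient_gain - C / (4 * p)) * N\<^sup>2"
          unfolding b_def N_def by (intro mult_left_mono lambda1_properties(2) nonempty u_H01 xT gain)
        finally show ?thesis .
      qed
      moreover have "C / 2 * a\<^sup>2 \<le> (1 + p / 2) * a\<^sup>2" using C(2) by (intro mult_right_mono) auto
      moreover have "C * P x \<le> C / 2 * a\<^sup>2 + C / 2 * b\<^sup>2"
      proof -
        have "P x \<le> a * b" using l2_Cauchy_Schwarz[OF v_L2[OF xT] u_L2[OF xT]] unfolding a_def b_def by linarith
        also have "\<dots> \<le> (a\<^sup>2 + b\<^sup>2) / 2" using zero_le_power2[of "a - b"] by (simp add: power2_diff)
        finally have "C * P x \<le> C * ((a\<^sup>2 + b\<^sup>2) / 2)" using C(1) by (intro mult_left_mono) auto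
        then show ?thesis by (simp add: algebra_simps)
      qed
      moreover have "C * L x = C * P x - p * E x" using C(1) by (simp add: L_def right_diff_distrib)
      moreover have "(gradient_gain - C / (4 * p)) * N\<^sup>2 = gradient_gain * N\<^sup>2 - C / (4 * p) * N\<^sup>2"
        by (rule left_diff_distrib)
      ultimately show ?thesis using ge D unfolding V_def[symmetric] N_def[symmetric] a_def[symmetric] by linarith
    qed
    show "AE x in time. C * L x \<le> utt x (u x) + (normH (v x))\<^sup>2 + p / C * (normV \<Omega> (v_rep x))\<^sup>2"
      using pairing_rate_ge pointwise by (auto simp: AE_restrict_space_iff elim!: eventually_mono)
  qed
  also have "\<dots> = (P t - P 0) + p / C * integral {0..t} (\<lambda>x. (normV \<Omega> (v_rep x))\<^sup>2)"
    unfolding Henstock_Kurzweil_Integration.integral_add[OF iuv ipV]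
    using v_u_increment[OF st] by (simp add: l2inner_self)
  also have "\<dots> \<le> (P t - P 0) + p / C * (E 0 - E t)"
    using energy_dissipation[OF st] p C(1) by (intro add_left_mono mult_left_mono) auto
  also have "\<dots> = L t - L 0" by (simp add: L_def right_diff_distrib)
  finally show "C * integral {0..t} L \<le> L t - L 0" .
qed

lemma displacement_le:
  assumes t: "t \<in> {0..T}"
  shows "(normV \<Omega> (\<lambda>x. u t x - u 0 x))\<^sup>2 \<le> t * (E 0 - E t)"
proof -
  have "(normV \<Omega> (\<lambda>x. u t x - u 0 x))\<^sup>2 \<le> t * integral {0..t} (\<lambda>x. (normV \<Omega> (v_rep x))\<^sup>2)"
    using normV_u_diff_square_le[of 0 t] t by auto
  also have "\<dots> \<le> t * (E 0 - E t)" using energy_dissipation[of 0 t] t by (intro mult_left_mono) auto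
  finally show ?thesis .
qed

text \<open>If the energy stayed above \<open>-\<beta>\<close> up to time \<open>\<tau>\<close>, the growth of \<open>(u, v)\<close> would make
  \<open>\<parallel>u(\<tau>)\<parallel>\<^sup>2\<close> larger than the total dissipation, at most \<open>E(0) + \<beta>\<close>, permits. The quadratic
  equation for \<open>\<tau>\<close> is the balance of these two bounds. As the dissipation up to the crossing time
  is at most \<open>E(0) + \<beta>\<close>, the solution is then still close to its initial value.\<close>

lemma energy_crosses_level:
  fixes C L0 \<beta> \<tau> :: real
  assumes C: "C > 0" "C \<le> p + 2" "C * (2 * p + lambda1 \<Omega>) \<le> 4 * p * lambda1 \<Omega> * gradient_gain"
    and L0: "L0 = P 0 - p / C * E 0" "L0 > 0" and \<beta>: "\<beta> = C * L0 / (2 * p)" and E0: "E 0 > 0"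
    and \<tau>: "0 < \<tau>" "\<tau> \<le> T"
    and root: "C * L0 * \<tau>\<^sup>2 + (L0 - 2 * (E 0 + \<beta>) / lambda1 \<Omega>) * \<tau> - (normH (u 0))\<^sup>2 = 0"
  obtains a where "0 \<le> a" "a \<le> \<tau>" "E a = - \<beta>" "P a \<ge> L0 / 2"
    "normH (u a) \<le> normH (u 0) + sqrt (\<tau> * (E 0 + \<beta>) / lambda1 \<Omega>)"
    "normV \<Omega> (u a) \<le> normV \<Omega> (u 0) + sqrt (\<tau> * (E 0 + \<beta>))"
proof -
  have p: "p > 0" using p_gt_2 by simp
  have lam: "lambda1 \<Omega> > 0" by (rule lambda1_properties(1)[OF nonempty])
  have \<beta>pos: "\<beta> > 0" using C(1) L0(2) p by (simp add: \<beta>)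
  have p\<beta>: "p / C * \<beta> = L0 / 2" using p C(1) by (simp add: \<beta>)
  have inT: "s \<in> {0..T}" if "0 \<le> s" "s \<le> \<tau>" for s using that \<tau> by auto
  have zT: "0 \<in> {0..T}" using T_pos by simp
  have growth: "P s \<ge> L0 * exp (C * s) + p / C * E s" if "0 \<le> s" "s \<le> \<tau>" for s
    using lyapunov_growth[OF C inT[OF that]] unfolding L0(1) by linarith
  have dist: "lambda1 \<Omega> * (normH (\<lambda>x. u s x - u 0 x))\<^sup>2 \<le> s * (E 0 - E s)" if "0 \<le> s" "s \<le> \<tau>" for s
    using lambda1_properties(2)[OF nonempty H01_diff[OF u_H01[OF inT[OF that]] u_H01[OF zT]]]
      displacement_le[OF inT[OF that]] by (rule order_trans)
  have "\<exists>a. 0 \<le> a \<and> a \<le> \<tau> \<and> E a = - \<beta>"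
  proof (cases "E \<tau> \<le> - \<beta>")
    case True
    show ?thesis
      by (rule IVT2'[of E \<tau> "- \<beta>" 0, OF True]) (use E0 \<beta>pos \<tau> continuous_on_subinterval[OF E_continuous, of 0 \<tau>] in auto)
  next
    case False
    show ?thesis
    proof (rule ccontr)
      assume no: "\<not> (\<exists>a. 0 \<le> a \<and> a \<le> \<tau> \<and> E a = - \<beta>)"
      have above: "E s > - \<beta>" if s: "0 \<le> s" "s \<le> \<tau>" for s
      proof (rule ccontr)
        assume "\<not> E s > - \<beta>"
        then have "\<exists>a. 0 \<le> a \<and> a \<le> s \<and> E a = - \<beta>"
          by (intro IVT2'[of E s "- \<beta>" 0]) (use E0 \<beta>pos \<tau> s continuous_on_subinterval[OF E_continuous, of 0 s] in auto)
        then show False using no s by force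
      qed
      have Pge: "P s \<ge> L0 / 2 + C * L0 * s" if s: "0 \<le> s" "s \<le> \<tau>" for s
      proof -
        have "L0 * (1 + C * s) \<le> L0 * exp (C * s)" using L0(2) exp_ge_add_one_self by (intro mult_left_mono) auto
        moreover have "- (L0 / 2) \<le> p / C * E s"
        proof -
          have "p / C * (- \<beta>) \<le> p / C * E s" using above[OF s] p C(1) by (intro mult_left_mono) auto
          then show ?thesis using p\<beta> by simp
        qed
        ultimately show ?thesis using growth[OF s] by (simp add: algebra_simps)
      qed
      have fund: "((\<lambda>s. L0 + 2 * C * L0 * s) has_integral (L0 * \<tau> + C * L0 * \<tau>\<^sup>2) - (L0 * 0 + C * L0 * 0\<^sup>2)) {0..\<tau>}"
        using \<tau> by (intro fundamental_theorem_of_calculus)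
          (auto intro!: derivative_eq_intros simp: has_real_derivative_iff_has_vector_derivative[symmetric])
      have "L0 * \<tau> + C * L0 * \<tau>\<^sup>2 = integral {0..\<tau>} (\<lambda>s. L0 + 2 * C * L0 * s)"
        using integral_unique[OF fund] by simp
      also have "\<dots> \<le> integral {0..\<tau>} (\<lambda>s. P s + P s)"
      proof (rule integral_le)
        show "(\<lambda>s. L0 + 2 * C * L0 * s) integrable_on {0..\<tau>}" using fund by blast
        show "(\<lambda>s. P s + P s) integrable_on {0..\<tau>}"
          using \<tau> by (intro continuous_integrable_on continuous_intros v_u_continuous) auto
        show "L0 + 2 * C * L0 * s \<le> P s + P s" if "s \<in> {0..\<tau>}" for s using Pge[of s] that by (simp add: algebra_simps)
      qed
      also have "\<dots> = (normH (u \<tau>))\<^sup>2 - (normH (u 0))\<^sup>2"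
        by (rule l2norm_u_increment[symmetric]) (use \<tau> in auto)
      finally have lower: "(normH (u 0))\<^sup>2 + L0 * \<tau> + C * L0 * \<tau>\<^sup>2 \<le> (normH (u \<tau>))\<^sup>2" by simp
      define w where "w = normH (\<lambda>x. u \<tau> x - u 0 x)"
      have "normH (u \<tau>) \<le> normH (u 0) + w"
        unfolding w_def using \<tau> T_pos by (intro l2norm_triangle_diff u_L2) auto
      then have "(normH (u \<tau>))\<^sup>2 \<le> (normH (u 0) + w)\<^sup>2" by (intro power_mono) auto
      also have "\<dots> \<le> 2 * (normH (u 0))\<^sup>2 + 2 * w\<^sup>2"
        using zero_le_power2[of "normH (u 0) - w"] by (simp add: power2_sum power2_diff)
      finally have upper: "(normH (u \<tau>))\<^sup>2 \<le> 2 * (normH (u 0))\<^sup>2 + 2 * w\<^sup>2" .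
      have "lambda1 \<Omega> * w\<^sup>2 < \<tau> * (E 0 + \<beta>)"
        using dist[of \<tau>] above[of \<tau>] \<tau> mult_strict_left_mono[of "E 0 - E \<tau>" "E 0 + \<beta>" \<tau>] unfolding w_def by linarith
      then have "w\<^sup>2 < (E 0 + \<beta>) / lambda1 \<Omega> * \<tau>" using lam by (simp add: field_simps)
      moreover have "C * L0 * \<tau>\<^sup>2 + L0 * \<tau> = (normH (u 0))\<^sup>2 + 2 * ((E 0 + \<beta>) / lambda1 \<Omega> * \<tau>)"
        using root by (simp add: algebra_simps)
      moreover have False if "w2 < Y" "A + B = n + 2 * Y" "n + B + A \<le> m" "m \<le> 2 * n + 2 * w2" for w2 Y A B n m :: real
        using that by linarith
      ultimately show False using lower upper by blast
    qed
  qed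
  then obtain a where a: "0 \<le> a" "a \<le> \<tau>" "E a = - \<beta>" by blast
  have le: "a * (E 0 - E a) \<le> \<tau> * (E 0 + \<beta>)" using a E0 \<beta>pos by (simp add: mult_right_mono)
  have aT: "a \<in> {0..T}" "0 \<in> {0..T}" using inT[OF a(1,2)] T_pos by auto
  show thesis
  proof (rule that[OF a])
    have "L0 * 1 \<le> L0 * exp (C * a)" using L0(2) C(1) a(1) by (intro mult_left_mono) auto
    moreover have "p / C * E a = - (L0 / 2)" unfolding a(3) using p\<beta> by simp
    with growth[OF a(1,2)] have "L0 * exp (C * a) - L0 / 2 \<le> P a" by simp
    ultimately show "P a \<ge> L0 / 2" by simp
    have "lambda1 \<Omega> * (normH (\<lambda>x. u a x - u 0 x))\<^sup>2 \<le> \<tau> * (E 0 + \<beta>)" using dist[OF a(1,2)] le by linarith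
    then have "(normH (\<lambda>x. u a x - u 0 x))\<^sup>2 \<le> \<tau> * (E 0 + \<beta>) / lambda1 \<Omega>" using lam by (simp add: field_simps)
    then have "normH (\<lambda>x. u a x - u 0 x) \<le> sqrt (\<tau> * (E 0 + \<beta>) / lambda1 \<Omega>)" by (rule real_le_rsqrt)
    then show "normH (u a) \<le> normH (u 0) + sqrt (\<tau> * (E 0 + \<beta>) / lambda1 \<Omega>)"
      using l2norm_triangle_diff[OF u_L2[OF aT(1)] u_L2[OF aT(2)]] by linarith
    have "(normV \<Omega> (\<lambda>x. u a x - u 0 x))\<^sup>2 \<le> \<tau> * (E 0 + \<beta>)" using displacement_le[OF aT(1)] le by linarith
    then have "normV \<Omega> (\<lambda>x. u a x - u 0 x) \<le> sqrt (\<tau> * (E 0 + \<beta>))" by (rule real_le_rsqrt)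
    then show "normV \<Omega> (u a) \<le> normV \<Omega> (u 0) + sqrt (\<tau> * (E 0 + \<beta>))"
      using normV_triangle_diff[OF u_H01[OF aT(1)] u_H01[OF aT(2)]] by linarith
  qed
qed

lemma l2norm_u_square_derivative:
  assumes t: "0 \<le> a" "a < t" "t < b" "b \<le> T"
  shows "((\<lambda>t. (normH (u t))\<^sup>2) has_real_derivative 2 * P t) (at t)"
proof -
  have c: "continuous_on {a..b} (\<lambda>x. P x + P x)"
    using t by (intro continuous_on_subinterval[OF continuous_on_add[OF v_u_continuous v_u_continuous]]) auto
  have "((\<lambda>t. (normH (u a))\<^sup>2 + integral {a..t} (\<lambda>x. P x + P x)) has_real_derivative 2 * P t) (at t within {a..b})"
    using DERIV_add[OF DERIV_const integral_has_real_derivative[OF c, of t]] t by simp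
  then have "((\<lambda>t. (normH (u t))\<^sup>2) has_real_derivative 2 * P t) (at t within {a..b})"
  proof (rule has_field_derivative_transform_within[OF _ zero_less_one])
    fix s assume "s \<in> {a..b}"
    then show "(normH (u a))\<^sup>2 + integral {a..s} (\<lambda>x. P x + P x) = (normH (u s))\<^sup>2"
      using l2norm_u_increment[of a s] t by auto
  qed (use t in auto)
  then show ?thesis using at_within_Icc_at[of a t b] t by simp
qed

text \<open>Levine's concavity argument on \<open>[a, a + S]\<close>, where the energy has fallen to \<open>-\<beta>\<close>. The
  functional is \<open>\<Phi>(t) = \<parallel>u(t)\<parallel>\<^sup>2 + \<integral> \<parallel>\<nabla>u\<parallel>\<^sup>2 + (a + S - t) \<parallel>\<nabla>u(a)\<parallel>\<^sup>2 + \<beta> (t - a + \<sigma>)\<^sup>2\<close>, the integral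
  being over \<open>[a, t]\<close>. The negative energy makes its second derivative at least \<open>(p + 2) \<kappa>\<close> with
  \<open>\<kappa> = \<parallel>v\<parallel>\<^sup>2 + \<integral> \<parallel>\<nabla>v\<parallel>\<^sup>2 + \<beta>\<close>, while the Cauchy-Schwarz inequality for the three parts of \<open>\<Phi>\<close>
  gives \<open>\<Phi>'\<^sup>2 \<le> 4 \<Phi> \<kappa>\<close>.\<close>

lemma concavity_after_crossing:
  fixes \<beta> S :: real
  assumes gain: "gradient_gain \<ge> 0" and \<beta>: "\<beta> > 0" and a: "0 \<le> a" "E a = - \<beta>" and S: "S > 0" "a + S \<le> T"
    and Pa: "P a > 0"
  shows "(p - 2)\<^sup>2 * \<beta> / 8 * S\<^sup>2 + ((p - 2) * P a - 2 * (normV \<Omega> (u a))\<^sup>2) * S - 2 * (normH (u a))\<^sup>2 < 0"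
proof -
  define b where "b = a + S"
  \<comment> \<open>This shift minimises the resulting bound for the length \<open>S\<close>.\<close>
  define \<sigma> where "\<sigma> = (p - 2) * S / 4"
  define Na where "Na = (normV \<Omega> (u a))\<^sup>2"
  define I where "I t = integral {a..t} (\<lambda>x. (normV \<Omega> (v_rep x))\<^sup>2)" for t
  define J where "J t = integral {a..t} (\<lambda>x. (normV \<Omega> (u x))\<^sup>2)" for t
  define X where "X t = integral {a..t} (\<lambda>x. dirichlet_form (v_rep x) (u x))" for t
  define A where "A t = (normH (u t))\<^sup>2 + J t + \<beta> * (t - a + \<sigma>)\<^sup>2" for t
  define \<Phi> where "\<Phi> t = A t + (b - t) * Na" for t
  define \<Phi>' where "\<Phi>' t = 2 * P t + (normV \<Omega> (u t))\<^sup>2 - Na + 2 * \<beta> * (t - a + \<sigma>)" for t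
  define \<kappa> where "\<kappa> t = (normH (v t))\<^sup>2 + I t + \<beta>" for t
  have ab: "a < b" "b \<le> T" "0 \<le> a" using S a by (auto simp: b_def)
  have \<sigma>: "\<sigma> > 0" using p_gt_2 S by (simp add: \<sigma>_def)
  have Na: "Na \<ge> 0" by (simp add: Na_def)
  have tT: "0 \<le> a" "a \<le> t" "t \<le> T" "t \<in> {0..T}" if "t \<in> {a..b}" for t using that ab by auto
  have iV: "(\<lambda>x. (normV \<Omega> (v_rep x))\<^sup>2) integrable_on {a..t}" if "t \<in> {a..b}" for t
    by (rule dissipation_integrable[OF tT(1,3)[OF that]])
  have iD: "(\<lambda>x. dirichlet_form (v_rep x) (u x)) integrable_on {a..t}" if "t \<in> {a..b}" for t
    by (rule dirichlet_v_u_integrable_on[OF tT(1,3)[OF that]])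
  have cN: "continuous_on {0..T} (\<lambda>x. (normV \<Omega> (u x))\<^sup>2)" by (intro continuous_intros normV_u_continuous)
  have cv: "continuous_on {0..T} (\<lambda>x. (normH (v x))\<^sup>2)" by (intro continuous_intros l2norm_v_continuous)
  have iN: "(\<lambda>x. (normV \<Omega> (u x))\<^sup>2) integrable_on {a..t}" if "t \<in> {a..b}" for t
    by (rule continuous_integrable_on[OF cN tT(1,3)[OF that]])
  have X_eq: "2 * X t = (normV \<Omega> (u t))\<^sup>2 - Na" if t: "t \<in> {a..b}" for t
    using normV_u_increment[OF tT(1-3)[OF t]] iD[OF t]
    by (simp add: X_def Na_def Henstock_Kurzweil_Integration.integral_add)
  have bT: "b \<in> {a..b}" using ab by simp
  have cI: "continuous_on {a..b} I" unfolding I_def by (rule indefinite_integral_continuous_1[OF iV[OF bT]])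
  have c\<kappa>: "continuous_on {a..b} \<kappa>" unfolding \<kappa>_def
    by (intro continuous_intros cI continuous_on_subinterval[OF cv] ab)
  have cJ: "continuous_on {a..b} J" unfolding J_def by (rule indefinite_integral_continuous_1[OF iN[OF bT]])
  have c\<Phi>': "continuous_on {a..b} \<Phi>'" unfolding \<Phi>'_def
    by (intro continuous_intros continuous_on_subinterval[OF cN] continuous_on_subinterval[OF v_u_continuous] ab)
  have I_nonneg: "I t \<ge> 0" if "t \<in> {a..b}" for t
    unfolding I_def by (rule dissipation_nonneg[OF tT(1,3)[OF that]])
  have J_nonneg: "J t \<ge> 0" if "t \<in> {a..b}" for t
    unfolding J_def by (intro Henstock_Kurzweil_Integration.integral_nonneg iN that) auto
  have A_pos: "A t > 0" if t: "t \<in> {a..b}" for t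
  proof -
    have "\<beta> * (t - a + \<sigma>)\<^sup>2 > 0" using \<beta> \<sigma> t by simp
    then show ?thesis using J_nonneg[OF t] zero_le_power2[of "normH (u t)"] unfolding A_def by linarith
  qed
  have \<Phi>_ge: "A t \<le> \<Phi> t" if "t \<in> {a..b}" for t unfolding \<Phi>_def using that Na by simp
  have \<Phi>_pos: "\<Phi> t > 0" if "t \<in> {a..b}" for t using A_pos[OF that] \<Phi>_ge[OF that] by linarith
  have \<kappa>_pos: "\<kappa> t > 0" if "t \<in> {a..b}" for t
    using I_nonneg[OF that] \<beta> zero_le_power2[of "normH (v t)"] unfolding \<kappa>_def by linarith
  have CS: "(\<Phi>' t)\<^sup>2 / \<Phi> t \<le> 4 * \<kappa> t" if t: "t \<in> {a..b}" for t
  proof -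
    have "(\<Phi>' t / 2)\<^sup>2 \<le> A t * \<kappa> t"
    proof (rule nonneg_quadratic_imp_square_le)
      fix x :: real
      have 1: "0 \<le> (normH (u t))\<^sup>2 + 2 * x * P t + x\<^sup>2 * (normH (v t))\<^sup>2"
        using l2norm_lincomb_square[OF u_L2[OF tT(4)[OF t]] v_L2[OF tT(4)[OF t]], of 1 x]
          zero_le_power2[of "normH (\<lambda>y. 1 *\<^sub>R u t y + x *\<^sub>R v t y)"] l2inner_commute[of \<Omega> "u t" "v t"] by simp
      have 2: "0 \<le> J t + 2 * x * X t + x\<^sup>2 * I t"
      proof -
        have "J t + 2 * x * X t + x\<^sup>2 * I t = integral {a..t} (\<lambda>s. (normV \<Omega> (u s))\<^sup>2
             + 2 * x * dirichlet_form (v_rep s) (u s) + x\<^sup>2 * (normV \<Omega> (v_rep s))\<^sup>2)"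
          unfolding J_def X_def I_def
          by (simp only: Henstock_Kurzweil_Integration.integral_add[OF integrable_add[OF iN[OF t] integrable_on_mult_right[OF iD[OF t]]]
                integrable_on_mult_right[OF iV[OF t]]]
              Henstock_Kurzweil_Integration.integral_add[OF iN[OF t] integrable_on_mult_right[OF iD[OF t]]]
              Henstock_Kurzweil_Integration.integral_mult_right)
        also have "\<dots> \<ge> 0"
        proof (rule Henstock_Kurzweil_Integration.integral_nonneg)
          show "(\<lambda>s. (normV \<Omega> (u s))\<^sup>2 + 2 * x * dirichlet_form (v_rep s) (u s) + x\<^sup>2 * (normV \<Omega> (v_rep s))\<^sup>2) integrable_on {a..t}"
            by (intro integrable_add integrable_on_mult_right iN iD iV t)
          fix s assume "s \<in> {a..t}"
          then have s: "s \<in> {0..T}" using t tT[OF t] by auto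
          have "\<bar>x * dirichlet_form (v_rep s) (u s)\<bar> \<le> \<bar>x\<bar> * (normV \<Omega> (v_rep s) * normV \<Omega> (u s))"
            unfolding abs_mult by (intro mult_left_mono dirichlet_form_Cauchy_Schwarz H01_H1 v_rep u_H01 s) auto
          then show "0 \<le> (normV \<Omega> (u s))\<^sup>2 + 2 * x * dirichlet_form (v_rep s) (u s) + x\<^sup>2 * (normV \<Omega> (v_rep s))\<^sup>2"
            using zero_le_power2[of "normV \<Omega> (u s) - \<bar>x\<bar> * normV \<Omega> (v_rep s)"]
            by (simp add: power2_diff power_mult_distrib algebra_simps)
        qed
        finally show ?thesis .
      qed
      have 3: "0 \<le> \<beta> * (t - a + \<sigma> + x)\<^sup>2" using \<beta> by simp
      show "0 \<le> A t + 2 * x * (\<Phi>' t / 2) + x\<^sup>2 * \<kappa> t"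
      proof -
        have half: "\<Phi>' t / 2 = P t + X t + \<beta> * (t - a + \<sigma>)" using X_eq[OF t] by (simp add: \<Phi>'_def)
        have "A t + 2 * x * (\<Phi>' t / 2) + x\<^sup>2 * \<kappa> t
          = ((normH (u t))\<^sup>2 + 2 * x * P t + x\<^sup>2 * (normH (v t))\<^sup>2) + (J t + 2 * x * X t + x\<^sup>2 * I t)
            + \<beta> * (t - a + \<sigma> + x)\<^sup>2"
          unfolding half A_def \<kappa>_def power2_sum[of "t - a + \<sigma>" x] by (simp only: distrib_left) (simp add: algebra_simps)
        then show ?thesis using 1 2 3 by linarith
      qed
    qed (use \<kappa>_pos[OF t] in simp)
    also have "\<dots> \<le> \<Phi> t * \<kappa> t" using \<Phi>_ge[OF t] \<kappa>_pos[OF t] by (intro mult_right_mono) auto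
    finally show ?thesis using \<Phi>_pos[OF t] by (simp add: field_simps)
  qed
  have convex: "\<Phi>' t - \<Phi>' a \<ge> (p + 2) * integral {a..t} \<kappa>" if t: "t \<in> {a..b}" for t
  proof -
    note st = tT(1-3)[OF t]
    note iu = utt_u_integrable_on[OF st(1,3)]
    note iv = continuous_integrable_on[OF cv st(1,3)]
    note iuv = integrable_add[OF iu iv]
    have "(p + 2) * integral {a..t} \<kappa> = integral {a..t} (\<lambda>x. (p + 2) * \<kappa> x)" by simp
    also have "\<dots> \<le> integral {a..t} (\<lambda>x. 2 * (utt x (u x) + (normH (v x))\<^sup>2)
        + 2 * dirichlet_form (v_rep x) (u x) + 2 * \<beta>)"
    proof -
      \<comment> \<open>The comparison holds for \<open>x \<ge> a\<close> only, so both sides are cut off there.\<close>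
      let ?l = "\<lambda>x. if x < a then 0 else (p + 2) * \<kappa> x"
      let ?r = "\<lambda>x. if x < a then 0 else 2 * (utt x (u x) + (normH (v x))\<^sup>2)
        + 2 * dirichlet_form (v_rep x) (u x) + 2 * \<beta>"
      have pointwise: "(p + 2) * \<kappa> x \<le> 2 * (utt x (u x) + (normH (v x))\<^sup>2) + 2 * dirichlet_form (v_rep x) (u x) + 2 * \<beta>"
        if x: "x \<in> {0<..<T}" "\<not> x < a" and ge: "utt x (u x) + (normH (v x))\<^sup>2
        \<ge> (1 + p / 2) * (normH (v x))\<^sup>2 + gradient_gain * (normV \<Omega> (u x))\<^sup>2 - p * E x - dirichlet_form (v_rep x) (u x)" for x
      proof -
        have Ex: "E x \<le> - \<beta> - I x" using energy_dissipation[of a x] x ab a(2) unfolding I_def by simp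
        have Ix: "I x \<ge> 0" unfolding I_def by (rule dissipation_nonneg) (use x ab in auto)
        have "(p + 2) * (\<beta> + I x) \<le> (2 * p) * (\<beta> + I x)" using p_gt_2 \<beta> Ix by (intro mult_right_mono) auto
        also have "\<dots> \<le> 2 * p * (- E x)" using Ex p_gt_2 by (intro mult_left_mono) auto
        finally have "(p + 2) * (\<beta> + I x) \<le> - 2 * (p * E x)" by simp
        moreover have "gradient_gain * (normV \<Omega> (u x))\<^sup>2 \<ge> 0" using gain by simp
        moreover have "(p + 2) * \<kappa> x = 2 * ((1 + p / 2) * (normH (v x))\<^sup>2) + (p + 2) * (\<beta> + I x)"
          by (simp add: \<kappa>_def algebra_simps)
        moreover have "k \<le> 2 * w + 2 * D + 2 * \<beta>"
          if "Q \<le> - 2 * e" "0 \<le> n" "k = 2 * m + Q" "m + n - e - D \<le> w" for k m Q e n D w :: real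
          using that \<beta> by linarith
        ultimately show ?thesis using ge by blast
      qed
      have "AE x in time. ?l x \<le> ?r x"
        using pairing_rate_ge pointwise by (auto simp: AE_restrict_space_iff elim!: eventually_mono)
      moreover have "(\<lambda>x. (p + 2) * \<kappa> x) integrable_on {a..t}"
        using t by (intro integrable_on_mult_right integrable_continuous_real continuous_on_subset[OF c\<kappa>]) auto
      then have "?l integrable_on {a..t}" by (rule integrable_eq) auto
      moreover have "(\<lambda>x. 2 * (utt x (u x) + (normH (v x))\<^sup>2) + 2 * dirichlet_form (v_rep x) (u x) + 2 * \<beta>) integrable_on {a..t}"
        by (intro integrable_add integrable_on_mult_right iu iv iD t integrable_const_ivl)
      then have "?r integrable_on {a..t}" by (rule integrable_eq) auto
      ultimately have "integral {a..t} ?l \<le> integral {a..t} ?r" by (rule integral_mono_time[OF _ st(1,3)])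
      moreover have "integral {a..t} ?l = integral {a..t} (\<lambda>x. (p + 2) * \<kappa> x)"
        "integral {a..t} ?r = integral {a..t} (\<lambda>x. 2 * (utt x (u x) + (normH (v x))\<^sup>2)
        + 2 * dirichlet_form (v_rep x) (u x) + 2 * \<beta>)"
        by (rule Henstock_Kurzweil_Integration.integral_cong, simp)+
      ultimately show ?thesis by simp
    qed
    also have "\<dots> = 2 * (P t - P a) + 2 * X t + 2 * \<beta> * (t - a)"
    proof -
      note i2 = integrable_on_mult_right[OF iuv, of 2] and i3 = integrable_on_mult_right[OF iD[OF t], of 2]
      have "integral {a..t} (\<lambda>x. 2 * (utt x (u x) + (normH (v x))\<^sup>2) + 2 * dirichlet_form (v_rep x) (u x) + 2 * \<beta>)
         = 2 * integral {a..t} (\<lambda>x. utt x (u x) + (normH (v x))\<^sup>2) + 2 * X t + integral {a..t} (\<lambda>x. 2 * \<beta>)"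
        by (simp only: Henstock_Kurzweil_Integration.integral_add[OF integrable_add[OF i2 i3] integrable_const_ivl]
            Henstock_Kurzweil_Integration.integral_add[OF i2 i3] Henstock_Kurzweil_Integration.integral_mult_right X_def)
      then show ?thesis using v_u_increment[OF st] st(2) by (simp add: l2inner_self)
    qed
    also have "\<dots> = \<Phi>' t - \<Phi>' a" using X_eq[OF t] by (simp add: \<Phi>'_def Na_def algebra_simps)
    finally show ?thesis .
  qed
  have \<Phi>_deriv: "(\<Phi> has_real_derivative \<Phi>' t) (at t)" if t: "a < t" "t < b" for t
  proof -
    have J': "(J has_real_derivative (normV \<Omega> (u t))\<^sup>2) (at t)"
      using integral_has_real_derivative[OF continuous_on_subinterval[OF cN ab(3,2)], of t] t at_within_Icc_at[of a t b]
      unfolding J_def by simp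
    show ?thesis unfolding \<Phi>_def A_def \<Phi>'_def
      by (rule derivative_eq_intros refl l2norm_u_square_derivative[OF ab(3) t ab(2)] J')+ (simp add: algebra_simps)
  qed
  have "continuous_on {a..b} \<Phi>"
  proof -
    have "continuous_on {a..b} (\<lambda>t. (normH (u a))\<^sup>2 + integral {a..t} (\<lambda>x. P x + P x))"
      using ab by (intro continuous_intros indefinite_integral_continuous_1 continuous_integrable_on v_u_continuous)
    moreover have "(normH (u a))\<^sup>2 + integral {a..t} (\<lambda>x. P x + P x) = (normH (u t))\<^sup>2" if "t \<in> {a..b}" for t
      using l2norm_u_increment[OF tT(1-3)[OF that]] by simp
    ultimately have "continuous_on {a..b} (\<lambda>t. (normH (u t))\<^sup>2)" by (rule continuous_on_eq)
    moreover have "continuous_on {a..b} (\<lambda>t. \<beta> * (t - a + \<sigma>)\<^sup>2)" "continuous_on {a..b} (\<lambda>t. (b - t) * Na)"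
      by (intro continuous_intros)+
    ultimately show ?thesis unfolding \<Phi>_def A_def by (intro continuous_on_add cJ)
  qed
  moreover have "\<Phi>' a > 0" using Pa \<beta> \<sigma> by (simp add: \<Phi>'_def Na_def add_pos_pos)
  moreover have "\<Phi>' t - \<Phi>' a \<ge> (p + 2) / 4 * integral {a..t} (\<lambda>s. (\<Phi>' s)\<^sup>2 / \<Phi> s)" if t: "t \<in> {a..b}" for t
  proof -
    have sub: "{a..t} \<subseteq> {a..b}" using t by auto
    have c: "continuous_on {a..t} \<Phi>" using \<open>continuous_on {a..b} \<Phi>\<close> sub by (rule continuous_on_subset)
    have "integral {a..t} (\<lambda>s. (\<Phi>' s)\<^sup>2 / \<Phi> s) \<le> integral {a..t} (\<lambda>s. 4 * \<kappa> s)"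
    proof (rule integral_le)
      have "\<forall>s\<in>{a..t}. \<Phi> s \<noteq> 0" using \<Phi>_pos sub by force
      then show "(\<lambda>s. (\<Phi>' s)\<^sup>2 / \<Phi> s) integrable_on {a..t}"
        by (intro integrable_continuous_real continuous_intros c continuous_on_subset[OF c\<Phi>' sub])
      show "(\<lambda>s. 4 * \<kappa> s) integrable_on {a..t}"
        by (intro integrable_continuous_real continuous_intros continuous_on_subset[OF c\<kappa> sub])
      show "(\<Phi>' s)\<^sup>2 / \<Phi> s \<le> 4 * \<kappa> s" if "s \<in> {a..t}" for s using CS that sub by blast
    qed
    then have "(p + 2) / 4 * integral {a..t} (\<lambda>s. (\<Phi>' s)\<^sup>2 / \<Phi> s) \<le> (p + 2) / 4 * (4 * integral {a..t} \<kappa>)"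
      using p_gt_2 by (intro mult_left_mono) auto
    then show ?thesis using convex[OF t] by simp
  qed
  ultimately have "((p + 2) / 4 - 1) * \<Phi>' a * (b - a) < \<Phi> a"
    using p_gt_2 ab by (intro concavity_lifespan_bound[OF _ _ _ c\<Phi>' \<Phi>_deriv \<Phi>_pos]) auto
  then have "(p - 2) / 4 * (2 * P a + 2 * \<beta> * \<sigma>) * S < (normH (u a))\<^sup>2 + \<beta> * \<sigma>\<^sup>2 + S * Na"
    by (simp add: \<Phi>'_def \<Phi>_def A_def J_def Na_def b_def diff_divide_distrib add_divide_distrib)
  then have "(p - 2) * P a * S + 4 * \<beta> * \<sigma>\<^sup>2 < 2 * (normH (u a))\<^sup>2 + 2 * \<beta> * \<sigma>\<^sup>2 + 2 * S * Na"
    by (simp add: \<sigma>_def field_simps power2_eq_square)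
  then have "2 * \<beta> * \<sigma>\<^sup>2 + ((p - 2) * P a - 2 * Na) * S - 2 * (normH (u a))\<^sup>2 < 0"
    by (simp add: algebra_simps)
  moreover have "2 * \<beta> * \<sigma>\<^sup>2 = (p - 2)\<^sup>2 * \<beta> / 8 * S\<^sup>2" by (simp add: \<sigma>_def power_mult_distrib power_divide)
  ultimately show ?thesis by (simp add: Na_def)
qed

lemma initial_values:
  assumes u0: "u0 \<in> H01 \<Omega>" and u1: "u1 \<in> L2 \<Omega>"
  shows "normH (u 0) = normH u0" "normV \<Omega> (u 0) = normV \<Omega> u0" "P 0 = innerH u0 u1"
    "E 0 = initial_energy \<Omega> p g u0 u1"
proof -
  have 0: "0 \<in> {0..T}" using T_pos by simp
  show l: "normH (u 0) = normH u0" by (rule l2norm_cong_AE[OF u_L2[OF 0] H01_L2[OF u0] u_initial])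
  show n: "normV \<Omega> (u 0) = normV \<Omega> u0" by (rule normV_cong_AE[OF H01_H1[OF u_H01[OF 0]] H01_H1[OF u0] u_initial])
  show "P 0 = innerH u0 u1"
    using l2inner_cong_AE[OF v_L2[OF 0] u1 u_L2[OF 0] v_initial] l2inner_cong_AE[OF u_L2[OF 0] H01_L2[OF u0] u1 u_initial]
    by (simp add: l2inner_commute)
  have v: "normH (v 0) = normH u1" by (rule l2norm_cong_AE[OF v_L2[OF 0] u1 v_initial])
  have [measurable]: "u 0 \<in> borel_measurable dx" "u0 \<in> borel_measurable dx"
    using u_L2[OF 0] H01_L2[OF u0] by (auto intro: L2_measurable)
  have "(\<integral>x. source_prim p (u 0 x) \<partial>dx) = (\<integral>x. source_prim p (u0 x) \<partial>dx)"
    by (rule integral_cong_AE) (use u_initial in \<open>auto elim!: eventually_mono\<close>)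
  then show "E 0 = initial_energy \<Omega> p g u0 u1"
    unfolding energy_eq[OF 0] initial_energy_eq memory_energy_def integral_lebesgue_on_point v n by simp
qed

text \<open>An existence time as long as the asserted bound is impossible: the length of the second phase
  is the positive root of the quadratic polynomial that the concavity argument forces to be
  negative.\<close>

lemma no_solution_up_to_bound:
  fixes C L0 \<beta> \<tau> U G d S :: real
  assumes C: "C > 0" "C \<le> p + 2" "C * (2 * p + lambda1 \<Omega>) \<le> 4 * p * lambda1 \<Omega> * gradient_gain"
    and L0: "L0 = P 0 - p / C * E 0" "L0 > 0" and \<beta>: "\<beta> = C * L0 / (2 * p)" and E0: "E 0 > 0"
    and \<tau>: "0 < \<tau>"
    and root: "C * L0 * \<tau>\<^sup>2 + (L0 - 2 * (E 0 + \<beta>) / lambda1 \<Omega>) * \<tau> - (normH (u 0))\<^sup>2 = 0"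
    and U: "U = (normH (u 0) + sqrt (\<tau> * (E 0 + \<beta>) / lambda1 \<Omega>))\<^sup>2"
    and G: "G = (normV \<Omega> (u 0) + sqrt (\<tau> * (E 0 + \<beta>)))\<^sup>2"
    and d: "d = (p - 2) / 2 * L0 - 2 * G"
    and S: "S = 4 * (sqrt (d\<^sup>2 + (p - 2)\<^sup>2 * \<beta> * U) - d) / ((p - 2)\<^sup>2 * \<beta>)"
  shows "T < \<tau> + S"
proof (rule ccontr)
  assume "\<not> T < \<tau> + S"
  then have T: "\<tau> + S \<le> T" by simp
  have p: "p > 0" using p_gt_2 by simp
  have lam: "lambda1 \<Omega> > 0" by (rule lambda1_properties(1)[OF nonempty])
  have \<beta>pos: "\<beta> > 0" using C(1) L0(2) p by (simp add: \<beta>)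
  have gain: "gradient_gain \<ge> 0"
  proof -
    have "0 < C * (2 * p + lambda1 \<Omega>)" using C(1) p lam by simp
    then have "0 < 4 * p * lambda1 \<Omega> * gradient_gain" using C(3) by linarith
    moreover have "0 < 4 * p * lambda1 \<Omega>" using p lam by simp
    ultimately have "0 < gradient_gain" by (rule zero_less_mult_pos)
    then show ?thesis by simp
  qed
  define M where "M = (p - 2)\<^sup>2 * \<beta>"
  have M: "M > 0" using p_gt_2 \<beta>pos by (simp add: M_def)
  have "sqrt (\<tau> * (E 0 + \<beta>) / lambda1 \<Omega>) > 0" using \<tau> E0 \<beta>pos lam by simp
  then have Upos: "U > 0" unfolding U by (intro zero_less_power add_nonneg_pos) auto
  define R where "R = sqrt (d\<^sup>2 + M * U)"
  have R2: "R\<^sup>2 = d\<^sup>2 + M * U" unfolding R_def using M Upos by simp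
  have "\<bar>d\<bar> < R" unfolding R_def using M Upos by (intro real_less_rsqrt) simp
  have S_eq: "S = 4 * (R - d) / M" by (simp add: S R_def M_def)
  have Spos: "S > 0" using \<open>\<bar>d\<bar> < R\<close> M by (simp add: S_eq)
  have S_root: "M / 8 * S\<^sup>2 + d * S - 2 * U = 0"
  proof -
    have "M / 8 * S\<^sup>2 + d * S = 2 * (R\<^sup>2 - d\<^sup>2) / M"
      unfolding S_eq using M by (simp add: field_simps power2_eq_square)
    then show ?thesis using M by (simp add: R2)
  qed
  have \<tau>T: "\<tau> \<le> T" using T Spos by linarith
  obtain a where a: "0 \<le> a" "a \<le> \<tau>" "E a = - \<beta>" "P a \<ge> L0 / 2"
    "normH (u a) \<le> normH (u 0) + sqrt (\<tau> * (E 0 + \<beta>) / lambda1 \<Omega>)"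
    "normV \<Omega> (u a) \<le> normV \<Omega> (u 0) + sqrt (\<tau> * (E 0 + \<beta>))"
    by (rule energy_crosses_level[OF C L0 \<beta> E0 \<tau> \<tau>T root]) (rule that)
  have "(p - 2)\<^sup>2 * \<beta> / 8 * S\<^sup>2 + ((p - 2) * P a - 2 * (normV \<Omega> (u a))\<^sup>2) * S - 2 * (normH (u a))\<^sup>2 < 0"
    using a L0(2) T by (intro concavity_after_crossing gain \<beta>pos Spos) auto
  moreover have "(normH (u a))\<^sup>2 \<le> U" unfolding U by (intro power_mono a) simp
  moreover have "d * S \<le> ((p - 2) * P a - 2 * (normV \<Omega> (u a))\<^sup>2) * S"
  proof (rule mult_right_mono)
    have "(normV \<Omega> (u a))\<^sup>2 \<le> G" unfolding G by (intro power_mono a) simp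
    moreover have "(p - 2) * (L0 / 2) \<le> (p - 2) * P a" using a(4) p_gt_2 by (intro mult_left_mono) auto
    ultimately show "d \<le> (p - 2) * P a - 2 * (normV \<Omega> (u a))\<^sup>2" unfolding d by simp
  qed (use Spos in simp)
  ultimately show False using S_root unfolding M_def by linarith
qed

end

text \<open>The product of the roots is negative.\<close>

lemma unique_positive_root:
  fixes a b c :: real
  assumes "a > 0" "c > 0"
  shows "\<exists>!x. 0 < x \<and> a * x\<^sup>2 + b * x - c = 0"
proof -
  define R where "R = sqrt (b\<^sup>2 + 4 * a * c)"
  have R2: "R\<^sup>2 = b\<^sup>2 + 4 * a * c" unfolding R_def using assms by simp
  have R: "\<bar>b\<bar> < R" unfolding R_def using assms by (intro real_less_rsqrt) simp
  have factor: "a * x\<^sup>2 + b * x - c = a * (x - (R - b) / (2 * a)) * (x + (R + b) / (2 * a))" for x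
  proof -
    have "a * (x - (R - b) / (2 * a)) * (x + (R + b) / (2 * a)) = a * x\<^sup>2 + b * x - (R\<^sup>2 - b\<^sup>2) / (4 * a)"
      using assms by (simp add: field_simps power2_eq_square)
    then show ?thesis using assms by (simp add: R2)
  qed
  have neg: "x + (R + b) / (2 * a) > 0" if "x > 0" for x
    using that R assms by (intro add_pos_nonneg) auto
  show ?thesis
  proof (rule ex1I)
    show "0 < (R - b) / (2 * a) \<and> a * ((R - b) / (2 * a))\<^sup>2 + b * ((R - b) / (2 * a)) - c = 0"
      unfolding factor using R assms by simp
    fix x assume "0 < x \<and> a * x\<^sup>2 + b * x - c = 0"
    then show "x = (R - b) / (2 * a)" unfolding factor using neg[of x] assms by simp
  qed
qed

context bounded_open_set
begin

text \<open>A maximal solution that lived longer would be an energy solution on the closed interval whose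
  right end is the bound.\<close>

lemma maximal_solution_lifespan_le:
  fixes C E0 L0 \<beta> \<tau> U G d :: real and Tm :: ereal
  assumes p: "2 < p" "(real DIM('a) - 2) * (p - 2) < 4" and ne: "\<Omega> \<noteq> {}"
    and H2: "H2 g g'" and ell: "ell g > 1 / (p - 1)\<^sup>2" and wellposed: "local_theory \<Omega> p g g'"
    and data: "u0 \<in> test_fun \<Omega>" "u1 \<in> test_fun \<Omega>"
    and C: "C = blowup_const \<Omega> p g" and E0: "E0 = initial_energy \<Omega> p g u0 u1" "E0 > 0"
    and L0: "L0 = innerH u0 u1 - p / C * E0" "L0 > 0" and \<beta>: "\<beta> = C * L0 / (2 * p)"
    and \<tau>: "0 < \<tau>"
    and root: "C * L0 * \<tau>\<^sup>2 + (L0 - 2 * (E0 + \<beta>) / lambda1 \<Omega>) * \<tau> - (normH u0)\<^sup>2 = 0"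
    and U: "U = (normH u0 + sqrt (\<tau> * (E0 + \<beta>) / lambda1 \<Omega>))\<^sup>2"
    and G: "G = (normV \<Omega> u0 + sqrt (\<tau> * (E0 + \<beta>)))\<^sup>2"
    and d: "d = (p - 2) / 2 * L0 - 2 * G"
    and maximal: "maximal_solution \<Omega> p g u0 u1 Tm u v"
  shows "Tm \<le> ereal (\<tau> + 4 * (sqrt (d\<^sup>2 + (p - 2)\<^sup>2 * \<beta> * U) - d) / ((p - 2)\<^sup>2 * \<beta>))"
proof (rule ccontr)
  define S where "S = 4 * (sqrt (d\<^sup>2 + (p - 2)\<^sup>2 * \<beta> * U) - d) / ((p - 2)\<^sup>2 * \<beta>)"
  define T where "T = \<tau> + S"
  assume "\<not> Tm \<le> ereal (\<tau> + 4 * (sqrt (d\<^sup>2 + (p - 2)\<^sup>2 * \<beta> * U) - d) / ((p - 2)\<^sup>2 * \<beta>))"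
  then have Tm: "ereal T < Tm" by (simp add: S_def T_def)
  have lam: "lambda1 \<Omega> > 0" by (rule lambda1_properties(1)[OF ne])
  have Cpos: "C > 0" unfolding C by (rule blowup_const_pos[OF lam p(1) ell])
  have \<beta>pos: "\<beta> > 0" using Cpos L0(2) p by (simp add: \<beta>)
  have "\<bar>d\<bar> \<le> sqrt (d\<^sup>2 + (p - 2)\<^sup>2 * \<beta> * U)" using \<beta>pos by (intro real_le_rsqrt) (simp add: U)
  then have "S \<ge> 0" unfolding S_def using \<beta>pos by (intro divide_nonneg_nonneg) auto
  then have Tpos: "T > 0" using \<tau> by (simp add: T_def)
  have H: "u0 \<in> H01 \<Omega>" "u1 \<in> L2 \<Omega>" using data test_fun_H01 test_fun_L2 by auto
  have known: "(0 < T \<and> ereal T < Tm \<longrightarrow> abs_cont_on 0 T (energy \<Omega> p g u v))"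
    "(AE t in lebesgue. 0 < t \<and> ereal t < Tm \<longrightarrow>
              (energy \<Omega> p g u v has_real_derivative energy_rate \<Omega> g g' u v t) (at t))"
    using wellposed H maximal unfolding local_theory_def by blast+
  interpret damped_wave_solution \<Omega> p g u0 u1 T u v g'
  proof
    show "energy_solution \<Omega> p g u0 u1 T u v"
      using maximal Tm Tpos unfolding maximal_solution_def solution_until_def by blast
    show "abs_cont_on 0 T (energy \<Omega> p g u v)" using known(1) Tm Tpos by blast
    show "AE t in lebesgue. 0 < t \<and> t < T \<longrightarrow>
      (energy \<Omega> p g u v has_real_derivative energy_rate \<Omega> g g' u v t) (at t)"
      using known(2)
    proof eventually_elim
      case (elim t)
      then show ?case using Tm less_trans[of "ereal t" "ereal T" Tm] by simp
    qed
  qed (use ne p H2 in auto)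
  have C2: "C \<le> p + 2" by (simp add: C blowup_const_def)
  have C3: "C * (2 * p + lambda1 \<Omega>) \<le> 4 * p * lambda1 \<Omega> * gradient_gain"
  proof -
    have "C \<le> 2 * lambda1 \<Omega> * ((p - 1)\<^sup>2 * ell g - 1) / (2 * p + lambda1 \<Omega>)" by (simp add: C blowup_const_def)
    then have "C * (2 * p + lambda1 \<Omega>) \<le> 2 * lambda1 \<Omega> * ((p - 1)\<^sup>2 * ell g - 1)"
      using p lam by (simp add: pos_le_divide_eq)
    then show ?thesis using p by (simp add: gradient_gain_def)
  qed
  note init = initial_values[OF H]
  have "T < \<tau> + S"
  proof (rule no_solution_up_to_bound[OF Cpos C2 C3 _ L0(2) \<beta> _ \<tau>])
    show "L0 = P 0 - p / C * E 0" "0 < E 0" using L0(1) E0 by (simp_all add: init)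
    show "C * L0 * \<tau>\<^sup>2 + (L0 - 2 * (E 0 + \<beta>) / lambda1 \<Omega>) * \<tau> - (normH (u 0))\<^sup>2 = 0"
      using root E0(1) by (simp add: init)
    show "U = (normH (u 0) + sqrt (\<tau> * (E 0 + \<beta>) / lambda1 \<Omega>))\<^sup>2"
      "G = (normV \<Omega> (u 0) + sqrt (\<tau> * (E 0 + \<beta>)))\<^sup>2"
      using U G E0(1) by (simp_all add: init)
  qed (rule d S_def)+
  then show False by (simp add: T_def)
qed

end

lemma subcritical_of_crit_exp:
  assumes "2 < p" "ereal p < crit_exp n"
  shows "(real n - 2) * (p - 2) < 4"
proof (cases "n \<ge> 3")
  case True
  then have "p < 2 * real n / (real n - 2)" using assms(2) by (simp add: crit_exp_def)
  then have "p * (real n - 2) < 2 * real n" using True by (simp add: pos_less_divide_eq)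
  then show ?thesis by (simp add: algebra_simps)
next
  case False
  then have "(real n - 2) * (p - 2) \<le> 0" using assms(1) by (intro mult_nonpos_nonneg) auto
  then show ?thesis by simp
qed

theorem proposition4p1:
  fixes \<Omega> :: "(real ^ 'n) set" and p :: real and g g' :: "real \<Rightarrow> real"
  assumes "smooth_bounded_domain \<Omega>"
    and "2 < p" and "ereal p < crit_exp CARD('n)"
    and "H2 g g'"
    and "ell g > 1 / (p - 1)\<^sup>2"
    and "local_theory \<Omega> p g g'"
  shows "let C = blowup_const \<Omega> p g; l1 = lambda1 \<Omega>; E0 = initial_energy \<Omega> p g in
    (\<forall>K>0. \<exists>u0\<in>test_fun \<Omega>. \<exists>u1\<in>test_fun \<Omega>.
        E0 u0 u1 > K \<and>
        C / (2 * p) * (l2norm \<Omega> u0)\<^sup>2 < E0 u0 u1 \<and> E0 u0 u1 < C / p * l2inner \<Omega> u0 u1) \<and>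
    (\<forall>u0\<in>test_fun \<Omega>. \<forall>u1\<in>test_fun \<Omega>.
        C / (2 * p) * (l2norm \<Omega> u0)\<^sup>2 < E0 u0 u1 \<and> E0 u0 u1 < C / p * l2inner \<Omega> u0 u1 \<longrightarrow>
        (let L0 = l2inner \<Omega> u0 u1 - p / C * E0 u0 u1;
             \<beta> = C * L0 / (2 * p);
             q = (\<lambda>\<tau>. C * L0 * \<tau>\<^sup>2 + (L0 - 2 * (E0 u0 u1 + \<beta>) / l1) * \<tau> - (l2norm \<Omega> u0)\<^sup>2)
         in L0 > 0 \<and>
            (\<exists>!\<tau>. 0 < \<tau> \<and> q \<tau> = 0) \<and>
            (\<forall>\<tau>. 0 < \<tau> \<and> q \<tau> = 0 \<longrightarrow>
               (let U = (l2norm \<Omega> u0 + sqrt (\<tau> * (E0 u0 u1 + \<beta>) / l1))\<^sup>2;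
                    G = (l2norm \<Omega> (wgrad \<Omega> u0) + sqrt (\<tau> * (E0 u0 u1 + \<beta>)))\<^sup>2;
                    d = (p - 2) / 2 * L0 - 2 * G
                in \<forall>Tm u v. maximal_solution \<Omega> p g u0 u1 Tm u v \<longrightarrow>
                     Tm \<le> ereal (\<tau> + 4 * (sqrt (d\<^sup>2 + (p - 2)\<^sup>2 * \<beta> * U) - d)
                                       / ((p - 2)\<^sup>2 * \<beta>))))) \<and>
        0 < E0 u0 u1 \<and> E0 u0 u1 < C / p * l2inner \<Omega> u0 u1 \<and>
        \<not> E0 u0 u1 \<le> C / (2 * p) * (l2norm \<Omega> u0)\<^sup>2)"
proof -
  have dom: "open \<Omega>" "bounded \<Omega>" "\<Omega> \<noteq> {}" using assms(1) by (auto simp: smooth_bounded_domain_def)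
  interpret bounded_open_set \<Omega> by unfold_locales (use dom in auto)
  have sub: "(real DIM(real ^ 'n) - 2) * (p - 2) < 4"
    using subcritical_of_crit_exp[OF assms(2,3)] by simp
  have lam: "lambda1 \<Omega> > 0" by (rule lambda1_properties(1)[OF dom(3)])
  define C where "C = blowup_const \<Omega> p g"
  have C: "C > 0" unfolding C_def by (rule blowup_const_pos[OF lam assms(2,5)])
  have data: "\<exists>u0\<in>test_fun \<Omega>. \<exists>u1\<in>test_fun \<Omega>. initial_energy \<Omega> p g u0 u1 > K \<and>
      C / (2 * p) * (l2norm \<Omega> u0)\<^sup>2 < initial_energy \<Omega> p g u0 u1 \<and>
      initial_energy \<Omega> p g u0 u1 < C / p * l2inner \<Omega> u0 u1" if K: "K > 0" for K
    by (rule exists_high_energy_data[OF assms(2) sub dom(3) C K, of g]) blast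
  have rest: "0 < E0" "L0 > 0" "\<exists>!\<tau>. 0 < \<tau> \<and> C * L0 * \<tau>\<^sup>2 + b * \<tau> - (l2norm \<Omega> u0)\<^sup>2 = 0"
    if u: "u0 \<in> test_fun \<Omega>" "u1 \<in> test_fun \<Omega>"
      and E: "C / (2 * p) * (l2norm \<Omega> u0)\<^sup>2 < E0" "E0 < C / p * l2inner \<Omega> u0 u1"
      and L0: "L0 = l2inner \<Omega> u0 u1 - p / C * E0" for u0 u1 E0 L0 b
  proof -
    show E0: "0 < E0"
      using E(1) C assms(2) zero_le_power2[of "l2norm \<Omega> u0"] by (smt (verit) divide_nonneg_pos mult_nonneg_nonneg)
    have "p / C * E0 < p / C * (C / p * l2inner \<Omega> u0 u1)"
      using E(2) C assms(2) by (intro mult_strict_left_mono) auto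
    then show L0pos: "L0 > 0" using C assms(2) by (simp add: L0)
    have inner: "l2inner \<Omega> u0 u1 > 0" using E0 E(2) C assms(2) by (smt (verit) divide_pos_pos mult_nonneg_nonpos)
    have "l2norm \<Omega> u0 \<noteq> 0"
    proof
      assume "l2norm \<Omega> u0 = 0"
      then show False
        using l2_Cauchy_Schwarz[OF test_fun_L2[OF u(1)] test_fun_L2[OF u(2)]] inner by simp
    qed
    then show "\<exists>!\<tau>. 0 < \<tau> \<and> C * L0 * \<tau>\<^sup>2 + b * \<tau> - (l2norm \<Omega> u0)\<^sup>2 = 0"
      using C L0pos by (intro unique_positive_root) auto
  qed
  note bound = maximal_solution_lifespan_le[OF assms(2) sub dom(3) assms(4-6) _ _ C_def refl _ refl _ refl
      _ _ refl refl refl]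
  show ?thesis
    unfolding Let_def C_def[symmetric] normV_def[symmetric]
    apply (intro conjI allI ballI impI)
    subgoal by (rule data)
    subgoal premises prems
      by (rule rest(2)[OF prems(1,2) conjunct1[OF prems(3)] conjunct2[OF prems(3)] refl])
    subgoal premises prems
      by (rule rest(3)[OF prems(1,2) conjunct1[OF prems(3)] conjunct2[OF prems(3)] refl])
    subgoal premises prems
      using rest(1,2)[OF prems(1,2) conjunct1[OF prems(3)] conjunct2[OF prems(3)] refl] prems(1,2,4,5)
      by (intro bound) auto
    subgoal premises prems
      by (rule rest(1)[OF prems(1,2) conjunct1[OF prems(3)] conjunct2[OF prems(3)] refl])
    subgoal by blast
    subgoal by simp
    done
qed

end
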